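(* Let $H$ be a finite-dimensional Hopf algebra over a field $\Bbbk$. There is an isomorphism of categories between the category of involutive Hopf bimodules over $H$ and the category of left modules over the algebra $\widehat T(H):=T_{S^{-2}}(H)\rtimes\mathbb Z_2$.
   Context: Notation: $\otimes=\otimes_\Bbbk$, $S$ is the (bijective) antipode of $H$, $h_{(1)}\otimes h_{(2)}=\Delta(h)$ Sweedler notation; on $H^*$, $S(\alpha)=\alpha\circ S$. **Involutive Hopf bimodules.** An involutive Hopf bimodule over $H$ is an $H$-bimodule and $H$-bicomodule $M$ (coactions $m_{[-1]}\otimes m_{[0]}$, $m_{[0]}\otimes m_{[1]}$) with $$(h\triangleright m\triangleleft g)_{[-1]}\otimes(h\triangleright m\triangleleft g)_{[0]}\otimes(h\triangleright m\triangleleft g)_{[1]}=h_{(1)}m_{[-1]}g_{(1)}\otimes h_{(2)}\triangleright m_{[0]}\triangleleft g_{(2)}\otimes h_{(3)}m_{[1]}S^{-2}(g_{(3)})$$ for all $g,h\in H$, $m\in M$, together with a linear map $\psi:M\to M$ with $\psi^2=\mathrm{id}$ such that $\psi(g\triangleright m\triangleleft h)=S^{-1}(h)\triangleright\psi(m)\triangleleft S(g)$ and $m_{[-1]}\otimes\psi(m_{[0]})\otimes m_{[1]}=S(\psi(m)_{[1]})\otimes\psi(m)_{[0]}\otimes S^{-1}(\psi(m)_{[-1]})$. Morphisms are linear maps that are bilinear and bicolinear over $H$ and intertwine the involutions. **The algebra.** $T_{S^{-2}}(H)$ is the vector space $H\otimes H\otimes H^*\otimes H^*$ with multiplication $$(g\otimes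 h\otimes\alpha\otimes\beta)(k\otimes\ell\otimes\gamma\otimes\delta)=g\,k_{(2)}\otimes\ell_{(2)}h\otimes\alpha(k_{(3)}\,\cdot\,S^{-2}(\ell_{(3)}))\gamma\otimes\delta\,\beta(k_{(1)}\,\cdot\,\ell_{(1)}),$$ where for $\alpha\in H^*$, $x,y\in H$ the functional $\alpha(x\,\cdot\,y)\in H^*$ is $f\mapsto\alpha(xfy)$, and products of functionals are convolution products. $\mathbb Z_2$ acts on $T_{S^{-2}}(H)$ by the algebra automorphism $g\otimes h\otimes\alpha\otimes\beta\mapsto S^{-1}(h)\otimes S(g)\otimes S(\beta)\otimes S^{-1}(\alpha)$, and $\widehat T(H)$ is the resulting crossed (smash) product $T_{S^{-2}}(H)\rtimes\mathbb Z_2$; i.e. $\widehat T(H)$ is generated by $T_{S^{-2}}(H)$ and an element $q$ with $q^2=1$ and $q(g\otimes h\otimes\alpha\otimes\beta)q=S^{-1}(h)\otimes S(g)\otimes S(\beta)\otimes S^{-1}(\alpha)$. *)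

theory Defs
  imports "HOL-Algebra.AbelCoset" "HOL-Algebra.Module"
begin

section \<open>Categories and isomorphisms of categories\<close>

record ('o, 'a) category =
  Obj :: "'o set"
  Hom :: "'o \<Rightarrow> 'o \<Rightarrow> 'a set"
  Ident :: "'o \<Rightarrow> 'a"
  Comp :: "'o \<Rightarrow> 'o \<Rightarrow> 'o \<Rightarrow> 'a \<Rightarrow> 'a \<Rightarrow> 'a"

text \<open>
  Hom-sets need not be disjoint, so composition carries its three objects:
  for \<open>f\<close> from \<open>X\<close> to \<open>Y\<close> and \<open>g\<close> from \<open>Y\<close> to \<open>Z\<close>,
  \<open>Comp C X Y Z g f\<close> is \<open>g\<close> after \<open>f\<close>.
\<close>

locale category =
  fixes C :: "('o, 'a) category"
  assumes Ident_in_Hom: "X \<in> Obj C \<Longrightarrow> Ident C X \<in> Hom C X X"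
    and Comp_in_Hom: "\<lbrakk>X \<in> Obj C; Y \<in> Obj C; Z \<in> Obj C; f \<in> Hom C X Y; g \<in> Hom C Y Z\<rbrakk>
      \<Longrightarrow> Comp C X Y Z g f \<in> Hom C X Z"
    and Comp_Ident_right: "\<lbrakk>X \<in> Obj C; Y \<in> Obj C; f \<in> Hom C X Y\<rbrakk>
      \<Longrightarrow> Comp C X X Y f (Ident C X) = f"
    and Comp_Ident_left: "\<lbrakk>X \<in> Obj C; Y \<in> Obj C; f \<in> Hom C X Y\<rbrakk>
      \<Longrightarrow> Comp C X Y Y (Ident C Y) f = f"
    and Comp_assoc: "\<lbrakk>W \<in> Obj C; X \<in> Obj C; Y \<in> Obj C; Z \<in> Obj C;
        f \<in> Hom C W X; g \<in> Hom C X Y; h \<in> Hom C Y Z\<rbrakk>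
      \<Longrightarrow> Comp C W Y Z h (Comp C W X Y g f) = Comp C W X Z (Comp C X Y Z h g) f"

locale cat_functor = C: category C + D: category D
  for C :: "('o, 'a) category" and D :: "('p, 'b) category" +
  fixes Fo :: "'o \<Rightarrow> 'p" and Fm :: "'o \<Rightarrow> 'o \<Rightarrow> 'a \<Rightarrow> 'b"
  assumes Fo_in_Obj: "X \<in> Obj C \<Longrightarrow> Fo X \<in> Obj D"
    and Fm_in_Hom: "\<lbrakk>X \<in> Obj C; Y \<in> Obj C; f \<in> Hom C X Y\<rbrakk> \<Longrightarrow> Fm X Y f \<in> Hom D (Fo X) (Fo Y)"
    and Fm_Ident: "X \<in> Obj C \<Longrightarrow> Fm X X (Ident C X) = Ident D (Fo X)"
    and Fm_Comp: "\<lbrakk>X \<in> Obj C; Y \<in> Obj C; Z \<in> Obj C; f \<in> Hom C X Y; g \<in> Hom C Y Z\<rbrakk>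
      \<Longrightarrow> Fm X Z (Comp C X Y Z g f) = Comp D (Fo X) (Fo Y) (Fo Z) (Fm Y Z g) (Fm X Y f)"

definition isomorphic_categories :: "('o, 'a) category \<Rightarrow> ('p, 'b) category \<Rightarrow> bool" where
  "isomorphic_categories C D \<longleftrightarrow>
    (\<exists>Fo Fm Go Gm. cat_functor C D Fo Fm \<and> cat_functor D C Go Gm \<and>
      (\<forall>X \<in> Obj C. Go (Fo X) = X) \<and>
      (\<forall>X \<in> Obj C. \<forall>Y \<in> Obj C. \<forall>f \<in> Hom C X Y. Gm (Fo X) (Fo Y) (Fm X Y f) = f) \<and>
      (\<forall>X \<in> Obj D. Fo (Go X) = X) \<and>
      (\<forall>X \<in> Obj D. \<forall>Y \<in> Obj D. \<forall>f \<in> Hom D X Y. Fm (Go X) (Go Y) (Gm X Y f) = f))"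


section \<open>Linear algebra over a field\<close>

text \<open>
  A vector space over the field \<open>K\<close> is a \<^const>\<open>module\<close> over \<open>K\<close>. The fields \<^const>\<open>mult\<close> and
  \<^const>\<open>one\<close> of the underlying record are not part of a vector space; they are set to
  \<^const>\<open>undefined\<close> wherever a bare vector space is built.
\<close>

definition linear_map ::
    "('k, 'r) ring_scheme \<Rightarrow> ('k, 'v, 'x) module_scheme \<Rightarrow> ('k, 'w, 'y) module_scheme
      \<Rightarrow> ('v \<Rightarrow> 'w) \<Rightarrow> bool" where
  "linear_map K V W f \<longleftrightarrow> f \<in> carrier V \<rightarrow> carrier W \<and>
    (\<forall>u \<in> carrier V. \<forall>v \<in> carrier V. f (u \<oplus>\<^bsub>V\<^esub> v) = f u \<oplus>\<^bsub>W\<^esub> f v) \<and>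
    (\<forall>a \<in> carrier K. \<forall>v \<in> carrier V. f (a \<odot>\<^bsub>V\<^esub> v) = a \<odot>\<^bsub>W\<^esub> f v)"

definition ring_as_module :: "('k, 'r) ring_scheme \<Rightarrow> ('k, 'k) module" where
  "ring_as_module K =
    \<lparr>carrier = carrier K, mult = mult K, one = one K, zero = zero K, add = add K, smult = mult K\<rparr>"

definition fin_dim :: "('k, 'r) ring_scheme \<Rightarrow> ('k, 'v, 'x) module_scheme \<Rightarrow> bool" where
  "fin_dim K V \<longleftrightarrow> (\<exists>B. finite B \<and> B \<subseteq> carrier V \<and>
    (\<forall>v \<in> carrier V. \<exists>c \<in> B \<rightarrow> carrier K. v = (\<Oplus>\<^bsub>V\<^esub>b \<in> B. c b \<odot>\<^bsub>V\<^esub> b)))"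

locale k_algebra = K?: field K + A?: ring A + module K A
  for K (structure) and A (structure) +
  assumes smult_mult_left: "\<lbrakk>a \<in> carrier K; x \<in> carrier A; y \<in> carrier A\<rbrakk>
      \<Longrightarrow> (a \<odot>\<^bsub>A\<^esub> x) \<otimes>\<^bsub>A\<^esub> y = a \<odot>\<^bsub>A\<^esub> (x \<otimes>\<^bsub>A\<^esub> y)"
    and smult_mult_right: "\<lbrakk>a \<in> carrier K; x \<in> carrier A; y \<in> carrier A\<rbrakk>
      \<Longrightarrow> x \<otimes>\<^bsub>A\<^esub> (a \<odot>\<^bsub>A\<^esub> y) = a \<odot>\<^bsub>A\<^esub> (x \<otimes>\<^bsub>A\<^esub> y)"


subsection \<open>Tensor products\<close>

definition free_module :: "('k, 'r) ring_scheme \<Rightarrow> 'x set \<Rightarrow> ('k, 'x \<Rightarrow> 'k) module" where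
  "free_module K X =
    \<lparr>carrier = {f. f \<in> X \<rightarrow> carrier K \<and> (\<forall>x. x \<notin> X \<longrightarrow> f x = \<zero>\<^bsub>K\<^esub>) \<and> finite {x. f x \<noteq> \<zero>\<^bsub>K\<^esub>}},
     mult = undefined, one = undefined,
     zero = (\<lambda>x. \<zero>\<^bsub>K\<^esub>),
     add = (\<lambda>f g x. f x \<oplus>\<^bsub>K\<^esub> g x),
     smult = (\<lambda>a f x. a \<otimes>\<^bsub>K\<^esub> f x)\<rparr>"

definition free_gen :: "('k, 'r) ring_scheme \<Rightarrow> 'x \<Rightarrow> 'x \<Rightarrow> 'k" where
  "free_gen K x = (\<lambda>y. if y = x then \<one>\<^bsub>K\<^esub> else \<zero>\<^bsub>K\<^esub>)"

definition generated_submodule ::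
    "('k, 'r) ring_scheme \<Rightarrow> ('k, 'v) module \<Rightarrow> 'v set \<Rightarrow> 'v set" where
  "generated_submodule K V S = \<Inter>{N. submodule N K V \<and> S \<subseteq> N}"

definition quotient_module :: "('k, 'v) module \<Rightarrow> 'v set \<Rightarrow> ('k, 'v set) module" where
  "quotient_module V N =
    \<lparr>carrier = a_rcosets\<^bsub>V\<^esub> N,
     mult = undefined, one = undefined,
     zero = N,
     add = set_add V,
     smult = (\<lambda>a A. \<Union>v\<in>A. N +>\<^bsub>V\<^esub> (a \<odot>\<^bsub>V\<^esub> v))\<rparr>"

type_synonym ('k, 'v, 'w) tensor = "('v \<times> 'w \<Rightarrow> 'k) set"

definition tensor_rels ::
    "('k, 'r) ring_scheme \<Rightarrow> ('k, 'v, 'x) module_scheme \<Rightarrow> ('k, 'w, 'y) module_scheme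
      \<Rightarrow> ('v \<times> 'w \<Rightarrow> 'k) set" where
  "tensor_rels K V W = (let F = free_module K (carrier V \<times> carrier W); e = free_gen K in
      {e (u \<oplus>\<^bsub>V\<^esub> v, w) \<ominus>\<^bsub>F\<^esub> (e (u, w) \<oplus>\<^bsub>F\<^esub> e (v, w)) |
        u v w. u \<in> carrier V \<and> v \<in> carrier V \<and> w \<in> carrier W} \<union>
      {e (v, w \<oplus>\<^bsub>W\<^esub> z) \<ominus>\<^bsub>F\<^esub> (e (v, w) \<oplus>\<^bsub>F\<^esub> e (v, z)) |
        v w z. v \<in> carrier V \<and> w \<in> carrier W \<and> z \<in> carrier W} \<union>
      {e (a \<odot>\<^bsub>V\<^esub> v, w) \<ominus>\<^bsub>F\<^esub> (a \<odot>\<^bsub>F\<^esub> e (v, w)) |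
        a v w. a \<in> carrier K \<and> v \<in> carrier V \<and> w \<in> carrier W} \<union>
      {e (v, a \<odot>\<^bsub>W\<^esub> w) \<ominus>\<^bsub>F\<^esub> (a \<odot>\<^bsub>F\<^esub> e (v, w)) |
        a v w. a \<in> carrier K \<and> v \<in> carrier V \<and> w \<in> carrier W})"

definition tensor_null ::
    "('k, 'r) ring_scheme \<Rightarrow> ('k, 'v, 'x) module_scheme \<Rightarrow> ('k, 'w, 'y) module_scheme
      \<Rightarrow> ('v \<times> 'w \<Rightarrow> 'k) set" where
  "tensor_null K V W =
    generated_submodule K (free_module K (carrier V \<times> carrier W)) (tensor_rels K V W)"

definition tensor_module ::
    "('k, 'r) ring_scheme \<Rightarrow> ('k, 'v, 'x) module_scheme \<Rightarrow> ('k, 'w, 'y) module_scheme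
      \<Rightarrow> ('k, ('k, 'v, 'w) tensor) module" where
  "tensor_module K V W =
    quotient_module (free_module K (carrier V \<times> carrier W)) (tensor_null K V W)"

definition tens ::
    "('k, 'r) ring_scheme \<Rightarrow> ('k, 'v, 'x) module_scheme \<Rightarrow> ('k, 'w, 'y) module_scheme
      \<Rightarrow> 'v \<Rightarrow> 'w \<Rightarrow> ('k, 'v, 'w) tensor" where
  "tens K V W v w =
    tensor_null K V W +>\<^bsub>free_module K (carrier V \<times> carrier W)\<^esub> free_gen K (v, w)"

text \<open>
  The linear map on a tensor product induced by a bilinear map \<open>f\<close> into \<open>X\<close>: a tensor
  represented by the formal sum of \<open>\<phi> (v, w)\<close> times \<open>(v, w)\<close> is sent to the sum of
  \<open>\<phi> (v, w) \<odot> f v w\<close>. For bilinear \<open>f\<close> the value does not depend on the representative,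
  and \<open>tensor_lift K X f (\<Delta> h)\<close> is what Sweedler notation writes as \<open>f h\<^sub>(\<^sub>1\<^sub>) h\<^sub>(\<^sub>2\<^sub>)\<close>.
\<close>

definition tensor_lift ::
    "('k, 'r) ring_scheme \<Rightarrow> ('k, 'u, 'x) module_scheme \<Rightarrow> ('v \<Rightarrow> 'w \<Rightarrow> 'u)
      \<Rightarrow> ('k, 'v, 'w) tensor \<Rightarrow> 'u" where
  "tensor_lift K X f t = (let \<phi> = (SOME \<phi>. \<phi> \<in> t) in
    (\<Oplus>\<^bsub>X\<^esub>p \<in> {p. \<phi> p \<noteq> \<zero>\<^bsub>K\<^esub>}. \<phi> p \<odot>\<^bsub>X\<^esub> f (fst p) (snd p)))"

text \<open>Threefold and fourfold tensor products are bracketed to the right.\<close>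

abbreviation tensor_module3 where
  "tensor_module3 K U V W \<equiv> tensor_module K U (tensor_module K V W)"

abbreviation tens3 where
  "tens3 K U V W u v w \<equiv> tens K U (tensor_module K V W) u (tens K V W v w)"

abbreviation tensor_module4 where
  "tensor_module4 K U V W Z \<equiv> tensor_module K U (tensor_module3 K V W Z)"

abbreviation tens4 where
  "tens4 K U V W Z u v w z \<equiv> tens K U (tensor_module3 K V W Z) u (tens3 K V W Z v w z)"

abbreviation tensor_lift4 where
  "tensor_lift4 K X f t \<equiv>
    tensor_lift K X (\<lambda>u t'. tensor_lift K X (\<lambda>v t''. tensor_lift K X (\<lambda>w z. f u v w z) t'') t') t"


section \<open>Hopf algebras\<close>

record ('k, 'h) hopf = "('k, 'h) module" +
  comult :: "'h \<Rightarrow> ('k, 'h, 'h) tensor"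
  counit :: "'h \<Rightarrow> 'k"
  antipode :: "'h \<Rightarrow> 'h"

text \<open>Sweedler notation: \<open>f h\<^sub>(\<^sub>1\<^sub>) h\<^sub>(\<^sub>2\<^sub>)\<close> and \<open>f h\<^sub>(\<^sub>1\<^sub>) h\<^sub>(\<^sub>2\<^sub>) h\<^sub>(\<^sub>3\<^sub>)\<close>, with values in \<open>X\<close>.\<close>

definition sweedler2 ::
    "('k, 'r) ring_scheme \<Rightarrow> ('k, 'h, 'y) hopf_scheme \<Rightarrow> ('k, 'u, 'x) module_scheme
      \<Rightarrow> 'h \<Rightarrow> ('h \<Rightarrow> 'h \<Rightarrow> 'u) \<Rightarrow> 'u" where
  "sweedler2 K H X h f = tensor_lift K X f (comult H h)"

definition sweedler3 ::
    "('k, 'r) ring_scheme \<Rightarrow> ('k, 'h, 'y) hopf_scheme \<Rightarrow> ('k, 'u, 'x) module_scheme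
      \<Rightarrow> 'h \<Rightarrow> ('h \<Rightarrow> 'h \<Rightarrow> 'h \<Rightarrow> 'u) \<Rightarrow> 'u" where
  "sweedler3 K H X h f = sweedler2 K H X h (\<lambda>a c. sweedler2 K H X a (\<lambda>a' b. f a' b c))"

locale hopf_algebra = k_algebra K H
  for K :: "('k, 'r) ring_scheme" (structure)
    and H :: "('k, 'h, 'y) hopf_scheme" (structure) +
  assumes comult_linear: "linear_map K H (tensor_module K H H) (comult H)"
    and counit_linear: "linear_map K H (ring_as_module K) (counit H)"
    and antipode_linear: "linear_map K H H (antipode H)"
    and comult_coassoc: "h \<in> carrier H \<Longrightarrow>
      sweedler2 K H (tensor_module3 K H H H) h
        (\<lambda>a c. sweedler2 K H (tensor_module3 K H H H) a (\<lambda>a' b. tens3 K H H H a' b c)) =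
      sweedler2 K H (tensor_module3 K H H H) h
        (\<lambda>a b. sweedler2 K H (tensor_module3 K H H H) b (\<lambda>b' c. tens3 K H H H a b' c))"
    and counit_left: "h \<in> carrier H \<Longrightarrow> sweedler2 K H H h (\<lambda>a b. counit H a \<odot>\<^bsub>H\<^esub> b) = h"
    and counit_right: "h \<in> carrier H \<Longrightarrow> sweedler2 K H H h (\<lambda>a b. counit H b \<odot>\<^bsub>H\<^esub> a) = h"
    and comult_mult: "\<lbrakk>g \<in> carrier H; h \<in> carrier H\<rbrakk> \<Longrightarrow>
      comult H (g \<otimes>\<^bsub>H\<^esub> h) =
        sweedler2 K H (tensor_module K H H) g (\<lambda>g1 g2.
          sweedler2 K H (tensor_module K H H) h (\<lambda>h1 h2.
            tens K H H (g1 \<otimes>\<^bsub>H\<^esub> h1) (g2 \<otimes>\<^bsub>H\<^esub> h2)))"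
    and comult_one: "comult H \<one>\<^bsub>H\<^esub> = tens K H H \<one>\<^bsub>H\<^esub> \<one>\<^bsub>H\<^esub>"
    and counit_mult: "\<lbrakk>g \<in> carrier H; h \<in> carrier H\<rbrakk> \<Longrightarrow>
      counit H (g \<otimes>\<^bsub>H\<^esub> h) = counit H g \<otimes>\<^bsub>K\<^esub> counit H h"
    and counit_one: "counit H \<one>\<^bsub>H\<^esub> = \<one>\<^bsub>K\<^esub>"
    and antipode_left: "h \<in> carrier H \<Longrightarrow>
      sweedler2 K H H h (\<lambda>a b. antipode H a \<otimes>\<^bsub>H\<^esub> b) = counit H h \<odot>\<^bsub>H\<^esub> \<one>\<^bsub>H\<^esub>"
    and antipode_right: "h \<in> carrier H \<Longrightarrow>
      sweedler2 K H H h (\<lambda>a b. a \<otimes>\<^bsub>H\<^esub> antipode H b) = counit H h \<odot>\<^bsub>H\<^esub> \<one>\<^bsub>H\<^esub>"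

text \<open>
  The antipode of a finite-dimensional Hopf algebra is bijective, so this is its two-sided
  inverse there.
\<close>

definition antipode_inv :: "('k, 'h, 'y) hopf_scheme \<Rightarrow> 'h \<Rightarrow> 'h" where
  "antipode_inv H = inv_into (carrier H) (antipode H)"

definition antipode_inv2 :: "('k, 'h, 'y) hopf_scheme \<Rightarrow> 'h \<Rightarrow> 'h" where
  "antipode_inv2 H h = antipode_inv H (antipode_inv H h)"

text \<open>The dual algebra, whose multiplication is the convolution product.\<close>

definition dual :: "('k, 'r) ring_scheme \<Rightarrow> ('k, 'h, 'y) hopf_scheme \<Rightarrow> ('k, 'h \<Rightarrow> 'k) module" where
  "dual K H =
    \<lparr>carrier = {\<alpha> \<in> extensional (carrier H). linear_map K H (ring_as_module K) \<alpha>},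
     mult = (\<lambda>\<alpha> \<beta>. \<lambda>h\<in>carrier H. sweedler2 K H (ring_as_module K) h (\<lambda>a b. \<alpha> a \<otimes>\<^bsub>K\<^esub> \<beta> b)),
     one = (\<lambda>h\<in>carrier H. counit H h),
     zero = (\<lambda>h\<in>carrier H. \<zero>\<^bsub>K\<^esub>),
     add = (\<lambda>\<alpha> \<beta>. \<lambda>h\<in>carrier H. \<alpha> h \<oplus>\<^bsub>K\<^esub> \<beta> h),
     smult = (\<lambda>a \<alpha>. \<lambda>h\<in>carrier H. a \<otimes>\<^bsub>K\<^esub> \<alpha> h)\<rparr>"

text \<open>\<open>dual_shift H \<alpha> x y\<close> is the functional \<open>\<alpha>(x \<cdot> y)\<close>, and \<open>dual_comp H \<alpha> s\<close> is \<open>\<alpha> \<circ> s\<close>.\<close>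

definition dual_shift :: "('k, 'h, 'y) hopf_scheme \<Rightarrow> ('h \<Rightarrow> 'k) \<Rightarrow> 'h \<Rightarrow> 'h \<Rightarrow> 'h \<Rightarrow> 'k" where
  "dual_shift H \<alpha> x y = (\<lambda>f\<in>carrier H. \<alpha> (x \<otimes>\<^bsub>H\<^esub> f \<otimes>\<^bsub>H\<^esub> y))"

definition dual_comp :: "('k, 'h, 'y) hopf_scheme \<Rightarrow> ('h \<Rightarrow> 'k) \<Rightarrow> ('h \<Rightarrow> 'h) \<Rightarrow> 'h \<Rightarrow> 'k" where
  "dual_comp H \<alpha> s = (\<lambda>f\<in>carrier H. \<alpha> (s f))"


section \<open>The crossed product algebra\<close>

type_synonym ('k, 'h) T_elem =
  "('k, 'h, ('k, 'h, ('k, 'h \<Rightarrow> 'k, 'h \<Rightarrow> 'k) tensor) tensor) tensor"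

abbreviation T_space ::
    "('k, 'r) ring_scheme \<Rightarrow> ('k, 'h, 'y) hopf_scheme \<Rightarrow> ('k, ('k, 'h) T_elem) module" where
  "T_space K H \<equiv> tensor_module4 K H H (dual K H) (dual K H)"

abbreviation T_tens ::
    "('k, 'r) ring_scheme \<Rightarrow> ('k, 'h, 'y) hopf_scheme
      \<Rightarrow> 'h \<Rightarrow> 'h \<Rightarrow> ('h \<Rightarrow> 'k) \<Rightarrow> ('h \<Rightarrow> 'k) \<Rightarrow> ('k, 'h) T_elem" where
  "T_tens K H g h \<alpha> \<beta> \<equiv> tens4 K H H (dual K H) (dual K H) g h \<alpha> \<beta>"

definition T_mult ::
    "('k, 'r) ring_scheme \<Rightarrow> ('k, 'h, 'y) hopf_scheme
      \<Rightarrow> ('k, 'h) T_elem \<Rightarrow> ('k, 'h) T_elem \<Rightarrow> ('k, 'h) T_elem" where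
  "T_mult K H s t =
    tensor_lift4 K (T_space K H) (\<lambda>g h \<alpha> \<beta>. tensor_lift4 K (T_space K H) (\<lambda>k l \<gamma> \<delta>.
      sweedler3 K H (T_space K H) k (\<lambda>k1 k2 k3. sweedler3 K H (T_space K H) l (\<lambda>l1 l2 l3.
        T_tens K H
          (g \<otimes>\<^bsub>H\<^esub> k2)
          (l2 \<otimes>\<^bsub>H\<^esub> h)
          (dual_shift H \<alpha> k3 (antipode_inv2 H l3) \<otimes>\<^bsub>dual K H\<^esub> \<gamma>)
          (\<delta> \<otimes>\<^bsub>dual K H\<^esub> dual_shift H \<beta> k1 l1)))) t) s"

definition T_algebra ::
    "('k, 'r) ring_scheme \<Rightarrow> ('k, 'h, 'y) hopf_scheme \<Rightarrow> ('k, ('k, 'h) T_elem) module" where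
  "T_algebra K H = (T_space K H)
    \<lparr>mult := T_mult K H,
     one := T_tens K H \<one>\<^bsub>H\<^esub> \<one>\<^bsub>H\<^esub> \<one>\<^bsub>dual K H\<^esub> \<one>\<^bsub>dual K H\<^esub>\<rparr>"

definition T_auto ::
    "('k, 'r) ring_scheme \<Rightarrow> ('k, 'h, 'y) hopf_scheme \<Rightarrow> ('k, 'h) T_elem \<Rightarrow> ('k, 'h) T_elem" where
  "T_auto K H t = tensor_lift4 K (T_space K H) (\<lambda>g h \<alpha> \<beta>.
    T_tens K H (antipode_inv H h) (antipode H g)
      (dual_comp H \<beta> (antipode H)) (dual_comp H \<alpha> (antipode_inv H))) t"

text \<open>
  The crossed product of \<open>A\<close> with the group of order two acting by the automorphism \<open>\<sigma>\<close>. The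
  pair \<open>(a, b)\<close> stands for \<open>a + b q\<close>, so that \<open>q\<^sup>2 = 1\<close> and \<open>q a q = \<sigma> a\<close>.
\<close>

definition crossed_product_Z2 ::
    "('a \<Rightarrow> 'a) \<Rightarrow> ('k, 'a, 'x) module_scheme \<Rightarrow> ('k, 'a \<times> 'a) module" where
  "crossed_product_Z2 \<sigma> A =
    \<lparr>carrier = carrier A \<times> carrier A,
     mult = (\<lambda>(a, b) (c, d). ((a \<otimes>\<^bsub>A\<^esub> c) \<oplus>\<^bsub>A\<^esub> (b \<otimes>\<^bsub>A\<^esub> \<sigma> d), (a \<otimes>\<^bsub>A\<^esub> d) \<oplus>\<^bsub>A\<^esub> (b \<otimes>\<^bsub>A\<^esub> \<sigma> c))),
     one = (\<one>\<^bsub>A\<^esub>, \<zero>\<^bsub>A\<^esub>),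
     zero = (\<zero>\<^bsub>A\<^esub>, \<zero>\<^bsub>A\<^esub>),
     add = (\<lambda>(a, b) (c, d). (a \<oplus>\<^bsub>A\<^esub> c, b \<oplus>\<^bsub>A\<^esub> d)),
     smult = (\<lambda>x (a, b). (x \<odot>\<^bsub>A\<^esub> a, x \<odot>\<^bsub>A\<^esub> b))\<rparr>"

type_synonym ('k, 'h) T_hat_elem = "('k, 'h) T_elem \<times> ('k, 'h) T_elem"

definition T_hat ::
    "('k, 'r) ring_scheme \<Rightarrow> ('k, 'h, 'y) hopf_scheme \<Rightarrow> ('k, ('k, 'h) T_hat_elem) module" where
  "T_hat K H = crossed_product_Z2 (T_auto K H) (T_algebra K H)"


section \<open>The two categories\<close>

text \<open>
  The objects of both categories have as underlying vector space an arbitrary vector space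
  whose carrier is a subset of a type \<open>'m\<close>, which plays the role of the universe. Since HOL
  functions are total, an object is determined by its mathematical data only if the structure
  maps have a fixed value off their domain; as isomorphism of categories is about equality of
  objects, the objects are required to be normalised in this sense.
\<close>

definition normal_space ::
    "('k, 'r) ring_scheme \<Rightarrow> ('k, 'm, 'x) module_scheme \<Rightarrow> bool" where
  "normal_space K M \<longleftrightarrow> mult M = undefined \<and> one M = undefined \<and>
    case_prod (add M) \<in> extensional (carrier M \<times> carrier M) \<and>
    case_prod (smult M) \<in> extensional (carrier K \<times> carrier M)"


subsection \<open>Left modules over an algebra\<close>

record ('k, 'a, 'm) left_module = "('k, 'm) module" +
  act :: "'a \<Rightarrow> 'm \<Rightarrow> 'm"

locale left_module_over = module K M
  for K :: "('k, 'r) ring_scheme" (structure) and A :: "('k, 'a, 'x) module_scheme"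
    and M :: "('k, 'a, 'm) left_module" (structure) +
  assumes act_closed: "\<lbrakk>s \<in> carrier A; m \<in> carrier M\<rbrakk> \<Longrightarrow> act M s m \<in> carrier M"
    and act_add_left: "\<lbrakk>s \<in> carrier A; t \<in> carrier A; m \<in> carrier M\<rbrakk> \<Longrightarrow>
      act M (s \<oplus>\<^bsub>A\<^esub> t) m = act M s m \<oplus>\<^bsub>M\<^esub> act M t m"
    and act_smult_left: "\<lbrakk>a \<in> carrier K; s \<in> carrier A; m \<in> carrier M\<rbrakk> \<Longrightarrow>
      act M (a \<odot>\<^bsub>A\<^esub> s) m = a \<odot>\<^bsub>M\<^esub> act M s m"
    and act_linear: "s \<in> carrier A \<Longrightarrow> linear_map K M M (act M s)"
    and act_mult: "\<lbrakk>s \<in> carrier A; t \<in> carrier A; m \<in> carrier M\<rbrakk> \<Longrightarrow>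
      act M (s \<otimes>\<^bsub>A\<^esub> t) m = act M s (act M t m)"
    and act_one: "m \<in> carrier M \<Longrightarrow> act M \<one>\<^bsub>A\<^esub> m = m"

definition normal_left_module ::
    "('k, 'r) ring_scheme \<Rightarrow> ('k, 'a, 'x) module_scheme \<Rightarrow> ('k, 'a, 'm) left_module \<Rightarrow> bool" where
  "normal_left_module K A M \<longleftrightarrow> normal_space K M \<and>
    case_prod (act M) \<in> extensional (carrier A \<times> carrier M)"

definition left_module_hom ::
    "('k, 'r) ring_scheme \<Rightarrow> ('k, 'a, 'x) module_scheme
      \<Rightarrow> ('k, 'a, 'm) left_module \<Rightarrow> ('k, 'a, 'm) left_module \<Rightarrow> ('m \<Rightarrow> 'm) set" where
  "left_module_hom K A M N = {f \<in> extensional (carrier M). linear_map K M N f \<and>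
    (\<forall>s \<in> carrier A. \<forall>m \<in> carrier M. f (act M s m) = act N s (f m))}"

definition left_module_category ::
    "('k, 'r) ring_scheme \<Rightarrow> ('k, 'a, 'x) module_scheme
      \<Rightarrow> (('k, 'a, 'm) left_module, 'm \<Rightarrow> 'm) category" where
  "left_module_category K A =
    \<lparr>Obj = {M. left_module_over K A M \<and> normal_left_module K A M},
     Hom = left_module_hom K A,
     Ident = (\<lambda>M. \<lambda>m\<in>carrier M. m),
     Comp = (\<lambda>M N P g f. compose (carrier M) g f)\<rparr>"


subsection \<open>Involutive Hopf bimodules\<close>

record ('k, 'h, 'm) hopf_bimodule = "('k, 'm) module" +
  lact :: "'h \<Rightarrow> 'm \<Rightarrow> 'm"
  ract :: "'m \<Rightarrow> 'h \<Rightarrow> 'm"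
  lcoact :: "'m \<Rightarrow> ('k, 'h, 'm) tensor"
  rcoact :: "'m \<Rightarrow> ('k, 'm, 'h) tensor"
  invol :: "'m \<Rightarrow> 'm"

text \<open>Sweedler notation \<open>f m\<^sub>[\<^sub>-\<^sub>1\<^sub>] m\<^sub>[\<^sub>0\<^sub>] m\<^sub>[\<^sub>1\<^sub>]\<close> for the two coactions of a bicomodule.\<close>

definition bisweedler ::
    "('k, 'r) ring_scheme \<Rightarrow> ('k, 'h, 'm) hopf_bimodule \<Rightarrow> ('k, 'u, 'x) module_scheme
      \<Rightarrow> 'm \<Rightarrow> ('h \<Rightarrow> 'm \<Rightarrow> 'h \<Rightarrow> 'u) \<Rightarrow> 'u" where
  "bisweedler K M X m f =
    tensor_lift K X (\<lambda>x n. tensor_lift K X (\<lambda>p y. f x p y) (rcoact M n)) (lcoact M m)"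

locale bimodule_over = module K M
  for K :: "('k, 'r) ring_scheme" (structure) and H :: "('k, 'h, 'y) hopf_scheme"
    and M :: "('k, 'h, 'm) hopf_bimodule" (structure) +
  assumes lact_linear: "h \<in> carrier H \<Longrightarrow> linear_map K M M (\<lambda>m. lact M h m)"
    and lact_linear': "m \<in> carrier M \<Longrightarrow> linear_map K H M (\<lambda>h. lact M h m)"
    and lact_mult: "\<lbrakk>g \<in> carrier H; h \<in> carrier H; m \<in> carrier M\<rbrakk> \<Longrightarrow>
      lact M (g \<otimes>\<^bsub>H\<^esub> h) m = lact M g (lact M h m)"
    and lact_one: "m \<in> carrier M \<Longrightarrow> lact M \<one>\<^bsub>H\<^esub> m = m"
    and ract_linear: "h \<in> carrier H \<Longrightarrow> linear_map K M M (\<lambda>m. ract M m h)"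
    and ract_linear': "m \<in> carrier M \<Longrightarrow> linear_map K H M (\<lambda>h. ract M m h)"
    and ract_mult: "\<lbrakk>g \<in> carrier H; h \<in> carrier H; m \<in> carrier M\<rbrakk> \<Longrightarrow>
      ract M m (g \<otimes>\<^bsub>H\<^esub> h) = ract M (ract M m g) h"
    and ract_one: "m \<in> carrier M \<Longrightarrow> ract M m \<one>\<^bsub>H\<^esub> = m"
    and lact_ract: "\<lbrakk>g \<in> carrier H; h \<in> carrier H; m \<in> carrier M\<rbrakk> \<Longrightarrow>
      ract M (lact M g m) h = lact M g (ract M m h)"

locale bicomodule_over = module K M
  for K :: "('k, 'r) ring_scheme" (structure) and H :: "('k, 'h, 'y) hopf_scheme"
    and M :: "('k, 'h, 'm) hopf_bimodule" (structure) +
  assumes lcoact_linear: "linear_map K M (tensor_module K H M) (lcoact M)"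
    and lcoact_coassoc: "m \<in> carrier M \<Longrightarrow>
      tensor_lift K (tensor_module3 K H H M)
        (\<lambda>x n. sweedler2 K H (tensor_module3 K H H M) x (\<lambda>x1 x2. tens3 K H H M x1 x2 n))
        (lcoact M m) =
      tensor_lift K (tensor_module3 K H H M)
        (\<lambda>x n. tensor_lift K (tensor_module3 K H H M) (\<lambda>y p. tens3 K H H M x y p) (lcoact M n))
        (lcoact M m)"
    and lcoact_counit: "m \<in> carrier M \<Longrightarrow>
      tensor_lift K M (\<lambda>x n. counit H x \<odot>\<^bsub>M\<^esub> n) (lcoact M m) = m"
    and rcoact_linear: "linear_map K M (tensor_module K M H) (rcoact M)"
    and rcoact_coassoc: "m \<in> carrier M \<Longrightarrow>
      tensor_lift K (tensor_module3 K M H H)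
        (\<lambda>n x. sweedler2 K H (tensor_module3 K M H H) x (\<lambda>x1 x2. tens3 K M H H n x1 x2))
        (rcoact M m) =
      tensor_lift K (tensor_module3 K M H H)
        (\<lambda>n x. tensor_lift K (tensor_module3 K M H H) (\<lambda>p y. tens3 K M H H p y x) (rcoact M n))
        (rcoact M m)"
    and rcoact_counit: "m \<in> carrier M \<Longrightarrow>
      tensor_lift K M (\<lambda>n x. counit H x \<odot>\<^bsub>M\<^esub> n) (rcoact M m) = m"
    and lcoact_rcoact: "m \<in> carrier M \<Longrightarrow>
      tensor_lift K (tensor_module3 K H M H)
        (\<lambda>x n. tensor_lift K (tensor_module3 K H M H) (\<lambda>p y. tens3 K H M H x p y) (rcoact M n))
        (lcoact M m) =
      tensor_lift K (tensor_module3 K H M H)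
        (\<lambda>n y. tensor_lift K (tensor_module3 K H M H) (\<lambda>x p. tens3 K H M H x p y) (lcoact M n))
        (rcoact M m)"

locale involutive_hopf_bimodule = bimodule_over K H M + bicomodule_over K H M
  for K :: "('k, 'r) ring_scheme" (structure) and H :: "('k, 'h, 'y) hopf_scheme"
    and M :: "('k, 'h, 'm) hopf_bimodule" (structure) +
  assumes coact_act: "\<lbrakk>g \<in> carrier H; h \<in> carrier H; m \<in> carrier M\<rbrakk> \<Longrightarrow>
      bisweedler K M (tensor_module3 K H M H) (ract M (lact M h m) g)
        (\<lambda>x n y. tens3 K H M H x n y) =
      sweedler3 K H (tensor_module3 K H M H) h (\<lambda>h1 h2 h3.
        sweedler3 K H (tensor_module3 K H M H) g (\<lambda>g1 g2 g3.
          bisweedler K M (tensor_module3 K H M H) m (\<lambda>x n y.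
            tens3 K H M H
              (h1 \<otimes>\<^bsub>H\<^esub> x \<otimes>\<^bsub>H\<^esub> g1)
              (ract M (lact M h2 n) g2)
              (h3 \<otimes>\<^bsub>H\<^esub> y \<otimes>\<^bsub>H\<^esub> antipode_inv2 H g3))))"
    and invol_linear: "linear_map K M M (invol M)"
    and invol_invol: "m \<in> carrier M \<Longrightarrow> invol M (invol M m) = m"
    and invol_act: "\<lbrakk>g \<in> carrier H; h \<in> carrier H; m \<in> carrier M\<rbrakk> \<Longrightarrow>
      invol M (ract M (lact M g m) h) =
        ract M (lact M (antipode_inv H h) (invol M m)) (antipode H g)"
    and invol_coact: "m \<in> carrier M \<Longrightarrow>
      bisweedler K M (tensor_module3 K H M H) m (\<lambda>x n y. tens3 K H M H x (invol M n) y) =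
      bisweedler K M (tensor_module3 K H M H) (invol M m)
        (\<lambda>x n y. tens3 K H M H (antipode H y) n (antipode_inv H x))"

definition normal_hopf_bimodule ::
    "('k, 'r) ring_scheme \<Rightarrow> ('k, 'h, 'y) hopf_scheme \<Rightarrow> ('k, 'h, 'm) hopf_bimodule \<Rightarrow> bool" where
  "normal_hopf_bimodule K H M \<longleftrightarrow> normal_space K M \<and>
    case_prod (lact M) \<in> extensional (carrier H \<times> carrier M) \<and>
    case_prod (ract M) \<in> extensional (carrier M \<times> carrier H) \<and>
    lcoact M \<in> extensional (carrier M) \<and>
    rcoact M \<in> extensional (carrier M) \<and>
    invol M \<in> extensional (carrier M)"

definition hopf_bimodule_hom ::
    "('k, 'r) ring_scheme \<Rightarrow> ('k, 'h, 'y) hopf_scheme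
      \<Rightarrow> ('k, 'h, 'm) hopf_bimodule \<Rightarrow> ('k, 'h, 'm) hopf_bimodule \<Rightarrow> ('m \<Rightarrow> 'm) set" where
  "hopf_bimodule_hom K H M N = {f \<in> extensional (carrier M). linear_map K M N f \<and>
    (\<forall>h \<in> carrier H. \<forall>m \<in> carrier M. f (lact M h m) = lact N h (f m)) \<and>
    (\<forall>h \<in> carrier H. \<forall>m \<in> carrier M. f (ract M m h) = ract N (f m) h) \<and>
    (\<forall>m \<in> carrier M. lcoact N (f m) =
      tensor_lift K (tensor_module K H N) (\<lambda>x n. tens K H N x (f n)) (lcoact M m)) \<and>
    (\<forall>m \<in> carrier M. rcoact N (f m) =
      tensor_lift K (tensor_module K N H) (\<lambda>n x. tens K N H (f n) x) (rcoact M m)) \<and>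
    (\<forall>m \<in> carrier M. f (invol M m) = invol N (f m))}"

definition involutive_hopf_bimodule_category ::
    "('k, 'r) ring_scheme \<Rightarrow> ('k, 'h, 'y) hopf_scheme
      \<Rightarrow> (('k, 'h, 'm) hopf_bimodule, 'm \<Rightarrow> 'm) category" where
  "involutive_hopf_bimodule_category K H =
    \<lparr>Obj = {M. involutive_hopf_bimodule K H M \<and> normal_hopf_bimodule K H M},
     Hom = hopf_bimodule_hom K H,
     Ident = (\<lambda>M. \<lambda>m\<in>carrier M. m),
     Comp = (\<lambda>M N P g f. compose (carrier M) g f)\<rparr>"

end

theory Submission
  imports Defs
begin

text \<open>
  As \<open>H\<close> is finite-dimensional, a pair of commuting coactions on \<open>M\<close> is the same as a pair of
  commuting actions of \<open>H\<^sup>*\<close>, namely \<open>R \<alpha> m = \<alpha>(m\<^sub>[\<^sub>1\<^sub>]) m\<^sub>[\<^sub>0\<^sub>]\<close> and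
  \<open>L \<beta> m = \<beta>(m\<^sub>[\<^sub>-\<^sub>1\<^sub>]) m\<^sub>[\<^sub>0\<^sub>]\<close>: elements of \<open>H \<otimes> M\<close> are separated by functionals on \<open>H\<close>, and a dual
  basis recovers the coaction from the action. Under this dictionary \<open>g \<otimes> h \<otimes> \<alpha> \<otimes> \<beta>\<close> acts by
  \<open>m \<mapsto> g \<triangleright> R \<alpha> (L \<beta> m) \<triangleleft> h\<close>, the generator \<open>q\<close> acts by the involution, and the axioms of an
  involutive Hopf bimodule become the relations of the crossed product. A linear map respects one
  structure if and only if it respects the other, so both functors are the identity on morphisms.

  The algebra makes sense because the antipode of \<open>H\<close> is bijective. By dimension it suffices that it
  is injective, and this follows from the existence of a nonzero integral on \<open>H\<close>, which is found, as
  for every Hopf module, by projecting \<open>H\<^sup>*\<close> to its coinvariants.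
\<close>

section \<open>Linear maps\<close>

text \<open>\<open>tensor_lift\<close> reads its value off one chosen representative, so
  coassociativity, the counit laws and multiplicativity of the coproduct apply to a Sweedler sum
  only after multilinearity of its summand is checked. Hence identities are tested on pure tensors
  or against an arbitrary multilinear \<open>f\<close>, and \<open>lins\<close>,
  \<open>tlins\<close>, \<open>mlins\<close> collect rules that settle linearity and closure goals
  along the structure of a term. Variance explains the product of T. \<open>Rop\<close> is a left
  and \<open>Lop\<close> a right action of the dual, as \<open>lact\<close> and \<open>ract\<close>
  are of \<open>H\<close>; so the first and third tensor factors multiply in order, the second and
  fourth in reverse. The relation moving a functional past an element of \<open>H\<close> is the
  compatibility of coactions with actions, paired with functionals. The integral has to be found
  with S alone, as its inverse is not yet available. The projection to coinvariants is m_0 S(m_1).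
  On the dual, with (f.u)(x) = f(x S(u)) and coaction f -> sum of \<xi>_i f \<otimes> e_i over a
  dual basis, it sends f to x -> sum of (\<xi>_i f)(x S(S(e_i))). This is
  \<open>trace_integral\<close>, and the source of its squared antipode.\<close>

lemma linear_mapI:
  assumes "\<And>v. v \<in> carrier V \<Longrightarrow> f v \<in> carrier W"
    and "\<And>u v. u \<in> carrier V \<Longrightarrow> v \<in> carrier V \<Longrightarrow> f (u \<oplus>\<^bsub>V\<^esub> v) = f u \<oplus>\<^bsub>W\<^esub> f v"
    and "\<And>a v. a \<in> carrier K \<Longrightarrow> v \<in> carrier V \<Longrightarrow> f (a \<odot>\<^bsub>V\<^esub> v) = a \<odot>\<^bsub>W\<^esub> f v"
  shows "linear_map K V W f"
  using assms unfolding linear_map_def by auto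

lemma linear_map_closed: "linear_map K V W f \<Longrightarrow> v \<in> carrier V \<Longrightarrow> f v \<in> carrier W"
  and linear_map_add: "linear_map K V W f \<Longrightarrow> u \<in> carrier V \<Longrightarrow> v \<in> carrier V
    \<Longrightarrow> f (u \<oplus>\<^bsub>V\<^esub> v) = f u \<oplus>\<^bsub>W\<^esub> f v"
  and linear_map_smult: "linear_map K V W f \<Longrightarrow> a \<in> carrier K \<Longrightarrow> v \<in> carrier V
    \<Longrightarrow> f (a \<odot>\<^bsub>V\<^esub> v) = a \<odot>\<^bsub>W\<^esub> f v"
  unfolding linear_map_def by auto

lemma linear_map_cong:
  assumes "module K V" "\<And>v. v \<in> carrier V \<Longrightarrow> f v = g v"
  shows "linear_map K V W f \<longleftrightarrow> linear_map K V W g"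
proof -
  interpret V: module K V by fact
  have *: "linear_map K V W g" if "linear_map K V W f" "\<And>v. v \<in> carrier V \<Longrightarrow> f v = g v" for f g
    using that(1) by (auto simp: linear_map_def Pi_iff that(2)[symmetric])
  show ?thesis using *[of f g] *[of g f] assms(2) by auto
qed

definition bilinear_map where
  "bilinear_map K V W X f \<longleftrightarrow>
    (\<forall>v\<in>carrier V. linear_map K W X (f v)) \<and> (\<forall>w\<in>carrier W. linear_map K V X (\<lambda>v. f v w))"

lemma bilinear_mapI:
  assumes "\<And>v. v \<in> carrier V \<Longrightarrow> linear_map K W X (f v)"
    and "\<And>w. w \<in> carrier W \<Longrightarrow> linear_map K V X (\<lambda>v. f v w)"
  shows "bilinear_map K V W X f"
  using assms unfolding bilinear_map_def by auto

lemma bilinear_map_right: "bilinear_map K V W X f \<Longrightarrow> v \<in> carrier V \<Longrightarrow> linear_map K W X (f v)"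
  and bilinear_map_left: "bilinear_map K V W X f \<Longrightarrow> w \<in> carrier W \<Longrightarrow> linear_map K V X (\<lambda>v. f v w)"
  and bilinear_map_closed: "bilinear_map K V W X f \<Longrightarrow> v \<in> carrier V \<Longrightarrow> w \<in> carrier W
    \<Longrightarrow> f v w \<in> carrier X"
  unfolding bilinear_map_def by (auto intro: linear_map_closed)

lemma linear_map_zero:
  assumes "module K V" "module K W" "linear_map K V W f"
  shows "f \<zero>\<^bsub>V\<^esub> = \<zero>\<^bsub>W\<^esub>"
proof -
  interpret V: module K V by fact
  interpret W: module K W by fact
  have "f (\<zero>\<^bsub>K\<^esub> \<odot>\<^bsub>V\<^esub> \<zero>\<^bsub>V\<^esub>) = \<zero>\<^bsub>K\<^esub> \<odot>\<^bsub>W\<^esub> f \<zero>\<^bsub>V\<^esub>"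
    by (rule linear_map_smult[OF assms(3)]) auto
  then show ?thesis using linear_map_closed[OF assms(3) V.zero_closed] by simp
qed

lemma linear_map_minus:
  assumes "module K V" "module K W" "linear_map K V W f" "u \<in> carrier V" "v \<in> carrier V"
  shows "f (u \<ominus>\<^bsub>V\<^esub> v) = f u \<ominus>\<^bsub>W\<^esub> f v"
proof -
  interpret V: module K V by fact
  interpret W: module K W by fact
  have "f (u \<ominus>\<^bsub>V\<^esub> v) \<oplus>\<^bsub>W\<^esub> f v = f (u \<ominus>\<^bsub>V\<^esub> v \<oplus>\<^bsub>V\<^esub> v)"
    using assms by (simp add: linear_map_add[OF assms(3)])
  also have "u \<ominus>\<^bsub>V\<^esub> v \<oplus>\<^bsub>V\<^esub> v = u"
    using assms by (simp add: V.minus_eq V.add.m_assoc V.l_neg)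
  finally have *: "f (u \<ominus>\<^bsub>V\<^esub> v) \<oplus>\<^bsub>W\<^esub> f v = f u" .
  show ?thesis
    unfolding *[symmetric] using assms linear_map_closed[OF assms(3)]
    by (simp add: W.minus_eq W.add.m_assoc W.r_neg)
qed

lemma linear_map_finsum:
  assumes "module K V" "module K W" "linear_map K V W f" "g \<in> A \<rightarrow> carrier V"
  shows "f (finsum V g A) = (\<Oplus>\<^bsub>W\<^esub>i\<in>A. f (g i))"
proof -
  interpret V: module K V by fact
  interpret W: module K W by fact
  note z = linear_map_zero[OF assms(1-3)]
  show ?thesis
  proof (cases "finite A")
    case True
    then show ?thesis using assms(4)
    proof (induction A)
      case empty
      then show ?case using z by simp
    next
      case (insert x F)
      then show ?case
        by (auto simp: linear_map_add[OF assms(3)] Pi_iff linear_map_closed[OF assms(3)])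
    qed
  next
    case False
    then show ?thesis using z by simp
  qed
qed

lemma ring_as_module_simps [simp]:
  "carrier (ring_as_module K) = carrier K" "add (ring_as_module K) = add K"
  "zero (ring_as_module K) = zero K" "smult (ring_as_module K) = mult K"
  by (simp_all add: ring_as_module_def)

lemma finsum_ring_as_module [simp]: "finsum (ring_as_module K) = finsum K"
  by (rule ext, rule ext) (simp add: finsum_def finprod_def ring_as_module_def)

text \<open>Apart from the existence of negatives, the module axioms are equations, and both kinds
  pass along a surjection that respects the operations. It serves for the projection to a quotient
  and, with the identity as \<pi>, for records that share their fields.\<close>

lemma module_surj_image:
  assumes "module K V" and im: "\<pi> ` carrier V = carrier Q"
    and add: "\<And>u v. u \<in> carrier V \<Longrightarrow> v \<in> carrier V \<Longrightarrow> \<pi> (u \<oplus>\<^bsub>V\<^esub> v) = \<pi> u \<oplus>\<^bsub>Q\<^esub> \<pi> v"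
    and smult: "\<And>a v. a \<in> carrier K \<Longrightarrow> v \<in> carrier V \<Longrightarrow> \<pi> (a \<odot>\<^bsub>V\<^esub> v) = a \<odot>\<^bsub>Q\<^esub> \<pi> v"
    and zero: "\<pi> \<zero>\<^bsub>V\<^esub> = \<zero>\<^bsub>Q\<^esub>"
  shows "module K Q"
proof -
  interpret V: module K V by fact
  have ex: "\<exists>v\<in>carrier V. x = \<pi> v" if "x \<in> carrier Q" for x using im that by auto
  have cl: "\<pi> v \<in> carrier Q" if "v \<in> carrier V" for v using im that by auto
  show ?thesis
  proof (rule moduleI)
    show "cring K" by (rule V.cring_axioms)
    show "abelian_group Q"
    proof (rule abelian_groupI)
      fix x y assume xy: "x \<in> carrier Q" "y \<in> carrier Q"
      then obtain u v where uv: "u \<in> carrier V" "v \<in> carrier V" "x = \<pi> u" "y = \<pi> v" using ex by metis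
      then show "x \<oplus>\<^bsub>Q\<^esub> y \<in> carrier Q" using cl[of "u \<oplus>\<^bsub>V\<^esub> v"] add by simp
      show "x \<oplus>\<^bsub>Q\<^esub> y = y \<oplus>\<^bsub>Q\<^esub> x" using uv add V.add.m_comm by metis
      fix z assume "z \<in> carrier Q"
      then obtain w where w: "w \<in> carrier V" "z = \<pi> w" using ex by metis
      show "x \<oplus>\<^bsub>Q\<^esub> y \<oplus>\<^bsub>Q\<^esub> z = x \<oplus>\<^bsub>Q\<^esub> (y \<oplus>\<^bsub>Q\<^esub> z)"
        using uv w by (simp add: add[symmetric] V.add.m_assoc)
    next
      show "\<zero>\<^bsub>Q\<^esub> \<in> carrier Q" using cl[of "\<zero>\<^bsub>V\<^esub>"] zero by simp
    next
      fix x assume "x \<in> carrier Q"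
      then obtain u where u: "u \<in> carrier V" "x = \<pi> u" using ex by metis
      then show "\<zero>\<^bsub>Q\<^esub> \<oplus>\<^bsub>Q\<^esub> x = x" by (simp add: zero[symmetric] add[symmetric])
      show "\<exists>y\<in>carrier Q. y \<oplus>\<^bsub>Q\<^esub> x = \<zero>\<^bsub>Q\<^esub>"
        using u by (intro bexI[of _ "\<pi> (\<ominus>\<^bsub>V\<^esub> u)"])
          (simp_all add: zero[symmetric] add[symmetric] cl V.l_neg)
    qed
  next
    fix a b x y assume ab: "a \<in> carrier K" "b \<in> carrier K" and "x \<in> carrier Q" "y \<in> carrier Q"
    then obtain u v where uv: "u \<in> carrier V" "v \<in> carrier V" "x = \<pi> u" "y = \<pi> v" using ex by metis
    show "a \<odot>\<^bsub>Q\<^esub> (x \<oplus>\<^bsub>Q\<^esub> y) = a \<odot>\<^bsub>Q\<^esub> x \<oplus>\<^bsub>Q\<^esub> a \<odot>\<^bsub>Q\<^esub> y"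
      using ab uv by (simp add: add[symmetric] smult[symmetric] V.smult_r_distr)
  next
    fix a b x assume ab: "a \<in> carrier K" "b \<in> carrier K" and "x \<in> carrier Q"
    then obtain u where u: "u \<in> carrier V" "x = \<pi> u" using ex by metis
    show "(a \<oplus>\<^bsub>K\<^esub> b) \<odot>\<^bsub>Q\<^esub> x = a \<odot>\<^bsub>Q\<^esub> x \<oplus>\<^bsub>Q\<^esub> b \<odot>\<^bsub>Q\<^esub> x"
      using ab u by (simp add: add[symmetric] smult[symmetric] V.smult_l_distr)
    show "a \<otimes>\<^bsub>K\<^esub> b \<odot>\<^bsub>Q\<^esub> x = a \<odot>\<^bsub>Q\<^esub> (b \<odot>\<^bsub>Q\<^esub> x)"
      using ab u by (simp add: smult[symmetric] V.smult_assoc1)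
  next
    fix a x assume a: "a \<in> carrier K" and "x \<in> carrier Q"
    then obtain u where u: "u \<in> carrier V" "x = \<pi> u" using ex by metis
    show "a \<odot>\<^bsub>Q\<^esub> x \<in> carrier Q" using a u cl[of "a \<odot>\<^bsub>V\<^esub> u"] smult by simp
  next
    fix x assume "x \<in> carrier Q"
    then obtain u where u: "u \<in> carrier V" "x = \<pi> u" using ex by metis
    show "\<one>\<^bsub>K\<^esub> \<odot>\<^bsub>Q\<^esub> x = x" using u by (simp add: smult[symmetric])
  qed
qed

section \<open>Free modules and quotients\<close>

text \<open>The value at \<phi> of the linear extension of \<open>g\<close> from generators to
  formal combinations. Summing over the support of \<phi> is the shape that the body of
  \<open>tensor_lift\<close> has once a representative is fixed.\<close>

definition lin_ext where
  "lin_ext K X g \<phi> = (\<Oplus>\<^bsub>X\<^esub>p \<in> {p. \<phi> p \<noteq> \<zero>\<^bsub>K\<^esub>}. \<phi> p \<odot>\<^bsub>X\<^esub> g p)"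

lemma free_module_simps [simp]:
  "zero (free_module K S) = (\<lambda>x. \<zero>\<^bsub>K\<^esub>)"
  "f \<oplus>\<^bsub>free_module K S\<^esub> g = (\<lambda>x. f x \<oplus>\<^bsub>K\<^esub> g x)"
  "a \<odot>\<^bsub>free_module K S\<^esub> f = (\<lambda>x. a \<otimes>\<^bsub>K\<^esub> f x)"
  by (simp_all add: free_module_def)

lemma free_module_carrierI:
  assumes "\<And>x. x \<in> S \<Longrightarrow> f x \<in> carrier K" "\<And>x. x \<notin> S \<Longrightarrow> f x = \<zero>\<^bsub>K\<^esub>" "finite {x. f x \<noteq> \<zero>\<^bsub>K\<^esub>}"
  shows "f \<in> carrier (free_module K S)"
  using assms by (simp add: free_module_def)

lemma free_module_carrierD:
  assumes "f \<in> carrier (free_module K S)"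
  shows "x \<in> S \<Longrightarrow> f x \<in> carrier K" "x \<notin> S \<Longrightarrow> f x = \<zero>\<^bsub>K\<^esub>" "finite {x. f x \<noteq> \<zero>\<^bsub>K\<^esub>}"
    "{x. f x \<noteq> \<zero>\<^bsub>K\<^esub>} \<subseteq> S"
  using assms by (auto simp: free_module_def)

context cring
begin

lemma module_ring_as_module [simp, intro]: "module R (ring_as_module R)"
  by (rule moduleI, rule cring_axioms, rule abelian_groupI)
    (auto simp: a_ac l_distr r_distr m_assoc intro: l_neg)

lemma free_module_closed: "f \<in> carrier (free_module R S) \<Longrightarrow> f x \<in> carrier R"
  by (cases "x \<in> S") (auto dest: free_module_carrierD)

lemma module_free_module [simp, intro]: "module R (free_module R S)"
proof (rule moduleI)
  note D = free_module_carrierD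
  show "cring R" by (rule cring_axioms)
  have clos: "(\<lambda>x. f x \<oplus> g x) \<in> carrier (free_module R S)"
    if "f \<in> carrier (free_module R S)" "g \<in> carrier (free_module R S)" for f g
  proof (rule free_module_carrierI)
    have "{x. f x \<oplus> g x \<noteq> \<zero>} \<subseteq> {x. f x \<noteq> \<zero>} \<union> {x. g x \<noteq> \<zero>}" by auto
    then show "finite {x. f x \<oplus> g x \<noteq> \<zero>}"
      using D(3)[OF that(1)] D(3)[OF that(2)] by (meson finite_UnI finite_subset)
  qed (use D(1,2)[OF that(1)] D(1,2)[OF that(2)] in auto)
  have cl: "f x \<in> carrier R" if "f \<in> carrier (free_module R S)" for f x
    using D(1,2)[OF that] by (cases "x \<in> S") auto
  have smult: "(\<lambda>x. a \<otimes> f x) \<in> carrier (free_module R S)"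
    if "a \<in> carrier R" "f \<in> carrier (free_module R S)" for a f
  proof (rule free_module_carrierI)
    have "{x. a \<otimes> f x \<noteq> \<zero>} \<subseteq> {x. f x \<noteq> \<zero>}" using that by auto
    then show "finite {x. a \<otimes> f x \<noteq> \<zero>}"
      using D(3)[OF that(2)] by (meson finite_subset)
  qed (use that D(1,2)[OF that(2)] in auto)
  show "abelian_group (free_module R S)"
  proof (rule abelian_groupI)
    fix f assume f: "f \<in> carrier (free_module R S)"
    have "(\<lambda>x. \<ominus> \<one> \<otimes> f x) \<in> carrier (free_module R S)" by (rule smult) (use f in auto)
    moreover have "\<ominus> \<one> \<otimes> f x \<oplus> f x = \<zero>" for x using cl[OF f, of x] by algebra
    ultimately show "\<exists>g\<in>carrier (free_module R S). g \<oplus>\<^bsub>free_module R S\<^esub> f = \<zero>\<^bsub>free_module R S\<^esub>"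
      by (intro bexI[of _ "\<lambda>x. \<ominus> \<one> \<otimes> f x"]) auto
  qed (auto simp: a_ac cl intro!: clos free_module_carrierI)
  show "a \<odot>\<^bsub>free_module R S\<^esub> f \<in> carrier (free_module R S)"
    if "a \<in> carrier R" "f \<in> carrier (free_module R S)" for a f using that by (simp add: smult)
qed (auto simp: l_distr r_distr m_assoc free_module_closed)

lemma free_gen_closed [simp, intro]: "p \<in> S \<Longrightarrow> free_gen R p \<in> carrier (free_module R S)"
  by (rule free_module_carrierI) (auto simp: free_gen_def)

text \<open>The supports of two combinations and of their sum differ; enlarging all of them to one
  common finite set makes the sums comparable, because the added terms vanish.\<close>

lemma lin_ext_superset:
  assumes "module R X" "finite A" "{p. \<phi> p \<noteq> \<zero>} \<subseteq> A" "g \<in> A \<rightarrow> carrier X" "\<And>p. \<phi> p \<in> carrier R"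
  shows "lin_ext R X g \<phi> = (\<Oplus>\<^bsub>X\<^esub>p\<in>A. \<phi> p \<odot>\<^bsub>X\<^esub> g p)"
proof -
  interpret X: module R X by fact
  show ?thesis unfolding lin_ext_def
    using assms(2-) by (intro X.add.finprod_mono_neutral_cong_left) (auto simp: Pi_iff)
qed

lemma linear_map_lin_ext:
  assumes "module R X" "g \<in> S \<rightarrow> carrier X"
  shows "linear_map R (free_module R S) X (lin_ext R X g)"
proof -
  interpret X: module R X by fact
  interpret F: module R "free_module R S" by (rule module_free_module)
  note D = free_module_carrierD
  show ?thesis
  proof (rule linear_mapI)
    fix f assume f: "f \<in> carrier (free_module R S)"
    have *: "lin_ext R X g f = (\<Oplus>\<^bsub>X\<^esub>p\<in>{p. f p \<noteq> \<zero>}. f p \<odot>\<^bsub>X\<^esub> g p)" by (simp add: lin_ext_def)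
    have gX: "g p \<in> carrier X" if "f p \<noteq> \<zero>" for p using D(4)[OF f] assms(2) that by blast
    show "lin_ext R X g f \<in> carrier X"
      unfolding * using D(4)[OF f] assms(2) free_module_closed[OF f]
      by (intro X.finsum_closed) auto
    fix a assume a: "a \<in> carrier R"
    have "lin_ext R X g (\<lambda>p. a \<otimes> f p) = (\<Oplus>\<^bsub>X\<^esub>p\<in>{p. f p \<noteq> \<zero>}. (a \<otimes> f p) \<odot>\<^bsub>X\<^esub> g p)"
      using a D(3,4)[OF f] assms(2) free_module_closed[OF f] by (intro lin_ext_superset assms) auto
    also have "\<dots> = (\<Oplus>\<^bsub>X\<^esub>p\<in>{p. f p \<noteq> \<zero>}. a \<odot>\<^bsub>X\<^esub> (f p \<odot>\<^bsub>X\<^esub> g p))"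
      using a gX free_module_closed[OF f]
      by (intro X.finsum_cong') (auto simp: X.smult_assoc1)
    also have "\<dots> = a \<odot>\<^bsub>X\<^esub> lin_ext R X g f"
      unfolding * using a D(3,4)[OF f] assms(2) free_module_closed[OF f]
      by (subst X.finsum_smult_ldistr) auto
    finally show "lin_ext R X g (a \<odot>\<^bsub>free_module R S\<^esub> f) = a \<odot>\<^bsub>X\<^esub> lin_ext R X g f" by simp
  next
    fix f h assume f: "f \<in> carrier (free_module R S)" and h: "h \<in> carrier (free_module R S)"
    let ?A = "{p. f p \<noteq> \<zero>} \<union> {p. h p \<noteq> \<zero>}"
    have A: "finite ?A" "?A \<subseteq> S" using D(3,4)[OF f] D(3,4)[OF h] by auto
    then have g: "g \<in> ?A \<rightarrow> carrier X" using assms(2) by blast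
    note cl = free_module_closed[OF f] free_module_closed[OF h]
    have "lin_ext R X g (\<lambda>p. f p \<oplus> h p) = (\<Oplus>\<^bsub>X\<^esub>p\<in>?A. (f p \<oplus> h p) \<odot>\<^bsub>X\<^esub> g p)"
      using A g cl by (intro lin_ext_superset assms) auto
    also have "\<dots> = (\<Oplus>\<^bsub>X\<^esub>p\<in>?A. f p \<odot>\<^bsub>X\<^esub> g p \<oplus>\<^bsub>X\<^esub> h p \<odot>\<^bsub>X\<^esub> g p)"
      using A g cl by (intro X.finsum_cong') (auto simp: X.smult_l_distr Pi_iff)
    also have "\<dots> = (\<Oplus>\<^bsub>X\<^esub>p\<in>?A. f p \<odot>\<^bsub>X\<^esub> g p) \<oplus>\<^bsub>X\<^esub> (\<Oplus>\<^bsub>X\<^esub>p\<in>?A. h p \<odot>\<^bsub>X\<^esub> g p)"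
      using A g cl by (intro X.finsum_addf) (auto simp: Pi_iff)
    also have "(\<Oplus>\<^bsub>X\<^esub>p\<in>?A. f p \<odot>\<^bsub>X\<^esub> g p) = lin_ext R X g f"
      by (rule lin_ext_superset[symmetric]) (use assms A g cl in auto)
    also have "(\<Oplus>\<^bsub>X\<^esub>p\<in>?A. h p \<odot>\<^bsub>X\<^esub> g p) = lin_ext R X g h"
      by (rule lin_ext_superset[symmetric]) (use assms A g cl in auto)
    finally show "lin_ext R X g (f \<oplus>\<^bsub>free_module R S\<^esub> h) = lin_ext R X g f \<oplus>\<^bsub>X\<^esub> lin_ext R X g h"
      by simp
  qed
qed

lemma lin_ext_free_gen:
  assumes "module R X" "g p \<in> carrier X"
  shows "lin_ext R X g (free_gen R p) = g p"
proof -
  interpret X: module R X by fact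
  have "lin_ext R X g (free_gen R p) = (\<Oplus>\<^bsub>X\<^esub>q\<in>{p}. free_gen R p q \<odot>\<^bsub>X\<^esub> g q)"
    using assms by (intro lin_ext_superset) (auto simp: free_gen_def)
  also have "\<dots> = g p" using assms by (simp add: free_gen_def)
  finally show ?thesis .
qed

text \<open>A formal combination is a function, so this is checked at each point \<open>x\<close>:
  evaluation at \<open>x\<close> is linear, and of the generators in the sum only the one at
  \<open>x\<close> survives.\<close>

lemma lin_ext_id:
  assumes "\<phi> \<in> carrier (free_module R S)"
  shows "lin_ext R (free_module R S) (free_gen R) \<phi> = \<phi>"
proof
  fix x
  interpret F: module R "free_module R S" by (rule module_free_module)
  let ?A = "{p. \<phi> p \<noteq> \<zero>}"
  have ev: "linear_map R (free_module R S) (ring_as_module R) (\<lambda>f. f x)"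
    by (rule linear_mapI) (auto simp: free_module_closed)
  have cl: "(\<lambda>y. \<phi> p \<otimes> free_gen R p y) \<in> carrier (free_module R S)" if "p \<in> ?A" for p
    using F.smult_closed[of "\<phi> p" "free_gen R p"] that assms free_module_carrierD(4)[OF assms]
    by (auto simp: free_module_closed)
  have "lin_ext R (free_module R S) (free_gen R) \<phi> x = (\<Oplus>p\<in>?A. \<phi> p \<otimes> free_gen R p x)"
    unfolding lin_ext_def
    using linear_map_finsum[OF _ _ ev, of "\<lambda>p. \<phi> p \<odot>\<^bsub>free_module R S\<^esub> free_gen R p" ?A] cl by auto
  also have "\<dots> = (\<Oplus>p\<in>?A. if x = p then \<phi> p else \<zero>)"
    using free_module_closed[OF assms] by (intro finsum_cong') (auto simp: free_gen_def)
  also have "\<dots> = \<phi> x"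
  proof (cases "x \<in> ?A")
    case True
    then show ?thesis
      using free_module_carrierD(3)[OF assms] free_module_closed[OF assms]
      by (intro add.finprod_singleton) auto
  next
    case False
    have "(\<Oplus>p\<in>?A. if x = p then \<phi> p else \<zero>) = (\<Oplus>p\<in>?A. \<zero>)"
      using False by (intro finsum_cong') auto
    then show ?thesis using False by simp
  qed
  finally show "lin_ext R (free_module R S) (free_gen R) \<phi> x = \<phi> x" .
qed

end

locale module_quotient = module R V + submodule N R V for R (structure) and V :: "('a, 'v) module" and N
begin

lemma N_sub: "abelian_subgroup N V"
  by (intro abelian_subgroupI3 additive_subgroup.intro subgroup_axioms abelian_group_axioms)

interpretation N: abelian_subgroup N V by (rule N_sub)

abbreviation "proj v \<equiv> N +>\<^bsub>V\<^esub> v"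

lemma proj_eq_iff:
  assumes "v \<in> carrier V" "w \<in> carrier V"
  shows "proj v = proj w \<longleftrightarrow> v \<ominus>\<^bsub>V\<^esub> w \<in> N"
proof
  assume "proj v = proj w"
  then have "v \<in> proj w" using N.a_rcos_self[OF assms(1)] by simp
  then show "v \<ominus>\<^bsub>V\<^esub> w \<in> N" using N.a_rcos_module[OF assms(2,1)] by (simp add: M.minus_eq)
next
  assume "v \<ominus>\<^bsub>V\<^esub> w \<in> N"
  then have "v \<in> proj w" using N.a_rcos_module[OF assms(2,1)] by (simp add: M.minus_eq)
  then show "proj v = proj w" using N.a_repr_independence'[OF _ assms(2)] by simp
qed

lemma proj_in_quotient: "v \<in> carrier V \<Longrightarrow> proj v \<in> carrier (quotient_module V N)"
  by (auto simp: quotient_module_def A_RCOSETS_def')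

lemma proj_add:
  "\<lbrakk>v \<in> carrier V; w \<in> carrier V\<rbrakk> \<Longrightarrow> proj (v \<oplus>\<^bsub>V\<^esub> w) = proj v \<oplus>\<^bsub>quotient_module V N\<^esub> proj w"
  by (simp add: quotient_module_def N.a_rcos_sum)

text \<open>\<open>quotient_module\<close> defines a scalar multiple as a union over all
  representatives of the coset. They all yield the same coset, since their differences lie in
  \<open>N\<close> and \<open>N\<close> is closed under scalars.\<close>

lemma proj_smult:
  assumes "a \<in> carrier R" "v \<in> carrier V"
  shows "proj (a \<odot>\<^bsub>V\<^esub> v) = a \<odot>\<^bsub>quotient_module V N\<^esub> proj v"
proof -
  have sub: "N \<subseteq> carrier V" by (rule N.a_subset)
  have eq: "proj (a \<odot>\<^bsub>V\<^esub> w) = proj (a \<odot>\<^bsub>V\<^esub> v)" if w: "w \<in> proj v" for w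
  proof -
    from w obtain n where n: "n \<in> N" "w = n \<oplus>\<^bsub>V\<^esub> v" by (auto simp: a_r_coset_def')
    have nV: "n \<in> carrier V" using n sub by auto
    have "a \<odot>\<^bsub>V\<^esub> w \<ominus>\<^bsub>V\<^esub> a \<odot>\<^bsub>V\<^esub> v = a \<odot>\<^bsub>V\<^esub> n"
      using assms n nV by (simp add: smult_r_distr M.minus_eq M.add.m_assoc M.r_neg)
    then show ?thesis using n nV assms by (subst proj_eq_iff) auto
  qed
  have "proj v \<noteq> {}" using N.a_rcos_self[OF assms(2)] by blast
  then have "(\<Union>w\<in>proj v. proj (a \<odot>\<^bsub>V\<^esub> w)) = proj (a \<odot>\<^bsub>V\<^esub> v)"
    by (rule SUP_eq_const) (rule eq)
  then show ?thesis unfolding quotient_module_def by simp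
qed

lemma module_quotient_module: "module R (quotient_module V N)"
proof (rule module_surj_image[where \<pi> = "\<lambda>v. proj v" and V = V])
  show "module R V" by (rule module_axioms)
  show "(\<lambda>v. proj v) ` carrier V = carrier (quotient_module V N)"
    by (auto simp: quotient_module_def A_RCOSETS_def')
  show "proj \<zero>\<^bsub>V\<^esub> = \<zero>\<^bsub>quotient_module V N\<^esub>"
    by (simp add: quotient_module_def M.a_coset_add_zero N.a_subset)
qed (auto simp: proj_add proj_smult)

end

section \<open>Tensor products\<close>

locale tensor_product = V: module R V + W: module R W
  for R (structure) and V :: "('k, 'v, 'x) module_scheme" and W :: "('k, 'w, 'y) module_scheme"
begin

abbreviation "P \<equiv> carrier V \<times> carrier W"

abbreviation "F \<equiv> free_module R P"

sublocale F: module R F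
  by (rule V.module_free_module)

lemma tensor_rels_subset: "tensor_rels R V W \<subseteq> carrier F"
  by (auto simp: tensor_rels_def Let_def simp del: free_module_simps intro!: F.minus_closed F.smult_closed
      F.add.m_closed V.free_gen_closed)

text \<open>The intersection is taken over a nonempty family: the whole free module contains the
  relations by \<open>tensor_rels_subset\<close>. This is what keeps the intersection inside the
  carrier.\<close>

lemma submodule_tensor_null: "submodule (tensor_null R V W) R F"
proof -
  have c: "carrier F \<in> {N. submodule N R F \<and> tensor_rels R V W \<subseteq> N}"
    using F.carrier_is_submodule tensor_rels_subset by auto
  have sm: "submodule N R F" if "N \<in> {N. submodule N R F \<and> tensor_rels R V W \<subseteq> N}" for N
    using that by auto
  show ?thesis unfolding tensor_null_def generated_submodule_def
  proof (rule F.submoduleI)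
    show "\<Inter> {N. submodule N R F \<and> tensor_rels R V W \<subseteq> N} \<subseteq> carrier F" using c by blast
    show "\<zero>\<^bsub>F\<^esub> \<in> \<Inter> {N. submodule N R F \<and> tensor_rels R V W \<subseteq> N}"
    proof (rule InterI)
      fix N assume "N \<in> {N. submodule N R F \<and> tensor_rels R V W \<subseteq> N}"
      then have "submodule N R F" by blast
      then have "subgroup N (add_monoid F)" by (rule submodule.axioms(1))
      from subgroup.one_closed[OF this] show "\<zero>\<^bsub>F\<^esub> \<in> N" by simp
    qed
  qed (auto intro: F.submoduleE[OF sm] simp del: free_module_simps)
qed

sublocale Q: module_quotient R F "tensor_null R V W"
  by (intro module_quotient.intro F.module_axioms submodule_tensor_null)

lemma module_tensor_module: "module R (tensor_module R V W)"
  unfolding tensor_module_def by (rule Q.module_quotient_module)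

lemma tens_def': "tens R V W v w = Q.proj (free_gen R (v, w))"
  by (simp add: tens_def)

lemma proj_eqI:
  assumes "x \<ominus>\<^bsub>F\<^esub> y \<in> tensor_rels R V W" "x \<in> carrier F" "y \<in> carrier F"
  shows "Q.proj x = Q.proj y"
  using assms by (subst Q.proj_eq_iff) (auto simp: tensor_null_def generated_submodule_def)

lemma tens_closed: "v \<in> carrier V \<Longrightarrow> w \<in> carrier W \<Longrightarrow> tens R V W v w \<in> carrier (tensor_module R V W)"
  unfolding tens_def' tensor_module_def by (auto intro: Q.proj_in_quotient)

text \<open>The four families in \<open>tensor_rels\<close> are the four clauses of bilinearity, and
  \<open>proj_eqI\<close> turns each generating difference into an equation of cosets.\<close>

lemma bilinear_map_tens: "bilinear_map R V W (tensor_module R V W) (tens R V W)"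
proof (intro bilinear_mapI linear_mapI)
  fix v w z assume vwz: "v \<in> carrier V" "w \<in> carrier W" "z \<in> carrier W"
  have "Q.proj (free_gen R (v, w \<oplus>\<^bsub>W\<^esub> z)) = Q.proj (free_gen R (v, w) \<oplus>\<^bsub>F\<^esub> free_gen R (v, z))"
    using vwz by (intro proj_eqI F.add.m_closed V.free_gen_closed) (auto simp: tensor_rels_def Let_def)
  also have "\<dots> = tens R V W v w \<oplus>\<^bsub>tensor_module R V W\<^esub> tens R V W v z"
    unfolding tens_def' tensor_module_def using vwz by (intro Q.proj_add V.free_gen_closed) auto
  finally show "tens R V W v (w \<oplus>\<^bsub>W\<^esub> z) = tens R V W v w \<oplus>\<^bsub>tensor_module R V W\<^esub> tens R V W v z"
    by (simp add: tens_def')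
next
  fix v w z assume vwz: "z \<in> carrier V" "v \<in> carrier V" "w \<in> carrier W"
  have "Q.proj (free_gen R (z \<oplus>\<^bsub>V\<^esub> v, w)) = Q.proj (free_gen R (z, w) \<oplus>\<^bsub>F\<^esub> free_gen R (v, w))"
    using vwz by (intro proj_eqI F.add.m_closed V.free_gen_closed) (auto simp: tensor_rels_def Let_def)
  also have "\<dots> = tens R V W z w \<oplus>\<^bsub>tensor_module R V W\<^esub> tens R V W v w"
    unfolding tens_def' tensor_module_def using vwz by (intro Q.proj_add V.free_gen_closed) auto
  finally show "tens R V W (z \<oplus>\<^bsub>V\<^esub> v) w = tens R V W z w \<oplus>\<^bsub>tensor_module R V W\<^esub> tens R V W v w"
    by (simp add: tens_def')
next
  fix a v w assume vwz: "a \<in> carrier R" "v \<in> carrier V" "w \<in> carrier W"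
  have "Q.proj (free_gen R (a \<odot>\<^bsub>V\<^esub> v, w)) = Q.proj (a \<odot>\<^bsub>F\<^esub> free_gen R (v, w))"
    using vwz by (intro proj_eqI F.smult_closed V.free_gen_closed)
      (auto simp: tensor_rels_def Let_def simp del: free_module_simps)
  also have "\<dots> = a \<odot>\<^bsub>tensor_module R V W\<^esub> tens R V W v w"
    unfolding tens_def' tensor_module_def using vwz by (intro Q.proj_smult V.free_gen_closed) auto
  finally show "tens R V W (a \<odot>\<^bsub>V\<^esub> v) w = a \<odot>\<^bsub>tensor_module R V W\<^esub> tens R V W v w"
    by (simp add: tens_def')
next
  fix a v w assume vwz: "a \<in> carrier R" "v \<in> carrier V" "w \<in> carrier W"
  have "Q.proj (free_gen R (v, a \<odot>\<^bsub>W\<^esub> w)) = Q.proj (a \<odot>\<^bsub>F\<^esub> free_gen R (v, w))"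
    using vwz by (intro proj_eqI F.smult_closed V.free_gen_closed)
      (auto simp: tensor_rels_def Let_def simp del: free_module_simps)
  also have "\<dots> = a \<odot>\<^bsub>tensor_module R V W\<^esub> tens R V W v w"
    unfolding tens_def' tensor_module_def using vwz by (intro Q.proj_smult V.free_gen_closed) auto
  finally show "tens R V W v (a \<odot>\<^bsub>W\<^esub> w) = a \<odot>\<^bsub>tensor_module R V W\<^esub> tens R V W v w"
    by (simp add: tens_def')
qed (auto intro: tens_closed)

text \<open>A coset contains the element that names it, so the choice in \<open>tensor_lift\<close>
  really picks a member; from there on \<open>tensor_lift\<close> is \<open>lin_ext\<close> at a
  formal combination representing \<open>t\<close>.\<close>

lemma tensor_rep:
  assumes t: "t \<in> carrier (tensor_module R V W)"
  defines "\<phi> \<equiv> (SOME \<phi>. \<phi> \<in> t)"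
  shows "\<phi> \<in> carrier F" "Q.proj \<phi> = t" "tensor_lift R X f t = lin_ext R X (case_prod f) \<phi>"
proof -
  obtain \<psi> where \<psi>: "\<psi> \<in> carrier F" "t = Q.proj \<psi>"
    using t by (auto simp: tensor_module_def quotient_module_def A_RCOSETS_def')
  have N: "abelian_subgroup (tensor_null R V W) F" by (rule Q.N_sub)
  have "\<psi> \<in> t" using abelian_subgroup.a_rcos_self[OF N \<psi>(1)] \<psi> by simp
  then have \<phi>: "\<phi> \<in> t" unfolding \<phi>_def by (rule someI[of "\<lambda>x. x \<in> t"])
  show "\<phi> \<in> carrier F"
    using \<phi> \<psi> abelian_subgroup.a_rcosets_part_G[OF N] t
    by (auto simp: tensor_module_def quotient_module_def)
  show "Q.proj \<phi> = t"
    using abelian_subgroup.a_repr_independence'[OF N, of \<phi> \<psi>] \<phi> \<psi> by simp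
  show "tensor_lift R X f t = lin_ext R X (case_prod f) \<phi>"
    by (simp add: tensor_lift_def lin_ext_def \<phi>_def Let_def case_prod_beta)
qed

text \<open>The kernel of the linear extension is a submodule, and bilinearity puts the four
  families of relations into it. Hence it contains the submodule they generate, and all
  representatives of a tensor have the same value.\<close>

lemma tensor_lift_proj:
  assumes "module R X" and f: "bilinear_map R V W X f" and \<phi>: "\<phi> \<in> carrier F"
  shows "tensor_lift R X f (Q.proj \<phi>) = lin_ext R X (case_prod f) \<phi>"
proof -
  interpret X: module R X by fact
  have cl: "case_prod f \<in> P \<rightarrow> carrier X" using bilinear_map_closed[OF f] by auto
  let ?L = "lin_ext R X (case_prod f)"
  have L: "linear_map R F X ?L" by (rule V.linear_map_lin_ext[OF assms(1) cl])
  have gen: "?L (free_gen R (v, w)) = f v w" if "v \<in> carrier V" "w \<in> carrier W" for v w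
    using V.lin_ext_free_gen[OF assms(1), of "case_prod f" "(v, w)"] bilinear_map_closed[OF f that] by simp
  let ?N = "{x \<in> carrier F. ?L x = \<zero>\<^bsub>X\<^esub>}"
  have sub: "submodule ?N R F"
  proof (rule F.submoduleI)
    show "\<zero>\<^bsub>F\<^esub> \<in> ?N" using linear_map_zero[OF F.module_axioms assms(1) L] F.zero_closed by blast
    fix x assume x: "x \<in> ?N"
    have "?L (\<zero>\<^bsub>F\<^esub> \<ominus>\<^bsub>F\<^esub> x) = ?L \<zero>\<^bsub>F\<^esub> \<ominus>\<^bsub>X\<^esub> ?L x"
      using x by (intro linear_map_minus[OF F.module_axioms assms(1) L] F.zero_closed) auto
    then have "?L (\<ominus>\<^bsub>F\<^esub> x) = \<zero>\<^bsub>X\<^esub>"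
      using x linear_map_zero[OF F.module_axioms assms(1) L]
      by (simp add: F.minus_eq X.minus_eq del: free_module_simps)
    then show "\<ominus>\<^bsub>F\<^esub> x \<in> ?N" using x by auto
  next
    fix x y assume "x \<in> ?N" "y \<in> ?N"
    then show "x \<oplus>\<^bsub>F\<^esub> y \<in> ?N"
      using linear_map_add[OF L, of x y] F.add.m_closed[of x y] by (simp del: free_module_simps)
  next
    fix a x assume "a \<in> carrier R" "x \<in> ?N"
    then show "a \<odot>\<^bsub>F\<^esub> x \<in> ?N"
      using linear_map_smult[OF L, of a x] F.smult_closed[of a x] by (simp del: free_module_simps)
  qed auto
  have Lminus: "?L (x \<ominus>\<^bsub>F\<^esub> y) = \<zero>\<^bsub>X\<^esub>" if "x \<in> carrier F" "y \<in> carrier F" "?L x = ?L y" for x y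
    using linear_map_minus[OF F.module_axioms assms(1) L that(1,2)] that(3)
      linear_map_closed[OF L that(2)] by (simp add: X.minus_eq X.r_neg)
  have "tensor_rels R V W \<subseteq> ?N"
  proof
    fix x assume x: "x \<in> tensor_rels R V W"
    note gF = V.free_gen_closed
    from x consider
      (1) u v w where "x = free_gen R (u \<oplus>\<^bsub>V\<^esub> v, w) \<ominus>\<^bsub>F\<^esub> (free_gen R (u, w) \<oplus>\<^bsub>F\<^esub> free_gen R (v, w))"
        "u \<in> carrier V" "v \<in> carrier V" "w \<in> carrier W"
    | (2) v w z where "x = free_gen R (v, w \<oplus>\<^bsub>W\<^esub> z) \<ominus>\<^bsub>F\<^esub> (free_gen R (v, w) \<oplus>\<^bsub>F\<^esub> free_gen R (v, z))"
        "v \<in> carrier V" "w \<in> carrier W" "z \<in> carrier W"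
    | (3) a v w where "x = free_gen R (a \<odot>\<^bsub>V\<^esub> v, w) \<ominus>\<^bsub>F\<^esub> (a \<odot>\<^bsub>F\<^esub> free_gen R (v, w))"
        "a \<in> carrier R" "v \<in> carrier V" "w \<in> carrier W"
    | (4) a v w where "x = free_gen R (v, a \<odot>\<^bsub>W\<^esub> w) \<ominus>\<^bsub>F\<^esub> (a \<odot>\<^bsub>F\<^esub> free_gen R (v, w))"
        "a \<in> carrier R" "v \<in> carrier V" "w \<in> carrier W"
      unfolding tensor_rels_def Let_def by blast
    then have "?L x = \<zero>\<^bsub>X\<^esub>"
    proof cases
      case (1 u v w)
      then show ?thesis
        using linear_map_add[OF bilinear_map_left[OF f], of w u v]
          linear_map_add[OF L gF gF, of "(u, w)" "(v, w)"]
        by (simp only:) (intro Lminus F.add.m_closed gF; simp add: gen)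
    next
      case (2 v w z)
      then show ?thesis
        using linear_map_add[OF bilinear_map_right[OF f], of v w z]
          linear_map_add[OF L gF gF, of "(v, w)" "(v, z)"]
        by (simp only:) (intro Lminus F.add.m_closed gF; simp add: gen)
    next
      case (3 a v w)
      then show ?thesis
        using linear_map_smult[OF bilinear_map_left[OF f], of w a v]
          linear_map_smult[OF L _ gF, of a "(v, w)"]
        by (simp only:) (intro Lminus F.smult_closed gF; simp add: gen)
    next
      case (4 a v w)
      then show ?thesis
        using linear_map_smult[OF bilinear_map_right[OF f], of v a w]
          linear_map_smult[OF L _ gF, of a "(v, w)"]
        by (simp only:) (intro Lminus F.smult_closed gF; simp add: gen)
    qed
    then show "x \<in> ?N" using x tensor_rels_subset by auto
  qed
  then have null: "tensor_null R V W \<subseteq> ?N"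
    using sub by (auto simp: tensor_null_def generated_submodule_def)
  define \<psi> where "\<psi> = (SOME \<psi>. \<psi> \<in> Q.proj \<phi>)"
  have t: "Q.proj \<phi> \<in> carrier (tensor_module R V W)"
    using Q.proj_in_quotient[OF \<phi>] by (simp add: tensor_module_def)
  note r = tensor_rep[OF t, folded \<psi>_def]
  have "\<psi> \<ominus>\<^bsub>F\<^esub> \<phi> \<in> tensor_null R V W" using r(1,2) \<phi> Q.proj_eq_iff by blast
  then have "?L (\<psi> \<ominus>\<^bsub>F\<^esub> \<phi>) = \<zero>\<^bsub>X\<^esub>" using null by auto
  then have "?L \<psi> \<ominus>\<^bsub>X\<^esub> ?L \<phi> = \<zero>\<^bsub>X\<^esub>"
    using linear_map_minus[OF F.module_axioms assms(1) L r(1) \<phi>] by simp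
  then have "?L \<psi> = ?L \<phi>"
    using linear_map_closed[OF L r(1)] linear_map_closed[OF L \<phi>]
    by (metis X.add.inv_closed X.add.m_assoc X.l_neg X.l_zero X.r_zero X.minus_eq)
  then show ?thesis by (simp add: r(3))
qed

end

section \<open>Linear maps depending on a parameter: scalars, sums and composites\<close>

lemma linear_map_smult_fun:
  assumes "module K X" "linear_map K V X f" "a \<in> carrier K"
  shows "linear_map K V X (\<lambda>v. a \<odot>\<^bsub>X\<^esub> f v)"
proof -
  interpret X: module K X by fact
  show ?thesis using assms(3) linear_map_closed[OF assms(2)]
    by (intro linear_mapI)
      (simp_all add: linear_map_add[OF assms(2)] linear_map_smult[OF assms(2)] X.smult_r_distr
        X.smult_assoc1[symmetric] X.R.m_comm)
qed

lemma linear_map_scalar_fun: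
  assumes "module K X" "linear_map K V (ring_as_module K) f" "x \<in> carrier X"
  shows "linear_map K V X (\<lambda>v. f v \<odot>\<^bsub>X\<^esub> x)"
proof -
  interpret X: module K X by fact
  show ?thesis using assms(3) linear_map_closed[OF assms(2)]
    by (intro linear_mapI)
      (simp_all add: linear_map_add[OF assms(2)] linear_map_smult[OF assms(2)] X.smult_l_distr
        X.smult_assoc1)
qed

lemma linear_map_add_fun:
  assumes "module K X" "linear_map K V X f" "linear_map K V X g"
  shows "linear_map K V X (\<lambda>v. f v \<oplus>\<^bsub>X\<^esub> g v)"
proof -
  interpret X: module K X by fact
  show ?thesis using linear_map_closed[OF assms(2)] linear_map_closed[OF assms(3)]
    by (intro linear_mapI)
      (simp_all add: linear_map_add[OF assms(2)] linear_map_smult[OF assms(2)] X.smult_r_distr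
        linear_map_add[OF assms(3)] linear_map_smult[OF assms(3)] X.add.m_ac)
qed

lemma linear_map_zero_fun:
  assumes "module K X" shows "linear_map K V X (\<lambda>v. \<zero>\<^bsub>X\<^esub>)"
proof -
  interpret X: module K X by fact
  show ?thesis by (rule linear_mapI) auto
qed

lemma linear_map_id: "linear_map K V V (\<lambda>v. v)"
  by (rule linear_mapI) (rule refl | assumption)+

lemma linear_map_compose:
  assumes "linear_map K W X g" "linear_map K V W f"
  shows "linear_map K V X (\<lambda>v. g (f v))"
  using linear_map_closed[OF assms(2)] linear_map_closed[OF assms(1)]
  by (intro linear_mapI)
    (simp_all add: linear_map_add[OF assms(2)] linear_map_smult[OF assms(2)]
        linear_map_add[OF assms(1)] linear_map_smult[OF assms(1)])

lemma linear_map_finsum_fun: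
  assumes "module K X" "\<And>p. p \<in> A \<Longrightarrow> linear_map K V X (\<lambda>v. f v p)"
  shows "linear_map K V X (\<lambda>v. \<Oplus>\<^bsub>X\<^esub>p\<in>A. f v p)"
proof -
  interpret X: module K X by fact
  have cl: "f v p \<in> carrier X" if "p \<in> A" "v \<in> carrier V" for v p
    using linear_map_closed assms(2) that by fast
  show ?thesis
  proof (cases "finite A")
    case True
    show ?thesis
    proof (rule linear_mapI)
      fix u v assume uv: "u \<in> carrier V" "v \<in> carrier V"
      have "(\<Oplus>\<^bsub>X\<^esub>p\<in>A. f (u \<oplus>\<^bsub>V\<^esub> v) p) = (\<Oplus>\<^bsub>X\<^esub>p\<in>A. f u p \<oplus>\<^bsub>X\<^esub> f v p)"
        using uv cl by (intro X.finsum_cong') (auto simp: linear_map_add[OF assms(2)])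
      then show "(\<Oplus>\<^bsub>X\<^esub>p\<in>A. f (u \<oplus>\<^bsub>V\<^esub> v) p) = (\<Oplus>\<^bsub>X\<^esub>p\<in>A. f u p) \<oplus>\<^bsub>X\<^esub> (\<Oplus>\<^bsub>X\<^esub>p\<in>A. f v p)"
        using uv cl by (subst X.finsum_addf[symmetric]) auto
    next
      fix a v assume av: "a \<in> carrier K" "v \<in> carrier V"
      have "(\<Oplus>\<^bsub>X\<^esub>p\<in>A. f (a \<odot>\<^bsub>V\<^esub> v) p) = (\<Oplus>\<^bsub>X\<^esub>p\<in>A. a \<odot>\<^bsub>X\<^esub> f v p)"
        using av cl by (intro X.finsum_cong') (auto simp: linear_map_smult[OF assms(2)])
      then show "(\<Oplus>\<^bsub>X\<^esub>p\<in>A. f (a \<odot>\<^bsub>V\<^esub> v) p) = a \<odot>\<^bsub>X\<^esub> (\<Oplus>\<^bsub>X\<^esub>p\<in>A. f v p)"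
        using av cl True by (subst X.finsum_smult_ldistr) auto
    qed (use cl in auto)
  next
    case False
    then show ?thesis using linear_map_zero_fun[OF assms(1)] by simp
  qed
qed

section \<open>The universal property of the tensor product, in terms of
  \<open>tensor_lift\<close>\<close>

context cring
begin

lemma tensor_productI: "module R V \<Longrightarrow> module R W \<Longrightarrow> tensor_product R V W"
  by (rule tensor_product.intro)

lemma module_tensor_module [simp, intro]:
  "module R V \<Longrightarrow> module R W \<Longrightarrow> module R (tensor_module R V W)"
  by (rule tensor_product.module_tensor_module) (rule tensor_productI)

lemma tens_closed [simp, intro]:
  "\<lbrakk>module R V; module R W; v \<in> carrier V; w \<in> carrier W\<rbrakk> \<Longrightarrow> tens R V W v w \<in> carrier (tensor_module R V W)"
  by (rule tensor_product.tens_closed) (auto intro: tensor_productI)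

lemma bilinear_map_tens:
  "module R V \<Longrightarrow> module R W \<Longrightarrow> bilinear_map R V W (tensor_module R V W) (tens R V W)"
  by (rule tensor_product.bilinear_map_tens) (auto intro: tensor_productI)

abbreviation (input) tensor_coeff :: "('v \<times> 'w \<Rightarrow> 'a) set \<Rightarrow> 'v \<times> 'w \<Rightarrow> 'a" where
  "tensor_coeff t \<equiv> (SOME \<phi>. \<phi> \<in> t)"

lemma tensor_lift_eq: "tensor_lift R X f t =
    (\<Oplus>\<^bsub>X\<^esub>p \<in> {p. tensor_coeff t p \<noteq> \<zero>}. tensor_coeff t p \<odot>\<^bsub>X\<^esub> f (fst p) (snd p))"
  by (simp add: tensor_lift_def Let_def)

lemma tensor_coeff:
  assumes "module R V" "module R W" "t \<in> carrier (tensor_module R V W)"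
  shows "tensor_coeff t \<in> carrier (free_module R (carrier V \<times> carrier W))"
    "finite {p. tensor_coeff t p \<noteq> \<zero>}"
    "tensor_coeff t p \<noteq> \<zero> \<Longrightarrow> fst p \<in> carrier V" "tensor_coeff t p \<noteq> \<zero> \<Longrightarrow> snd p \<in> carrier W"
    "tensor_coeff t p \<in> carrier R"
proof -
  note r = tensor_product.tensor_rep(1)[OF tensor_productI[OF assms(1,2)] assms(3)]
  then show "tensor_coeff t \<in> carrier (free_module R (carrier V \<times> carrier W))"
    "finite {p. tensor_coeff t p \<noteq> \<zero>}" "tensor_coeff t p \<in> carrier R"
    by (auto dest: free_module_carrierD free_module_closed)
  have "tensor_coeff t p \<noteq> \<zero> \<Longrightarrow> p \<in> carrier V \<times> carrier W"
    using free_module_carrierD(4)[OF r] by blast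
  then show "tensor_coeff t p \<noteq> \<zero> \<Longrightarrow> fst p \<in> carrier V" "tensor_coeff t p \<noteq> \<zero> \<Longrightarrow> snd p \<in> carrier W"
    by auto
qed

lemma tensor_lift_closed:
  assumes "module R V" "module R W" "module R X" "t \<in> carrier (tensor_module R V W)"
    and "\<And>v w. v \<in> carrier V \<Longrightarrow> w \<in> carrier W \<Longrightarrow> f v w \<in> carrier X"
  shows "tensor_lift R X f t \<in> carrier X"
proof -
  interpret X: module R X by fact
  note c = tensor_coeff[OF assms(1,2,4)]
  show ?thesis unfolding tensor_lift_eq by (intro X.finsum_closed) (auto intro!: c assms X.smult_closed)
qed

lemma tensor_lift_cong:
  assumes "module R V" "module R W" "module R X" "t \<in> carrier (tensor_module R V W)"
    and "\<And>v w. v \<in> carrier V \<Longrightarrow> w \<in> carrier W \<Longrightarrow> f v w = g v w"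
    and "\<And>v w. v \<in> carrier V \<Longrightarrow> w \<in> carrier W \<Longrightarrow> g v w \<in> carrier X"
  shows "tensor_lift R X f t = tensor_lift R X g t"
proof -
  interpret X: module R X by fact
  note c = tensor_coeff[OF assms(1,2,4)]
  show ?thesis unfolding tensor_lift_eq
    by (intro X.finsum_cong') (auto intro!: c assms X.smult_closed simp: assms(5)[OF c(3,4)])
qed

text \<open>Both sides sum over the same chosen representative, so a linear map passes through the
  finite sum term by term; of \<open>f\<close> only the values at carrier elements enter.\<close>

lemma tensor_lift_hom:
  assumes "module R V" "module R W" "module R X" "module R Y" "t \<in> carrier (tensor_module R V W)"
    and "\<And>v w. v \<in> carrier V \<Longrightarrow> w \<in> carrier W \<Longrightarrow> f v w \<in> carrier X"
    and L: "linear_map R X Y L"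
  shows "L (tensor_lift R X f t) = tensor_lift R Y (\<lambda>v w. L (f v w)) t"
proof -
  interpret X: module R X by fact
  interpret Y: module R Y by fact
  note c = tensor_coeff[OF assms(1,2,5)]
  have "L (tensor_lift R X f t) =
      (\<Oplus>\<^bsub>Y\<^esub>p \<in> {p. tensor_coeff t p \<noteq> \<zero>}. L (tensor_coeff t p \<odot>\<^bsub>X\<^esub> f (fst p) (snd p)))"
    unfolding tensor_lift_eq
    by (intro linear_map_finsum[OF assms(3,4) L]) (auto intro!: c assms X.smult_closed)
  also have "\<dots> = tensor_lift R Y (\<lambda>v w. L (f v w)) t"
    unfolding tensor_lift_eq
    by (intro Y.finsum_cong')
      (auto intro!: c assms Y.smult_closed linear_map_closed[OF L] simp: linear_map_smult[OF L] c assms)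
  finally show ?thesis .
qed

lemma linear_map_tensor_lift_param:
  assumes "module R V" "module R W" "module R X" "t \<in> carrier (tensor_module R V W)"
    and "\<And>v w. v \<in> carrier V \<Longrightarrow> w \<in> carrier W \<Longrightarrow> linear_map R U X (\<lambda>u. f u v w)"
  shows "linear_map R U X (\<lambda>u. tensor_lift R X (f u) t)"
proof -
  note c = tensor_coeff[OF assms(1,2,4)]
  show ?thesis unfolding tensor_lift_eq
    by (intro linear_map_finsum_fun linear_map_smult_fun assms) (auto intro!: c)
qed

lemma tensor_lift_tens:
  assumes "module R V" "module R W" "module R X" "bilinear_map R V W X f" "v \<in> carrier V" "w \<in> carrier W"
  shows "tensor_lift R X f (tens R V W v w) = f v w"
proof -
  interpret tensor_product R V W by (rule tensor_productI) fact+
  show ?thesis unfolding tens_def'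
    using assms by (subst tensor_lift_proj) (auto simp: lin_ext_free_gen bilinear_map_closed)
qed

lemma linear_map_tensor_lift:
  assumes "module R V" "module R W" "module R X" "bilinear_map R V W X f"
  shows "linear_map R (tensor_module R V W) X (tensor_lift R X f)"
proof -
  interpret tensor_product R V W by (rule tensor_productI) fact+
  have L: "linear_map R F X (lin_ext R X (case_prod f))"
    using bilinear_map_closed[OF assms(4)] by (intro linear_map_lin_ext assms) auto
  have ex: "\<exists>\<phi>\<in>carrier F. s = Q.proj \<phi>" if "s \<in> carrier (tensor_module R V W)" for s
    using tensor_rep(1,2)[OF that] by metis
  note p = tensor_lift_proj[OF assms(3,4)]
  show ?thesis
  proof (rule linear_mapI)
    fix s t assume "s \<in> carrier (tensor_module R V W)" "t \<in> carrier (tensor_module R V W)"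
    then obtain \<phi> \<psi> where *: "\<phi> \<in> carrier F" "\<psi> \<in> carrier F" "s = Q.proj \<phi>" "t = Q.proj \<psi>" using ex by metis
    have "s \<oplus>\<^bsub>tensor_module R V W\<^esub> t = Q.proj (\<phi> \<oplus>\<^bsub>F\<^esub> \<psi>)"
      unfolding * tensor_module_def by (rule Q.proj_add[symmetric]) fact+
    then show "tensor_lift R X f (s \<oplus>\<^bsub>tensor_module R V W\<^esub> t) = tensor_lift R X f s \<oplus>\<^bsub>X\<^esub> tensor_lift R X f t"
      using * F.add.m_closed[OF *(1,2)] by (simp add: p linear_map_add[OF L] del: free_module_simps)
  next
    fix a s assume a: "a \<in> carrier R" and "s \<in> carrier (tensor_module R V W)"
    then obtain \<phi> where *: "\<phi> \<in> carrier F" "s = Q.proj \<phi>" using ex by metis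
    have "a \<odot>\<^bsub>tensor_module R V W\<^esub> s = Q.proj (a \<odot>\<^bsub>F\<^esub> \<phi>)"
      unfolding * tensor_module_def by (rule Q.proj_smult[symmetric]) fact+
    then show "tensor_lift R X f (a \<odot>\<^bsub>tensor_module R V W\<^esub> s) = a \<odot>\<^bsub>X\<^esub> tensor_lift R X f s"
      using * F.smult_closed[OF a *(1)] a by (simp add: p linear_map_smult[OF L] del: free_module_simps)
  qed (auto intro: tensor_lift_closed[OF assms(1-3)] bilinear_map_closed[OF assms(4)])
qed

text \<open>Every tensor is a finite sum of pure tensors: project the expansion of its
  representative into generators. \<open>tensor_map_eqI\<close> rests on this.\<close>

lemma tensor_lift_id:
  assumes "module R V" "module R W" "t \<in> carrier (tensor_module R V W)"
  shows "tensor_lift R (tensor_module R V W) (tens R V W) t = t"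
proof -
  interpret tensor_product R V W by (rule tensor_productI) fact+
  interpret T: module R "tensor_module R V W" by (rule module_tensor_module)
  define \<phi> where "\<phi> = tensor_coeff t"
  note r = tensor_rep[OF assms(3), folded \<phi>_def]
  have proj: "linear_map R F (tensor_module R V W) Q.proj"
    by (rule linear_mapI)
      (auto simp: tensor_module_def Q.proj_add Q.proj_smult Q.proj_in_quotient simp del: free_module_simps)
  let ?A = "{p. \<phi> p \<noteq> \<zero>}"
  note c = tensor_coeff[OF assms, folded \<phi>_def]
  have PA: "p \<in> P" if "p \<in> ?A" for p using c(3,4)[of p] that by (cases p) auto
  have "t = Q.proj (lin_ext R F (free_gen R) \<phi>)" using lin_ext_id[OF r(1)] r(2) by simp
  also have "\<dots> = (\<Oplus>\<^bsub>tensor_module R V W\<^esub>p\<in>?A. Q.proj (\<phi> p \<odot>\<^bsub>F\<^esub> free_gen R p))"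
    unfolding lin_ext_def
    by (intro linear_map_finsum[OF _ _ proj] F.module_axioms T.module_axioms Pi_I F.smult_closed free_gen_closed)
      (blast intro: PA c)+
  also have "\<dots> = tensor_lift R (tensor_module R V W) (tens R V W) t"
    unfolding tensor_lift_eq \<phi>_def[symmetric]
    by (intro T.finsum_cong')
      (auto simp: linear_map_smult[OF proj] tens_def' PA c simp del: free_module_simps
         intro!: T.smult_closed linear_map_closed[OF proj] free_gen_closed PA[unfolded mem_Collect_eq])
  finally show ?thesis by simp
qed

lemma tensor_map_eqI:
  assumes "module R V" "module R W" "module R X" "t \<in> carrier (tensor_module R V W)"
    and L: "linear_map R (tensor_module R V W) X L" "linear_map R (tensor_module R V W) X L'"
    and eq: "\<And>v w. v \<in> carrier V \<Longrightarrow> w \<in> carrier W \<Longrightarrow> L (tens R V W v w) = L' (tens R V W v w)"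
  shows "L t = L' t"
proof -
  let ?T = "tensor_module R V W"
  have "L t = L (tensor_lift R ?T (tens R V W) t)" by (simp add: tensor_lift_id assms)
  also have "\<dots> = tensor_lift R X (\<lambda>v w. L (tens R V W v w)) t"
    using assms by (intro tensor_lift_hom[OF assms(1,2) _ assms(3,4)]) auto
  also have "\<dots> = tensor_lift R X (\<lambda>v w. L' (tens R V W v w)) t"
    using assms by (intro tensor_lift_cong[OF assms(1-4)]) (auto intro: linear_map_closed[OF L(2)])
  also have "\<dots> = L' (tensor_lift R ?T (tens R V W) t)"
    using assms by (intro tensor_lift_hom[OF assms(1,2) _ assms(3,4), symmetric]) auto
  also have "\<dots> = L' t" by (simp add: tensor_lift_id assms)
  finally show ?thesis .
qed

lemma tensor_lift_swap:
  assumes "module R U" "module R V" "module R W" "module R Z" "module R X"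
    and s: "s \<in> carrier (tensor_module R U V)" and t: "t \<in> carrier (tensor_module R W Z)"
    and f: "\<And>u v w z. \<lbrakk>u \<in> carrier U; v \<in> carrier V; w \<in> carrier W; z \<in> carrier Z\<rbrakk> \<Longrightarrow> f u v w z \<in> carrier X"
  shows "tensor_lift R X (\<lambda>u v. tensor_lift R X (\<lambda>w z. f u v w z) t) s =
    tensor_lift R X (\<lambda>w z. tensor_lift R X (\<lambda>u v. f u v w z) s) t"
proof -
  interpret X: module R X by fact
  note c = tensor_coeff[OF assms(1,2) s] and d = tensor_coeff[OF assms(3,4) t]
  let ?c = "tensor_coeff s" and ?d = "tensor_coeff t"
  let ?F = "free_module R (carrier U \<times> carrier V)"
  \<comment> \<open>The right-hand side as a function of a formal combination \<phi> put in place of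
    the representative of \<open>s\<close>. It is linear, so expanding the representative into
    generators yields the left-hand side without handling a double sum.\<close>
  let ?L = "\<lambda>\<phi>. tensor_lift R X (\<lambda>w z. lin_ext R X (\<lambda>p. f (fst p) (snd p) w z) \<phi>) t"
  have L: "linear_map R ?F X ?L"
    using assms by (intro linear_map_tensor_lift_param[OF assms(3,4)] linear_map_lin_ext) auto
  have gen: "?L (free_gen R p) = tensor_lift R X (\<lambda>w z. f (fst p) (snd p) w z) t"
    if "p \<in> carrier U \<times> carrier V" for p
    using that f by (intro tensor_lift_cong[OF assms(3,4,5) t]) (auto simp: lin_ext_free_gen assms)
  have pA: "p \<in> carrier U \<times> carrier V" if "?c p \<noteq> \<zero>" for p using c(3,4)[of p] that by (cases p) auto
  have "tensor_lift R X (\<lambda>w z. tensor_lift R X (\<lambda>u v. f u v w z) s) t = ?L ?c"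
    unfolding tensor_lift_eq[of X "\<lambda>u v. f u v _ _"] lin_ext_def by simp
  also have "\<dots> = ?L (lin_ext R ?F (free_gen R) ?c)" using lin_ext_id[OF c(1)] by simp
  also have "\<dots> = (\<Oplus>\<^bsub>X\<^esub>p\<in>{p. ?c p \<noteq> \<zero>}. ?L (?c p \<odot>\<^bsub>?F\<^esub> free_gen R p))"
    unfolding lin_ext_def[of R ?F]
    by (intro linear_map_finsum[OF module_free_module assms(5) L] Pi_I module.smult_closed[OF module_free_module]
        free_gen_closed pA c) auto
  also have "\<dots> = (\<Oplus>\<^bsub>X\<^esub>p\<in>{p. ?c p \<noteq> \<zero>}. ?c p \<odot>\<^bsub>X\<^esub> tensor_lift R X (\<lambda>w z. f (fst p) (snd p) w z) t)"
    by (intro X.finsum_cong' Pi_I X.smult_closed c tensor_lift_closed[OF assms(3-5) t] f refl)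
      (auto simp: linear_map_smult[OF L] gen pA c simp del: free_module_simps)
  also have "\<dots> = tensor_lift R X (\<lambda>u v. tensor_lift R X (\<lambda>w z. f u v w z) t) s"
    unfolding tensor_lift_eq[of X _ s] by simp
  finally show ?thesis by simp
qed

end

section \<open>Finite-dimensional vector spaces\<close>

text \<open>Only the completeness relation is asked for, not that \<xi> takes the values 0 and 1 on
  \<open>e\<close>; this is the form in which dual bases enter traces and contractions.\<close>

definition dual_basis where
  "dual_basis K V I e \<xi> \<longleftrightarrow> finite I \<and> (\<forall>i\<in>I. e i \<in> carrier V) \<and>
    (\<forall>i\<in>I. linear_map K V (ring_as_module K) (\<xi> i)) \<and>
    (\<forall>v\<in>carrier V. (\<Oplus>\<^bsub>V\<^esub>i\<in>I. \<xi> i v \<odot>\<^bsub>V\<^esub> e i) = v)"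

lemma dual_basisD:
  assumes "dual_basis K V I e \<xi>"
  shows "finite I" "i \<in> I \<Longrightarrow> e i \<in> carrier V" "i \<in> I \<Longrightarrow> linear_map K V (ring_as_module K) (\<xi> i)"
    "v \<in> carrier V \<Longrightarrow> (\<Oplus>\<^bsub>V\<^esub>i\<in>I. \<xi> i v \<odot>\<^bsub>V\<^esub> e i) = v"
    "i \<in> I \<Longrightarrow> v \<in> carrier V \<Longrightarrow> \<xi> i v \<in> carrier K"
  using assms linear_map_closed unfolding dual_basis_def by fastforce+

text \<open>A generating set of least cardinality is a basis.\<close>

lemma fin_dim_basis:
  assumes "field K" "module K V" "fin_dim K V"
  obtains B \<xi> where "dual_basis K V B (\<lambda>b. b) \<xi>"
    and "\<And>c b. \<lbrakk>c \<in> B \<rightarrow> carrier K; (\<Oplus>\<^bsub>V\<^esub>b\<in>B. c b \<odot>\<^bsub>V\<^esub> b) = \<zero>\<^bsub>V\<^esub>; b \<in> B\<rbrakk> \<Longrightarrow> c b = \<zero>\<^bsub>K\<^esub>"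
proof -
  interpret K: field K by fact
  interpret V: module K V by fact
  define gen where "gen B \<longleftrightarrow> finite B \<and> B \<subseteq> carrier V \<and>
    (\<forall>v \<in> carrier V. \<exists>c \<in> B \<rightarrow> carrier K. v = (\<Oplus>\<^bsub>V\<^esub>b \<in> B. c b \<odot>\<^bsub>V\<^esub> b))" for B
  have "\<exists>B. gen B" using assms(3) by (simp add: fin_dim_def gen_def)
  then obtain B where B: "gen B" and min: "\<And>B'. gen B' \<Longrightarrow> card B \<le> card B'"
    using ex_has_least_nat[of gen _ card] by metis
  have fin: "finite B" and BV: "B \<subseteq> carrier V"
    and sp: "\<And>v. v \<in> carrier V \<Longrightarrow> \<exists>c \<in> B \<rightarrow> carrier K. v = (\<Oplus>\<^bsub>V\<^esub>b \<in> B. c b \<odot>\<^bsub>V\<^esub> b)"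
    using B by (auto simp: gen_def)
  \<comment> \<open>A relation with a nonzero coefficient at \<open>b0\<close> would let
    \<open>b0\<close> be dropped from the generating set, against the minimality of its
    cardinality.\<close>
  have ind: "c b0 = \<zero>\<^bsub>K\<^esub>"
    if c: "c \<in> B \<rightarrow> carrier K" and z: "(\<Oplus>\<^bsub>V\<^esub>b\<in>B. c b \<odot>\<^bsub>V\<^esub> b) = \<zero>\<^bsub>V\<^esub>" and b0: "b0 \<in> B" for c b0
  proof (rule ccontr)
    assume nz: "c b0 \<noteq> \<zero>\<^bsub>K\<^esub>"
    have b0V: "b0 \<in> carrier V" and c0: "c b0 \<in> carrier K" using b0 BV c by auto
    let ?i = "inv\<^bsub>K\<^esub> (c b0)"
    have i: "?i \<in> carrier K" "c b0 \<otimes>\<^bsub>K\<^esub> ?i = \<one>\<^bsub>K\<^esub>"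
      using nz c0 K.field_Units by auto
    have "gen (B - {b0})" unfolding gen_def
    proof (intro conjI ballI)
      fix v assume v: "v \<in> carrier V"
      obtain d where d: "d \<in> B \<rightarrow> carrier K" "v = (\<Oplus>\<^bsub>V\<^esub>b\<in>B. d b \<odot>\<^bsub>V\<^esub> b)" using sp[OF v] by auto
      \<comment> \<open>The multiple of the relation \<open>c\<close> that cancels the coefficient
        of \<open>v\<close> at \<open>b0\<close>.\<close>
      let ?s = "\<ominus>\<^bsub>K\<^esub> (d b0 \<otimes>\<^bsub>K\<^esub> ?i)"
      let ?e = "\<lambda>b. d b \<oplus>\<^bsub>K\<^esub> ?s \<otimes>\<^bsub>K\<^esub> c b"
      have d0: "d b0 \<in> carrier K" using d b0 by auto
      have s: "?s \<in> carrier K" using d0 i by auto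
      have e: "?e \<in> B \<rightarrow> carrier K" using c d s by (auto simp: Pi_iff)
      have e0: "?e b0 = \<zero>\<^bsub>K\<^esub>"
      proof -
        have "?s \<otimes>\<^bsub>K\<^esub> c b0 = \<ominus>\<^bsub>K\<^esub> (d b0 \<otimes>\<^bsub>K\<^esub> (c b0 \<otimes>\<^bsub>K\<^esub> ?i))"
          using d0 c0 i(1) by (simp add: K.l_minus K.r_minus K.m_ac)
        then show ?thesis using i(2) d0 by (simp add: K.r_neg)
      qed
      have "(\<Oplus>\<^bsub>V\<^esub>b\<in>B. ?e b \<odot>\<^bsub>V\<^esub> b) = (\<Oplus>\<^bsub>V\<^esub>b\<in>B. d b \<odot>\<^bsub>V\<^esub> b \<oplus>\<^bsub>V\<^esub> ?s \<odot>\<^bsub>V\<^esub> (c b \<odot>\<^bsub>V\<^esub> b))"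
        using c d s BV by (intro V.finsum_cong') (auto simp: V.smult_l_distr V.smult_assoc1 Pi_iff subset_iff)
      also have "\<dots> = (\<Oplus>\<^bsub>V\<^esub>b\<in>B. d b \<odot>\<^bsub>V\<^esub> b) \<oplus>\<^bsub>V\<^esub> (\<Oplus>\<^bsub>V\<^esub>b\<in>B. ?s \<odot>\<^bsub>V\<^esub> (c b \<odot>\<^bsub>V\<^esub> b))"
        using c d s BV by (intro V.finsum_addf) (auto simp: Pi_iff subset_iff)
      also have "(\<Oplus>\<^bsub>V\<^esub>b\<in>B. ?s \<odot>\<^bsub>V\<^esub> (c b \<odot>\<^bsub>V\<^esub> b)) = ?s \<odot>\<^bsub>V\<^esub> (\<Oplus>\<^bsub>V\<^esub>b\<in>B. c b \<odot>\<^bsub>V\<^esub> b)"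
        using c s BV fin by (intro V.finsum_smult_ldistr[symmetric]) (auto simp: Pi_iff subset_iff)
      finally have "(\<Oplus>\<^bsub>V\<^esub>b\<in>B. ?e b \<odot>\<^bsub>V\<^esub> b) = v"
        using z s v d(2) by simp
      moreover have "(\<Oplus>\<^bsub>V\<^esub>b\<in>B. ?e b \<odot>\<^bsub>V\<^esub> b) = (\<Oplus>\<^bsub>V\<^esub>b\<in>B - {b0}. ?e b \<odot>\<^bsub>V\<^esub> b)"
      proof -
        have "(\<Oplus>\<^bsub>V\<^esub>b\<in>insert b0 (B - {b0}). ?e b \<odot>\<^bsub>V\<^esub> b)
            = ?e b0 \<odot>\<^bsub>V\<^esub> b0 \<oplus>\<^bsub>V\<^esub> (\<Oplus>\<^bsub>V\<^esub>b\<in>B - {b0}. ?e b \<odot>\<^bsub>V\<^esub> b)"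
          using fin e BV b0V e0 by (intro V.finsum_insert) (auto simp: Pi_iff subset_iff simp del: K.r_zero)
        moreover have "insert b0 (B - {b0}) = B" using b0 by auto
        moreover have "(\<Oplus>\<^bsub>V\<^esub>b\<in>B - {b0}. ?e b \<odot>\<^bsub>V\<^esub> b) \<in> carrier V"
          using e BV by (intro V.finsum_closed) (auto simp: Pi_iff subset_iff)
        ultimately show ?thesis unfolding e0 using b0V by simp
      qed
      ultimately show "\<exists>c\<in>B - {b0} \<rightarrow> carrier K. v = (\<Oplus>\<^bsub>V\<^esub>b\<in>B - {b0}. c b \<odot>\<^bsub>V\<^esub> b)"
        using e by (intro bexI[of _ ?e]) auto
    qed (use fin BV in auto)
    from min[OF this] show False using fin b0 card_Diff1_less[of B b0] by simp
  qed
  have uniq: "c b = d b" if c: "c \<in> B \<rightarrow> carrier K" and d: "d \<in> B \<rightarrow> carrier K"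
    and eq: "(\<Oplus>\<^bsub>V\<^esub>b\<in>B. c b \<odot>\<^bsub>V\<^esub> b) = (\<Oplus>\<^bsub>V\<^esub>b\<in>B. d b \<odot>\<^bsub>V\<^esub> b)" and b: "b \<in> B" for c d b
  proof -
    let ?m = "\<ominus>\<^bsub>K\<^esub> \<one>\<^bsub>K\<^esub>"
    have D: "(\<Oplus>\<^bsub>V\<^esub>b\<in>B. d b \<odot>\<^bsub>V\<^esub> b) \<in> carrier V"
      using d BV by (intro V.finsum_closed) (auto simp: Pi_iff subset_iff)
    have "(\<Oplus>\<^bsub>V\<^esub>b\<in>B. (c b \<oplus>\<^bsub>K\<^esub> ?m \<otimes>\<^bsub>K\<^esub> d b) \<odot>\<^bsub>V\<^esub> b) = (\<Oplus>\<^bsub>V\<^esub>b\<in>B. c b \<odot>\<^bsub>V\<^esub> b \<oplus>\<^bsub>V\<^esub> ?m \<odot>\<^bsub>V\<^esub> (d b \<odot>\<^bsub>V\<^esub> b))"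
      using c d BV by (intro V.finsum_cong') (auto simp: V.smult_l_distr V.smult_assoc1 Pi_iff subset_iff)
    also have "\<dots> = (\<Oplus>\<^bsub>V\<^esub>b\<in>B. c b \<odot>\<^bsub>V\<^esub> b) \<oplus>\<^bsub>V\<^esub> (\<Oplus>\<^bsub>V\<^esub>b\<in>B. ?m \<odot>\<^bsub>V\<^esub> (d b \<odot>\<^bsub>V\<^esub> b))"
      using c d BV by (intro V.finsum_addf) (auto simp: Pi_iff subset_iff)
    also have "(\<Oplus>\<^bsub>V\<^esub>b\<in>B. ?m \<odot>\<^bsub>V\<^esub> (d b \<odot>\<^bsub>V\<^esub> b)) = ?m \<odot>\<^bsub>V\<^esub> (\<Oplus>\<^bsub>V\<^esub>b\<in>B. d b \<odot>\<^bsub>V\<^esub> b)"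
      using d BV fin by (intro V.finsum_smult_ldistr[symmetric]) (auto simp: Pi_iff subset_iff)
    also have "(\<Oplus>\<^bsub>V\<^esub>b\<in>B. c b \<odot>\<^bsub>V\<^esub> b) \<oplus>\<^bsub>V\<^esub> \<dots> = \<zero>\<^bsub>V\<^esub>"
      using D by (simp add: eq V.smult_l_minus V.r_neg)
    finally have "c b \<oplus>\<^bsub>K\<^esub> ?m \<otimes>\<^bsub>K\<^esub> d b = \<zero>\<^bsub>K\<^esub>"
      using c d b by (intro ind) (auto simp: Pi_iff)
    moreover have "c b \<in> carrier K" "d b \<in> carrier K" using c d b by auto
    ultimately show ?thesis using K.minus_equality[of "c b" "\<ominus>\<^bsub>K\<^esub> d b"] by (simp add: K.l_minus)
  qed
  \<comment> \<open>Coordinates are picked by choice; it is their uniqueness that makes them linear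
    in \<open>v\<close>.\<close>
  define co where "co v = (SOME c. c \<in> B \<rightarrow> carrier K \<and> v = (\<Oplus>\<^bsub>V\<^esub>b \<in> B. c b \<odot>\<^bsub>V\<^esub> b))" for v
  have co: "co v \<in> B \<rightarrow> carrier K" "v = (\<Oplus>\<^bsub>V\<^esub>b \<in> B. co v b \<odot>\<^bsub>V\<^esub> b)" if "v \<in> carrier V" for v
  proof -
    have "\<exists>c. c \<in> B \<rightarrow> carrier K \<and> v = (\<Oplus>\<^bsub>V\<^esub>b \<in> B. c b \<odot>\<^bsub>V\<^esub> b)" using sp[OF that] by blast
    from someI_ex[OF this] show "co v \<in> B \<rightarrow> carrier K" "v = (\<Oplus>\<^bsub>V\<^esub>b \<in> B. co v b \<odot>\<^bsub>V\<^esub> b)"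
      unfolding co_def by auto
  qed
  have coK: "co v b \<in> carrier K" if "v \<in> carrier V" "b \<in> B" for v b using co(1)[OF that(1)] that by auto
  have "dual_basis K V B (\<lambda>b. b) (\<lambda>b v. co v b)" unfolding dual_basis_def
  proof (intro conjI ballI)
    fix b assume b: "b \<in> B"
    show "linear_map K V (ring_as_module K) (\<lambda>v. co v b)"
    proof (rule linear_mapI; simp)
      fix u v assume uv: "u \<in> carrier V" "v \<in> carrier V"
      have "(\<Oplus>\<^bsub>V\<^esub>b\<in>B. (co u b \<oplus>\<^bsub>K\<^esub> co v b) \<odot>\<^bsub>V\<^esub> b) = (\<Oplus>\<^bsub>V\<^esub>b\<in>B. co u b \<odot>\<^bsub>V\<^esub> b \<oplus>\<^bsub>V\<^esub> co v b \<odot>\<^bsub>V\<^esub> b)"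
        using uv BV coK by (intro V.finsum_cong') (auto simp: V.smult_l_distr)
      also have "\<dots> = (\<Oplus>\<^bsub>V\<^esub>b\<in>B. co u b \<odot>\<^bsub>V\<^esub> b) \<oplus>\<^bsub>V\<^esub> (\<Oplus>\<^bsub>V\<^esub>b\<in>B. co v b \<odot>\<^bsub>V\<^esub> b)"
        using uv BV coK by (intro V.finsum_addf) auto
      also have "\<dots> = u \<oplus>\<^bsub>V\<^esub> v" using co(2) uv by simp
      also have "\<dots> = (\<Oplus>\<^bsub>V\<^esub>b\<in>B. co (u \<oplus>\<^bsub>V\<^esub> v) b \<odot>\<^bsub>V\<^esub> b)" using co(2)[of "u \<oplus>\<^bsub>V\<^esub> v"] uv by simp
      finally show "co (u \<oplus>\<^bsub>V\<^esub> v) b = co u b \<oplus>\<^bsub>K\<^esub> co v b"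
        using uv coK b by (intro uniq) auto
    next
      fix a v assume av: "a \<in> carrier K" "v \<in> carrier V"
      have "(\<Oplus>\<^bsub>V\<^esub>b\<in>B. (a \<otimes>\<^bsub>K\<^esub> co v b) \<odot>\<^bsub>V\<^esub> b) = (\<Oplus>\<^bsub>V\<^esub>b\<in>B. a \<odot>\<^bsub>V\<^esub> (co v b \<odot>\<^bsub>V\<^esub> b))"
        using av BV coK by (intro V.finsum_cong') (auto simp: V.smult_assoc1)
      also have "\<dots> = a \<odot>\<^bsub>V\<^esub> (\<Oplus>\<^bsub>V\<^esub>b\<in>B. co v b \<odot>\<^bsub>V\<^esub> b)"
        using av BV coK fin by (intro V.finsum_smult_ldistr[symmetric]) auto
      also have "\<dots> = a \<odot>\<^bsub>V\<^esub> v" using co(2) av by simp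
      also have "\<dots> = (\<Oplus>\<^bsub>V\<^esub>b\<in>B. co (a \<odot>\<^bsub>V\<^esub> v) b \<odot>\<^bsub>V\<^esub> b)" using co(2)[of "a \<odot>\<^bsub>V\<^esub> v"] av by simp
      finally show "co (a \<odot>\<^bsub>V\<^esub> v) b = a \<otimes>\<^bsub>K\<^esub> co v b"
        using av coK b by (intro uniq) auto
    qed (use coK b in auto)
  qed (use fin BV co(2) in auto)
  then show thesis using that ind by blast
qed

text \<open>Gaussian elimination, by induction on the equations. Either equation \<open>k\<close> is
  void and is dropped, or it has a nonzero coefficient at some \<open>l\<close> and removes one
  unknown together with one equation, which preserves the surplus of unknowns.\<close>

lemma (in field) homogeneous_system:
  assumes "finite I" "finite J" "card I < card J" "\<And>i j. i \<in> I \<Longrightarrow> j \<in> J \<Longrightarrow> c i j \<in> carrier R"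
  shows "\<exists>x \<in> J \<rightarrow> carrier R. (\<exists>j\<in>J. x j \<noteq> \<zero>) \<and> (\<forall>i\<in>I. (\<Oplus>j\<in>J. c i j \<otimes> x j) = \<zero>)"
  using assms
proof (induction I arbitrary: J c rule: finite_induct)
  case empty
  then obtain j where "j \<in> J" by fastforce
  then show ?case by (intro bexI[of _ "\<lambda>_. \<one>"]) auto
next
  case (insert k I)
  show ?case
  proof (cases "\<forall>j\<in>J. c k j = \<zero>")
    case True
    obtain x where x: "x \<in> J \<rightarrow> carrier R" "\<exists>j\<in>J. x j \<noteq> \<zero>" "\<forall>i\<in>I. (\<Oplus>j\<in>J. c i j \<otimes> x j) = \<zero>"
      using insert.IH[of J c] insert.prems insert.hyps by auto
    have "(\<Oplus>j\<in>J. c k j \<otimes> x j) = (\<Oplus>j\<in>J. \<zero>)" using True x(1) by (intro finsum_cong') (auto simp: Pi_iff)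
    then show ?thesis using x by (intro bexI[of _ x]) auto
  next
    case False
    then obtain l where l: "l \<in> J" "c k l \<noteq> \<zero>" by auto
    let ?J = "J - {l}"
    let ?p = "inv (c k l)"
    have p: "?p \<in> carrier R" "c k l \<otimes> ?p = \<one>" using l insert.prems field_Units by auto
    have cl: "c i j \<in> carrier R" if "i \<in> insert k I" "j \<in> J" for i j using that insert.prems by auto
    have J: "J = insert l ?J" "l \<notin> ?J" "finite ?J" using l insert.prems by auto
    \<comment> \<open>The coefficients left after equation \<open>k\<close> has been solved for the
      unknown \<open>l\<close> and substituted into the others; \<open>?y\<close> below puts that
      solution back.\<close>
    let ?d = "\<lambda>i j. c i j \<oplus> (\<ominus> (c i l \<otimes> ?p)) \<otimes> c k j"
    have "card I < card ?J" using insert.prems insert.hyps l by simp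
    then obtain x where x: "x \<in> ?J \<rightarrow> carrier R" "\<exists>j\<in>?J. x j \<noteq> \<zero>" "\<forall>i\<in>I. (\<Oplus>j\<in>?J. ?d i j \<otimes> x j) = \<zero>"
      using insert.IH[of ?J ?d] insert.prems cl p l J(3) by auto
    let ?s = "\<Oplus>j\<in>?J. c k j \<otimes> x j"
    have s: "?s \<in> carrier R" using x cl by (intro finsum_closed) auto
    let ?y = "\<lambda>j. if j = l then \<ominus> (?p \<otimes> ?s) else x j"
    have y: "?y \<in> J \<rightarrow> carrier R" using x(1) s p by (auto simp: Pi_iff)
    have split: "(\<Oplus>j\<in>J. c i j \<otimes> ?y j) = c i l \<otimes> (\<ominus> (?p \<otimes> ?s)) \<oplus> (\<Oplus>j\<in>?J. c i j \<otimes> x j)"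
      if i: "i \<in> insert k I" for i
    proof -
      have "(\<Oplus>j\<in>insert l ?J. c i j \<otimes> ?y j) = c i l \<otimes> ?y l \<oplus> (\<Oplus>j\<in>?J. c i j \<otimes> ?y j)"
        using J y cl[OF i] l s p x(1) by (intro finsum_insert) auto
      also have "(\<Oplus>j\<in>?J. c i j \<otimes> ?y j) = (\<Oplus>j\<in>?J. c i j \<otimes> x j)"
        using x cl[OF i] by (intro finsum_cong') auto
      finally show ?thesis using J(1) by simp
    qed
    have "(\<Oplus>j\<in>J. c i j \<otimes> ?y j) = \<zero>" if i: "i \<in> insert k I" for i
    proof (cases "i = k")
      case True
      have "c k l \<otimes> (\<ominus> (?p \<otimes> ?s)) = \<ominus> (c k l \<otimes> ?p \<otimes> ?s)"
        using p(1) s cl l by (simp add: r_minus m_assoc)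
      then show ?thesis unfolding split[OF i] using True s p(2) by (simp add: l_neg)
    next
      case False
      then have iI: "i \<in> I" using i by auto
      have il: "c i l \<in> carrier R" using cl i l by auto
      let ?q = "\<ominus> (c i l \<otimes> ?p)"
      have q: "?q \<in> carrier R" using il p by auto
      have "\<zero> = (\<Oplus>j\<in>?J. ?d i j \<otimes> x j)" using x(3) iI by simp
      also have "\<dots> = (\<Oplus>j\<in>?J. c i j \<otimes> x j \<oplus> ?q \<otimes> (c k j \<otimes> x j))"
        using x(1) cl q i by (intro finsum_cong') (auto simp: l_distr m_assoc Pi_iff)
      also have "\<dots> = (\<Oplus>j\<in>?J. c i j \<otimes> x j) \<oplus> (\<Oplus>j\<in>?J. ?q \<otimes> (c k j \<otimes> x j))"
        using x(1) cl q i by (intro finsum_addf) (auto simp: Pi_iff)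
      also have "(\<Oplus>j\<in>?J. ?q \<otimes> (c k j \<otimes> x j)) = ?q \<otimes> ?s"
        using x(1) cl i q J(3) by (intro finsum_rdistr[symmetric]) (auto simp: Pi_iff)
      also have "?q \<otimes> ?s = c i l \<otimes> (\<ominus> (?p \<otimes> ?s))"
        using il p(1) s by (simp add: l_minus r_minus m_assoc)
      finally show ?thesis unfolding split[OF i]
        using il p(1) s x(1) cl i by (subst a_comm) (auto simp: Pi_iff intro!: finsum_closed)
    qed
    then show ?thesis using y x(2) by (intro bexI[of _ ?y]) auto
  qed
qed

text \<open>The vector \<open>y\<close> and the images of the basis are one more than the
  coordinates, so they satisfy a nontrivial linear relation. Injectivity and independence of the
  basis force a nonzero coefficient at \<open>y\<close>, and solving for \<open>y\<close> exhibits
  it as a value of \<open>f\<close>.\<close>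

lemma injective_imp_surjective:
  assumes "field K" "module K V" "fin_dim K V" "linear_map K V V f"
    and inj: "\<And>v. v \<in> carrier V \<Longrightarrow> f v = \<zero>\<^bsub>V\<^esub> \<Longrightarrow> v = \<zero>\<^bsub>V\<^esub>"
  shows "f ` carrier V = carrier V"
proof
  interpret K: field K by fact
  interpret V: module K V by fact
  note fcl = linear_map_closed[OF assms(4)]
  show "f ` carrier V \<subseteq> carrier V" using fcl by auto
  show "carrier V \<subseteq> f ` carrier V"
  proof
    fix y assume y: "y \<in> carrier V"
    obtain B \<xi> where db: "dual_basis K V B (\<lambda>b. b) \<xi>"
      and ind: "\<And>c b. \<lbrakk>c \<in> B \<rightarrow> carrier K; (\<Oplus>\<^bsub>V\<^esub>b\<in>B. c b \<odot>\<^bsub>V\<^esub> b) = \<zero>\<^bsub>V\<^esub>; b \<in> B\<rbrakk> \<Longrightarrow> c b = \<zero>\<^bsub>K\<^esub>"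
      by (rule fin_dim_basis[OF assms(1-3)]) (rule that, assumption, blast)
    note B = dual_basisD[OF db]
    define w where "w j = (case j of None \<Rightarrow> y | Some b \<Rightarrow> f b)" for j
    let ?J = "insert None (Some ` B)"
    have w: "w j \<in> carrier V" if "j \<in> ?J" for j using that y B(2) fcl by (auto simp: w_def)
    have "card ?J = Suc (card B)" using B(1) by (subst card_insert_disjoint) (auto simp: card_image)
    then have "\<exists>x \<in> ?J \<rightarrow> carrier K. (\<exists>j\<in>?J. x j \<noteq> \<zero>\<^bsub>K\<^esub>) \<and> (\<forall>i\<in>B. (\<Oplus>\<^bsub>K\<^esub>j\<in>?J. \<xi> i (w j) \<otimes>\<^bsub>K\<^esub> x j) = \<zero>\<^bsub>K\<^esub>)"
      using B(1) B(5) w by (intro K.homogeneous_system) (auto simp: w_def)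
    then obtain x where x: "x \<in> ?J \<rightarrow> carrier K" "\<exists>j\<in>?J. x j \<noteq> \<zero>\<^bsub>K\<^esub>"
      "\<And>i. i \<in> B \<Longrightarrow> (\<Oplus>\<^bsub>K\<^esub>j\<in>?J. \<xi> i (w j) \<otimes>\<^bsub>K\<^esub> x j) = \<zero>\<^bsub>K\<^esub>" by auto
    let ?z = "\<Oplus>\<^bsub>V\<^esub>j\<in>?J. x j \<odot>\<^bsub>V\<^esub> w j"
    have xw: "x j \<odot>\<^bsub>V\<^esub> w j \<in> carrier V" if "j \<in> ?J" for j using x(1) w that by blast
    then have z: "?z \<in> carrier V" by (intro V.finsum_closed) auto
    have "\<xi> i ?z = \<zero>\<^bsub>K\<^esub>" if i: "i \<in> B" for i
    proof -
      have "\<xi> i ?z = (\<Oplus>\<^bsub>K\<^esub>j\<in>?J. \<xi> i (x j \<odot>\<^bsub>V\<^esub> w j))"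
        using linear_map_finsum[OF assms(2) K.module_ring_as_module B(3)[OF i], of "\<lambda>j. x j \<odot>\<^bsub>V\<^esub> w j" ?J] xw
        by simp
      also have "\<dots> = (\<Oplus>\<^bsub>K\<^esub>j\<in>?J. \<xi> i (w j) \<otimes>\<^bsub>K\<^esub> x j)"
        using x(1) w B(5)[OF i]
        by (intro K.finsum_cong') (auto simp: linear_map_smult[OF B(3)[OF i]] K.m_comm Pi_iff)
      finally show ?thesis using x(3)[OF i] by simp
    qed
    then have "(\<Oplus>\<^bsub>V\<^esub>i\<in>B. \<xi> i ?z \<odot>\<^bsub>V\<^esub> i) = (\<Oplus>\<^bsub>V\<^esub>i\<in>B. \<zero>\<^bsub>V\<^esub>)"
      using B(2) by (intro V.finsum_cong') auto
    then have z0: "?z = \<zero>\<^bsub>V\<^esub>" using B(4)[OF z] by simp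
    let ?u = "\<Oplus>\<^bsub>V\<^esub>b\<in>B. x (Some b) \<odot>\<^bsub>V\<^esub> b"
    have xB: "x (Some b) \<in> carrier K" if "b \<in> B" for b using x(1) that by auto
    have u: "?u \<in> carrier V" using xB B(2) by (intro V.finsum_closed) auto
    have x0: "x None \<in> carrier K" using x(1) by auto
    have "?z = x None \<odot>\<^bsub>V\<^esub> y \<oplus>\<^bsub>V\<^esub> (\<Oplus>\<^bsub>V\<^esub>j\<in>Some ` B. x j \<odot>\<^bsub>V\<^esub> w j)"
      using B(1) xw x0 y by (subst V.finsum_insert) (auto simp: w_def)
    also have "(\<Oplus>\<^bsub>V\<^esub>j\<in>Some ` B. x j \<odot>\<^bsub>V\<^esub> w j) = (\<Oplus>\<^bsub>V\<^esub>b\<in>B. x (Some b) \<odot>\<^bsub>V\<^esub> f b)"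
      using xw by (subst V.finsum_reindex) (auto simp: w_def)
    also have "\<dots> = f ?u"
      using xB B(2) fcl
      by (subst linear_map_finsum[OF assms(2,2,4)])
        (auto simp: linear_map_smult[OF assms(4)] intro!: V.finsum_cong')
    finally have eq: "x None \<odot>\<^bsub>V\<^esub> y \<oplus>\<^bsub>V\<^esub> f ?u = \<zero>\<^bsub>V\<^esub>" using z0 by simp
    show "y \<in> f ` carrier V"
    proof (cases "x None = \<zero>\<^bsub>K\<^esub>")
      case True
      then have "f ?u = \<zero>\<^bsub>V\<^esub>" using eq y fcl[OF u] by simp
      then have "?u = \<zero>\<^bsub>V\<^esub>" by (rule inj[OF u])
      then have "x (Some b) = \<zero>\<^bsub>K\<^esub>" if "b \<in> B" for b
        using ind[of "\<lambda>b. x (Some b)" b] xB that by auto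
      then show ?thesis using x(2) True by auto
    next
      case False
      let ?p = "inv\<^bsub>K\<^esub> (x None)"
      have p: "?p \<in> carrier K" "?p \<otimes>\<^bsub>K\<^esub> x None = \<one>\<^bsub>K\<^esub>" using False x0 K.field_Units by auto
      have "x None \<odot>\<^bsub>V\<^esub> y = \<ominus>\<^bsub>V\<^esub> f ?u"
        using eq y x0 fcl[OF u] by (intro V.minus_equality[symmetric]) (auto simp: V.add.m_comm)
      also have "\<dots> = f ((\<ominus>\<^bsub>K\<^esub> \<one>\<^bsub>K\<^esub>) \<odot>\<^bsub>V\<^esub> ?u)"
        using u fcl[OF u] by (subst linear_map_smult[OF assms(4)]) (simp_all add: V.smult_l_minus)
      finally have "?p \<odot>\<^bsub>V\<^esub> (x None \<odot>\<^bsub>V\<^esub> y) = f (?p \<odot>\<^bsub>V\<^esub> ((\<ominus>\<^bsub>K\<^esub> \<one>\<^bsub>K\<^esub>) \<odot>\<^bsub>V\<^esub> ?u))"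
        using u p by (simp add: linear_map_smult[OF assms(4)])
      moreover have "?p \<odot>\<^bsub>V\<^esub> (x None \<odot>\<^bsub>V\<^esub> y) = y"
        using p x0 y by (simp add: V.smult_assoc1[symmetric])
      ultimately have "y = f (?p \<odot>\<^bsub>V\<^esub> ((\<ominus>\<^bsub>K\<^esub> \<one>\<^bsub>K\<^esub>) \<odot>\<^bsub>V\<^esub> ?u))" by simp
      then show ?thesis by (rule image_eqI) (use u p in auto)
    qed
  qed
qed

lemma (in abelian_monoid) finsum_swap:
  assumes "finite I" "finite J" "\<And>i j. i \<in> I \<Longrightarrow> j \<in> J \<Longrightarrow> f i j \<in> carrier G"
  shows "(\<Oplus>i\<in>I. \<Oplus>j\<in>J. f i j) = (\<Oplus>j\<in>J. \<Oplus>i\<in>I. f i j)"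
  using assms
proof (induction I rule: finite_induct)
  case empty
  then show ?case by simp
next
  case (insert k I)
  have "(\<Oplus>j\<in>J. \<Oplus>i\<in>insert k I. f i j) = (\<Oplus>j\<in>J. f k j \<oplus> (\<Oplus>i\<in>I. f i j))"
    using insert by (intro finsum_cong') auto
  also have "\<dots> = (\<Oplus>j\<in>J. f k j) \<oplus> (\<Oplus>j\<in>J. \<Oplus>i\<in>I. f i j)"
    using insert by (intro finsum_addf) auto
  finally show ?case using insert by (subst finsum_insert) auto
qed

section \<open>Contracting sums over a dual basis\<close>

context cring
begin

lemma tensor_lift_finsum:
  assumes "module R V" "module R W" "module R X" "t \<in> carrier (tensor_module R V W)" "finite I"
    and "\<And>i v w. \<lbrakk>i \<in> I; v \<in> carrier V; w \<in> carrier W\<rbrakk> \<Longrightarrow> f i v w \<in> carrier X"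
  shows "tensor_lift R X (\<lambda>v w. \<Oplus>\<^bsub>X\<^esub>i\<in>I. f i v w) t = (\<Oplus>\<^bsub>X\<^esub>i\<in>I. tensor_lift R X (f i) t)"
proof -
  interpret X: module R X by fact
  note c = tensor_coeff[OF assms(1,2,4)]
  let ?c = "SOME \<phi>. \<phi> \<in> t"
  have "tensor_lift R X (\<lambda>v w. \<Oplus>\<^bsub>X\<^esub>i\<in>I. f i v w) t
      = (\<Oplus>\<^bsub>X\<^esub>p\<in>{p. ?c p \<noteq> \<zero>}. \<Oplus>\<^bsub>X\<^esub>i\<in>I. ?c p \<odot>\<^bsub>X\<^esub> f i (fst p) (snd p))"
    unfolding tensor_lift_eq using assms(5,6) c
    by (intro X.finsum_cong' refl X.finsum_smult_ldistr) (auto intro!: X.finsum_closed)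
  also have "\<dots> = (\<Oplus>\<^bsub>X\<^esub>i\<in>I. tensor_lift R X (f i) t)"
    unfolding tensor_lift_eq using assms(5,6) c by (intro X.finsum_swap) auto
  finally show ?thesis .
qed

text \<open>Read from left to right, this removes a sum over the basis. Read from right to left, it
  replaces a varying argument of \<open>L\<close> by the constants \<open>e i\<close>, at the price
  of the scalars \<open>\<xi> i v\<close>.\<close>

lemma dual_basis_expand:
  assumes "module R V" "module R X" "dual_basis R V I e \<xi>" "linear_map R V X L" "v \<in> carrier V"
  shows "(\<Oplus>\<^bsub>X\<^esub>i\<in>I. \<xi> i v \<odot>\<^bsub>X\<^esub> L (e i)) = L v"
proof -
  interpret V: module R V by fact
  interpret X: module R X by fact
  note d = dual_basisD[OF assms(3)]
  have "L v = L (\<Oplus>\<^bsub>V\<^esub>i\<in>I. \<xi> i v \<odot>\<^bsub>V\<^esub> e i)" by (simp add: d(4)[OF assms(5)])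
  also have "\<dots> = (\<Oplus>\<^bsub>X\<^esub>i\<in>I. L (\<xi> i v \<odot>\<^bsub>V\<^esub> e i))"
    using d assms(5) by (intro linear_map_finsum[OF assms(1,2,4)]) auto
  also have "\<dots> = (\<Oplus>\<^bsub>X\<^esub>i\<in>I. \<xi> i v \<odot>\<^bsub>X\<^esub> L (e i))"
    using d assms(5) linear_map_closed[OF assms(4)]
    by (intro X.finsum_cong') (auto simp: linear_map_smult[OF assms(4)])
  finally show ?thesis by simp
qed

end

section \<open>Calculus with Sweedler notation\<close>

definition trilinear_map where
  "trilinear_map K U V W X f \<longleftrightarrow>
    (\<forall>v\<in>carrier V. \<forall>w\<in>carrier W. linear_map K U X (\<lambda>u. f u v w)) \<and>
    (\<forall>u\<in>carrier U. bilinear_map K V W X (f u))"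

lemma trilinear_mapI:
  assumes "\<And>v w. v \<in> carrier V \<Longrightarrow> w \<in> carrier W \<Longrightarrow> linear_map K U X (\<lambda>u. f u v w)"
    and "\<And>u. u \<in> carrier U \<Longrightarrow> bilinear_map K V W X (f u)"
  shows "trilinear_map K U V W X f"
  using assms by (auto simp: trilinear_map_def)

text \<open>Each slot is filled with a linear map of a further variable, so that these facts chain
  by resolution with the other linearity rules on nested terms.\<close>

lemma trilinear_map_1: "\<lbrakk>trilinear_map K U V W X f; linear_map K Y U A; v \<in> carrier V; w \<in> carrier W\<rbrakk>
    \<Longrightarrow> linear_map K Y X (\<lambda>y. f (A y) v w)"
  and trilinear_map_2: "\<lbrakk>trilinear_map K U V W X f; linear_map K Y V B; u \<in> carrier U; w \<in> carrier W\<rbrakk>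
    \<Longrightarrow> linear_map K Y X (\<lambda>y. f u (B y) w)"
  and trilinear_map_3: "\<lbrakk>trilinear_map K U V W X f; linear_map K Y W C; u \<in> carrier U; v \<in> carrier V\<rbrakk>
    \<Longrightarrow> linear_map K Y X (\<lambda>y. f u v (C y))"
  and trilinear_map_closed: "\<lbrakk>trilinear_map K U V W X f; u \<in> carrier U; v \<in> carrier V; w \<in> carrier W\<rbrakk>
    \<Longrightarrow> f u v w \<in> carrier X"
  unfolding trilinear_map_def
  by (auto intro: linear_map_compose[of K U X "\<lambda>u. f u v w" Y A]
      linear_map_compose[OF bilinear_map_left, of K V W X "f u" w Y B]
      linear_map_compose[OF bilinear_map_right, of K V W X "f u" v Y C]
      dest: bilinear_map_closed)

lemma bilinear_map_1: "\<lbrakk>bilinear_map K V W X f; linear_map K Y V B; w \<in> carrier W\<rbrakk>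
    \<Longrightarrow> linear_map K Y X (\<lambda>y. f (B y) w)"
  and bilinear_map_2: "\<lbrakk>bilinear_map K V W X f; linear_map K Y W C; v \<in> carrier V\<rbrakk>
    \<Longrightarrow> linear_map K Y X (\<lambda>y. f v (C y))"
  using linear_map_compose[OF bilinear_map_left] linear_map_compose[OF bilinear_map_right] by metis+

context hopf_algebra
begin

abbreviation sw where "sw X h f \<equiv> sweedler2 K H X h f"

abbreviation "KK \<equiv> ring_as_module K"

abbreviation mult_H (infixl "\<cdot>" 70) where "x \<cdot> y \<equiv> x \<otimes>\<^bsub>H\<^esub> y"

abbreviation smult_H (infixl "\<bullet>" 70) where "a \<bullet> x \<equiv> a \<odot>\<^bsub>H\<^esub> x"

lemma module_H [simp, intro]: "module K H"
  by (rule module_axioms)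

lemma comult_closed [simp, intro]: "h \<in> carrier H \<Longrightarrow> comult H h \<in> carrier (tensor_module K H H)"
  by (rule linear_map_closed[OF comult_linear])

lemma antipode_closed [simp, intro]: "h \<in> carrier H \<Longrightarrow> antipode H h \<in> carrier H"
  by (rule linear_map_closed[OF antipode_linear])

lemma counit_closed [simp, intro]: "h \<in> carrier H \<Longrightarrow> counit H h \<in> carrier K"
  using linear_map_closed[OF counit_linear] by simp

lemma sw_closed:
  "\<lbrakk>module K X; h \<in> carrier H; \<And>a b. a \<in> carrier H \<Longrightarrow> b \<in> carrier H \<Longrightarrow> f a b \<in> carrier X\<rbrakk>
    \<Longrightarrow> sw X h f \<in> carrier X"
  unfolding sweedler2_def by (rule K.tensor_lift_closed) auto

lemma sw_cong:
  assumes "module K X" "h \<in> carrier H"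
    and "\<And>a b. a \<in> carrier H \<Longrightarrow> b \<in> carrier H \<Longrightarrow> f a b = g a b"
    and "\<And>a b. a \<in> carrier H \<Longrightarrow> b \<in> carrier H \<Longrightarrow> g a b \<in> carrier X"
  shows "sw X h f = sw X h g"
  unfolding sweedler2_def using assms by (intro K.tensor_lift_cong[of H H]) auto

lemma sw_hom:
  assumes "linear_map K X Y L" "module K X" "module K Y" "h \<in> carrier H"
    and "\<And>a b. a \<in> carrier H \<Longrightarrow> b \<in> carrier H \<Longrightarrow> f a b \<in> carrier X"
  shows "L (sw X h f) = sw Y h (\<lambda>a b. L (f a b))"
  unfolding sweedler2_def using assms by (intro K.tensor_lift_hom[of H H X]) auto

lemma sw_swap:
  assumes "module K X" "g \<in> carrier H" "h \<in> carrier H"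
    and "\<And>a b c d. \<lbrakk>a \<in> carrier H; b \<in> carrier H; c \<in> carrier H; d \<in> carrier H\<rbrakk> \<Longrightarrow> f a b c d \<in> carrier X"
  shows "sw X g (\<lambda>a b. sw X h (\<lambda>c d. f a b c d)) = sw X h (\<lambda>c d. sw X g (\<lambda>a b. f a b c d))"
  unfolding sweedler2_def using assms by (intro K.tensor_lift_swap[of H H H H]) auto

lemma sw_finsum:
  assumes "module K X" "h \<in> carrier H" "finite I"
    and "\<And>i a b. \<lbrakk>i \<in> I; a \<in> carrier H; b \<in> carrier H\<rbrakk> \<Longrightarrow> f i a b \<in> carrier X"
  shows "sw X h (\<lambda>a b. \<Oplus>\<^bsub>X\<^esub>i\<in>I. f i a b) = (\<Oplus>\<^bsub>X\<^esub>i\<in>I. sw X h (f i))"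
  unfolding sweedler2_def using assms by (intro K.tensor_lift_finsum[of H H]) auto

lemma lin_sw:
  assumes "linear_map K V H A" "module K X" "bilinear_map K H H X f"
  shows "linear_map K V X (\<lambda>v. sw X (A v) f)"
  unfolding sweedler2_def
  by (rule linear_map_compose[OF K.linear_map_tensor_lift])
    (auto intro: assms linear_map_compose[OF comult_linear])

lemma lin_sw_param:
  assumes "module K X" "h \<in> carrier H"
    and "\<And>a b. a \<in> carrier H \<Longrightarrow> b \<in> carrier H \<Longrightarrow> linear_map K V X (\<lambda>v. f v a b)"
  shows "linear_map K V X (\<lambda>v. sw X h (f v))"
  unfolding sweedler2_def using assms by (intro K.linear_map_tensor_lift_param[of H H]) auto

lemma lin_mult_left: "linear_map K V H A \<Longrightarrow> y \<in> carrier H \<Longrightarrow> linear_map K V H (\<lambda>v. A v \<cdot> y)"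
  by (rule linear_mapI)
    (auto simp: linear_map_add linear_map_smult linear_map_closed A.l_distr smult_mult_left
      dest: linear_map_closed)

lemma lin_mult_right: "linear_map K V H A \<Longrightarrow> y \<in> carrier H \<Longrightarrow> linear_map K V H (\<lambda>v. y \<cdot> A v)"
  by (rule linear_mapI)
    (auto simp: linear_map_add linear_map_smult linear_map_closed A.r_distr smult_mult_right
      dest: linear_map_closed)

lemma lin_kmult_left: "linear_map K V KK A \<Longrightarrow> y \<in> carrier K \<Longrightarrow> linear_map K V KK (\<lambda>v. A v \<otimes> y)"
  using linear_map_scalar_fun[of K KK V A y] by simp

lemma lin_kmult_right: "linear_map K V KK A \<Longrightarrow> y \<in> carrier K \<Longrightarrow> linear_map K V KK (\<lambda>v. y \<otimes> A v)"
  using linear_map_smult_fun[of K KK V A y] by simp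

lemma lin_tens_left:
  "\<lbrakk>linear_map K U V A; module K V; module K W; w \<in> carrier W\<rbrakk>
    \<Longrightarrow> linear_map K U (tensor_module K V W) (\<lambda>u. tens K V W (A u) w)"
  by (rule bilinear_map_1[OF K.bilinear_map_tens])

lemma lin_tens_right:
  "\<lbrakk>linear_map K U W A; module K V; module K W; v \<in> carrier V\<rbrakk>
    \<Longrightarrow> linear_map K U (tensor_module K V W) (\<lambda>u. tens K V W v (A u))"
  by (rule bilinear_map_2[OF K.bilinear_map_tens])

text \<open>Resolution with these rules reduces linearity of a composite term to linearity in its
  innermost variable; later collections extend this one.\<close>

lemmas lin = bilinear_mapI trilinear_mapI linear_map_id lin_sw lin_sw_param lin_mult_left lin_mult_right
  lin_kmult_left lin_kmult_right lin_tens_left lin_tens_right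
  linear_map_compose[OF antipode_linear] linear_map_compose[OF counit_linear]
  linear_map_smult_fun linear_map_scalar_fun sw_closed

lemma smult_closed_over: "\<lbrakk>module K X; a \<in> carrier K; x \<in> carrier X\<rbrakk> \<Longrightarrow> a \<odot>\<^bsub>X\<^esub> x \<in> carrier X"
  by (rule module.smult_closed)

lemma sw_closed_scalar:
  "\<lbrakk>h \<in> carrier H; \<And>a b. a \<in> carrier H \<Longrightarrow> b \<in> carrier H \<Longrightarrow> f a b \<in> carrier K\<rbrakk>
    \<Longrightarrow> sw KK h f \<in> carrier K"
  using sw_closed[of KK h f] by simp

lemma scalar_closedI: "a \<in> carrier K \<Longrightarrow> a \<in> carrier KK"
  by simp

lemmas lins = lin A.m_closed A.one_closed antipode_closed counit_closed K.m_closed smult_closed_over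
  module_H K.module_ring_as_module sw_closed_scalar scalar_closedI

text \<open>A trilinear \<open>f\<close> factors through the threefold tensor product by a linear
  map. The axiom \<open>comult_coassoc\<close> is the case of the universal \<open>f\<close>, and
  applying the linear map to its two sides gives the general case.\<close>

lemma sw_coassoc:
  assumes "module K X" "trilinear_map K H H H X f" "h \<in> carrier H"
  shows "sw X h (\<lambda>a c. sw X a (\<lambda>a' b. f a' b c)) = sw X h (\<lambda>a b. sw X b (\<lambda>b' c. f a b' c))"
proof -
  note t = trilinear_map_1[OF assms(2)] trilinear_map_2[OF assms(2)] trilinear_map_3[OF assms(2)]
  let ?T = "tensor_module3 K H H H"
  let ?L = "tensor_lift K X (\<lambda>a u. tensor_lift K X (f a) u)"
  have bil: "bilinear_map K H H X (f a)" if "a \<in> carrier H" for a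
    using that assms(2) by (auto simp: trilinear_map_def)
  have bil2: "bilinear_map K H (tensor_module K H H) X (\<lambda>a u. tensor_lift K X (f a) u)"
    using assms(1) bil
    by (auto intro!: bilinear_mapI K.linear_map_tensor_lift K.linear_map_tensor_lift_param[of H H] t lin)
  have L: "linear_map K ?T X ?L"
    using assms(1) bil2 by (intro K.linear_map_tensor_lift) auto
  have Lt: "?L (tens3 K H H H a b c) = f a b c"
    if "a \<in> carrier H" "b \<in> carrier H" "c \<in> carrier H" for a b c
    using that assms(1) bil bil2 by (simp add: K.tensor_lift_tens)
  have cl: "f a b c \<in> carrier X" if "a \<in> carrier H" "b \<in> carrier H" "c \<in> carrier H" for a b c
    using trilinear_map_closed[OF assms(2)] that by auto
  have 1: "?L (sw ?T h (\<lambda>a c. sw ?T a (\<lambda>a' b. tens3 K H H H a' b c))) =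
     sw X h (\<lambda>a c. sw X a (\<lambda>a' b. f a' b c))"
    using assms(1,3) cl
    by (subst sw_hom[OF L]) (auto simp: sw_hom[OF L] Lt intro!: sw_closed sw_cong)
  have 2: "?L (sw ?T h (\<lambda>a b. sw ?T b (\<lambda>b' c. tens3 K H H H a b' c))) =
     sw X h (\<lambda>a b. sw X b (\<lambda>b' c. f a b' c))"
    using assms(1,3) cl
    by (subst sw_hom[OF L]) (auto simp: sw_hom[OF L] Lt intro!: sw_closed sw_cong)
  show ?thesis unfolding 1[symmetric] 2[symmetric] comult_coassoc[OF assms(3)] ..
qed

lemma sw_counit_left:
  assumes "module K X" "linear_map K H X f" "h \<in> carrier H"
  shows "sw X h (\<lambda>a b. counit H a \<odot>\<^bsub>X\<^esub> f b) = f h"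
proof -
  have "f h = f (sw H h (\<lambda>a b. counit H a \<bullet> b))" using counit_left[OF assms(3)] by simp
  also have "\<dots> = sw X h (\<lambda>a b. f (counit H a \<bullet> b))"
    using assms by (intro sw_hom) auto
  also have "\<dots> = sw X h (\<lambda>a b. counit H a \<odot>\<^bsub>X\<^esub> f b)"
    using assms linear_map_closed[OF assms(2)]
    by (intro sw_cong) (auto simp: linear_map_smult[OF assms(2)] intro: module.smult_closed)
  finally show ?thesis by simp
qed

lemma sw_counit_right:
  assumes "module K X" "linear_map K H X f" "h \<in> carrier H"
  shows "sw X h (\<lambda>a b. counit H b \<odot>\<^bsub>X\<^esub> f a) = f h"
proof -
  have "f h = f (sw H h (\<lambda>a b. counit H b \<bullet> a))" using counit_right[OF assms(3)] by simp
  also have "\<dots> = sw X h (\<lambda>a b. f (counit H b \<bullet> a))"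
    using assms by (intro sw_hom) auto
  also have "\<dots> = sw X h (\<lambda>a b. counit H b \<odot>\<^bsub>X\<^esub> f a)"
    using assms linear_map_closed[OF assms(2)]
    by (intro sw_cong) (auto simp: linear_map_smult[OF assms(2)] intro: module.smult_closed)
  finally show ?thesis by simp
qed

lemma sw_antipode_left:
  assumes "module K X" "linear_map K H X f" "h \<in> carrier H"
  shows "sw X h (\<lambda>a b. f (antipode H a \<cdot> b)) = counit H h \<odot>\<^bsub>X\<^esub> f \<one>\<^bsub>H\<^esub>"
proof -
  have "sw X h (\<lambda>a b. f (antipode H a \<cdot> b)) = f (sw H h (\<lambda>a b. antipode H a \<cdot> b))"
    using assms by (intro sw_hom[symmetric]) auto
  then show ?thesis using antipode_left[OF assms(3)] linear_map_smult[OF assms(2)] assms(3) by simp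
qed

lemma sw_antipode_right:
  assumes "module K X" "linear_map K H X f" "h \<in> carrier H"
  shows "sw X h (\<lambda>a b. f (a \<cdot> antipode H b)) = counit H h \<odot>\<^bsub>X\<^esub> f \<one>\<^bsub>H\<^esub>"
proof -
  have "sw X h (\<lambda>a b. f (a \<cdot> antipode H b)) = f (sw H h (\<lambda>a b. a \<cdot> antipode H b))"
    using assms by (intro sw_hom[symmetric]) auto
  then show ?thesis using antipode_right[OF assms(3)] linear_map_smult[OF assms(2)] assms(3) by simp
qed

lemma sw_mult:
  assumes "module K X" "bilinear_map K H H X f" "g \<in> carrier H" "h \<in> carrier H"
  shows "sw X (g \<cdot> h) f =
    sw X g (\<lambda>a b. sw X h (\<lambda>c d. f (a \<cdot> c) (b \<cdot> d)))"
proof -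
  let ?L = "tensor_lift K X f"
  have L: "linear_map K (tensor_module K H H) X ?L"
    using assms by (intro K.linear_map_tensor_lift) auto
  have "sw X (g \<cdot> h) f = ?L (comult H (g \<cdot> h))" by (simp add: sweedler2_def)
  also have "\<dots> = sw X g (\<lambda>a b. sw X h (\<lambda>c d. ?L (tens K H H (a \<cdot> c) (b \<cdot> d))))"
    unfolding comult_mult[OF assms(3,4)] using assms
    by (subst sw_hom[OF L]) (auto simp: sw_hom[OF L] intro!: sw_closed sw_cong linear_map_closed[OF L])
  also have "\<dots> = sw X g (\<lambda>a b. sw X h (\<lambda>c d. f (a \<cdot> c) (b \<cdot> d)))"
    using assms by (intro sw_cong) (auto simp: K.tensor_lift_tens intro!: sw_closed bilinear_map_closed[OF assms(2)])
  finally show ?thesis .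
qed

lemma sw_one: "module K X \<Longrightarrow> bilinear_map K H H X f \<Longrightarrow> sw X \<one>\<^bsub>H\<^esub> f = f \<one>\<^bsub>H\<^esub> \<one>\<^bsub>H\<^esub>"
  by (simp add: sweedler2_def comult_one K.tensor_lift_tens)


subsection \<open>The antipode\<close>

text \<open>Replace h by h_1 \<otimes> h_2 S(h_3). In S(g_1 h_1) g_2 h_2 S(h_3) the antipode axiom
  then applies to the product of g and h_1, and \<epsilon>(g) S(h) remains.\<close>

lemma antipode_mult_aux:
  assumes "g \<in> carrier H" "h \<in> carrier H"
  shows "sw H g (\<lambda>a b. antipode H (a \<cdot> h) \<cdot> b) = counit H g \<bullet> antipode H h"
proof -
  let ?S = "antipode H"
  have "sw H g (\<lambda>a b. ?S (a \<cdot> h) \<cdot> b) =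
      sw H g (\<lambda>a b. sw H h (\<lambda>c d. counit H d \<bullet> (?S (a \<cdot> c) \<cdot> b)))"
    using assms by (intro sw_cong sw_counit_right[symmetric]) (auto intro!: lin)
  also have "\<dots> = sw H g (\<lambda>a b. sw H h (\<lambda>c d. sw H d (\<lambda>d e. (?S (a \<cdot> c) \<cdot> b) \<cdot> (d \<cdot> ?S e))))"
    using assms by (intro sw_cong trans[OF _ sw_antipode_right[where f = "\<lambda>z. _ \<cdot> z", symmetric]])
      (auto intro!: lin)
  also have "\<dots> = sw H g (\<lambda>a b. sw H h (\<lambda>c e. sw H c (\<lambda>c d. (?S (a \<cdot> c) \<cdot> b) \<cdot> (d \<cdot> ?S e))))"
    using assms by (intro sw_cong sw_coassoc[symmetric]) (auto intro!: lin)
  also have "\<dots> = sw H h (\<lambda>c e. sw H g (\<lambda>a b. sw H c (\<lambda>c d. ?S (a \<cdot> c) \<cdot> (b \<cdot> d) \<cdot> ?S e)))"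
    using assms by (subst sw_swap) (auto intro!: lin sw_cong simp: A.m_assoc)
  also have "\<dots> = sw H h (\<lambda>c e. sw H (g \<cdot> c) (\<lambda>a b. ?S a \<cdot> b \<cdot> ?S e))"
    using assms by (intro sw_cong sw_mult[symmetric]) (auto intro!: lin)
  also have "\<dots> = sw H h (\<lambda>c e. counit H c \<bullet> (counit H g \<bullet> ?S e))"
    using assms by (intro sw_cong trans[OF sw_antipode_left[where f = "\<lambda>z. z \<cdot> _"]])
      (auto intro!: lin simp: counit_mult smult_assoc1[symmetric] K.m_comm)
  also have "\<dots> = counit H g \<bullet> ?S h"
    using assms by (intro sw_counit_left) (auto intro!: lin)
  finally show ?thesis .
qed

text \<open>Replace g by g_1 \<otimes> g_2 S(g_3) in S(g h). The preceding lemma evaluates S(g_1 h)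
  g_2, and S(h) S(g) remains.\<close>

lemma antipode_mult:
  assumes "g \<in> carrier H" "h \<in> carrier H"
  shows "antipode H (g \<cdot> h) = antipode H h \<cdot> antipode H g"
proof -
  let ?S = "antipode H"
  have "?S (g \<cdot> h) = sw H g (\<lambda>a b. counit H b \<bullet> ?S (a \<cdot> h))"
    using assms by (intro sw_counit_right[symmetric]) (auto intro!: lin)
  also have "\<dots> = sw H g (\<lambda>a b. sw H b (\<lambda>b c. ?S (a \<cdot> h) \<cdot> (b \<cdot> ?S c)))"
    using assms by (intro sw_cong trans[OF _ sw_antipode_right[where f = "\<lambda>z. _ \<cdot> z", symmetric]])
      (auto intro!: lin)
  also have "\<dots> = sw H g (\<lambda>a c. sw H a (\<lambda>a b. ?S (a \<cdot> h) \<cdot> (b \<cdot> ?S c)))"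
    using assms by (intro sw_coassoc[symmetric]) (auto intro!: lin)
  also have "\<dots> = sw H g (\<lambda>a c. sw H a (\<lambda>a b. ?S (a \<cdot> h) \<cdot> b) \<cdot> ?S c)"
    using assms
    by (intro sw_cong trans[OF _ sw_hom[where L = "\<lambda>z. z \<cdot> _", symmetric]])
      (auto intro!: lin sw_cong simp: A.m_assoc)
  also have "\<dots> = sw H g (\<lambda>a c. counit H a \<bullet> (?S h \<cdot> ?S c))"
    using assms by (intro sw_cong) (auto simp: antipode_mult_aux smult_mult_left)
  also have "\<dots> = ?S h \<cdot> ?S g"
    using assms by (intro sw_counit_left) (auto intro!: lin)
  finally show ?thesis .
qed

lemma antipode_one [simp]: "antipode H \<one>\<^bsub>H\<^esub> = \<one>\<^bsub>H\<^esub>"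
  using antipode_left[OF A.one_closed] by (simp add: sw_one bilinear_mapI lin counit_one)

lemma counit_antipode:
  assumes "h \<in> carrier H"
  shows "counit H (antipode H h) = counit H h"
proof -
  have "counit H (antipode H h) = sw KK h (\<lambda>a b. counit H b \<odot>\<^bsub>KK\<^esub> counit H (antipode H a))"
    using assms by (intro sw_counit_right[symmetric]) (auto intro!: lin)
  also have "\<dots> = sw KK h (\<lambda>a b. counit H (antipode H a \<cdot> b))"
    using assms by (intro sw_cong) (auto simp: counit_mult K.m_comm)
  also have "\<dots> = counit H h \<odot>\<^bsub>KK\<^esub> counit H \<one>\<^bsub>H\<^esub>"
    using assms by (intro sw_antipode_left) (auto intro!: lin linear_map_compose[OF counit_linear])
  finally show ?thesis using assms by (simp add: counit_one)
qed

text \<open>With \<open>f\<close> the pure tensor this reads S(h_2)_1 \<otimes> h_1 S(h_2)_2 = S(h)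
  \<otimes> 1. It follows by multiplying S(h_1) \<otimes> 1 with the coproduct of h_2 S(h_3), which
  is trivial by the antipode axiom, then expanding that coproduct instead and cancelling S(h_1)
  against the leg next to it.\<close>

lemma comult_antipode_aux:
  assumes X: "module K X" and f: "bilinear_map K H H X f" and h: "h \<in> carrier H"
  shows "sw X h (\<lambda>a b. sw X (antipode H b) (\<lambda>c d. f c (a \<cdot> d))) = f (antipode H h) \<one>\<^bsub>H\<^esub>"
proof -
  let ?S = "antipode H"
  note l = lin bilinear_map_1[OF f] bilinear_map_2[OF f] bilinear_map_closed[OF f] X
  have cl: "f a b \<in> carrier X" if "a \<in> carrier H" "b \<in> carrier H" for a b
    using bilinear_map_closed[OF f] that by auto
  have "f (?S h) \<one>\<^bsub>H\<^esub> = sw X h (\<lambda>a b. counit H b \<odot>\<^bsub>X\<^esub> f (?S a) \<one>\<^bsub>H\<^esub>)"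
    using h by (intro sw_counit_right[symmetric]) (auto intro!: l)
  also have "\<dots> = sw X h (\<lambda>a b. sw X b (\<lambda>b c. sw X (b \<cdot> ?S c) (\<lambda>p q. f (?S a \<cdot> p) q)))"
  proof (intro sw_cong X h)
    fix a b assume ab: "a \<in> carrier H" "b \<in> carrier H"
    have "sw X b (\<lambda>b c. sw X (b \<cdot> ?S c) (\<lambda>p q. f (?S a \<cdot> p) q)) =
        counit H b \<odot>\<^bsub>X\<^esub> sw X \<one>\<^bsub>H\<^esub> (\<lambda>p q. f (?S a \<cdot> p) q)"
      using ab by (intro sw_antipode_right[where f = "\<lambda>z. sw X z (\<lambda>p q. f (?S a \<cdot> p) q)"]) (auto intro!: l)
    also have "sw X \<one>\<^bsub>H\<^esub> (\<lambda>p q. f (?S a \<cdot> p) q) = f (?S a) \<one>\<^bsub>H\<^esub>"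
      using ab by (subst sw_one) (auto intro!: l)
    finally show "counit H b \<odot>\<^bsub>X\<^esub> f (?S a) \<one>\<^bsub>H\<^esub> =
      sw X b (\<lambda>b c. sw X (b \<cdot> ?S c) (\<lambda>p q. f (?S a \<cdot> p) q))" by simp
  qed (auto intro!: l)
  also have "\<dots> = sw X h (\<lambda>a b. sw X b (\<lambda>b c. sw X b (\<lambda>p q. sw X (?S c) (\<lambda>r s. f (?S a \<cdot> (p \<cdot> r)) (q \<cdot> s)))))"
    using h X cl by (intro sw_cong sw_mult) (auto intro!: l)
  also have "\<dots> = sw X h (\<lambda>a c. sw X a (\<lambda>a b. sw X b (\<lambda>p q. sw X (?S c) (\<lambda>r s. f (?S a \<cdot> (p \<cdot> r)) (q \<cdot> s)))))"
    using h X cl by (intro sw_coassoc[symmetric]) (auto intro!: l)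
  also have "\<dots> = sw X h (\<lambda>a c. sw X a (\<lambda>b q. sw X b (\<lambda>a p. sw X (?S c) (\<lambda>r s. f (?S a \<cdot> (p \<cdot> r)) (q \<cdot> s)))))"
    using h X cl by (intro sw_cong sw_coassoc[symmetric]) (auto intro!: l)
  also have "\<dots> = sw X h (\<lambda>a c. sw X a (\<lambda>b q. sw X b (\<lambda>a p. sw X (?S c) (\<lambda>r s. f (?S a \<cdot> p \<cdot> r) (q \<cdot> s)))))"
    using h X cl by (intro sw_cong) (auto intro!: l simp: A.m_assoc)
  also have "\<dots> = sw X h (\<lambda>a c. sw X a (\<lambda>b q. counit H b \<odot>\<^bsub>X\<^esub> sw X (?S c) (\<lambda>r s. f r (q \<cdot> s))))"
  proof (intro sw_cong X h)
    fix a c b q assume ab: "a \<in> carrier H" "c \<in> carrier H" "b \<in> carrier H" "q \<in> carrier H"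
    have "sw X b (\<lambda>a p. sw X (?S c) (\<lambda>r s. f (?S a \<cdot> p \<cdot> r) (q \<cdot> s))) =
        counit H b \<odot>\<^bsub>X\<^esub> sw X (?S c) (\<lambda>r s. f (\<one>\<^bsub>H\<^esub> \<cdot> r) (q \<cdot> s))"
      using ab by (intro sw_antipode_left[where f = "\<lambda>z. sw X (?S c) (\<lambda>r s. f (z \<cdot> r) (q \<cdot> s))"])
        (auto intro!: l)
    also have "sw X (?S c) (\<lambda>r s. f (\<one>\<^bsub>H\<^esub> \<cdot> r) (q \<cdot> s)) = sw X (?S c) (\<lambda>r s. f r (q \<cdot> s))"
      using ab by (intro sw_cong) (auto intro!: l)
    finally show "sw X b (\<lambda>a p. sw X (?S c) (\<lambda>r s. f (?S a \<cdot> p \<cdot> r) (q \<cdot> s))) =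
        counit H b \<odot>\<^bsub>X\<^esub> sw X (?S c) (\<lambda>r s. f r (q \<cdot> s))" .
  qed (auto intro!: l module.smult_closed)
  also have "\<dots> = sw X h (\<lambda>a b. sw X (?S b) (\<lambda>c d. f c (a \<cdot> d)))"
    using h X cl by (intro sw_cong sw_counit_left) (auto intro!: l)
  finally show ?thesis by simp
qed

text \<open>The preceding lemma writes S(h_2) \<otimes> S(h_1) as S(h_3)_1 \<otimes> S(h_1) h_2
  S(h_3)_2, where the antipode axiom removes S(h_1) h_2 and the coproduct of S(h) is left.\<close>

lemma sw_antipode:
  assumes X: "module K X" and f: "bilinear_map K H H X f" and h: "h \<in> carrier H"
  shows "sw X (antipode H h) f = sw X h (\<lambda>a b. f (antipode H b) (antipode H a))"
proof -
  let ?S = "antipode H"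
  note l = lin bilinear_map_1[OF f] bilinear_map_2[OF f] bilinear_map_closed[OF f] X
  have cl: "f a b \<in> carrier X" if "a \<in> carrier H" "b \<in> carrier H" for a b
    using bilinear_map_closed[OF f] that by auto
  have "sw X h (\<lambda>a b. f (?S b) (?S a)) =
      sw X h (\<lambda>a b. sw X b (\<lambda>b c. sw X (?S c) (\<lambda>c d. f c (?S a \<cdot> (b \<cdot> d)))))"
    using h X cl by (intro sw_cong trans[OF _ comult_antipode_aux[where f = "\<lambda>p q. f p (_ \<cdot> q)", symmetric]])
      (auto intro!: l)
  also have "\<dots> = sw X h (\<lambda>a c. sw X a (\<lambda>a b. sw X (?S c) (\<lambda>c d. f c (?S a \<cdot> (b \<cdot> d)))))"
    using h X cl by (intro sw_coassoc[symmetric]) (auto intro!: l)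
  also have "\<dots> = sw X h (\<lambda>a c. sw X a (\<lambda>a b. sw X (?S c) (\<lambda>c d. f c (?S a \<cdot> b \<cdot> d))))"
    using h X cl by (intro sw_cong) (auto intro!: l simp: A.m_assoc)
  also have "\<dots> = sw X h (\<lambda>a c. counit H a \<odot>\<^bsub>X\<^esub> sw X (?S c) f)"
    using h X cl
    by (intro sw_cong trans[OF sw_antipode_left[where f = "\<lambda>z. sw X _ (\<lambda>r s. f r (z \<cdot> s))"]])
      (auto intro!: l module.smult_closed arg_cong2[where f = "smult X"] sw_cong)
  also have "\<dots> = sw X (?S h) f"
    using h X f by (intro sw_counit_left) (auto intro!: lin)
  finally show ?thesis by simp
qed

end

section \<open>Bijectivity of the antipode\<close>

context hopf_algebra
begin

text \<open>The order of the legs is reversed twice.\<close>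

lemma sw_antipode_antipode:
  assumes X: "module K X" and f: "bilinear_map K H H X f" and h: "h \<in> carrier H"
  shows "sw X (antipode H (antipode H h)) f =
    sw X h (\<lambda>a b. f (antipode H (antipode H a)) (antipode H (antipode H b)))"
proof -
  note l = lins bilinear_map_1[OF f] bilinear_map_2[OF f] bilinear_map_closed[OF f] X
  have "sw X (antipode H (antipode H h)) f = sw X (antipode H h) (\<lambda>a b. f (antipode H b) (antipode H a))"
    using h X f by (intro sw_antipode) (assumption | rule l)+
  also have "\<dots> = sw X h (\<lambda>a b. f (antipode H (antipode H a)) (antipode H (antipode H b)))"
    using h by (intro sw_antipode[where f = "\<lambda>a b. f (antipode H b) (antipode H a)"]) (assumption | rule l)+
  finally show ?thesis .
qed

text \<open>The compatibility condition that makes the dual of \<open>H\<close> a Hopf module, with \<open>H\<close> acting through the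
  antipode.\<close>

lemma sw_antipode_shift:
  assumes h: "linear_map K H KK f" and x: "x \<in> carrier H" and u: "u \<in> carrier H"
  shows "sw H u (\<lambda>c d. sw H (x \<cdot> antipode H (antipode H d)) (\<lambda>p r. f r \<bullet> (p \<cdot> antipode H c))) =
    sw H x (\<lambda>a b. f (b \<cdot> antipode H (antipode H u)) \<bullet> a)"
proof -
  let ?S = "antipode H"
  note l = lins linear_map_compose[OF h] 
  have cl: "f a \<in> carrier K" if "a \<in> carrier H" for a
    using linear_map_closed[OF h that] by simp
  note l = l cl
  have "sw H u (\<lambda>c d. sw H (x \<cdot> ?S (?S d)) (\<lambda>p r. f r \<bullet> (p \<cdot> ?S c))) =
      sw H u (\<lambda>c d. sw H x (\<lambda>a b. sw H (?S (?S d)) (\<lambda>p r. f (b \<cdot> r) \<bullet> (a \<cdot> p \<cdot> ?S c))))"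
    using x u by (intro sw_cong sw_mult) (assumption | rule l)+
  also have "\<dots> = sw H u (\<lambda>c d. sw H x (\<lambda>a b. sw H d (\<lambda>d e. f (b \<cdot> ?S (?S e)) \<bullet> (a \<cdot> ?S (?S d) \<cdot> ?S c))))"
    using x u by (intro sw_cong sw_antipode_antipode) (assumption | rule l)+
  also have "\<dots> = sw H u (\<lambda>c d. sw H d (\<lambda>d e. sw H x (\<lambda>a b. f (b \<cdot> ?S (?S e)) \<bullet> (a \<cdot> ?S (?S d) \<cdot> ?S c))))"
    using x u by (intro sw_cong sw_swap) (assumption | rule l)+
  also have "\<dots> = sw H u (\<lambda>c e. sw H c (\<lambda>c d. sw H x (\<lambda>a b. f (b \<cdot> ?S (?S e)) \<bullet> (a \<cdot> ?S (?S d) \<cdot> ?S c))))"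
    using x u by (intro sw_coassoc[symmetric]) (assumption | rule l)+
  \<comment> \<open>Antimultiplicativity gathers S(S(d)) S(c) into S(c S(d)), to which the antipode
    axiom for \<open>c\<close> applies.\<close>
  also have "\<dots> = sw H u (\<lambda>c e. sw H c (\<lambda>c d. sw H x (\<lambda>a b. f (b \<cdot> ?S (?S e)) \<bullet> (a \<cdot> ?S (c \<cdot> ?S d)))))"
    using x u by (intro sw_cong) (assumption | rule l | simp add: antipode_mult A.m_assoc)+
  also have "\<dots> = sw H u (\<lambda>c e. counit H c \<bullet> sw H x (\<lambda>a b. f (b \<cdot> ?S (?S e)) \<bullet> a))"
  proof (intro sw_cong module_H u)
    fix c e assume ce: "c \<in> carrier H" "e \<in> carrier H"
    have "sw H c (\<lambda>c d. sw H x (\<lambda>a b. f (b \<cdot> ?S (?S e)) \<bullet> (a \<cdot> ?S (c \<cdot> ?S d)))) =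
      counit H c \<bullet> sw H x (\<lambda>a b. f (b \<cdot> ?S (?S e)) \<bullet> (a \<cdot> ?S \<one>\<^bsub>H\<^esub>))"
      using ce x
      by (intro sw_antipode_right[where f = "\<lambda>z. sw H x (\<lambda>a b. f (b \<cdot> ?S (?S e)) \<bullet> (a \<cdot> ?S z))"]) (assumption | rule l)+
    also have "sw H x (\<lambda>a b. f (b \<cdot> ?S (?S e)) \<bullet> (a \<cdot> ?S \<one>\<^bsub>H\<^esub>)) =
        sw H x (\<lambda>a b. f (b \<cdot> ?S (?S e)) \<bullet> a)"
      using ce x by (intro sw_cong) (assumption | rule l | simp)+
    finally show "sw H c (\<lambda>c d. sw H x (\<lambda>a b. f (b \<cdot> ?S (?S e)) \<bullet> (a \<cdot> ?S (c \<cdot> ?S d)))) =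
      counit H c \<bullet> sw H x (\<lambda>a b. f (b \<cdot> ?S (?S e)) \<bullet> a)" .
  qed (rule x l | assumption)+
  also have "\<dots> = sw H x (\<lambda>a b. f (b \<cdot> ?S (?S u)) \<bullet> a)"
    using x u by (intro sw_counit_left) (assumption | rule l)+
  finally show ?thesis .
qed

text \<open>Invariance of \<open>t\<close> turns \<open>S h = 0\<close> into \<open>t (x S h\<^sub>(\<^sub>1\<^sub>)) h\<^sub>(\<^sub>2\<^sub>) = 0\<close> for all \<open>x\<close>; inserting
  \<open>x = y S (S h\<^sub>(\<^sub>2\<^sub>))\<close>, with \<open>h\<^sub>(\<^sub>3\<^sub>)\<close> as the last factor, this collapses to \<open>t y h = 0\<close>.\<close>

lemma antipode_inj_of_integral:
  assumes db: "dual_basis K H I e \<xi>" and t: "linear_map K H KK t"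
    and inv: "\<And>x. x \<in> carrier H \<Longrightarrow> sw H x (\<lambda>a b. t b \<bullet> a) = t x \<bullet> \<one>\<^bsub>H\<^esub>"
    and y: "y \<in> carrier H" "t y \<noteq> \<zero>"
    and h: "h \<in> carrier H" "antipode H h = \<zero>\<^bsub>H\<^esub>"
  shows "h = \<zero>\<^bsub>H\<^esub>"
proof -
  let ?S = "antipode H"
  note l = lins linear_map_compose[OF t]
  have cl: "t a \<in> carrier K" if "a \<in> carrier H" for a
    using linear_map_closed[OF t that] by simp
  note l = l cl
  \<comment> \<open>Invariance turns the scalar t(x S(a)) into the element x_1 S(a_2) t(x_2 S(a_1)).
    Its factor S(a_2) cancels against \<open>b\<close>, and the sum that is left contains
    \<open>h\<close> only through S(h) = 0.\<close>
  have vanish: "sw H h (\<lambda>a b. t (x \<cdot> ?S a) \<bullet> b) = \<zero>\<^bsub>H\<^esub>" if x: "x \<in> carrier H" for x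
  proof -
    have "sw H h (\<lambda>a b. t (x \<cdot> ?S a) \<bullet> b) =
        sw H h (\<lambda>a b. (t (x \<cdot> ?S a) \<bullet> \<one>\<^bsub>H\<^esub>) \<cdot> b)"
      using x h by (intro sw_cong) (assumption | rule l | simp add: smult_mult_left cl)+
    also have "\<dots> = sw H h (\<lambda>a b. sw H (x \<cdot> ?S a) (\<lambda>p q. t q \<bullet> p) \<cdot> b)"
      using x h by (intro sw_cong) (assumption | rule l | simp add: inv)+
    also have "\<dots> = sw H h (\<lambda>a b. sw H (x \<cdot> ?S a) (\<lambda>p q. t q \<bullet> (p \<cdot> b)))"
    proof (intro sw_cong module_H h)
      fix a b assume ab: "a \<in> carrier H" "b \<in> carrier H"
      have "sw H (x \<cdot> ?S a) (\<lambda>p q. t q \<bullet> p) \<cdot> b =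
          sw H (x \<cdot> ?S a) (\<lambda>p q. (t q \<bullet> p) \<cdot> b)"
        using x ab by (intro sw_hom[where L = "\<lambda>z. z \<cdot> b"]) (assumption | rule l)+
      also have "\<dots> = sw H (x \<cdot> ?S a) (\<lambda>p q. t q \<bullet> (p \<cdot> b))"
        using x ab by (intro sw_cong) (assumption | rule l | simp add: smult_mult_left cl)+
      finally show "sw H (x \<cdot> ?S a) (\<lambda>p q. t q \<bullet> p) \<cdot> b =
          sw H (x \<cdot> ?S a) (\<lambda>p q. t q \<bullet> (p \<cdot> b))" .
    qed (rule x l | assumption)+
    also have "\<dots> = sw H h (\<lambda>a b. sw H x (\<lambda>p q. sw H (?S a) (\<lambda>r s. t (q \<cdot> s) \<bullet> (p \<cdot> r \<cdot> b))))"
      using x h by (intro sw_cong sw_mult) (assumption | rule l)+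
    also have "\<dots> = sw H h (\<lambda>a b. sw H x (\<lambda>p q. sw H a (\<lambda>s r. t (q \<cdot> ?S s) \<bullet> (p \<cdot> ?S r \<cdot> b))))"
      using x h by (intro sw_cong sw_antipode) (assumption | rule l)+
    also have "\<dots> = sw H h (\<lambda>a b. sw H a (\<lambda>s r. sw H x (\<lambda>p q. t (q \<cdot> ?S s) \<bullet> (p \<cdot> ?S r \<cdot> b))))"
      using x h by (intro sw_cong sw_swap) (assumption | rule l)+
    also have "\<dots> = sw H h (\<lambda>s a. sw H a (\<lambda>r b. sw H x (\<lambda>p q. t (q \<cdot> ?S s) \<bullet> (p \<cdot> ?S r \<cdot> b))))"
      using x h by (intro sw_coassoc) (assumption | rule l)+
    also have "\<dots> = sw H h (\<lambda>s a. sw H a (\<lambda>r b. sw H x (\<lambda>p q. t (q \<cdot> ?S s) \<bullet> (p \<cdot> (?S r \<cdot> b)))))"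
      using x h by (intro sw_cong) (assumption | rule l | simp add: A.m_assoc)+
    also have "\<dots> = sw H h (\<lambda>s a. counit H a \<bullet> sw H x (\<lambda>p q. t (q \<cdot> ?S s) \<bullet> (p \<cdot> \<one>\<^bsub>H\<^esub>)))"
    proof (intro sw_cong module_H h)
      fix s a assume sa: "s \<in> carrier H" "a \<in> carrier H"
      show "sw H a (\<lambda>r b. sw H x (\<lambda>p q. t (q \<cdot> ?S s) \<bullet> (p \<cdot> (?S r \<cdot> b)))) =
        counit H a \<bullet> sw H x (\<lambda>p q. t (q \<cdot> ?S s) \<bullet> (p \<cdot> \<one>\<^bsub>H\<^esub>))"
        using sa x cl
        by (intro sw_antipode_left[where f = "\<lambda>z. sw H x (\<lambda>p q. t (q \<cdot> ?S s) \<bullet> (p \<cdot> z))"]) (assumption | rule l)+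
    qed (rule x l | assumption)+
    also have "\<dots> = sw H x (\<lambda>p q. t (q \<cdot> ?S h) \<bullet> (p \<cdot> \<one>\<^bsub>H\<^esub>))"
      using x h(1) by (intro sw_counit_right) (assumption | rule l)+
    also have "\<dots> = sw H x (\<lambda>p q. counit H q \<bullet> \<zero>\<^bsub>H\<^esub>)"
      using x h(2) cl linear_map_zero[OF _ _ t] by (intro sw_cong) auto
    also have "\<dots> = \<zero>\<^bsub>H\<^esub>"
      using x by (intro sw_counit_right[where f = "\<lambda>_. \<zero>\<^bsub>H\<^esub>"] linear_map_zero_fun) auto
    finally show ?thesis .
  qed
  note d = dual_basisD[OF db]
  have l\<xi>: "linear_map K V KK (\<lambda>v. \<xi> i (A v))" if "i \<in> I" "linear_map K V H A" for i A and V :: "('k, 'v, 'z) module_scheme"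
    using linear_map_compose[OF d(3)] that by blast
  have "t y \<bullet> h = sw H h (\<lambda>a d. counit H a \<bullet> (t y \<bullet> d))"
    using h y(1) by (intro sw_counit_left[symmetric]) (assumption | rule l)+
  also have "\<dots> = sw H h (\<lambda>a d. sw H a (\<lambda>a c. t (y \<cdot> ?S (a \<cdot> ?S c)) \<bullet> d))"
  proof (intro sw_cong module_H h)
    fix a d assume ad: "a \<in> carrier H" "d \<in> carrier H"
    have "sw H a (\<lambda>a c. t (y \<cdot> ?S (a \<cdot> ?S c)) \<bullet> d) = counit H a \<bullet> (t (y \<cdot> ?S \<one>\<^bsub>H\<^esub>) \<bullet> d)"
      using ad y by (intro sw_antipode_right[where f = "\<lambda>z. t (y \<cdot> ?S z) \<bullet> d"]) (assumption | rule l)+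
    then show "counit H a \<bullet> (t y \<bullet> d) = sw H a (\<lambda>a c. t (y \<cdot> ?S (a \<cdot> ?S c)) \<bullet> d)"
      using y by simp
  qed (rule y l | assumption)+
  also have "\<dots> = sw H h (\<lambda>a d. sw H a (\<lambda>a c. t (y \<cdot> ?S (?S c) \<cdot> ?S a) \<bullet> d))"
    using h y(1) by (intro sw_cong) (assumption | rule l | simp add: antipode_mult A.m_assoc)+
  also have "\<dots> = sw H h (\<lambda>a d. sw H d (\<lambda>c d. t (y \<cdot> ?S (?S c) \<cdot> ?S a) \<bullet> d))"
    using h y(1) by (intro sw_coassoc) (assumption | rule l)+
  \<comment> \<open>\<open>vanish\<close> speaks of a fixed \<open>x\<close>, whereas y S(S(c))
    varies with the summation variable \<open>c\<close>. Expanding it in the dual basis leaves the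
    fixed elements \<open>e i\<close> in that place.\<close>
  also have "\<dots> = sw H h (\<lambda>a d. sw H d (\<lambda>c d. \<Oplus>\<^bsub>H\<^esub>i\<in>I. \<xi> i (y \<cdot> ?S (?S c)) \<bullet> (t (e i \<cdot> ?S a) \<bullet> d)))"
  proof (intro sw_cong module_H h)
    fix a d' c d assume ad: "a \<in> carrier H" "d' \<in> carrier H" "c \<in> carrier H" "d \<in> carrier H"
    show "t (y \<cdot> ?S (?S c) \<cdot> ?S a) \<bullet> d =
        (\<Oplus>\<^bsub>H\<^esub>i\<in>I. \<xi> i (y \<cdot> ?S (?S c)) \<bullet> (t (e i \<cdot> ?S a) \<bullet> d))"
      using ad y(1)
      by (intro K.dual_basis_expand[OF _ _ db, where L = "\<lambda>z. t (z \<cdot> ?S a) \<bullet> d", symmetric])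
        (assumption | rule l)+
  qed (assumption | rule y(1) l d A.finsum_closed Pi_I)+
  also have "\<dots> = sw H h (\<lambda>a d. \<Oplus>\<^bsub>H\<^esub>i\<in>I. sw H d (\<lambda>c d. \<xi> i (y \<cdot> ?S (?S c)) \<bullet> (t (e i \<cdot> ?S a) \<bullet> d)))"
    using h y(1) by (intro sw_cong sw_finsum) (assumption | rule l d A.finsum_closed Pi_I)+
  also have "\<dots> = (\<Oplus>\<^bsub>H\<^esub>i\<in>I. sw H h (\<lambda>a d. sw H d (\<lambda>c d. \<xi> i (y \<cdot> ?S (?S c)) \<bullet> (t (e i \<cdot> ?S a) \<bullet> d))))"
    using h y(1) by (intro sw_finsum) (assumption | rule l d)+
  also have "\<dots> = (\<Oplus>\<^bsub>H\<^esub>i\<in>I. \<zero>\<^bsub>H\<^esub>)"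
  proof (intro A.finsum_cong' refl)
    fix i assume i: "i \<in> I"
    \<comment> \<open>Summation over \<open>c\<close> is absorbed into a linear map of the last leg,
      so that the summand at \<open>i\<close> becomes this map applied to the vanishing sum for
      \<open>e i\<close>.\<close>
    let ?L = "\<lambda>z. sw H z (\<lambda>c d. \<xi> i (y \<cdot> ?S (?S c)) \<bullet> d)"
    have L: "linear_map K H H ?L" using i y(1) by - (assumption | rule l l\<xi>[OF i] d(5)[OF i])+
    have "sw H h (\<lambda>a d. sw H d (\<lambda>c d. \<xi> i (y \<cdot> ?S (?S c)) \<bullet> (t (e i \<cdot> ?S a) \<bullet> d))) =
      sw H h (\<lambda>a d. t (e i \<cdot> ?S a) \<bullet> ?L d)"
    proof (intro sw_cong module_H h)
      fix a d' assume ab: "a \<in> carrier H" "d' \<in> carrier H"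
      have \<xi>cl: "\<xi> i z \<in> carrier K" if "z \<in> carrier H" for z using d(5) i that .
      have ei: "e i \<in> carrier H" using d(2) i .
      have "t (e i \<cdot> ?S a) \<bullet> ?L d' =
        sw H d' (\<lambda>c d. t (e i \<cdot> ?S a) \<bullet> (\<xi> i (y \<cdot> ?S (?S c)) \<bullet> d))"
        using y(1) ab ei
        by (intro sw_hom[where L = "\<lambda>z. t (e i \<cdot> ?S a) \<bullet> z"]) (assumption | rule l \<xi>cl)+
      also have "\<dots> = sw H d' (\<lambda>c d. \<xi> i (y \<cdot> ?S (?S c)) \<bullet> (t (e i \<cdot> ?S a) \<bullet> d))"
        using y(1) ab ei
        by (intro sw_cong) (assumption | rule l \<xi>cl | simp add: smult_assoc1[symmetric] K.m_comm cl \<xi>cl)+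
      finally show "sw H d' (\<lambda>c d. \<xi> i (y \<cdot> ?S (?S c)) \<bullet> (t (e i \<cdot> ?S a) \<bullet> d)) =
        t (e i \<cdot> ?S a) \<bullet> ?L d'" by simp
    qed (use i y(1) d(2) linear_map_closed[OF L] in \<open>auto intro!: A.m_closed cl smult_closed_over\<close>)
    also have "\<dots> = sw H h (\<lambda>a d. ?L (t (e i \<cdot> ?S a) \<bullet> d))"
      using i y h cl d by (intro sw_cong) (auto simp: linear_map_smult[OF L] intro!: linear_map_closed[OF L])
    also have "\<dots> = ?L (sw H h (\<lambda>a d. t (e i \<cdot> ?S a) \<bullet> d))"
      using i y h cl d by (intro sw_hom[OF L, symmetric]) (assumption | rule l)+
    also have "\<dots> = \<zero>\<^bsub>H\<^esub>"
      using vanish[of "e i"] d i linear_map_zero[OF _ _ L] by auto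
    finally show "sw H h (\<lambda>a d. sw H d (\<lambda>c d. \<xi> i (y \<cdot> ?S (?S c)) \<bullet> (t (e i \<cdot> ?S a) \<bullet> d))) = \<zero>\<^bsub>H\<^esub>" .
  qed auto
  finally have 0: "t y \<bullet> h = \<zero>\<^bsub>H\<^esub>" by simp
  have iy: "inv (t y) \<in> carrier K" "inv (t y) \<otimes> t y = \<one>" using y cl K.field_Units by auto
  have "h = inv (t y) \<bullet> (t y \<bullet> h)" using iy h y cl by (simp add: smult_assoc1[symmetric])
  then show ?thesis using 0 iy by simp
qed

text \<open>Only the left leg of the coproduct of \<open>y\<close> is split further; by
  coassociativity this amounts to splitting the right leg and handing its last part to
  \<open>f\<close>.\<close>

lemma sw_of_sw:
  assumes X: "module K X" and g: "bilinear_map K H H X g" and f: "linear_map K H KK f" and y: "y \<in> carrier H"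
  shows "sw X (sw H y (\<lambda>p q. f q \<bullet> p)) g = sw X y (\<lambda>p r. sw X r (\<lambda>q q'. f q' \<odot>\<^bsub>X\<^esub> g p q))"
proof -
  have fcl: "f a \<in> carrier K" if "a \<in> carrier H" for a
    using linear_map_closed[OF f that] by simp
  note l = lins bilinear_map_1[OF g] bilinear_map_2[OF g] bilinear_map_closed[OF g] linear_map_compose[OF f] X fcl g
  have L: "linear_map K H X (\<lambda>z. sw X z g)" by (assumption | rule l)+
  have "sw X (sw H y (\<lambda>p q. f q \<bullet> p)) g = sw X y (\<lambda>p q. sw X (f q \<bullet> p) g)"
    using y by (intro sw_hom[OF L]) (assumption | rule l)+
  also have "\<dots> = sw X y (\<lambda>p q. f q \<odot>\<^bsub>X\<^esub> sw X p g)"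
    using y by (intro sw_cong) (assumption | rule l linear_map_smult[OF L])+
  also have "\<dots> = sw X y (\<lambda>p q. sw X p (\<lambda>c d. f q \<odot>\<^bsub>X\<^esub> g c d))"
  proof (intro sw_cong X y)
    fix p q assume pq: "p \<in> carrier H" "q \<in> carrier H"
    then show "f q \<odot>\<^bsub>X\<^esub> sw X p g = sw X p (\<lambda>c d. f q \<odot>\<^bsub>X\<^esub> g c d)"
      by (intro sw_hom[where L = "\<lambda>z. f q \<odot>\<^bsub>X\<^esub> z"]) (assumption | rule l)+
  qed (assumption | rule l)+
  also have "\<dots> = sw X y (\<lambda>p r. sw X r (\<lambda>q q'. f q' \<odot>\<^bsub>X\<^esub> g p q))"
    using y by (intro sw_coassoc) (assumption | rule l)+
  finally show ?thesis .
qed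

section \<open>A nonzero integral as the trace of an endomorphism of \<open>H\<close>\<close>

definition conv where "conv f g y = sw KK y (\<lambda>a b. f a \<otimes> g b)"

text \<open>For a dual basis \<open>(e, \<xi>)\<close>, this is the trace of
  \<open>u \<mapsto> x\<^sub>(\<^sub>1\<^sub>) S (S u\<^sub>(\<^sub>1\<^sub>)) f (x\<^sub>(\<^sub>2\<^sub>) S (S u\<^sub>(\<^sub>2\<^sub>)))\<close>. As a function of \<open>x\<close> it is the projection of \<open>f\<close> to
  the coinvariants of the Hopf module dual to \<open>H\<close>, that is, an integral.\<close>

definition trace_integral where
  "trace_integral I e \<xi> f x = (\<Oplus>\<^bsub>KK\<^esub>i\<in>I. conv (\<xi> i) f (x \<cdot> antipode H (antipode H (e i))))"

lemma lin_conv: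
  assumes "linear_map K H KK f" "linear_map K H KK g"
  shows "linear_map K H KK (conv f g)"
proof -
  have cl: "f a \<in> carrier K" "g a \<in> carrier K" if "a \<in> carrier H" for a
    using linear_map_closed[OF assms(1) that] linear_map_closed[OF assms(2) that] by simp_all
  show ?thesis
    unfolding conv_def[abs_def]
    by (assumption | rule lins cl linear_map_compose[OF assms(1)] linear_map_compose[OF assms(2)])+
qed

lemma trace_integral_linear:
  assumes db: "dual_basis K H I e \<xi>" and f: "linear_map K H KK f"
  shows "linear_map K H KK (trace_integral I e \<xi> f)"
  unfolding trace_integral_def[abs_def]
  by (intro linear_map_finsum_fun linear_map_compose[OF lin_conv] K.module_ring_as_module dual_basisD[OF db] f
      lin_mult_left linear_map_id antipode_closed)

lemma lin_smult: "a \<in> carrier H \<Longrightarrow> linear_map K KK H (\<lambda>c. c \<bullet> a)"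
  by (intro linear_map_scalar_fun linear_map_id module_H)

text \<open>This is cyclicity of a trace. With \<Phi> the endomorphism whose trace is
  \<open>trace_integral\<close>, the shift lemma turns the left side into the sum over i of
  \<Phi>(d)_1 S(c) \<xi>_i(\<Phi>(d)_2), where c \<otimes> d is the coproduct of e_i. Expanding d
  over a second copy of the basis allows the sum over i to be contracted. What is left contains q_1
  S(q_2), so the antipode axiom leaves the trace of \<Phi> times the unit.\<close>

lemma trace_integral_invariant:
  assumes db: "dual_basis K H I e \<xi>" and f: "linear_map K H KK f" and x: "x \<in> carrier H"
  shows "sw H x (\<lambda>a b. trace_integral I e \<xi> f b \<bullet> a) = trace_integral I e \<xi> f x \<bullet> \<one>\<^bsub>H\<^esub>"
proof -
  let ?S = "antipode H"
  note d = dual_basisD[OF db] and sc = lin_smult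
  have \<xi>: "linear_map K V KK (\<lambda>v. \<xi> i (A v))" if "i \<in> I" "linear_map K V H A" for i A and V :: "('k, 'v, 'z) module_scheme"
    using linear_map_compose[OF d(3)] that by blast
  have fcl: "f a \<in> carrier K" if "a \<in> carrier H" for a
    using linear_map_closed[OF f that] by simp
  note l = lins \<xi> d(2) d(5) linear_map_compose[OF f] fcl
  have hlin: "linear_map K H KK (conv (\<xi> i) f)" if "i \<in> I" for i
    using that by (intro lin_conv d f)
  have hcl: "conv (\<xi> i) f a \<in> carrier K" if "i \<in> I" "a \<in> carrier H" for a i
    using linear_map_closed[OF hlin[OF that(1)] that(2)] by simp
  define \<Phi> where "\<Phi> z = sw H (x \<cdot> ?S (?S z)) (\<lambda>p q. f q \<bullet> p)" for z
  have \<Phi>lin: "linear_map K H H \<Phi>"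
    unfolding \<Phi>_def using x by - (assumption | rule l)+
  have \<Phi>cl: "\<Phi> z \<in> carrier H" if "z \<in> carrier H" for z using linear_map_closed[OF \<Phi>lin that] .
  note l = l linear_map_compose[OF \<Phi>lin] \<Phi>cl
  have "sw H x (\<lambda>a b. trace_integral I e \<xi> f b \<bullet> a) = sw H x (\<lambda>a b. \<Oplus>\<^bsub>H\<^esub>i\<in>I. conv (\<xi> i) f (b \<cdot> ?S (?S (e i))) \<bullet> a)"
    unfolding trace_integral_def using x
    by (intro sw_cong linear_map_finsum[OF _ _ sc]) (assumption | rule l hcl Pi_I A.finsum_closed)+
  also have "\<dots> = (\<Oplus>\<^bsub>H\<^esub>i\<in>I. sw H x (\<lambda>a b. conv (\<xi> i) f (b \<cdot> ?S (?S (e i))) \<bullet> a))"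
    using x by (intro sw_finsum) (assumption | rule l hcl d(1))+
  also have "\<dots> = (\<Oplus>\<^bsub>H\<^esub>i\<in>I. sw H (e i) (\<lambda>c d. sw H (x \<cdot> ?S (?S d)) (\<lambda>p r. conv (\<xi> i) f r \<bullet> (p \<cdot> ?S c))))"
    using x by (intro A.finsum_cong' sw_antipode_shift[symmetric]) (assumption | rule l hcl hlin refl Pi_I)+
  also have "\<dots> = (\<Oplus>\<^bsub>H\<^esub>i\<in>I. sw H (e i) (\<lambda>c d. sw H (\<Phi> d) (\<lambda>p q. \<xi> i q \<bullet> (p \<cdot> ?S c))))"
  proof (intro A.finsum_cong' refl sw_cong module_H)
    fix i c d' assume *: "i \<in> I" "c \<in> carrier H" "d' \<in> carrier H"
    show "sw H (x \<cdot> ?S (?S d')) (\<lambda>p r. conv (\<xi> i) f r \<bullet> (p \<cdot> ?S c)) =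
      sw H (\<Phi> d') (\<lambda>p q. \<xi> i q \<bullet> (p \<cdot> ?S c))"
      unfolding \<Phi>_def
    proof (subst sw_of_sw[OF module_H _ f], goal_cases)
      case 3
      show ?case
      proof (intro sw_cong)
        fix p r assume pr: "p \<in> carrier H" "r \<in> carrier H"
        have "conv (\<xi> i) f r \<bullet> (p \<cdot> ?S c) = sw H r (\<lambda>a b. (\<xi> i a \<otimes> f b) \<bullet> (p \<cdot> ?S c))"
          unfolding conv_def using pr * by (intro sw_hom[OF sc]) (assumption | rule l)+
        also have "\<dots> = sw H r (\<lambda>q q'. f q' \<bullet> (\<xi> i q \<bullet> (p \<cdot> ?S c)))"
          using pr * by (intro sw_cong) (assumption | rule l | simp add: smult_assoc1[symmetric] K.m_comm fcl d)+
        finally show "conv (\<xi> i) f r \<bullet> (p \<cdot> ?S c) = sw H r (\<lambda>q q'. f q' \<bullet> (\<xi> i q \<bullet> (p \<cdot> ?S c)))" .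
      qed (insert x *, (assumption | rule l)+)
    qed (insert x *, (assumption | rule l)+)
  qed (insert x, (assumption | rule l Pi_I)+)
  \<comment> \<open>A second index \<open>j\<close> now carries the trace, which frees the index
    \<open>i\<close> for contraction.\<close>
  also have "\<dots> = (\<Oplus>\<^bsub>H\<^esub>i\<in>I. sw H (e i) (\<lambda>c d. \<Oplus>\<^bsub>H\<^esub>j\<in>I. \<xi> j d \<bullet> sw H (\<Phi> (e j)) (\<lambda>p q. \<xi> i q \<bullet> (p \<cdot> ?S c))))"
  proof (intro A.finsum_cong' refl sw_cong module_H)
    fix i c d' assume *: "i \<in> I" "c \<in> carrier H" "d' \<in> carrier H"
    show "sw H (\<Phi> d') (\<lambda>p q. \<xi> i q \<bullet> (p \<cdot> ?S c)) =
      (\<Oplus>\<^bsub>H\<^esub>j\<in>I. \<xi> j d' \<bullet> sw H (\<Phi> (e j)) (\<lambda>p q. \<xi> i q \<bullet> (p \<cdot> ?S c)))"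
      using * by (intro K.dual_basis_expand[OF _ _ db, where L = "\<lambda>d. sw H (\<Phi> d) (\<lambda>p q. \<xi> i q \<bullet> (p \<cdot> ?S c))", symmetric])
        (assumption | rule l)+
  qed (assumption | rule l Pi_I A.finsum_closed)+
  also have "\<dots> = (\<Oplus>\<^bsub>H\<^esub>i\<in>I. \<Oplus>\<^bsub>H\<^esub>j\<in>I. sw H (e i) (\<lambda>c d. \<xi> j d \<bullet> sw H (\<Phi> (e j)) (\<lambda>p q. \<xi> i q \<bullet> (p \<cdot> ?S c))))"
    by (intro A.finsum_cong' refl sw_finsum) (assumption | rule l Pi_I A.finsum_closed d(1))+
  also have "\<dots> = (\<Oplus>\<^bsub>H\<^esub>j\<in>I. \<Oplus>\<^bsub>H\<^esub>i\<in>I. sw H (e i) (\<lambda>c d. \<xi> j d \<bullet> sw H (\<Phi> (e j)) (\<lambda>p q. \<xi> i q \<bullet> (p \<cdot> ?S c))))"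
    by (intro A.finsum_swap) (assumption | rule l d(1))+
  also have "\<dots> = (\<Oplus>\<^bsub>H\<^esub>j\<in>I. \<Oplus>\<^bsub>H\<^esub>i\<in>I. sw H (\<Phi> (e j)) (\<lambda>p q. \<xi> i q \<bullet> sw H (e i) (\<lambda>c d. \<xi> j d \<bullet> (p \<cdot> ?S c))))"
  proof (intro A.finsum_cong' refl)
    fix i j assume ij: "i \<in> I" "j \<in> I"
    have "sw H (e i) (\<lambda>c d. \<xi> j d \<bullet> sw H (\<Phi> (e j)) (\<lambda>p q. \<xi> i q \<bullet> (p \<cdot> ?S c)))
      = sw H (e i) (\<lambda>c d. sw H (\<Phi> (e j)) (\<lambda>p q. \<xi> j d \<bullet> (\<xi> i q \<bullet> (p \<cdot> ?S c))))"
    proof (intro sw_cong module_H)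
      fix c d' assume *: "c \<in> carrier H" "d' \<in> carrier H"
      show "\<xi> j d' \<bullet> sw H (\<Phi> (e j)) (\<lambda>p q. \<xi> i q \<bullet> (p \<cdot> ?S c)) =
        sw H (\<Phi> (e j)) (\<lambda>p q. \<xi> j d' \<bullet> (\<xi> i q \<bullet> (p \<cdot> ?S c)))"
        using ij * by (intro sw_hom[where L = "\<lambda>z. \<xi> j d' \<bullet> z"]) (assumption | rule l)+
    qed (insert ij, (assumption | rule l)+)
    also have "\<dots> = sw H (\<Phi> (e j)) (\<lambda>p q. sw H (e i) (\<lambda>c d. \<xi> j d \<bullet> (\<xi> i q \<bullet> (p \<cdot> ?S c))))"
      using ij by (intro sw_swap) (assumption | rule l)+
    also have "\<dots> = sw H (\<Phi> (e j)) (\<lambda>p q. \<xi> i q \<bullet> sw H (e i) (\<lambda>c d. \<xi> j d \<bullet> (p \<cdot> ?S c)))"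
    proof (intro sw_cong module_H)
      fix p q assume *: "p \<in> carrier H" "q \<in> carrier H"
      have "\<xi> i q \<bullet> sw H (e i) (\<lambda>c d. \<xi> j d \<bullet> (p \<cdot> ?S c)) =
        sw H (e i) (\<lambda>c d. \<xi> i q \<bullet> (\<xi> j d \<bullet> (p \<cdot> ?S c)))"
        using ij * by (intro sw_hom[where L = "\<lambda>z. \<xi> i q \<bullet> z"]) (assumption | rule l)+
      also have "\<dots> = sw H (e i) (\<lambda>c d. \<xi> j d \<bullet> (\<xi> i q \<bullet> (p \<cdot> ?S c)))"
        using ij * by (intro sw_cong) (assumption | rule l | simp add: smult_assoc1[symmetric] K.m_comm d)+
      finally show "sw H (e i) (\<lambda>c d. \<xi> j d \<bullet> (\<xi> i q \<bullet> (p \<cdot> ?S c))) =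
        \<xi> i q \<bullet> sw H (e i) (\<lambda>c d. \<xi> j d \<bullet> (p \<cdot> ?S c))" by simp
    qed (insert ij, (assumption | rule l)+)
    finally show "sw H (e i) (\<lambda>c d. \<xi> j d \<bullet> sw H (\<Phi> (e j)) (\<lambda>p q. \<xi> i q \<bullet> (p \<cdot> ?S c)))
      = sw H (\<Phi> (e j)) (\<lambda>p q. \<xi> i q \<bullet> sw H (e i) (\<lambda>c d. \<xi> j d \<bullet> (p \<cdot> ?S c)))" .
  qed (assumption | rule l Pi_I A.finsum_closed)+
  also have "\<dots> = (\<Oplus>\<^bsub>H\<^esub>j\<in>I. sw H (\<Phi> (e j)) (\<lambda>p q. \<Oplus>\<^bsub>H\<^esub>i\<in>I. \<xi> i q \<bullet> sw H (e i) (\<lambda>c d. \<xi> j d \<bullet> (p \<cdot> ?S c))))"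
    by (intro A.finsum_cong' refl sw_finsum[symmetric]) (assumption | rule l Pi_I A.finsum_closed d(1))+
  \<comment> \<open>The index \<open>i\<close> is contracted: the coproduct of \<open>e i\<close>
    becomes that of the second leg of \<Phi>(e j).\<close>
  also have "\<dots> = (\<Oplus>\<^bsub>H\<^esub>j\<in>I. sw H (\<Phi> (e j)) (\<lambda>p q. sw H q (\<lambda>c d. \<xi> j d \<bullet> (p \<cdot> ?S c))))"
  proof (intro A.finsum_cong' refl sw_cong module_H)
    fix j p q assume *: "j \<in> I" "p \<in> carrier H" "q \<in> carrier H"
    show "(\<Oplus>\<^bsub>H\<^esub>i\<in>I. \<xi> i q \<bullet> sw H (e i) (\<lambda>c d. \<xi> j d \<bullet> (p \<cdot> ?S c))) =
      sw H q (\<lambda>c d. \<xi> j d \<bullet> (p \<cdot> ?S c))"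
      using * by (intro K.dual_basis_expand[OF _ _ db, where L = "\<lambda>z. sw H z (\<lambda>c d. \<xi> j d \<bullet> (p \<cdot> ?S c))"])
        (assumption | rule l)+
  qed (assumption | rule l Pi_I)+
  also have "\<dots> = (\<Oplus>\<^bsub>H\<^esub>j\<in>I. sw H (\<Phi> (e j)) (\<lambda>q d. sw H q (\<lambda>p c. \<xi> j d \<bullet> (p \<cdot> ?S c))))"
    by (intro A.finsum_cong' refl sw_coassoc[symmetric]) (assumption | rule l Pi_I)+
  also have "\<dots> = (\<Oplus>\<^bsub>H\<^esub>j\<in>I. sw H (\<Phi> (e j)) (\<lambda>q d. counit H q \<bullet> (\<xi> j d \<bullet> \<one>\<^bsub>H\<^esub>)))"
  proof (intro A.finsum_cong' refl sw_cong module_H)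
    fix j q d' assume *: "j \<in> I" "q \<in> carrier H" "d' \<in> carrier H"
    show "sw H q (\<lambda>p c. \<xi> j d' \<bullet> (p \<cdot> ?S c)) = counit H q \<bullet> (\<xi> j d' \<bullet> \<one>\<^bsub>H\<^esub>)"
      using * by (intro sw_antipode_right[where f = "\<lambda>z. \<xi> j d' \<bullet> z"]) (assumption | rule l)+
  qed (assumption | rule l Pi_I)+
  also have "\<dots> = (\<Oplus>\<^bsub>H\<^esub>j\<in>I. \<xi> j (\<Phi> (e j)) \<bullet> \<one>\<^bsub>H\<^esub>)"
    by (intro A.finsum_cong' refl sw_counit_left) (assumption | rule l Pi_I)+
  also have "\<dots> = (\<Oplus>\<^bsub>H\<^esub>j\<in>I. conv (\<xi> j) f (x \<cdot> ?S (?S (e j))) \<bullet> \<one>\<^bsub>H\<^esub>)"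
  proof (intro A.finsum_cong' refl)
    fix j assume j: "j \<in> I"
    have "\<xi> j (\<Phi> (e j)) = sw KK (x \<cdot> ?S (?S (e j))) (\<lambda>p q. \<xi> j (f q \<bullet> p))"
      unfolding \<Phi>_def using j x by (intro sw_hom[OF d(3)]) (assumption | rule l)+
    also have "\<dots> = conv (\<xi> j) f (x \<cdot> ?S (?S (e j)))"
      unfolding conv_def using j x
      by (intro sw_cong) (assumption | rule l | simp add: linear_map_smult[OF d(3)] fcl d K.m_comm)+
    finally show "\<xi> j (\<Phi> (e j)) \<bullet> \<one>\<^bsub>H\<^esub> = conv (\<xi> j) f (x \<cdot> ?S (?S (e j))) \<bullet> \<one>\<^bsub>H\<^esub>" by simp
  qed (insert x, (assumption | rule l hcl Pi_I)+)
  also have "\<dots> = trace_integral I e \<xi> f x \<bullet> \<one>\<^bsub>H\<^esub>"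
    unfolding trace_integral_def using x
    by (intro linear_map_finsum[OF _ _ sc, symmetric]) (assumption | rule l hcl Pi_I)+
  finally show ?thesis .
qed

text \<open>The counit is the sum of translates of the integrals obtained from the dual basis.\<close>

lemma trace_integral_nonzero:
  assumes db: "dual_basis K H I e \<xi>"
  shows "\<exists>i\<in>I. trace_integral I e \<xi> (\<xi> i) (antipode H (e i)) \<noteq> \<zero>"
proof (rule ccontr)
  let ?S = "antipode H"
  note d = dual_basisD[OF db]
  interpret KK: module K KK by (rule K.module_ring_as_module)
  have \<xi>: "linear_map K V KK (\<lambda>v. \<xi> i (A v))" if "i \<in> I" "linear_map K V H A" for i A and V :: "('k, 'v, 'z) module_scheme"
    using linear_map_compose[OF d(3)] that by blast
  note l = lins \<xi> d(2) d(5)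
  assume "\<not> ?thesis"
  then have z: "trace_integral I e \<xi> (\<xi> i) (?S (e i)) = \<zero>" if "i \<in> I" for i using that by auto
  have g: "linear_map K H KK (conv (\<xi> j) (\<xi> i))" if "i \<in> I" "j \<in> I" for i j
    unfolding conv_def using that by - (assumption | rule l)+
  have gcl: "conv (\<xi> j) (\<xi> i) a \<in> carrier K" if "i \<in> I" "j \<in> I" "a \<in> carrier H" for i j a
    using linear_map_closed[OF g[OF that(1,2)] that(3)] by simp
  \<comment> \<open>The sum over \<open>i\<close> of the values assumed to be zero is evaluated and
    comes out as the counit at the unit, which is 1.\<close>
  have "\<zero>\<^bsub>KK\<^esub> = (\<Oplus>\<^bsub>KK\<^esub>i\<in>I. \<zero>\<^bsub>KK\<^esub>)" by simp
  also have "\<dots> = (\<Oplus>\<^bsub>KK\<^esub>i\<in>I. \<Oplus>\<^bsub>KK\<^esub>j\<in>I. conv (\<xi> j) (\<xi> i) (?S (?S (e j) \<cdot> e i)))"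
  proof (intro KK.M.finsum_cong' refl)
    fix i assume i: "i \<in> I"
    have "\<zero>\<^bsub>KK\<^esub> = (\<Oplus>\<^bsub>KK\<^esub>j\<in>I. conv (\<xi> j) (\<xi> i) (?S (e i) \<cdot> ?S (?S (e j))))"
      using z[OF i] by (simp add: trace_integral_def)
    also have "\<dots> = (\<Oplus>\<^bsub>KK\<^esub>j\<in>I. conv (\<xi> j) (\<xi> i) (?S (?S (e j) \<cdot> e i)))"
      using i by (intro KK.M.finsum_cong') (auto simp: antipode_mult d(2) gcl)
    finally show "\<zero>\<^bsub>KK\<^esub> = (\<Oplus>\<^bsub>KK\<^esub>j\<in>I. conv (\<xi> j) (\<xi> i) (?S (?S (e j) \<cdot> e i)))" .
  qed (assumption | rule l gcl Pi_I KK.M.finsum_closed)+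
  \<comment> \<open>A third copy of the basis detaches the argument S(S(e_j) e_i) from the
    convolution, so that \<open>i\<close> and \<open>j\<close> can be contracted against the
    coproduct of \<open>e k\<close>.\<close>
  also have "\<dots> = (\<Oplus>\<^bsub>KK\<^esub>i\<in>I. \<Oplus>\<^bsub>KK\<^esub>j\<in>I. \<Oplus>\<^bsub>KK\<^esub>k\<in>I. \<xi> k (?S (?S (e j) \<cdot> e i)) \<odot>\<^bsub>KK\<^esub> conv (\<xi> j) (\<xi> i) (e k))"
    by (intro KK.M.finsum_cong' refl K.dual_basis_expand[OF _ _ db g, symmetric])
      (assumption | rule l gcl Pi_I KK.M.finsum_closed)+
  also have "\<dots> = (\<Oplus>\<^bsub>KK\<^esub>i\<in>I. \<Oplus>\<^bsub>KK\<^esub>k\<in>I. \<Oplus>\<^bsub>KK\<^esub>j\<in>I. \<xi> k (?S (?S (e j) \<cdot> e i)) \<odot>\<^bsub>KK\<^esub> conv (\<xi> j) (\<xi> i) (e k))"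
    by (intro KK.M.finsum_cong' refl KK.M.finsum_swap)
      (assumption | rule l gcl Pi_I KK.M.finsum_closed d(1))+
  also have "\<dots> = (\<Oplus>\<^bsub>KK\<^esub>k\<in>I. \<Oplus>\<^bsub>KK\<^esub>i\<in>I. \<Oplus>\<^bsub>KK\<^esub>j\<in>I. \<xi> k (?S (?S (e j) \<cdot> e i)) \<odot>\<^bsub>KK\<^esub> conv (\<xi> j) (\<xi> i) (e k))"
    by (intro KK.M.finsum_swap) (assumption | rule l gcl Pi_I KK.M.finsum_closed d(1))+
  also have "\<dots> = (\<Oplus>\<^bsub>KK\<^esub>k\<in>I. \<Oplus>\<^bsub>KK\<^esub>i\<in>I. \<Oplus>\<^bsub>KK\<^esub>j\<in>I. sw KK (e k) (\<lambda>a b. \<xi> i b \<odot>\<^bsub>KK\<^esub> (\<xi> j a \<odot>\<^bsub>KK\<^esub> \<xi> k (?S (?S (e j) \<cdot> e i)))))"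
  proof (intro KK.M.finsum_cong' refl)
    fix i j k assume *: "i \<in> I" "j \<in> I" "k \<in> I"
    let ?c = "\<xi> k (?S (?S (e j) \<cdot> e i))"
    have "?c \<odot>\<^bsub>KK\<^esub> conv (\<xi> j) (\<xi> i) (e k) = sw KK (e k) (\<lambda>a b. ?c \<odot>\<^bsub>KK\<^esub> (\<xi> j a \<otimes> \<xi> i b))"
      unfolding conv_def using * by (intro sw_hom[where L = "\<lambda>z. ?c \<odot>\<^bsub>KK\<^esub> z"]) (assumption | rule l)+
    also have "\<dots> = sw KK (e k) (\<lambda>a b. \<xi> i b \<odot>\<^bsub>KK\<^esub> (\<xi> j a \<odot>\<^bsub>KK\<^esub> ?c))"
      using * by (intro sw_cong) (assumption | rule l | simp add: K.m_ac d)+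
    finally show "?c \<odot>\<^bsub>KK\<^esub> conv (\<xi> j) (\<xi> i) (e k) = sw KK (e k) (\<lambda>a b. \<xi> i b \<odot>\<^bsub>KK\<^esub> (\<xi> j a \<odot>\<^bsub>KK\<^esub> ?c))" .
  qed (assumption | rule l gcl Pi_I KK.M.finsum_closed d(1))+
  also have "\<dots> = (\<Oplus>\<^bsub>KK\<^esub>k\<in>I. sw KK (e k) (\<lambda>a b. \<Oplus>\<^bsub>KK\<^esub>i\<in>I. \<Oplus>\<^bsub>KK\<^esub>j\<in>I. \<xi> i b \<odot>\<^bsub>KK\<^esub> (\<xi> j a \<odot>\<^bsub>KK\<^esub> \<xi> k (?S (?S (e j) \<cdot> e i)))))"
  proof (intro KK.M.finsum_cong' refl)
    fix k assume k: "k \<in> I"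
    have "(\<Oplus>\<^bsub>KK\<^esub>i\<in>I. \<Oplus>\<^bsub>KK\<^esub>j\<in>I. sw KK (e k) (\<lambda>a b. \<xi> i b \<odot>\<^bsub>KK\<^esub> (\<xi> j a \<odot>\<^bsub>KK\<^esub> \<xi> k (?S (?S (e j) \<cdot> e i)))))
      = (\<Oplus>\<^bsub>KK\<^esub>i\<in>I. sw KK (e k) (\<lambda>a b. \<Oplus>\<^bsub>KK\<^esub>j\<in>I. \<xi> i b \<odot>\<^bsub>KK\<^esub> (\<xi> j a \<odot>\<^bsub>KK\<^esub> \<xi> k (?S (?S (e j) \<cdot> e i)))))"
      using k by (intro KK.M.finsum_cong' refl sw_finsum[symmetric]) (assumption | rule l Pi_I KK.M.finsum_closed d(1))+
    also have "\<dots> = sw KK (e k) (\<lambda>a b. \<Oplus>\<^bsub>KK\<^esub>i\<in>I. \<Oplus>\<^bsub>KK\<^esub>j\<in>I. \<xi> i b \<odot>\<^bsub>KK\<^esub> (\<xi> j a \<odot>\<^bsub>KK\<^esub> \<xi> k (?S (?S (e j) \<cdot> e i))))"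
      using k by (intro sw_finsum[symmetric]) (assumption | rule l Pi_I KK.M.finsum_closed d(1))+
    finally show "(\<Oplus>\<^bsub>KK\<^esub>i\<in>I. \<Oplus>\<^bsub>KK\<^esub>j\<in>I. sw KK (e k) (\<lambda>a b. \<xi> i b \<odot>\<^bsub>KK\<^esub> (\<xi> j a \<odot>\<^bsub>KK\<^esub> \<xi> k (?S (?S (e j) \<cdot> e i)))))
      = sw KK (e k) (\<lambda>a b. \<Oplus>\<^bsub>KK\<^esub>i\<in>I. \<Oplus>\<^bsub>KK\<^esub>j\<in>I. \<xi> i b \<odot>\<^bsub>KK\<^esub> (\<xi> j a \<odot>\<^bsub>KK\<^esub> \<xi> k (?S (?S (e j) \<cdot> e i))))" .
  qed (assumption | rule l Pi_I KK.M.finsum_closed d(1))+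
  also have "\<dots> = (\<Oplus>\<^bsub>KK\<^esub>k\<in>I. sw KK (e k) (\<lambda>a b. \<xi> k (?S (?S a \<cdot> b))))"
  proof (intro KK.M.finsum_cong' refl sw_cong)
    fix k a b assume *: "k \<in> I" "a \<in> carrier H" "b \<in> carrier H"
    have "(\<Oplus>\<^bsub>KK\<^esub>i\<in>I. \<Oplus>\<^bsub>KK\<^esub>j\<in>I. \<xi> i b \<odot>\<^bsub>KK\<^esub> (\<xi> j a \<odot>\<^bsub>KK\<^esub> \<xi> k (?S (?S (e j) \<cdot> e i)))) =
      (\<Oplus>\<^bsub>KK\<^esub>i\<in>I. \<xi> i b \<odot>\<^bsub>KK\<^esub> (\<Oplus>\<^bsub>KK\<^esub>j\<in>I. \<xi> j a \<odot>\<^bsub>KK\<^esub> \<xi> k (?S (?S (e j) \<cdot> e i))))"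
      using * by (intro KK.M.finsum_cong' refl KK.finsum_smult_ldistr[symmetric]) (assumption | rule l Pi_I KK.M.finsum_closed d(1))+
    also have "\<dots> = (\<Oplus>\<^bsub>KK\<^esub>i\<in>I. \<xi> i b \<odot>\<^bsub>KK\<^esub> \<xi> k (?S (?S a \<cdot> e i)))"
    proof (intro KK.M.finsum_cong' refl arg_cong2[where f = "smult KK"])
      fix i assume i: "i \<in> I"
      show "(\<Oplus>\<^bsub>KK\<^esub>j\<in>I. \<xi> j a \<odot>\<^bsub>KK\<^esub> \<xi> k (?S (?S (e j) \<cdot> e i))) = \<xi> k (?S (?S a \<cdot> e i))"
        using i * by (intro K.dual_basis_expand[OF _ _ db, where L = "\<lambda>z. \<xi> k (?S (?S z \<cdot> e i))"]) (assumption | rule l)+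
    qed (insert *, (assumption | rule l Pi_I)+)
    also have "\<dots> = \<xi> k (?S (?S a \<cdot> b))"
      using * by (intro K.dual_basis_expand[OF _ _ db, where L = "\<lambda>z. \<xi> k (?S (?S a \<cdot> z))"]) (assumption | rule l)+
    finally show "(\<Oplus>\<^bsub>KK\<^esub>i\<in>I. \<Oplus>\<^bsub>KK\<^esub>j\<in>I. \<xi> i b \<odot>\<^bsub>KK\<^esub> (\<xi> j a \<odot>\<^bsub>KK\<^esub> \<xi> k (?S (?S (e j) \<cdot> e i)))) = \<xi> k (?S (?S a \<cdot> b))" .
  qed (assumption | rule l Pi_I)+
  also have "\<dots> = (\<Oplus>\<^bsub>KK\<^esub>k\<in>I. counit H (e k) \<odot>\<^bsub>KK\<^esub> \<xi> k (?S \<one>\<^bsub>H\<^esub>))"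
  proof (intro KK.M.finsum_cong' refl)
    fix k assume k: "k \<in> I"
    show "sw KK (e k) (\<lambda>a b. \<xi> k (?S (?S a \<cdot> b))) = counit H (e k) \<odot>\<^bsub>KK\<^esub> \<xi> k (?S \<one>\<^bsub>H\<^esub>)"
      using k by (intro sw_antipode_left[where f = "\<lambda>z. \<xi> k (?S z)"]) (assumption | rule l)+
  qed (assumption | rule l Pi_I)+
  also have "\<dots> = (\<Oplus>\<^bsub>KK\<^esub>k\<in>I. \<xi> k \<one>\<^bsub>H\<^esub> \<odot>\<^bsub>KK\<^esub> counit H (e k))"
    by (intro KK.M.finsum_cong') (auto simp: K.m_comm d)
  also have "\<dots> = counit H \<one>\<^bsub>H\<^esub>"
    by (intro K.dual_basis_expand[OF _ _ db counit_linear]) auto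
  finally show False by (simp add: counit_one)
qed

end

section \<open>The antipode of a finite-dimensional Hopf algebra\<close>

locale finite_hopf_algebra = hopf_algebra K H
  for K :: "('k, 'r) ring_scheme" (structure) and H :: "('k, 'h, 'y) hopf_scheme" (structure) +
  assumes fin_dim: "fin_dim K H"
begin

lemma antipode_bij: "bij_betw (antipode H) (carrier H) (carrier H)"
proof -
  obtain B \<xi> where db: "dual_basis K H B (\<lambda>b. b) \<xi>"
    by (rule fin_dim_basis[OF K.field_axioms module_H fin_dim])
  note \<xi> = dual_basisD[OF db]
  obtain b where b: "b \<in> B" "trace_integral B (\<lambda>b. b) \<xi> (\<xi> b) (antipode H b) \<noteq> \<zero>"
    using trace_integral_nonzero[OF db] by blast
  have inj0: "h = \<zero>\<^bsub>H\<^esub>" if "h \<in> carrier H" "antipode H h = \<zero>\<^bsub>H\<^esub>" for h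
    by (rule antipode_inj_of_integral[OF db trace_integral_linear[OF db] trace_integral_invariant[OF db] _ b(2) that])
      (simp_all add: \<xi> b(1))
  have "antipode H ` carrier H = carrier H"
    by (rule injective_imp_surjective[OF K.field_axioms module_H fin_dim antipode_linear]) (rule inj0)
  moreover have "inj_on (antipode H) (carrier H)"
  proof (rule inj_onI)
    fix g h assume gh: "g \<in> carrier H" "h \<in> carrier H" "antipode H g = antipode H h"
    have "antipode H (g \<ominus>\<^bsub>H\<^esub> h) = \<zero>\<^bsub>H\<^esub>"
      using gh linear_map_minus[OF module_H module_H antipode_linear gh(1,2)] by (simp add: A.r_neg a_minus_def)
    with inj0 have 0: "g \<ominus>\<^bsub>H\<^esub> h = \<zero>\<^bsub>H\<^esub>" by (meson A.minus_closed gh(1,2))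
    have "g = g \<ominus>\<^bsub>H\<^esub> h \<oplus>\<^bsub>H\<^esub> h" using gh(1,2) by (simp add: a_minus_def A.a_assoc A.l_neg)
    then show "g = h" unfolding 0 using gh(2) by simp
  qed
  ultimately show ?thesis by (simp add: bij_betw_def)
qed

end

section \<open>Fourfold tensor products\<close>

definition quadrilinear_map where
  "quadrilinear_map K U V W Z X f \<longleftrightarrow>
    (\<forall>v\<in>carrier V. \<forall>w\<in>carrier W. \<forall>z\<in>carrier Z. linear_map K U X (\<lambda>u. f u v w z)) \<and>
    (\<forall>u\<in>carrier U. trilinear_map K V W Z X (f u))"

lemma quadrilinear_mapI:
  assumes "\<And>v w z. \<lbrakk>v \<in> carrier V; w \<in> carrier W; z \<in> carrier Z\<rbrakk> \<Longrightarrow> linear_map K U X (\<lambda>u. f u v w z)"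
    and "\<And>u. u \<in> carrier U \<Longrightarrow> trilinear_map K V W Z X (f u)"
  shows "quadrilinear_map K U V W Z X f"
  using assms by (auto simp: quadrilinear_map_def)

context cring
begin

abbreviation (input) tensor_lift3 where
  "tensor_lift3 X f t \<equiv> tensor_lift R X (\<lambda>v t'. tensor_lift R X (f v) t') t"

lemma bilinear_map_tensor_lift:
  assumes "module R V" "module R W" "module R Z" "module R X" "trilinear_map R V W Z X f"
  shows "bilinear_map R V (tensor_module R W Z) X (\<lambda>v t. tensor_lift R X (f v) t)"
proof (rule bilinear_mapI)
  show "linear_map R (tensor_module R W Z) X (\<lambda>t. tensor_lift R X (f v) t)" if "v \<in> carrier V" for v
    using assms that by (intro linear_map_tensor_lift) (auto simp: trilinear_map_def)
  show "linear_map R V X (\<lambda>v. tensor_lift R X (f v) t)" if "t \<in> carrier (tensor_module R W Z)" for t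
    using assms that by (intro linear_map_tensor_lift_param[of W Z]) (auto simp: trilinear_map_def)
qed

lemma linear_map_tensor_lift3:
  assumes "module R V" "module R W" "module R Z" "module R X" "trilinear_map R V W Z X f"
  shows "linear_map R (tensor_module3 R V W Z) X (tensor_lift3 X f)"
  by (intro linear_map_tensor_lift bilinear_map_tensor_lift module_tensor_module assms)

lemma tensor_lift3_tens:
  assumes "module R V" "module R W" "module R Z" "module R X" "trilinear_map R V W Z X f"
    and "v \<in> carrier V" "w \<in> carrier W" "z \<in> carrier Z"
  shows "tensor_lift3 X f (tens3 R V W Z v w z) = f v w z"
proof -
  have "tensor_lift3 X f (tens3 R V W Z v w z) = tensor_lift R X (f v) (tens R W Z w z)"
    by (intro tensor_lift_tens bilinear_map_tensor_lift module_tensor_module tens_closed assms)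
  also have "\<dots> = f v w z"
    using assms(5,6) by (intro tensor_lift_tens assms) (auto simp: trilinear_map_def)
  finally show ?thesis .
qed

text \<open>With the first leg fixed, both maps become linear maps on the tensor product of the
  remaining legs, so pure tensors are reached one leg at a time.\<close>

lemma tensor3_map_eqI:
  assumes "module R V" "module R W" "module R Z" "module R X" "t \<in> carrier (tensor_module3 R V W Z)"
    and L: "linear_map R (tensor_module3 R V W Z) X L" "linear_map R (tensor_module3 R V W Z) X L'"
    and eq: "\<And>v w z. \<lbrakk>v \<in> carrier V; w \<in> carrier W; z \<in> carrier Z\<rbrakk>
      \<Longrightarrow> L (tens3 R V W Z v w z) = L' (tens3 R V W Z v w z)"
  shows "L t = L' t"
proof (rule tensor_map_eqI[OF _ _ _ assms(5) L])
  fix v u assume v: "v \<in> carrier V" and u: "u \<in> carrier (tensor_module R W Z)"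
  have b: "linear_map R (tensor_module R W Z) (tensor_module3 R V W Z) (tens R V (tensor_module R W Z) v)"
    using assms(1-3) v by (intro bilinear_map_right[OF bilinear_map_tens]) auto
  show "L (tens R V (tensor_module R W Z) v u) = L' (tens R V (tensor_module R W Z) v u)"
    using v by (intro tensor_map_eqI[OF assms(2,3,4) u linear_map_compose[OF L(1) b] linear_map_compose[OF L(2) b]] eq)
qed (use assms in auto)

lemma tensor4_map_eqI:
  assumes "module R U" "module R V" "module R W" "module R Z" "module R X"
    and t: "t \<in> carrier (tensor_module4 R U V W Z)"
    and L: "linear_map R (tensor_module4 R U V W Z) X L" "linear_map R (tensor_module4 R U V W Z) X L'"
    and eq: "\<And>u v w z. \<lbrakk>u \<in> carrier U; v \<in> carrier V; w \<in> carrier W; z \<in> carrier Z\<rbrakk>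
      \<Longrightarrow> L (tens4 R U V W Z u v w z) = L' (tens4 R U V W Z u v w z)"
  shows "L t = L' t"
proof (rule tensor_map_eqI[OF _ _ _ t L])
  fix v u assume v: "v \<in> carrier U" and u: "u \<in> carrier (tensor_module3 R V W Z)"
  have b: "linear_map R (tensor_module3 R V W Z) (tensor_module4 R U V W Z) (tens R U (tensor_module3 R V W Z) v)"
    using assms(1-4) v by (intro bilinear_map_right[OF bilinear_map_tens]) auto
  show "L (tens R U (tensor_module3 R V W Z) v u) = L' (tens R U (tensor_module3 R V W Z) v u)"
    using v
    by (intro tensor3_map_eqI[OF assms(2-5) u linear_map_compose[OF L(1) b] linear_map_compose[OF L(2) b]] eq)
qed (use assms in auto)

lemma bilinear_map_tensor_lift3:
  assumes "module R U" "module R V" "module R W" "module R Z" "module R X" "quadrilinear_map R U V W Z X f"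
  shows "bilinear_map R U (tensor_module3 R V W Z) X (\<lambda>u t. tensor_lift3 X (f u) t)"
  using assms unfolding quadrilinear_map_def
  by (intro bilinear_mapI linear_map_tensor_lift3 linear_map_tensor_lift_param[of V "tensor_module R W Z"]
      linear_map_tensor_lift_param[of W Z]) auto

lemma linear_map_tensor_lift4:
  assumes "module R U" "module R V" "module R W" "module R Z" "module R X" "quadrilinear_map R U V W Z X f"
  shows "linear_map R (tensor_module4 R U V W Z) X (\<lambda>t. tensor_lift4 R X f t)"
  by (intro linear_map_tensor_lift bilinear_map_tensor_lift3 module_tensor_module assms)

lemma tensor_lift4_tens:
  assumes "module R U" "module R V" "module R W" "module R Z" "module R X" "quadrilinear_map R U V W Z X f"
    and "u \<in> carrier U" "v \<in> carrier V" "w \<in> carrier W" "z \<in> carrier Z"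
  shows "tensor_lift4 R X f (tens4 R U V W Z u v w z) = f u v w z"
proof -
  have "tensor_lift4 R X f (tens4 R U V W Z u v w z) = tensor_lift3 X (f u) (tens3 R V W Z v w z)"
    by (intro tensor_lift_tens bilinear_map_tensor_lift3 module_tensor_module tens_closed assms)
  also have "\<dots> = f u v w z"
    using assms(6,7) by (intro tensor_lift3_tens assms) (auto simp: quadrilinear_map_def)
  finally show ?thesis .
qed

lemma linear_map_tensor_lift4_param:
  assumes "module R U" "module R V" "module R W" "module R Z" "module R X" "t \<in> carrier (tensor_module4 R U V W Z)"
    and "\<And>u v w z. \<lbrakk>u \<in> carrier U; v \<in> carrier V; w \<in> carrier W; z \<in> carrier Z\<rbrakk> \<Longrightarrow> linear_map R Y X (\<lambda>y. f y u v w z)"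
  shows "linear_map R Y X (\<lambda>y. tensor_lift4 R X (f y) t)"
  using assms
  by (intro linear_map_tensor_lift_param[of U "tensor_module3 R V W Z"]
      linear_map_tensor_lift_param[of V "tensor_module R W Z"] linear_map_tensor_lift_param[of W Z]) auto

end

section \<open>The algebra \<open>T\<close>\<close>

context hopf_algebra
begin

abbreviation "Hd \<equiv> dual K H"

abbreviation mult_dual (infixl "\<star>" 70) where "\<alpha> \<star> \<beta> \<equiv> \<alpha> \<otimes>\<^bsub>Hd\<^esub> \<beta>"

lemma dual_simps [simp]:
  "add Hd = (\<lambda>\<alpha> \<beta>. \<lambda>h\<in>carrier H. \<alpha> h \<oplus> \<beta> h)" "zero Hd = (\<lambda>h\<in>carrier H. \<zero>)"
  "smult Hd = (\<lambda>a \<alpha>. \<lambda>h\<in>carrier H. a \<otimes> \<alpha> h)" "one Hd = (\<lambda>h\<in>carrier H. counit H h)"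
  by (simp_all add: dual_def)

lemma dual_mult: "h \<in> carrier H \<Longrightarrow> (\<alpha> \<star> \<beta>) h = sw KK h (\<lambda>a b. \<alpha> a \<otimes> \<beta> b)"
  by (simp add: dual_def)

lemma dualD: "\<alpha> \<in> carrier Hd \<Longrightarrow> linear_map K H KK \<alpha>" "\<alpha> \<in> carrier Hd \<Longrightarrow> \<alpha> \<in> extensional (carrier H)"
  by (simp_all add: dual_def)

lemma dual_app_closed: "\<alpha> \<in> carrier Hd \<Longrightarrow> h \<in> carrier H \<Longrightarrow> \<alpha> h \<in> carrier K"
  using linear_map_closed[OF dualD(1)] by fastforce

lemma dual_eqI:
  "\<lbrakk>\<alpha> \<in> carrier Hd; \<beta> \<in> carrier Hd; \<And>h. h \<in> carrier H \<Longrightarrow> \<alpha> h = \<beta> h\<rbrakk> \<Longrightarrow> \<alpha> = \<beta>"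
  by (rule extensionalityI[OF dualD(2) dualD(2)])

lemma restrict_in_dual: "linear_map K H KK f \<Longrightarrow> (\<lambda>h\<in>carrier H. f h) \<in> carrier Hd"
  using linear_map_cong[of K H f "\<lambda>h\<in>carrier H. f h" KK] by (simp add: dual_def)

lemma module_dual [simp, intro]: "module K Hd"
proof (rule moduleI)
  show "cring K" by (rule K.is_cring)
  show "abelian_group Hd"
  proof (rule abelian_groupI)
    fix \<alpha> assume \<alpha>: "\<alpha> \<in> carrier Hd"
    note c = dual_app_closed[OF \<alpha>]
    have "linear_map K H KK (\<lambda>h. \<ominus> \<one> \<otimes> \<alpha> h)"
      by (rule lin_kmult_right[OF dualD(1)[OF \<alpha>]]) simp
    then show "\<exists>\<beta>\<in>carrier Hd. \<beta> \<oplus>\<^bsub>Hd\<^esub> \<alpha> = \<zero>\<^bsub>Hd\<^esub>"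
      using c by (intro bexI[of _ "\<lambda>h\<in>carrier H. \<ominus> \<one> \<otimes> \<alpha> h"] restrict_in_dual)
        (auto simp: K.l_minus K.l_neg intro!: restrict_ext)
  next
    fix \<alpha> \<beta> assume ab: "\<alpha> \<in> carrier Hd" "\<beta> \<in> carrier Hd"
    show "\<alpha> \<oplus>\<^bsub>Hd\<^esub> \<beta> \<in> carrier Hd"
      using linear_map_add_fun[OF K.module_ring_as_module dualD(1)[OF ab(1)] dualD(1)[OF ab(2)]]
      by (auto intro!: restrict_in_dual)
    show "\<alpha> \<oplus>\<^bsub>Hd\<^esub> \<beta> = \<beta> \<oplus>\<^bsub>Hd\<^esub> \<alpha>"
      using ab by (auto simp: K.a_comm dual_app_closed intro!: restrict_ext)
  next
    show "\<zero>\<^bsub>Hd\<^esub> \<in> carrier Hd"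
      using restrict_in_dual[OF linear_map_zero_fun[OF K.module_ring_as_module]] by simp
  next
    fix \<alpha> assume a: "\<alpha> \<in> carrier Hd"
    show "\<zero>\<^bsub>Hd\<^esub> \<oplus>\<^bsub>Hd\<^esub> \<alpha> = \<alpha>"
      using a dualD(2)[OF a] by (auto simp: dual_app_closed extensional_def restrict_def fun_eq_iff)
  qed (auto simp: K.a_assoc dual_app_closed intro!: restrict_ext)
  show "a \<odot>\<^bsub>Hd\<^esub> \<alpha> \<in> carrier Hd" if "a \<in> carrier K" "\<alpha> \<in> carrier Hd" for a \<alpha>
    using lin_kmult_right[OF dualD(1)[OF that(2)] that(1)] by (auto intro!: restrict_in_dual)
  show "\<one> \<odot>\<^bsub>Hd\<^esub> \<alpha> = \<alpha>" if a: "\<alpha> \<in> carrier Hd" for \<alpha>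
    using a dualD(2)[OF a] by (auto simp: dual_app_closed extensional_def restrict_def fun_eq_iff)
qed (auto simp: K.l_distr K.r_distr K.m_assoc dual_app_closed intro!: restrict_ext)

text \<open>Functionals are compared and combined pointwise, so a family of them is linear as soon
  as each of its evaluations is.\<close>

lemma lin_dualI:
  assumes "module K V" "\<And>v. v \<in> carrier V \<Longrightarrow> F v \<in> carrier Hd"
    and "\<And>h. h \<in> carrier H \<Longrightarrow> linear_map K V KK (\<lambda>v. F v h)"
  shows "linear_map K V Hd F"
proof -
  interpret V: module K V by fact
  interpret D: module K Hd by (rule module_dual)
  show ?thesis
  proof (rule linear_mapI)
    fix u v assume uv: "u \<in> carrier V" "v \<in> carrier V"
    show "F (u \<oplus>\<^bsub>V\<^esub> v) = F u \<oplus>\<^bsub>Hd\<^esub> F v"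
    proof (rule dual_eqI)
      show "F u \<oplus>\<^bsub>Hd\<^esub> F v \<in> carrier Hd" using uv assms(2) by (intro D.add.m_closed)
    qed (use uv assms(2) linear_map_add[OF assms(3) uv] in auto)
  next
    fix a v assume av: "a \<in> carrier K" "v \<in> carrier V"
    show "F (a \<odot>\<^bsub>V\<^esub> v) = a \<odot>\<^bsub>Hd\<^esub> F v"
    proof (rule dual_eqI)
      show "a \<odot>\<^bsub>Hd\<^esub> F v \<in> carrier Hd" using av assms(2) by (intro D.smult_closed)
    qed (use av assms(2) linear_map_smult[OF assms(3) av] in auto)
  qed (rule assms(2))
qed

lemma lin_app: "h \<in> carrier H \<Longrightarrow> linear_map K Hd KK (\<lambda>\<alpha>. \<alpha> h)"
  by (rule linear_mapI) (auto simp: dual_app_closed)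

lemma dual_one_closed: "\<one>\<^bsub>Hd\<^esub> \<in> carrier Hd"
  using restrict_in_dual[OF counit_linear] by simp

lemma dual_mult_closed: 
  assumes "\<alpha> \<in> carrier Hd" "\<beta> \<in> carrier Hd"
  shows "\<alpha> \<star> \<beta> \<in> carrier Hd"
proof -
  note l = lins linear_map_compose[OF dualD(1)[OF assms(1)]] linear_map_compose[OF dualD(1)[OF assms(2)]]
    dual_app_closed[OF assms(1)] dual_app_closed[OF assms(2)]
  have "linear_map K H KK (\<lambda>h. sw KK h (\<lambda>a b. \<alpha> a \<otimes> \<beta> b))"
    by (assumption | rule l)+
  then show ?thesis using restrict_in_dual by (simp add: dual_def)
qed

lemma lin_dmult_left:
  assumes "linear_map K V Hd A" "\<beta> \<in> carrier Hd" "module K V"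
  shows "linear_map K V Hd (\<lambda>v. A v \<star> \<beta>)"
proof (rule lin_dualI[OF assms(3)])
  show "A v \<star> \<beta> \<in> carrier Hd" if "v \<in> carrier V" for v
    using assms that by (intro dual_mult_closed linear_map_closed[OF assms(1)])
  fix h assume h: "h \<in> carrier H"
  have "linear_map K V KK (\<lambda>v. sw KK h (\<lambda>a b. A v a \<otimes> \<beta> b))"
    using h by (intro lin_sw_param lin_kmult_left linear_map_compose[OF lin_app assms(1)]
      dual_app_closed[OF assms(2)]) auto
  then show "linear_map K V KK (\<lambda>v. (A v \<star> \<beta>) h)" using h by (simp add: dual_mult)
qed

lemma lin_dmult_right:
  assumes "linear_map K V Hd A" "\<beta> \<in> carrier Hd" "module K V"
  shows "linear_map K V Hd (\<lambda>v. \<beta> \<star> A v)"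
proof (rule lin_dualI[OF assms(3)])
  show "\<beta> \<star> A v \<in> carrier Hd" if "v \<in> carrier V" for v
    using assms that by (intro dual_mult_closed linear_map_closed[OF assms(1)])
  fix h assume h: "h \<in> carrier H"
  have "linear_map K V KK (\<lambda>v. sw KK h (\<lambda>a b. \<beta> a \<otimes> A v b))"
    using h by (intro lin_sw_param lin_kmult_right linear_map_compose[OF lin_app assms(1)]
      dual_app_closed[OF assms(2)]) auto
  then show "linear_map K V KK (\<lambda>v. (\<beta> \<star> A v) h)" using h by (simp add: dual_mult)
qed

lemma dual_one_mult: "\<alpha> \<in> carrier Hd \<Longrightarrow> \<one>\<^bsub>Hd\<^esub> \<star> \<alpha> = \<alpha>"
  and dual_mult_one: "\<alpha> \<in> carrier Hd \<Longrightarrow> \<alpha> \<star> \<one>\<^bsub>Hd\<^esub> = \<alpha>"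
proof -
  assume a: "\<alpha> \<in> carrier Hd"
  have "(\<one>\<^bsub>Hd\<^esub> \<star> \<alpha>) h = \<alpha> h" if h: "h \<in> carrier H" for h
    using sw_counit_left[OF K.module_ring_as_module dualD(1)[OF a] h] sw_cong[OF K.module_ring_as_module h,
      of "\<lambda>x y. \<one>\<^bsub>Hd\<^esub> x \<otimes> \<alpha> y" "\<lambda>x y. counit H x \<odot>\<^bsub>KK\<^esub> \<alpha> y"] h a by (simp add: dual_mult dual_app_closed)
  then show "\<one>\<^bsub>Hd\<^esub> \<star> \<alpha> = \<alpha>"
    using a by (intro dual_eqI dual_mult_closed dual_one_closed)
  have "(\<alpha> \<star> \<one>\<^bsub>Hd\<^esub>) h = \<alpha> h" if h: "h \<in> carrier H" for h
    using sw_counit_right[OF K.module_ring_as_module dualD(1)[OF a] h] sw_cong[OF K.module_ring_as_module h,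
      of "\<lambda>x y. \<alpha> x \<otimes> \<one>\<^bsub>Hd\<^esub> y" "\<lambda>x y. counit H y \<odot>\<^bsub>KK\<^esub> \<alpha> x"] h a by (simp add: dual_mult dual_app_closed K.m_comm)
  then show "\<alpha> \<star> \<one>\<^bsub>Hd\<^esub> = \<alpha>"
    using a by (intro dual_eqI dual_mult_closed dual_one_closed)
qed

lemma dual_shift_app: "f \<in> carrier H \<Longrightarrow> dual_shift H \<alpha> x y f = \<alpha> (x \<cdot> f \<cdot> y)"
  by (simp add: dual_shift_def)

lemma dual_shift_closed:
  assumes "\<alpha> \<in> carrier Hd" "x \<in> carrier H" "y \<in> carrier H"
  shows "dual_shift H \<alpha> x y \<in> carrier Hd"
  unfolding dual_shift_def
  by (rule restrict_in_dual) (assumption | rule assms linear_map_compose[OF dualD(1)[OF assms(1)]] lins)+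

lemma lin_shift_1:
  assumes "linear_map K V Hd A" "x \<in> carrier H" "y \<in> carrier H" "module K V"
  shows "linear_map K V Hd (\<lambda>v. dual_shift H (A v) x y)"
proof (rule lin_dualI[OF assms(4)])
  show "dual_shift H (A v) x y \<in> carrier Hd" if "v \<in> carrier V" for v
    using assms that by (intro dual_shift_closed linear_map_closed[OF assms(1)])
  show "linear_map K V KK (\<lambda>v. dual_shift H (A v) x y h)" if "h \<in> carrier H" for h
    using that assms by (simp add: dual_shift_app linear_map_compose[OF lin_app assms(1)])
qed

lemma lin_shift_2:
  assumes "linear_map K V H A" "\<alpha> \<in> carrier Hd" "y \<in> carrier H" "module K V"
  shows "linear_map K V Hd (\<lambda>v. dual_shift H \<alpha> (A v) y)"
proof (rule lin_dualI[OF assms(4)])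
  show "dual_shift H \<alpha> (A v) y \<in> carrier Hd" if "v \<in> carrier V" for v
    using assms that by (intro dual_shift_closed linear_map_closed[OF assms(1)])
  fix h assume "h \<in> carrier H"
  then show "linear_map K V KK (\<lambda>v. dual_shift H \<alpha> (A v) y h)"
    using assms by (simp add: dual_shift_app)
      (intro linear_map_compose[OF dualD(1)] lin_mult_left; assumption)
qed

lemma lin_shift_3:
  assumes "linear_map K V H A" "\<alpha> \<in> carrier Hd" "x \<in> carrier H" "module K V"
  shows "linear_map K V Hd (\<lambda>v. dual_shift H \<alpha> x (A v))"
proof (rule lin_dualI[OF assms(4)])
  show "dual_shift H \<alpha> x (A v) \<in> carrier Hd" if "v \<in> carrier V" for v
    using assms that by (intro dual_shift_closed linear_map_closed[OF assms(1)])
  fix h assume "h \<in> carrier H"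
  then show "linear_map K V KK (\<lambda>v. dual_shift H \<alpha> x (A v) h)"
    using assms by (simp add: dual_shift_app)
      (intro linear_map_compose[OF dualD(1)] lin_mult_right A.m_closed; assumption)
qed

lemma dual_comp_closed:
  assumes "\<alpha> \<in> carrier Hd" "linear_map K H H s"
  shows "dual_comp H \<alpha> s \<in> carrier Hd"
  unfolding dual_comp_def
  by (rule restrict_in_dual) (rule linear_map_compose[OF dualD(1)[OF assms(1)] assms(2)])

lemma dual_comp_app: "f \<in> carrier H \<Longrightarrow> dual_comp H \<alpha> s f = \<alpha> (s f)"
  by (simp add: dual_comp_def)

lemma lin_dcomp:
  assumes "linear_map K V Hd A" "linear_map K H H s" "module K V"
  shows "linear_map K V Hd (\<lambda>v. dual_comp H (A v) s)"
proof (rule lin_dualI[OF assms(3)])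
  show "dual_comp H (A v) s \<in> carrier Hd" if "v \<in> carrier V" for v
    using assms that by (intro dual_comp_closed linear_map_closed[OF assms(1)])
  show "linear_map K V KK (\<lambda>v. dual_comp H (A v) s h)" if "h \<in> carrier H" for h
    using that assms
    by (simp add: dual_comp_app linear_map_compose[OF lin_app assms(1)] linear_map_closed[OF assms(2)])
qed

subsection \<open>Threefold Sweedler sums\<close>

abbreviation sw3 where "sw3 X h f \<equiv> sweedler3 K H X h f"

lemma sw3_closed:
  "\<lbrakk>module K X; h \<in> carrier H; \<And>a b c. \<lbrakk>a \<in> carrier H; b \<in> carrier H; c \<in> carrier H\<rbrakk> \<Longrightarrow> f a b c \<in> carrier X\<rbrakk>
    \<Longrightarrow> sw3 X h f \<in> carrier X"
  unfolding sweedler3_def by (intro sw_closed)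

lemma sw3_cong:
  assumes "module K X" "h \<in> carrier H"
    and "\<And>a b c. \<lbrakk>a \<in> carrier H; b \<in> carrier H; c \<in> carrier H\<rbrakk> \<Longrightarrow> f a b c = g a b c"
    and "\<And>a b c. \<lbrakk>a \<in> carrier H; b \<in> carrier H; c \<in> carrier H\<rbrakk> \<Longrightarrow> g a b c \<in> carrier X"
  shows "sw3 X h f = sw3 X h g"
  unfolding sweedler3_def using assms by (intro sw_cong sw_closed)

lemma sw3_hom:
  assumes L: "linear_map K X Y L" and m: "module K X" "module K Y" and h: "h \<in> carrier H"
    and f: "\<And>a b c. \<lbrakk>a \<in> carrier H; b \<in> carrier H; c \<in> carrier H\<rbrakk> \<Longrightarrow> f a b c \<in> carrier X"
  shows "L (sw3 X h f) = sw3 Y h (\<lambda>a b c. L (f a b c))"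
proof -
  have "L (sw3 X h f) = sw Y h (\<lambda>a c. L (sw X a (\<lambda>a b. f a b c)))"
    unfolding sweedler3_def using m h f by (intro sw_hom[OF L] sw_closed)
  also have "\<dots> = sw3 Y h (\<lambda>a b c. L (f a b c))"
    unfolding sweedler3_def using m h f by (intro sw_cong sw_hom[OF L] sw_closed linear_map_closed[OF L])
  finally show ?thesis .
qed

lemma lin_sw3:
  assumes "linear_map K V H A" "module K X" "trilinear_map K H H H X f"
  shows "linear_map K V X (\<lambda>v. sw3 X (A v) f)"
proof -
  note l = lins assms(2) trilinear_map_1[OF assms(3)] trilinear_map_2[OF assms(3)] trilinear_map_3[OF assms(3)]
  show ?thesis unfolding sweedler3_def
    by (intro lin_sw assms(1)) (assumption | rule l)+
qed

lemma lin_sw3_param: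
  assumes "module K X" "h \<in> carrier H"
    and "\<And>a b c. \<lbrakk>a \<in> carrier H; b \<in> carrier H; c \<in> carrier H\<rbrakk> \<Longrightarrow> linear_map K V X (\<lambda>v. f v a b c)"
  shows "linear_map K V X (\<lambda>v. sw3 X h (f v))"
  unfolding sweedler3_def using assms by (intro lin_sw_param)

lemma sw3_one:
  assumes "module K X" "trilinear_map K H H H X f"
  shows "sw3 X \<one>\<^bsub>H\<^esub> f = f \<one>\<^bsub>H\<^esub> \<one>\<^bsub>H\<^esub> \<one>\<^bsub>H\<^esub>"
proof -
  note l = lins assms(1) trilinear_map_1[OF assms(2)] trilinear_map_2[OF assms(2)] trilinear_map_3[OF assms(2)]
  have "sw3 X \<one>\<^bsub>H\<^esub> f = sw X \<one>\<^bsub>H\<^esub> (\<lambda>a b. f a b \<one>\<^bsub>H\<^esub>)"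
    unfolding sweedler3_def by (rule sw_one) (assumption | rule l)+
  also have "\<dots> = f \<one>\<^bsub>H\<^esub> \<one>\<^bsub>H\<^esub> \<one>\<^bsub>H\<^esub>"
    by (rule sw_one) (assumption | rule l)+
  finally show ?thesis .
qed

lemma sw3_counit:
  assumes "module K X" "linear_map K H X f" "h \<in> carrier H"
  shows "sw3 X h (\<lambda>a b c. counit H a \<odot>\<^bsub>X\<^esub> (counit H c \<odot>\<^bsub>X\<^esub> f b)) = f h"
proof -
  note l = lins assms linear_map_compose[OF assms(2)] linear_map_closed[OF assms(2)]
  have "sw3 X h (\<lambda>a b c. counit H a \<odot>\<^bsub>X\<^esub> (counit H c \<odot>\<^bsub>X\<^esub> f b)) = sw X h (\<lambda>a c. counit H c \<odot>\<^bsub>X\<^esub> f a)"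
    unfolding sweedler3_def by (intro sw_cong sw_counit_left) (assumption | rule l)+
  also have "\<dots> = f h" by (rule sw_counit_right) (assumption | rule l)+
  finally show ?thesis .
qed

end

context finite_hopf_algebra
begin

subsection \<open>The inverse of the antipode\<close>

lemma antipode_inv_closed: "h \<in> carrier H \<Longrightarrow> antipode_inv H h \<in> carrier H"
  and antipode_antipode_inv: "h \<in> carrier H \<Longrightarrow> antipode H (antipode_inv H h) = h"
  and antipode_inv_antipode: "h \<in> carrier H \<Longrightarrow> antipode_inv H (antipode H h) = h"
  using antipode_bij unfolding antipode_inv_def
  by (auto simp: bij_betw_def inv_into_into f_inv_into_f intro!: inv_into_f_f)

lemma antipode_inv_linear: "linear_map K H H (antipode_inv H)"
proof (rule linear_mapI)
  fix g h assume gh: "g \<in> carrier H" "h \<in> carrier H"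
  have "antipode H (antipode_inv H g \<oplus>\<^bsub>H\<^esub> antipode_inv H h) = g \<oplus>\<^bsub>H\<^esub> h"
    using gh by (simp add: linear_map_add[OF antipode_linear] antipode_inv_closed antipode_antipode_inv)
  then show "antipode_inv H (g \<oplus>\<^bsub>H\<^esub> h) = antipode_inv H g \<oplus>\<^bsub>H\<^esub> antipode_inv H h"
    using gh by (metis A.add.m_closed antipode_inv_antipode antipode_inv_closed)
next
  fix a h assume ah: "a \<in> carrier K" "h \<in> carrier H"
  have "antipode H (a \<bullet> antipode_inv H h) = a \<bullet> h"
    using ah by (simp add: linear_map_smult[OF antipode_linear] antipode_inv_closed antipode_antipode_inv)
  then show "antipode_inv H (a \<bullet> h) = a \<bullet> antipode_inv H h"
    using ah by (metis smult_closed antipode_inv_antipode antipode_inv_closed)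
qed (rule antipode_inv_closed)

lemma antipode_inv_one: "antipode_inv H \<one>\<^bsub>H\<^esub> = \<one>\<^bsub>H\<^esub>"
  using antipode_inv_antipode[OF A.one_closed] by simp

lemma counit_antipode_inv: "h \<in> carrier H \<Longrightarrow> counit H (antipode_inv H h) = counit H h"
  by (metis antipode_antipode_inv antipode_inv_closed counit_antipode)

lemma antipode_inv2_closed: "h \<in> carrier H \<Longrightarrow> antipode_inv2 H h \<in> carrier H"
  by (simp add: antipode_inv2_def antipode_inv_closed)

lemma antipode_inv2_linear: "linear_map K H H (antipode_inv2 H)"
  using linear_map_compose[OF antipode_inv_linear antipode_inv_linear]
  by (simp add: antipode_inv2_def[abs_def])

lemma antipode_inv2_one: "antipode_inv2 H \<one>\<^bsub>H\<^esub> = \<one>\<^bsub>H\<^esub>"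
  by (simp add: antipode_inv2_def antipode_inv_one)

lemma counit_antipode_inv2: "h \<in> carrier H \<Longrightarrow> counit H (antipode_inv2 H h) = counit H h"
  by (simp add: antipode_inv2_def counit_antipode_inv antipode_inv_closed)

lemmas tlins = lins K.module_tensor_module module_dual lin_dmult_left lin_dmult_right lin_shift_1 lin_shift_2
  lin_shift_3 lin_dcomp lin_sw3 lin_sw3_param sw3_closed dual_mult_closed dual_one_closed dual_shift_closed
  dual_comp_closed linear_map_compose[OF antipode_inv_linear] linear_map_compose[OF antipode_inv2_linear]
  antipode_inv_closed antipode_inv2_closed K.tens_closed quadrilinear_mapI
  antipode_linear antipode_inv_linear

end

section \<open>The product of T on pure tensors\<close>

context finite_hopf_algebra
begin

abbreviation "T \<equiv> T_space K H"

abbreviation "TT \<equiv> T_tens K H"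

text \<open>Split off from \<open>T_mult\<close> so that multilinearity in either quadruple of
  arguments can be established before the lifts over tensors are taken.\<close>

definition T_prod where
  "T_prod g h \<alpha> \<beta> k l \<gamma> \<delta> =
    sw3 T k (\<lambda>k1 k2 k3. sw3 T l (\<lambda>l1 l2 l3.
      TT (g \<cdot> k2) (l2 \<cdot> h)
        (dual_shift H \<alpha> k3 (antipode_inv2 H l3) \<star> \<gamma>) (\<delta> \<star> dual_shift H \<beta> k1 l1)))"

lemma T_mult_eq: "T_mult K H s t =
    tensor_lift4 K T (\<lambda>g h \<alpha> \<beta>. tensor_lift4 K T (\<lambda>k l \<gamma> \<delta>. T_prod g h \<alpha> \<beta> k l \<gamma> \<delta>) t) s"
  by (simp add: T_mult_def T_prod_def)

lemma module_T [simp, intro]: "module K T"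
  by (intro K.module_tensor_module module_H module_dual)

lemma T_tens_closed: "\<lbrakk>g \<in> carrier H; h \<in> carrier H; \<alpha> \<in> carrier Hd; \<beta> \<in> carrier Hd\<rbrakk> \<Longrightarrow> TT g h \<alpha> \<beta> \<in> carrier T"
  by (intro K.tens_closed K.module_tensor_module module_H module_dual)

lemma quadrilinear_T_prod_right:
  assumes "g \<in> carrier H" "h \<in> carrier H" "\<alpha> \<in> carrier Hd" "\<beta> \<in> carrier Hd"
  shows "quadrilinear_map K H H Hd Hd T (T_prod g h \<alpha> \<beta>)"
  unfolding T_prod_def using assms by - (assumption | rule tlins)+

text \<open>The inner lift runs over the fixed tensor \<open>t\<close>, so the outer four variables
  are parameters of a finite sum.\<close>

lemma quadrilinear_T_prod_left:
  assumes "t \<in> carrier T"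
  shows "quadrilinear_map K H H Hd Hd T
    (\<lambda>g h \<alpha> \<beta>. tensor_lift4 K T (\<lambda>k l \<gamma> \<delta>. T_prod g h \<alpha> \<beta> k l \<gamma> \<delta>) t)"
  unfolding T_prod_def using assms
  by (intro quadrilinear_mapI trilinear_mapI bilinear_mapI K.linear_map_tensor_lift4_param[of H H Hd Hd])
    (assumption | rule tlins)+

lemma T_mult_tens:
  assumes "g \<in> carrier H" "h \<in> carrier H" "\<alpha> \<in> carrier Hd" "\<beta> \<in> carrier Hd"
    "k \<in> carrier H" "l \<in> carrier H" "\<gamma> \<in> carrier Hd" "\<delta> \<in> carrier Hd"
  shows "T_mult K H (TT g h \<alpha> \<beta>) (TT k l \<gamma> \<delta>) = T_prod g h \<alpha> \<beta> k l \<gamma> \<delta>"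
  unfolding T_mult_eq using assms
  by (simp only: K.tensor_lift4_tens[OF module_H module_H module_dual module_dual module_T quadrilinear_T_prod_left]
    K.tensor_lift4_tens[OF module_H module_H module_dual module_dual module_T quadrilinear_T_prod_right] T_tens_closed)

lemma T_mult_linear_left: "t \<in> carrier T \<Longrightarrow> linear_map K T T (\<lambda>s. T_mult K H s t)"
  unfolding T_mult_eq
  by (intro K.linear_map_tensor_lift4 module_H module_dual module_T quadrilinear_T_prod_left)

lemma T_mult_linear_right:
  assumes "s \<in> carrier T"
  shows "linear_map K T T (\<lambda>t. T_mult K H s t)"
  unfolding T_mult_eq using assms
  by (intro K.linear_map_tensor_lift4_param[of H H Hd Hd] K.linear_map_tensor_lift4 module_H module_dual
      module_T quadrilinear_T_prod_right)

lemma T_mult_closed: "s \<in> carrier T \<Longrightarrow> t \<in> carrier T \<Longrightarrow> T_mult K H s t \<in> carrier T"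
  by (rule linear_map_closed[OF T_mult_linear_left])

text \<open>With units in the first two slots of the right factor the iterated coproducts are
  trivial and the shifts change nothing. Together with \<open>T_mult_one_tens\<close> this factors a
  pure tensor into elements of \<open>H\<close> and functionals.\<close>

lemma T_mult_tens_one:
  assumes "g \<in> carrier H" "h \<in> carrier H" "\<alpha> \<in> carrier Hd" "\<beta> \<in> carrier Hd" "\<gamma> \<in> carrier Hd" "\<delta> \<in> carrier Hd"
  shows "T_mult K H (TT g h \<alpha> \<beta>) (TT \<one>\<^bsub>H\<^esub> \<one>\<^bsub>H\<^esub> \<gamma> \<delta>) = TT g h (\<alpha> \<star> \<gamma>) (\<delta> \<star> \<beta>)"
proof -
  have sh: "dual_shift H \<chi> \<one>\<^bsub>H\<^esub> \<one>\<^bsub>H\<^esub> = \<chi>" if "\<chi> \<in> carrier Hd" for \<chi>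
    using that by (intro dual_eqI dual_shift_closed) (auto simp: dual_shift_app)
  have "T_mult K H (TT g h \<alpha> \<beta>) (TT \<one>\<^bsub>H\<^esub> \<one>\<^bsub>H\<^esub> \<gamma> \<delta>) = T_prod g h \<alpha> \<beta> \<one>\<^bsub>H\<^esub> \<one>\<^bsub>H\<^esub> \<gamma> \<delta>"
    using assms by (intro T_mult_tens) auto
  also have "\<dots> = sw3 T \<one>\<^bsub>H\<^esub> (\<lambda>l1 l2 l3.
      TT (g \<cdot> \<one>\<^bsub>H\<^esub>) (l2 \<cdot> h)
        (dual_shift H \<alpha> \<one>\<^bsub>H\<^esub> (antipode_inv2 H l3) \<star> \<gamma>) (\<delta> \<star> dual_shift H \<beta> \<one>\<^bsub>H\<^esub> l1))"
    unfolding T_prod_def using assms by (intro sw3_one) (assumption | rule tlins)+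
  also have "\<dots> = TT (g \<cdot> \<one>\<^bsub>H\<^esub>) (\<one>\<^bsub>H\<^esub> \<cdot> h)
        (dual_shift H \<alpha> \<one>\<^bsub>H\<^esub> (antipode_inv2 H \<one>\<^bsub>H\<^esub>) \<star> \<gamma>) (\<delta> \<star> dual_shift H \<beta> \<one>\<^bsub>H\<^esub> \<one>\<^bsub>H\<^esub>)"
    using assms by (intro sw3_one) (assumption | rule tlins)+
  finally show ?thesis using assms by (simp only: sh antipode_inv2_one A.r_one A.l_one)
qed

lemma T_tens_smult:
  assumes "g \<in> carrier H" "h \<in> carrier H" "\<alpha> \<in> carrier Hd" "\<beta> \<in> carrier Hd" "a \<in> carrier K"
  shows "TT g h (a \<odot>\<^bsub>Hd\<^esub> \<alpha>) \<beta> = a \<odot>\<^bsub>T\<^esub> TT g h \<alpha> \<beta>" "TT g h \<alpha> (a \<odot>\<^bsub>Hd\<^esub> \<beta>) = a \<odot>\<^bsub>T\<^esub> TT g h \<alpha> \<beta>"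
proof -
  have "linear_map K Hd T (\<lambda>\<alpha>. TT g h \<alpha> \<beta>)" "linear_map K Hd T (\<lambda>\<beta>. TT g h \<alpha> \<beta>)"
    using assms by - (assumption | rule tlins)+
  from this[THEN linear_map_smult] assms
  show "TT g h (a \<odot>\<^bsub>Hd\<^esub> \<alpha>) \<beta> = a \<odot>\<^bsub>T\<^esub> TT g h \<alpha> \<beta>" "TT g h \<alpha> (a \<odot>\<^bsub>Hd\<^esub> \<beta>) = a \<odot>\<^bsub>T\<^esub> TT g h \<alpha> \<beta>"
    by blast+
qed

text \<open>The unit of the dual is the counit, and shifting it produces the scalars \<epsilon>(x)
  \<epsilon>(y). These absorb the outer legs of both iterated coproducts, so only the middle legs
  remain.\<close>

lemma T_mult_one_tens:
  assumes "g \<in> carrier H" "h \<in> carrier H" "k \<in> carrier H" "l \<in> carrier H" "\<gamma> \<in> carrier Hd" "\<delta> \<in> carrier Hd"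
  shows "T_mult K H (TT g h \<one>\<^bsub>Hd\<^esub> \<one>\<^bsub>Hd\<^esub>) (TT k l \<gamma> \<delta>) = TT (g \<cdot> k) (l \<cdot> h) \<gamma> \<delta>"
proof -
  let ?e = "\<one>\<^bsub>Hd\<^esub>"
  interpret D: module K Hd by (rule module_dual)
  interpret T: module K T by (rule module_T)
  \<comment> \<open>Reorders the four scalars so that those of the legs of \<open>l\<close> stand
    outside those of \<open>k\<close>, as the two applications of \<open>sw3_counit\<close>
    require.\<close>
  have four: "(a \<otimes> b) \<odot>\<^bsub>T\<^esub> ((c \<otimes> d) \<odot>\<^bsub>T\<^esub> x) = b \<odot>\<^bsub>T\<^esub> (d \<odot>\<^bsub>T\<^esub> (a \<odot>\<^bsub>T\<^esub> (c \<odot>\<^bsub>T\<^esub> x)))"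
    if "a \<in> carrier K" "b \<in> carrier K" "c \<in> carrier K" "d \<in> carrier K" "x \<in> carrier T" for a b c d x
  proof -
    have "(a \<otimes> b) \<otimes> (c \<otimes> d) = b \<otimes> (d \<otimes> (a \<otimes> c))" using that by (simp add: K.m_ac)
    then show ?thesis
      using that by (simp only: T.smult_assoc1[symmetric] K.m_closed T.smult_closed)
  qed
  have sh: "dual_shift H ?e x y = (counit H x \<otimes> counit H y) \<odot>\<^bsub>Hd\<^esub> ?e" if "x \<in> carrier H" "y \<in> carrier H" for x y
  proof (rule dual_eqI)
    show "(counit H x \<otimes> counit H y) \<odot>\<^bsub>Hd\<^esub> ?e \<in> carrier Hd"
      using that by (intro D.smult_closed dual_one_closed) auto
  qed (use that in \<open>auto simp: dual_shift_app counit_mult K.m_ac intro!: dual_shift_closed dual_one_closed[simplified]\<close>)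
  have m1: "((a \<odot>\<^bsub>Hd\<^esub> ?e) \<star> \<gamma>) = a \<odot>\<^bsub>Hd\<^esub> \<gamma>" "(\<delta> \<star> (a \<odot>\<^bsub>Hd\<^esub> ?e)) = a \<odot>\<^bsub>Hd\<^esub> \<delta>"
    if "a \<in> carrier K" for a
    using linear_map_smult[OF lin_dmult_left[OF linear_map_id assms(5) module_dual] that dual_one_closed]
      linear_map_smult[OF lin_dmult_right[OF linear_map_id assms(6) module_dual] that dual_one_closed]
      dual_one_mult[OF assms(5)] dual_mult_one[OF assms(6)] by simp_all
  have "T_mult K H (TT g h ?e ?e) (TT k l \<gamma> \<delta>) = T_prod g h ?e ?e k l \<gamma> \<delta>"
    using assms by (intro T_mult_tens dual_one_closed)
  also have "\<dots> = sw3 T k (\<lambda>k1 k2 k3. counit H k1 \<odot>\<^bsub>T\<^esub> (counit H k3 \<odot>\<^bsub>T\<^esub> TT (g \<cdot> k2) (l \<cdot> h) \<gamma> \<delta>))"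
    unfolding T_prod_def
  proof (intro sw3_cong module_T assms)
    fix k1 k2 k3 assume k: "k1 \<in> carrier H" "k2 \<in> carrier H" "k3 \<in> carrier H"
    have "sw3 T l (\<lambda>l1 l2 l3.
      TT (g \<cdot> k2) (l2 \<cdot> h)
        (dual_shift H ?e k3 (antipode_inv2 H l3) \<star> \<gamma>) (\<delta> \<star> dual_shift H ?e k1 l1)) =
      sw3 T l (\<lambda>l1 l2 l3. counit H l1 \<odot>\<^bsub>T\<^esub> (counit H l3 \<odot>\<^bsub>T\<^esub>
        (counit H k1 \<odot>\<^bsub>T\<^esub> (counit H k3 \<odot>\<^bsub>T\<^esub> TT (g \<cdot> k2) (l2 \<cdot> h) \<gamma> \<delta>))))"
    proof (intro sw3_cong module_T assms)
      fix l1 l2 l3 assume l: "l1 \<in> carrier H" "l2 \<in> carrier H" "l3 \<in> carrier H"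
      have c: "TT (g \<cdot> k2) (l2 \<cdot> h) \<gamma> \<delta> \<in> carrier T"
        using assms k l by (intro T_tens_closed A.m_closed)
      have "TT (g \<cdot> k2) (l2 \<cdot> h)
        (dual_shift H ?e k3 (antipode_inv2 H l3) \<star> \<gamma>) (\<delta> \<star> dual_shift H ?e k1 l1) =
        TT (g \<cdot> k2) (l2 \<cdot> h) ((counit H k3 \<otimes> counit H l3) \<odot>\<^bsub>Hd\<^esub> \<gamma>) ((counit H k1 \<otimes> counit H l1) \<odot>\<^bsub>Hd\<^esub> \<delta>)"
        using k l by (simp only: sh m1 K.m_closed counit_closed antipode_inv2_closed counit_antipode_inv2)
      also have "\<dots> = (counit H k1 \<otimes> counit H l1) \<odot>\<^bsub>T\<^esub> ((counit H k3 \<otimes> counit H l3) \<odot>\<^bsub>T\<^esub> TT (g \<cdot> k2) (l2 \<cdot> h) \<gamma> \<delta>)"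
        using assms k l
        by (simp only: T_tens_smult K.m_closed counit_closed A.m_closed D.smult_closed)
      also have "\<dots> = counit H l1 \<odot>\<^bsub>T\<^esub> (counit H l3 \<odot>\<^bsub>T\<^esub>
        (counit H k1 \<odot>\<^bsub>T\<^esub> (counit H k3 \<odot>\<^bsub>T\<^esub> TT (g \<cdot> k2) (l2 \<cdot> h) \<gamma> \<delta>)))"
        using c k l by (intro four) auto
      finally show "TT (g \<cdot> k2) (l2 \<cdot> h)
        (dual_shift H ?e k3 (antipode_inv2 H l3) \<star> \<gamma>) (\<delta> \<star> dual_shift H ?e k1 l1) = counit H l1 \<odot>\<^bsub>T\<^esub> (counit H l3 \<odot>\<^bsub>T\<^esub>
        (counit H k1 \<odot>\<^bsub>T\<^esub> (counit H k3 \<odot>\<^bsub>T\<^esub> TT (g \<cdot> k2) (l2 \<cdot> h) \<gamma> \<delta>)))" .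
    qed (insert assms k, (assumption | rule tlins)+)
    also have "\<dots> = counit H k1 \<odot>\<^bsub>T\<^esub> (counit H k3 \<odot>\<^bsub>T\<^esub> TT (g \<cdot> k2) (l \<cdot> h) \<gamma> \<delta>)"
      using assms k by (intro sw3_counit) (assumption | rule tlins)+
    finally show "sw3 T l (\<lambda>l1 l2 l3.
      TT (g \<cdot> k2) (l2 \<cdot> h)
        (dual_shift H ?e k3 (antipode_inv2 H l3) \<star> \<gamma>) (\<delta> \<star> dual_shift H ?e k1 l1)) =
        counit H k1 \<odot>\<^bsub>T\<^esub> (counit H k3 \<odot>\<^bsub>T\<^esub> TT (g \<cdot> k2) (l \<cdot> h) \<gamma> \<delta>)" .
  qed (insert assms, (assumption | rule tlins)+)
  also have "\<dots> = TT (g \<cdot> k) (l \<cdot> h) \<gamma> \<delta>"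
    using assms by (intro sw3_counit) (assumption | rule tlins)+
  finally show ?thesis .
qed

text \<open>The product in which a functional has to pass an element of \<open>H\<close>. Its
  right-hand side is the pattern that \<open>cross_sum\<close> reproduces on a Hopf
  bimodule.\<close>

lemma T_mult_cross:
  assumes "\<alpha> \<in> carrier Hd" "\<beta> \<in> carrier Hd" "k \<in> carrier H" "l \<in> carrier H"
  shows "T_mult K H (TT \<one>\<^bsub>H\<^esub> \<one>\<^bsub>H\<^esub> \<alpha> \<beta>) (TT k l \<one>\<^bsub>Hd\<^esub> \<one>\<^bsub>Hd\<^esub>) =
    sw3 T k (\<lambda>k1 k2 k3. sw3 T l (\<lambda>l1 l2 l3.
      TT k2 l2 (dual_shift H \<alpha> k3 (antipode_inv2 H l3)) (dual_shift H \<beta> k1 l1)))"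
proof -
  have "T_mult K H (TT \<one>\<^bsub>H\<^esub> \<one>\<^bsub>H\<^esub> \<alpha> \<beta>) (TT k l \<one>\<^bsub>Hd\<^esub> \<one>\<^bsub>Hd\<^esub>) = T_prod \<one>\<^bsub>H\<^esub> \<one>\<^bsub>H\<^esub> \<alpha> \<beta> k l \<one>\<^bsub>Hd\<^esub> \<one>\<^bsub>Hd\<^esub>"
    using assms by (intro T_mult_tens dual_one_closed A.one_closed)
  also have "\<dots> = sw3 T k (\<lambda>k1 k2 k3. sw3 T l (\<lambda>l1 l2 l3.
      TT k2 l2 (dual_shift H \<alpha> k3 (antipode_inv2 H l3)) (dual_shift H \<beta> k1 l1)))"
    unfolding T_prod_def using assms
    by (intro sw3_cong) (assumption | rule tlins
      | simp only: dual_mult_one dual_one_mult A.l_one A.r_one dual_shift_closed antipode_inv2_closed)+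
  finally show ?thesis .
qed

abbreviation "T1 \<equiv> TT \<one>\<^bsub>H\<^esub> \<one>\<^bsub>H\<^esub> \<one>\<^bsub>Hd\<^esub> \<one>\<^bsub>Hd\<^esub>"

lemma T1_closed: "T1 \<in> carrier T"
  by (intro T_tens_closed dual_one_closed A.one_closed)

lemma T_mult_T1: assumes "t \<in> carrier T" shows "T_mult K H t T1 = t"
proof (rule K.tensor4_map_eqI[where L' = "\<lambda>t. t", OF _ _ _ _ _ assms T_mult_linear_left[OF T1_closed] linear_map_id])
  fix g h \<alpha> \<beta> assume *: "g \<in> carrier H" "h \<in> carrier H" "\<alpha> \<in> carrier Hd" "\<beta> \<in> carrier Hd"
  then show "T_mult K H (TT g h \<alpha> \<beta>) T1 = TT g h \<alpha> \<beta>"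
    by (simp only: T_mult_tens_one dual_one_closed dual_mult_one dual_one_mult)
qed (rule module_H module_dual module_T)+

lemma T1_T_mult: assumes "t \<in> carrier T" shows "T_mult K H T1 t = t"
proof (rule K.tensor4_map_eqI[where L' = "\<lambda>t. t", OF _ _ _ _ _ assms T_mult_linear_right[OF T1_closed] linear_map_id])
  fix g h \<alpha> \<beta> assume *: "g \<in> carrier H" "h \<in> carrier H" "\<alpha> \<in> carrier Hd" "\<beta> \<in> carrier Hd"
  then show "T_mult K H T1 (TT g h \<alpha> \<beta>) = TT g h \<alpha> \<beta>"
    by (simp only: T_mult_one_tens A.one_closed A.l_one A.r_one)
qed (rule module_H module_dual module_T)+

section \<open>The action of the group of order two and the crossed product\<close>

abbreviation T_auto_tens where
  "T_auto_tens g h \<alpha> \<beta> \<equiv> TT (antipode_inv H h) (antipode H g)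
      (dual_comp H \<beta> (antipode H)) (dual_comp H \<alpha> (antipode_inv H))"

lemma quadrilinear_T_auto: "quadrilinear_map K H H Hd Hd T T_auto_tens"
  by (assumption | rule tlins)+

lemma T_auto_linear: "linear_map K T T (T_auto K H)"
  unfolding T_auto_def[abs_def]
  by (intro K.linear_map_tensor_lift4 module_H module_dual module_T quadrilinear_T_auto)

lemma T_auto_closed: "t \<in> carrier T \<Longrightarrow> T_auto K H t \<in> carrier T"
  by (rule linear_map_closed[OF T_auto_linear])

lemma T_auto_tens:
  "\<lbrakk>g \<in> carrier H; h \<in> carrier H; \<alpha> \<in> carrier Hd; \<beta> \<in> carrier Hd\<rbrakk>
    \<Longrightarrow> T_auto K H (TT g h \<alpha> \<beta>) = T_auto_tens g h \<alpha> \<beta>"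
  unfolding T_auto_def
  by (intro K.tensor_lift4_tens module_H module_dual module_T quadrilinear_T_auto)

lemma dual_comp_one:
  "dual_comp H \<one>\<^bsub>Hd\<^esub> (antipode H) = \<one>\<^bsub>Hd\<^esub>" "dual_comp H \<one>\<^bsub>Hd\<^esub> (antipode_inv H) = \<one>\<^bsub>Hd\<^esub>"
  by (auto simp: dual_comp_def counit_antipode counit_antipode_inv antipode_inv_closed intro!: restrict_ext)

lemma T_auto_T1: "T_auto K H T1 = T1"
  using T_auto_tens[OF A.one_closed A.one_closed dual_one_closed dual_one_closed]
  by (simp only: antipode_one antipode_inv_one dual_comp_one)

abbreviation "TH \<equiv> T_hat K H"

lemma T_hat_simps:
  "carrier TH = carrier T \<times> carrier T"
  "(a, b) \<otimes>\<^bsub>TH\<^esub> (c, d) = (T_mult K H a c \<oplus>\<^bsub>T\<^esub> T_mult K H b (T_auto K H d), T_mult K H a d \<oplus>\<^bsub>T\<^esub> T_mult K H b (T_auto K H c))"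
  "\<one>\<^bsub>TH\<^esub> = (T1, \<zero>\<^bsub>T\<^esub>)"
  "(a, b) \<oplus>\<^bsub>TH\<^esub> (c, d) = (a \<oplus>\<^bsub>T\<^esub> c, b \<oplus>\<^bsub>T\<^esub> d)"
  "x \<odot>\<^bsub>TH\<^esub> (a, b) = (x \<odot>\<^bsub>T\<^esub> a, x \<odot>\<^bsub>T\<^esub> b)"
  by (simp_all add: T_hat_def crossed_product_Z2_def T_algebra_def)

end

section \<open>Coactions as actions of the dual algebra\<close>

context finite_hopf_algebra
begin

text \<open>One basis is fixed for good, since the coactions of \<open>to_hopf_bimodule\<close> are
  written with it.\<close>

definition hbasis where "hbasis = (SOME B. \<exists>\<xi>. dual_basis K H B (\<lambda>b. b) \<xi>)"

text \<open>Members of \<open>dual\<close> are extensional, so the chosen coordinate functionals are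
  cut off outside the carrier.\<close>

definition coord where
  "coord b = (\<lambda>h\<in>carrier H. (SOME \<xi>. dual_basis K H hbasis (\<lambda>b. b) \<xi>) b h)"

lemma dual_basis_H: "dual_basis K H hbasis (\<lambda>b. b) coord"
proof -
  have "\<exists>B \<xi>. dual_basis K H B (\<lambda>b. b) \<xi>"
    by (rule fin_dim_basis[OF K.field_axioms module_H fin_dim]) blast
  then have "\<exists>\<xi>. dual_basis K H hbasis (\<lambda>b. b) \<xi>" unfolding hbasis_def by (rule someI_ex)
  then have db: "dual_basis K H hbasis (\<lambda>b. b) (SOME \<xi>. dual_basis K H hbasis (\<lambda>b. b) \<xi>)" by (rule someI_ex)
  note d = dual_basisD[OF db]
  have lin: "linear_map K H KK (coord b)" if "b \<in> hbasis" for b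
    using dualD(1)[OF restrict_in_dual[OF d(3)[OF that]]] by (simp add: coord_def[abs_def])
  have eq: "(\<Oplus>\<^bsub>H\<^esub>b\<in>hbasis. coord b v \<bullet> b) = v" if v: "v \<in> carrier H" for v
  proof -
    have "(\<Oplus>\<^bsub>H\<^esub>b\<in>hbasis. coord b v \<bullet> b) =
        (\<Oplus>\<^bsub>H\<^esub>b\<in>hbasis. (SOME \<xi>. dual_basis K H hbasis (\<lambda>b. b) \<xi>) b v \<bullet> b)"
      using v d by (intro A.finsum_cong') (auto simp: coord_def)
    then show ?thesis using d(4)[OF v] by simp
  qed
  show ?thesis unfolding dual_basis_def using d(1,2) lin eq by blast
qed

lemmas hbasis = dual_basisD[OF dual_basis_H]

lemma coord_closed: "b \<in> hbasis \<Longrightarrow> coord b \<in> carrier Hd"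
  using hbasis(3)[of b] by (simp add: dual_def coord_def)

text \<open>A functional has its values on the basis as coefficients with respect to
  \<open>coord\<close>, so \<open>H\<close> and its dual exchange roles. This contraction recovers
  the action of an arbitrary \<beta> from that of the \<open>coord b\<close>.\<close>

lemma dual_basis_dual: "dual_basis K Hd hbasis coord (\<lambda>b \<alpha>. \<alpha> b)"
  unfolding dual_basis_def
proof (intro conjI ballI hbasis coord_closed lin_app)
  fix \<alpha> assume \<alpha>: "\<alpha> \<in> carrier Hd"
  interpret D: module K Hd by (rule module_dual)
  let ?s = "\<Oplus>\<^bsub>Hd\<^esub>b\<in>hbasis. \<alpha> b \<odot>\<^bsub>Hd\<^esub> coord b"
  have c: "\<alpha> b \<odot>\<^bsub>Hd\<^esub> coord b \<in> carrier Hd" if "b \<in> hbasis" for b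
    using that by (intro D.smult_closed coord_closed dual_app_closed[OF \<alpha>] hbasis)
  show "?s = \<alpha>"
  proof (rule dual_eqI)
    show "?s \<in> carrier Hd" using c by (intro D.finsum_closed) auto
    fix h assume h: "h \<in> carrier H"
    have "?s h = (\<Oplus>\<^bsub>KK\<^esub>b\<in>hbasis. (\<alpha> b \<odot>\<^bsub>Hd\<^esub> coord b) h)"
      using c by (intro linear_map_finsum[OF module_dual K.module_ring_as_module lin_app[OF h]]) auto
    also have "\<dots> = (\<Oplus>\<^bsub>KK\<^esub>b\<in>hbasis. coord b h \<odot>\<^bsub>KK\<^esub> \<alpha> b)"
      using h hbasis dual_app_closed[OF \<alpha>] by (auto intro!: K.finsum_cong' simp: K.m_comm)
    also have "\<dots> = \<alpha> h"
      using K.dual_basis_expand[OF module_H K.module_ring_as_module dual_basis_H dualD(1)[OF \<alpha>] h] .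
    finally show "?s h = \<alpha> h" .
  qed (rule \<alpha>)
qed

section \<open>Contracting the \<open>H\<close>-legs of a tensor with functionals\<close>

definition pairL where "pairL X \<beta> t = tensor_lift K X (\<lambda>x v. \<beta> x \<odot>\<^bsub>X\<^esub> v) t"

definition pairR where "pairR X \<alpha> t = tensor_lift K X (\<lambda>v x. \<alpha> x \<odot>\<^bsub>X\<^esub> v) t"

lemma pairL_bilinear: "module K X \<Longrightarrow> \<beta> \<in> carrier Hd \<Longrightarrow> bilinear_map K H X X (\<lambda>x v. \<beta> x \<odot>\<^bsub>X\<^esub> v)"
  by (intro bilinear_mapI linear_map_smult_fun linear_map_scalar_fun linear_map_id dualD dual_app_closed)

lemma pairR_bilinear: "module K X \<Longrightarrow> \<beta> \<in> carrier Hd \<Longrightarrow> bilinear_map K X H X (\<lambda>v x. \<beta> x \<odot>\<^bsub>X\<^esub> v)"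
  by (intro bilinear_mapI linear_map_smult_fun linear_map_scalar_fun linear_map_id dualD dual_app_closed)

lemma pairL_linear:
  "module K X \<Longrightarrow> \<beta> \<in> carrier Hd \<Longrightarrow> linear_map K (tensor_module K H X) X (pairL X \<beta>)"
  unfolding pairL_def[abs_def] by (intro K.linear_map_tensor_lift pairL_bilinear module_H)

lemma pairR_linear:
  "module K X \<Longrightarrow> \<beta> \<in> carrier Hd \<Longrightarrow> linear_map K (tensor_module K X H) X (pairR X \<beta>)"
  unfolding pairR_def[abs_def] by (intro K.linear_map_tensor_lift pairR_bilinear module_H)

lemma pairL_tens:
  "\<lbrakk>module K X; \<beta> \<in> carrier Hd; x \<in> carrier H; v \<in> carrier X\<rbrakk> \<Longrightarrow> pairL X \<beta> (tens K H X x v) = \<beta> x \<odot>\<^bsub>X\<^esub> v"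
  unfolding pairL_def by (intro K.tensor_lift_tens pairL_bilinear module_H)

lemma pairR_tens:
  "\<lbrakk>module K X; \<beta> \<in> carrier Hd; x \<in> carrier H; v \<in> carrier X\<rbrakk> \<Longrightarrow> pairR X \<beta> (tens K X H v x) = \<beta> x \<odot>\<^bsub>X\<^esub> v"
  unfolding pairR_def by (intro K.tensor_lift_tens pairR_bilinear module_H)

text \<open>On a pure tensor this is the expansion of its \<open>H\<close>-leg in the basis. It
  rebuilds a coaction from the operators of the functionals \<open>coord b\<close>, and it shows
  that contractions with functionals separate tensors.\<close>

lemma pairL_expand:
  assumes X: "module K X" and t: "t \<in> carrier (tensor_module K H X)"
  shows "(\<Oplus>\<^bsub>tensor_module K H X\<^esub>b\<in>hbasis. tens K H X b (pairL X (coord b) t)) = t"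
proof (rule K.tensor_map_eqI[where L' = "\<lambda>t. t", OF module_H X _ t])
  note l = lins K.module_tensor_module X
  show "module K (tensor_module K H X)" by (rule l)+
  show "linear_map K (tensor_module K H X) (tensor_module K H X)
      (\<lambda>t. \<Oplus>\<^bsub>tensor_module K H X\<^esub>b\<in>hbasis. tens K H X b (pairL X (coord b) t))"
    by (intro linear_map_finsum_fun lin_tens_right pairL_linear coord_closed hbasis l)
  fix x v assume xv: "x \<in> carrier H" "v \<in> carrier X"
  interpret T: module K "tensor_module K H X" by (rule l)+
  have "(\<Oplus>\<^bsub>tensor_module K H X\<^esub>b\<in>hbasis. tens K H X b (pairL X (coord b) (tens K H X x v))) =
      (\<Oplus>\<^bsub>tensor_module K H X\<^esub>b\<in>hbasis. coord b x \<odot>\<^bsub>tensor_module K H X\<^esub> tens K H X b v)"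
  proof (intro T.finsum_cong' refl)
    fix b assume b: "b \<in> hbasis"
    have "tens K H X b (pairL X (coord b) (tens K H X x v)) = tens K H X b (coord b x \<odot>\<^bsub>X\<^esub> v)"
      using b xv X by (simp add: pairL_tens coord_closed)
    also have "\<dots> = coord b x \<odot>\<^bsub>tensor_module K H X\<^esub> tens K H X b v"
      using b xv X by (intro linear_map_smult[OF bilinear_map_right[OF K.bilinear_map_tens]]) (auto intro: hbasis)
    finally show "tens K H X b (pairL X (coord b) (tens K H X x v)) = coord b x \<odot>\<^bsub>tensor_module K H X\<^esub> tens K H X b v" .
  qed (use xv X in \<open>auto intro!: T.smult_closed hbasis K.tens_closed\<close>)
  also have "\<dots> = tens K H X x v"
    using xv by (intro K.dual_basis_expand[OF _ _ dual_basis_H, where L = "\<lambda>z. tens K H X z v"]) (assumption | rule l)+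
  finally show "(\<Oplus>\<^bsub>tensor_module K H X\<^esub>b\<in>hbasis. tens K H X b (pairL X (coord b) (tens K H X x v))) = tens K H X x v" .
qed (rule linear_map_id)

lemma pairR_expand:
  assumes X: "module K X" and t: "t \<in> carrier (tensor_module K X H)"
  shows "(\<Oplus>\<^bsub>tensor_module K X H\<^esub>b\<in>hbasis. tens K X H (pairR X (coord b) t) b) = t"
proof (rule K.tensor_map_eqI[where L' = "\<lambda>t. t", OF X module_H _ t])
  note l = lins K.module_tensor_module X
  show "module K (tensor_module K X H)" by (rule l)+
  show "linear_map K (tensor_module K X H) (tensor_module K X H)
      (\<lambda>t. \<Oplus>\<^bsub>tensor_module K X H\<^esub>b\<in>hbasis. tens K X H (pairR X (coord b) t) b)"
    by (intro linear_map_finsum_fun lin_tens_left pairR_linear coord_closed hbasis l)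
  fix v x assume xv: "v \<in> carrier X" "x \<in> carrier H"
  interpret T: module K "tensor_module K X H" by (rule l)+
  have "(\<Oplus>\<^bsub>tensor_module K X H\<^esub>b\<in>hbasis. tens K X H (pairR X (coord b) (tens K X H v x)) b) =
      (\<Oplus>\<^bsub>tensor_module K X H\<^esub>b\<in>hbasis. coord b x \<odot>\<^bsub>tensor_module K X H\<^esub> tens K X H v b)"
  proof (intro T.finsum_cong' refl)
    fix b assume b: "b \<in> hbasis"
    have "tens K X H (pairR X (coord b) (tens K X H v x)) b = tens K X H (coord b x \<odot>\<^bsub>X\<^esub> v) b"
      using b xv X by (simp add: pairR_tens coord_closed)
    also have "\<dots> = coord b x \<odot>\<^bsub>tensor_module K X H\<^esub> tens K X H v b"
      using b xv X by (intro linear_map_smult[OF bilinear_map_left[OF K.bilinear_map_tens]]) (auto intro: hbasis)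
    finally show "tens K X H (pairR X (coord b) (tens K X H v x)) b = coord b x \<odot>\<^bsub>tensor_module K X H\<^esub> tens K X H v b" .
  qed (use xv X in \<open>auto intro!: T.smult_closed hbasis K.tens_closed\<close>)
  also have "\<dots> = tens K X H v x"
    using xv by (intro K.dual_basis_expand[OF _ _ dual_basis_H, where L = "\<lambda>z. tens K X H v z"]) (assumption | rule l)+
  finally show "(\<Oplus>\<^bsub>tensor_module K X H\<^esub>b\<in>hbasis. tens K X H (pairR X (coord b) (tens K X H v x)) b) = tens K X H v x" .
qed (rule linear_map_id)

lemma pairL_eqI:
  assumes "module K X" "s \<in> carrier (tensor_module K H X)" "t \<in> carrier (tensor_module K H X)"
    and eq: "\<And>\<beta>. \<beta> \<in> carrier Hd \<Longrightarrow> pairL X \<beta> s = pairL X \<beta> t"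
  shows "s = t"
proof -
  interpret X: module K X by fact
  interpret T: module K "tensor_module K H X" using assms by auto
  have "s = (\<Oplus>\<^bsub>tensor_module K H X\<^esub>b\<in>hbasis. tens K H X b (pairL X (coord b) s))"
    by (rule pairL_expand[symmetric]) fact+
  also have "\<dots> = (\<Oplus>\<^bsub>tensor_module K H X\<^esub>b\<in>hbasis. tens K H X b (pairL X (coord b) t))"
    using assms
    by (intro T.finsum_cong' refl Pi_I K.tens_closed hbasis linear_map_closed[OF pairL_linear] module_H coord_closed)
      (simp_all only: eq coord_closed)
  also have "\<dots> = t" by (rule pairL_expand) fact+
  finally show ?thesis .
qed

lemma pairR_eqI:
  assumes "module K X" "s \<in> carrier (tensor_module K X H)" "t \<in> carrier (tensor_module K X H)"
    and eq: "\<And>\<beta>. \<beta> \<in> carrier Hd \<Longrightarrow> pairR X \<beta> s = pairR X \<beta> t"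
  shows "s = t"
proof -
  interpret X: module K X by fact
  interpret T: module K "tensor_module K X H" using assms by auto
  have "s = (\<Oplus>\<^bsub>tensor_module K X H\<^esub>b\<in>hbasis. tens K X H (pairR X (coord b) s) b)"
    by (rule pairR_expand[symmetric]) fact+
  also have "\<dots> = (\<Oplus>\<^bsub>tensor_module K X H\<^esub>b\<in>hbasis. tens K X H (pairR X (coord b) t) b)"
    using assms
    by (intro T.finsum_cong' refl Pi_I K.tens_closed hbasis linear_map_closed[OF pairR_linear] module_H coord_closed)
      (simp_all only: eq coord_closed)
  also have "\<dots> = t" by (rule pairR_expand) fact+
  finally show ?thesis .
qed

text \<open>With brackets to the right both \<open>H\<close>-legs of M \<otimes> (H \<otimes> H) sit
  inside one factor, where \<open>pairR\<close> cannot be iterated; so both are contracted at once,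
  the first with \<alpha> and the second with \<alpha>'.\<close>

definition pairRR where
  "pairRR X \<alpha> \<alpha>' t = tensor_lift K X (\<lambda>v u. tensor_lift K X (\<lambda>x y. \<alpha> x \<odot>\<^bsub>X\<^esub> (\<alpha>' y \<odot>\<^bsub>X\<^esub> v)) u) t"

lemma pairRR_trilinear:
  assumes "module K X" "\<alpha> \<in> carrier Hd" "\<alpha>' \<in> carrier Hd"
  shows "trilinear_map K X H H X (\<lambda>v x y. \<alpha> x \<odot>\<^bsub>X\<^esub> (\<alpha>' y \<odot>\<^bsub>X\<^esub> v))"
  by (assumption | rule lins linear_map_compose[OF dualD(1)[OF assms(2)]] linear_map_compose[OF dualD(1)[OF assms(3)]]
      dual_app_closed[OF assms(2)] dual_app_closed[OF assms(3)] assms(1))+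

lemma pairRR_linear:
  "\<lbrakk>module K X; \<alpha> \<in> carrier Hd; \<alpha>' \<in> carrier Hd\<rbrakk> \<Longrightarrow> linear_map K (tensor_module3 K X H H) X (pairRR X \<alpha> \<alpha>')"
  unfolding pairRR_def[abs_def] by (intro K.linear_map_tensor_lift3 pairRR_trilinear module_H)

lemma pairRR_tens:
  "\<lbrakk>module K X; \<alpha> \<in> carrier Hd; \<alpha>' \<in> carrier Hd; v \<in> carrier X; x \<in> carrier H; y \<in> carrier H\<rbrakk>
    \<Longrightarrow> pairRR X \<alpha> \<alpha>' (tens3 K X H H v x y) = \<alpha> x \<odot>\<^bsub>X\<^esub> (\<alpha>' y \<odot>\<^bsub>X\<^esub> v)"
  unfolding pairRR_def by (intro K.tensor_lift3_tens pairRR_trilinear module_H)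

lemma pairRR_expand:
  assumes X: "module K X" and t: "t \<in> carrier (tensor_module3 K X H H)"
  shows "(\<Oplus>\<^bsub>tensor_module3 K X H H\<^esub>b\<in>hbasis. \<Oplus>\<^bsub>tensor_module3 K X H H\<^esub>c\<in>hbasis.
    tens3 K X H H (pairRR X (coord b) (coord c) t) b c) = t"
proof (rule K.tensor3_map_eqI[where L' = "\<lambda>t. t", OF X module_H module_H _ t])
  note l = lins K.module_tensor_module X K.tens_closed
  let ?T = "tensor_module3 K X H H"
  show "module K ?T" by (rule l)+
  show "linear_map K ?T ?T
      (\<lambda>t. \<Oplus>\<^bsub>?T\<^esub>b\<in>hbasis. \<Oplus>\<^bsub>?T\<^esub>c\<in>hbasis. tens3 K X H H (pairRR X (coord b) (coord c) t) b c)"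
    by (assumption | rule linear_map_finsum_fun lin_tens_left pairRR_linear coord_closed hbasis(2) l)+
  fix v x y assume xv: "v \<in> carrier X" "x \<in> carrier H" "y \<in> carrier H"
  interpret T: module K ?T by (rule l)+
  interpret X: module K X by (rule X)
  have "(\<Oplus>\<^bsub>?T\<^esub>b\<in>hbasis. \<Oplus>\<^bsub>?T\<^esub>c\<in>hbasis. tens3 K X H H (pairRR X (coord b) (coord c) (tens3 K X H H v x y)) b c) =
    (\<Oplus>\<^bsub>?T\<^esub>b\<in>hbasis. coord b x \<odot>\<^bsub>?T\<^esub> tens3 K X H H v b y)"
  proof (intro T.finsum_cong' refl)
    fix b assume b: "b \<in> hbasis"
    have bH: "b \<in> carrier H" and bx: "coord b x \<in> carrier K" using b xv hbasis by auto
    have "(\<Oplus>\<^bsub>?T\<^esub>c\<in>hbasis. tens3 K X H H (pairRR X (coord b) (coord c) (tens3 K X H H v x y)) b c) =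
      (\<Oplus>\<^bsub>?T\<^esub>c\<in>hbasis. coord c y \<odot>\<^bsub>?T\<^esub> tens3 K X H H (coord b x \<odot>\<^bsub>X\<^esub> v) b c)"
    proof (intro T.finsum_cong' refl)
      fix c assume c: "c \<in> hbasis"
      have cH: "c \<in> carrier H" and cy: "coord c y \<in> carrier K" using c xv hbasis by auto
      have "pairRR X (coord b) (coord c) (tens3 K X H H v x y) = coord c y \<odot>\<^bsub>X\<^esub> (coord b x \<odot>\<^bsub>X\<^esub> v)"
        using b c xv X bx cy
        by (simp add: pairRR_tens coord_closed X.smult_assoc1[symmetric] K.m_comm)
      then show "tens3 K X H H (pairRR X (coord b) (coord c) (tens3 K X H H v x y)) b c =
        coord c y \<odot>\<^bsub>?T\<^esub> tens3 K X H H (coord b x \<odot>\<^bsub>X\<^esub> v) b c"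
        using bH cH xv bx cy X
        by (simp only:) (intro linear_map_smult[OF bilinear_map_left[OF K.bilinear_map_tens]]; auto)
    qed (use bH bx xv X hbasis in \<open>auto intro!: T.smult_closed K.tens_closed\<close>)
    also have "\<dots> = tens3 K X H H (coord b x \<odot>\<^bsub>X\<^esub> v) b y"
      using xv bH bx by (intro K.dual_basis_expand[OF _ _ dual_basis_H, where L = "\<lambda>z. tens3 K X H H (coord b x \<odot>\<^bsub>X\<^esub> v) b z"])
        (assumption | rule l)+
    also have "\<dots> = coord b x \<odot>\<^bsub>?T\<^esub> tens3 K X H H v b y"
      using bH xv bx X by (intro linear_map_smult[OF bilinear_map_left[OF K.bilinear_map_tens]]) auto
    finally show "(\<Oplus>\<^bsub>?T\<^esub>c\<in>hbasis. tens3 K X H H (pairRR X (coord b) (coord c) (tens3 K X H H v x y)) b c)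
      = coord b x \<odot>\<^bsub>?T\<^esub> tens3 K X H H v b y" .
  qed (use xv X hbasis in \<open>auto intro!: T.smult_closed K.tens_closed\<close>)
  also have "\<dots> = tens3 K X H H v x y"
    using xv by (intro K.dual_basis_expand[OF _ _ dual_basis_H, where L = "\<lambda>z. tens3 K X H H v z y"]) (assumption | rule l)+
  finally show "(\<Oplus>\<^bsub>?T\<^esub>b\<in>hbasis. \<Oplus>\<^bsub>?T\<^esub>c\<in>hbasis. tens3 K X H H (pairRR X (coord b) (coord c) (tens3 K X H H v x y)) b c)
    = tens3 K X H H v x y" .
qed (rule linear_map_id)

lemma pairRR_eqI:
  assumes "module K X" "s \<in> carrier (tensor_module3 K X H H)" "t \<in> carrier (tensor_module3 K X H H)"
    and eq: "\<And>\<alpha> \<beta>. \<alpha> \<in> carrier Hd \<Longrightarrow> \<beta> \<in> carrier Hd \<Longrightarrow> pairRR X \<alpha> \<beta> s = pairRR X \<alpha> \<beta> t"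
  shows "s = t"
proof -
  let ?T = "tensor_module3 K X H H"
  interpret X: module K X by fact
  interpret T: module K ?T using assms by auto
  have "s = (\<Oplus>\<^bsub>?T\<^esub>b\<in>hbasis. \<Oplus>\<^bsub>?T\<^esub>c\<in>hbasis. tens3 K X H H (pairRR X (coord b) (coord c) s) b c)"
    by (rule pairRR_expand[symmetric]) fact+
  also have "\<dots> = (\<Oplus>\<^bsub>?T\<^esub>b\<in>hbasis. \<Oplus>\<^bsub>?T\<^esub>c\<in>hbasis. tens3 K X H H (pairRR X (coord b) (coord c) t) b c)"
    using assms
    by (intro T.finsum_cong' T.finsum_closed refl Pi_I K.tens_closed K.module_tensor_module hbasis
        linear_map_closed[OF pairRR_linear] module_H coord_closed)
      (simp_all only: eq coord_closed)
  also have "\<dots> = t" by (rule pairRR_expand) fact+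
  finally show ?thesis .
qed

end

text \<open>Coactions and involution are only assumed linear here. Each of the axioms that involve a
  coaction is then shown equivalent to a relation between operators, and the equivalences serve in
  both directions: for a given Hopf bimodule and for the structure built from a module over the
  crossed product.\<close>

locale hopf_bimodule_data = finite_hopf_algebra K H + M: bimodule_over K H M
  for K :: "('k, 'r) ring_scheme" (structure) and H :: "('k, 'h, 'y) hopf_scheme" (structure)
    and M :: "('k, 'h, 'm) hopf_bimodule" +
  assumes lcoact_lin: "linear_map K M (tensor_module K H M) (lcoact M)"
    and rcoact_lin: "linear_map K M (tensor_module K M H) (rcoact M)"
    and invol_lin: "linear_map K M M (invol M)"
begin

section \<open>Sweedler sums and operators of the two coactions\<close>

abbreviation lsw where "lsw X m f \<equiv> tensor_lift K X f (lcoact M m)"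
abbreviation rsw where "rsw X m f \<equiv> tensor_lift K X f (rcoact M m)"

definition Rop where "Rop \<alpha> m = rsw M m (\<lambda>n x. \<alpha> x \<odot>\<^bsub>M\<^esub> n)"
definition Lop where "Lop \<beta> m = lsw M m (\<lambda>x n. \<beta> x \<odot>\<^bsub>M\<^esub> n)"

lemma module_M [simp, intro]: "module K M"
  by (rule M.module_axioms)

lemma lcoact_closed: "m \<in> carrier M \<Longrightarrow> lcoact M m \<in> carrier (tensor_module K H M)"
  by (rule linear_map_closed[OF lcoact_lin])

lemma rcoact_closed: "m \<in> carrier M \<Longrightarrow> rcoact M m \<in> carrier (tensor_module K M H)"
  by (rule linear_map_closed[OF rcoact_lin])

lemma invol_closed: "m \<in> carrier M \<Longrightarrow> invol M m \<in> carrier M"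
  by (rule linear_map_closed[OF invol_lin])

lemma lact_closed: "h \<in> carrier H \<Longrightarrow> m \<in> carrier M \<Longrightarrow> lact M h m \<in> carrier M"
  by (rule linear_map_closed[OF M.lact_linear])

lemma ract_closed: "h \<in> carrier H \<Longrightarrow> m \<in> carrier M \<Longrightarrow> ract M m h \<in> carrier M"
  by (rule linear_map_closed[OF M.ract_linear])

lemma lsw_closed:
  "\<lbrakk>module K X; m \<in> carrier M; \<And>x n. x \<in> carrier H \<Longrightarrow> n \<in> carrier M \<Longrightarrow> f x n \<in> carrier X\<rbrakk>
    \<Longrightarrow> lsw X m f \<in> carrier X"
  by (rule K.tensor_lift_closed[OF module_H module_M _ lcoact_closed])

lemma rsw_closed:
  "\<lbrakk>module K X; m \<in> carrier M; \<And>n x. n \<in> carrier M \<Longrightarrow> x \<in> carrier H \<Longrightarrow> f n x \<in> carrier X\<rbrakk>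
    \<Longrightarrow> rsw X m f \<in> carrier X"
  by (rule K.tensor_lift_closed[OF module_M module_H _ rcoact_closed])

lemma lsw_cong:
  "\<lbrakk>module K X; m \<in> carrier M; \<And>x n. x \<in> carrier H \<Longrightarrow> n \<in> carrier M \<Longrightarrow> f x n = g x n;
    \<And>x n. x \<in> carrier H \<Longrightarrow> n \<in> carrier M \<Longrightarrow> g x n \<in> carrier X\<rbrakk>
    \<Longrightarrow> lsw X m f = lsw X m g"
  by (rule K.tensor_lift_cong[OF module_H module_M _ lcoact_closed])

lemma rsw_cong:
  "\<lbrakk>module K X; m \<in> carrier M; \<And>n x. n \<in> carrier M \<Longrightarrow> x \<in> carrier H \<Longrightarrow> f n x = g n x;
    \<And>n x. n \<in> carrier M \<Longrightarrow> x \<in> carrier H \<Longrightarrow> g n x \<in> carrier X\<rbrakk>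
    \<Longrightarrow> rsw X m f = rsw X m g"
  by (rule K.tensor_lift_cong[OF module_M module_H _ rcoact_closed])

lemma lsw_hom:
  "\<lbrakk>linear_map K X Y L; module K X; module K Y; m \<in> carrier M;
    \<And>x n. x \<in> carrier H \<Longrightarrow> n \<in> carrier M \<Longrightarrow> f x n \<in> carrier X\<rbrakk>
    \<Longrightarrow> L (lsw X m f) = lsw Y m (\<lambda>x n. L (f x n))"
  by (rule K.tensor_lift_hom[OF module_H module_M _ _ lcoact_closed])

lemma rsw_hom:
  "\<lbrakk>linear_map K X Y L; module K X; module K Y; m \<in> carrier M;
    \<And>n x. n \<in> carrier M \<Longrightarrow> x \<in> carrier H \<Longrightarrow> f n x \<in> carrier X\<rbrakk>
    \<Longrightarrow> L (rsw X m f) = rsw Y m (\<lambda>n x. L (f n x))"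
  by (rule K.tensor_lift_hom[OF module_M module_H _ _ rcoact_closed])

lemma lin_lsw:
  "\<lbrakk>linear_map K V M A; module K X; bilinear_map K H M X f\<rbrakk> \<Longrightarrow> linear_map K V X (\<lambda>v. lsw X (A v) f)"
  by (rule linear_map_compose[OF K.linear_map_tensor_lift[OF module_H module_M] linear_map_compose[OF lcoact_lin]])

lemma lin_rsw:
  "\<lbrakk>linear_map K V M A; module K X; bilinear_map K M H X f\<rbrakk> \<Longrightarrow> linear_map K V X (\<lambda>v. rsw X (A v) f)"
  by (rule linear_map_compose[OF K.linear_map_tensor_lift[OF module_M module_H] linear_map_compose[OF rcoact_lin]])

lemma lin_lsw_param:
  "\<lbrakk>module K X; m \<in> carrier M; \<And>x n. x \<in> carrier H \<Longrightarrow> n \<in> carrier M \<Longrightarrow> linear_map K V X (\<lambda>v. f v x n)\<rbrakk>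
    \<Longrightarrow> linear_map K V X (\<lambda>v. lsw X m (f v))"
  by (rule K.linear_map_tensor_lift_param[OF module_H module_M _ lcoact_closed])

lemma lin_rsw_param:
  "\<lbrakk>module K X; m \<in> carrier M; \<And>n x. n \<in> carrier M \<Longrightarrow> x \<in> carrier H \<Longrightarrow> linear_map K V X (\<lambda>v. f v n x)\<rbrakk>
    \<Longrightarrow> linear_map K V X (\<lambda>v. rsw X m (f v))"
  by (rule K.linear_map_tensor_lift_param[OF module_M module_H _ rcoact_closed])

lemma lin_lact_left: "linear_map K V H A \<Longrightarrow> m \<in> carrier M \<Longrightarrow> linear_map K V M (\<lambda>v. lact M (A v) m)"
  by (rule linear_map_compose[OF M.lact_linear'])

lemma lin_lact_right: "linear_map K V M A \<Longrightarrow> h \<in> carrier H \<Longrightarrow> linear_map K V M (\<lambda>v. lact M h (A v))"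
  by (rule linear_map_compose[OF M.lact_linear])

lemma lin_ract_right: "linear_map K V H A \<Longrightarrow> m \<in> carrier M \<Longrightarrow> linear_map K V M (\<lambda>v. ract M m (A v))"
  by (rule linear_map_compose[OF M.ract_linear'])

lemma lin_ract_left: "linear_map K V M A \<Longrightarrow> h \<in> carrier H \<Longrightarrow> linear_map K V M (\<lambda>v. ract M (A v) h)"
  by (rule linear_map_compose[OF M.ract_linear])

lemma Rop_eq: "Rop \<alpha> m = pairR M \<alpha> (rcoact M m)"
  by (simp add: Rop_def pairR_def)

lemma Lop_eq: "Lop \<alpha> m = pairL M \<alpha> (lcoact M m)"
  by (simp add: Lop_def pairL_def)

lemma lin_Rop_right: "linear_map K V M A \<Longrightarrow> \<alpha> \<in> carrier Hd \<Longrightarrow> linear_map K V M (\<lambda>v. Rop \<alpha> (A v))"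
  unfolding Rop_eq by (intro linear_map_compose[OF pairR_linear] linear_map_compose[OF rcoact_lin] module_M)

lemma lin_Lop_right: "linear_map K V M A \<Longrightarrow> \<alpha> \<in> carrier Hd \<Longrightarrow> linear_map K V M (\<lambda>v. Lop \<alpha> (A v))"
  unfolding Lop_eq by (intro linear_map_compose[OF pairL_linear] linear_map_compose[OF lcoact_lin] module_M)

lemma lin_Rop_left: "linear_map K V Hd A \<Longrightarrow> m \<in> carrier M \<Longrightarrow> linear_map K V M (\<lambda>v. Rop (A v) m)"
  unfolding Rop_def by (intro lin_rsw_param linear_map_scalar_fun linear_map_compose[OF lin_app] module_M)

lemma lin_Lop_left: "linear_map K V Hd A \<Longrightarrow> m \<in> carrier M \<Longrightarrow> linear_map K V M (\<lambda>v. Lop (A v) m)"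
  unfolding Lop_def by (intro lin_lsw_param linear_map_scalar_fun linear_map_compose[OF lin_app] module_M)

lemma Rop_closed: "\<alpha> \<in> carrier Hd \<Longrightarrow> m \<in> carrier M \<Longrightarrow> Rop \<alpha> m \<in> carrier M"
  by (rule linear_map_closed[OF lin_Rop_right[OF linear_map_id]])

lemma Lop_closed: "\<alpha> \<in> carrier Hd \<Longrightarrow> m \<in> carrier M \<Longrightarrow> Lop \<alpha> m \<in> carrier M"
  by (rule linear_map_closed[OF lin_Lop_right[OF linear_map_id]])

lemmas mlins = tlins module_M lsw_closed rsw_closed lin_lsw lin_rsw lin_lsw_param lin_rsw_param
  lin_lact_left lin_lact_right lin_ract_left lin_ract_right lin_Rop_left lin_Rop_right lin_Lop_left lin_Lop_right
  Rop_closed Lop_closed lact_closed ract_closed invol_closed linear_map_compose[OF invol_lin]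

lemma Rop_tensor: assumes "\<alpha> \<in> carrier Hd" "m \<in> carrier M" "linear_map K M X L" "module K X"
  shows "rsw X m (\<lambda>n x. \<alpha> x \<odot>\<^bsub>X\<^esub> L n) = L (Rop \<alpha> m)"
proof -
  note l = mlins dual_app_closed[OF assms(1)] linear_map_closed[OF assms(3)] assms
  have "L (Rop \<alpha> m) = rsw X m (\<lambda>n x. L (\<alpha> x \<odot>\<^bsub>M\<^esub> n))"
    unfolding Rop_def by (rule rsw_hom) (assumption | rule l)+
  also have "\<dots> = rsw X m (\<lambda>n x. \<alpha> x \<odot>\<^bsub>X\<^esub> L n)"
    by (rule rsw_cong) (assumption | rule l linear_map_smult[OF assms(3)])+
  finally show ?thesis ..
qed

lemma Lop_tensor: assumes "\<alpha> \<in> carrier Hd" "m \<in> carrier M" "linear_map K M X L" "module K X"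
  shows "lsw X m (\<lambda>x n. \<alpha> x \<odot>\<^bsub>X\<^esub> L n) = L (Lop \<alpha> m)"
proof -
  note l = mlins dual_app_closed[OF assms(1)] linear_map_closed[OF assms(3)] assms
  have "L (Lop \<alpha> m) = lsw X m (\<lambda>x n. L (\<alpha> x \<odot>\<^bsub>M\<^esub> n))"
    unfolding Lop_def by (rule lsw_hom) (assumption | rule l)+
  also have "\<dots> = lsw X m (\<lambda>x n. \<alpha> x \<odot>\<^bsub>X\<^esub> L n)"
    by (rule lsw_cong) (assumption | rule l linear_map_smult[OF assms(3)])+
  finally show ?thesis ..
qed

section \<open>The coaction axioms as relations between the operators \<open>Lop\<close> and
  \<open>Rop\<close>\<close>

lemma lcoact_counit_iff:
  assumes "m \<in> carrier M"
  shows "tensor_lift K M (\<lambda>x n. counit H x \<odot>\<^bsub>M\<^esub> n) (lcoact M m) = m \<longleftrightarrow> Lop \<one>\<^bsub>Hd\<^esub> m = m"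
proof -
  have "lsw M m (\<lambda>x n. counit H x \<odot>\<^bsub>M\<^esub> n) = Lop \<one>\<^bsub>Hd\<^esub> m"
    unfolding Lop_def using assms dual_app_closed[OF dual_one_closed] by (intro lsw_cong) auto
  then show ?thesis by simp
qed

lemma rcoact_counit_iff:
  assumes "m \<in> carrier M"
  shows "tensor_lift K M (\<lambda>n x. counit H x \<odot>\<^bsub>M\<^esub> n) (rcoact M m) = m \<longleftrightarrow> Rop \<one>\<^bsub>Hd\<^esub> m = m"
proof -
  have "rsw M m (\<lambda>n x. counit H x \<odot>\<^bsub>M\<^esub> n) = Rop \<one>\<^bsub>Hd\<^esub> m"
    unfolding Rop_def using assms dual_app_closed[OF dual_one_closed] by (intro rsw_cong) auto
  then show ?thesis by simp
qed

lemma dual_mult_smult: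
  assumes "\<alpha> \<in> carrier Hd" "\<beta> \<in> carrier Hd" "x \<in> carrier H" "n \<in> carrier M"
  shows "sw M x (\<lambda>a b. \<alpha> a \<odot>\<^bsub>M\<^esub> (\<beta> b \<odot>\<^bsub>M\<^esub> n)) = (\<alpha> \<star> \<beta>) x \<odot>\<^bsub>M\<^esub> n"
proof -
  note l = mlins dual_app_closed[OF assms(1)] dual_app_closed[OF assms(2)] assms
  have "(\<alpha> \<star> \<beta>) x \<odot>\<^bsub>M\<^esub> n = sw M x (\<lambda>a b. (\<alpha> a \<otimes> \<beta> b) \<odot>\<^bsub>M\<^esub> n)"
    unfolding dual_mult[OF assms(3)] by (rule sw_hom[where L = "\<lambda>z. z \<odot>\<^bsub>M\<^esub> n"]) (assumption | rule l)+
  also have "\<dots> = sw M x (\<lambda>a b. \<alpha> a \<odot>\<^bsub>M\<^esub> (\<beta> b \<odot>\<^bsub>M\<^esub> n))"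
    by (rule sw_cong) (assumption | rule l M.smult_assoc1)+
  finally show ?thesis ..
qed

text \<open>Both \<open>H\<close>-legs are contracted with functionals, and such contractions
  separate tensors. In the iterated coaction the outer leg stands left of the inner one, so the
  operator of \<beta> is applied before that of \<beta>' and \<open>Lop\<close> is a right
  action.\<close>

lemma lcoact_coassoc_iff:
  assumes m: "m \<in> carrier M"
  shows "tensor_lift K (tensor_module3 K H H M)
        (\<lambda>x n. sweedler2 K H (tensor_module3 K H H M) x (\<lambda>x1 x2. tens3 K H H M x1 x2 n))
        (lcoact M m) =
      tensor_lift K (tensor_module3 K H H M)
        (\<lambda>x n. tensor_lift K (tensor_module3 K H H M) (\<lambda>y p. tens3 K H H M x y p) (lcoact M n))
        (lcoact M m) \<longleftrightarrow> (\<forall>\<beta>\<in>carrier Hd. \<forall>\<beta>'\<in>carrier Hd. Lop \<beta>' (Lop \<beta> m) = Lop (\<beta> \<star> \<beta>') m)"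
    (is "?l = ?r \<longleftrightarrow> _")
proof -
  let ?T = "tensor_module3 K H H M" and ?T2 = "tensor_module K H M"
  note l = mlins m
  have cl: "?l \<in> carrier ?T" "?r \<in> carrier ?T" by (assumption | rule l)+
  have pair: "pairL M \<beta>' (pairL ?T2 \<beta> ?l) = Lop (\<beta> \<star> \<beta>') m" (is ?A)
    "pairL M \<beta>' (pairL ?T2 \<beta> ?r) = Lop \<beta>' (Lop \<beta> m)" (is ?B)
    if b: "\<beta> \<in> carrier Hd" "\<beta>' \<in> carrier Hd" for \<beta> \<beta>'
  proof -
    let ?P = "\<lambda>t. pairL M \<beta>' (pairL ?T2 \<beta> t)"
    note l = l b dual_app_closed[OF b(1)] dual_app_closed[OF b(2)]
    have P: "linear_map K ?T M ?P"
      using b by (intro linear_map_compose[OF pairL_linear pairL_linear]) auto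
    have Pt: "?P (tens3 K H H M x y p) = \<beta> x \<odot>\<^bsub>M\<^esub> (\<beta>' y \<odot>\<^bsub>M\<^esub> p)"
      if "x \<in> carrier H" "y \<in> carrier H" "p \<in> carrier M" for x y p
    proof -
      have "pairL ?T2 \<beta> (tens3 K H H M x y p) = \<beta> x \<odot>\<^bsub>?T2\<^esub> tens K H M y p"
        using b that by (intro pairL_tens) auto
      then show ?thesis
        using b that dual_app_closed[OF b(1)]
        by (simp add: linear_map_smult[OF pairL_linear[OF module_M b(2)]] pairL_tens)
    qed
    have "?P ?l = lsw M m (\<lambda>x n. sw M x (\<lambda>x1 x2. \<beta> x1 \<odot>\<^bsub>M\<^esub> (\<beta>' x2 \<odot>\<^bsub>M\<^esub> n)))"
      using m
      apply (subst lsw_hom[OF P])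
          apply (assumption | rule l)+
      apply (intro lsw_cong module_M, assumption)
       apply (subst sw_hom[OF P])
           apply (assumption | rule l)+
       apply (intro sw_cong module_M, assumption)
        apply (simp only: Pt)
       apply (assumption | rule l)+
      done
    also have "\<dots> = lsw M m (\<lambda>x n. (\<beta> \<star> \<beta>') x \<odot>\<^bsub>M\<^esub> n)"
      using b by (intro lsw_cong dual_mult_smult m module_M) (assumption | rule l dual_app_closed[OF dual_mult_closed])+
    finally show ?A unfolding Lop_def .
    have "?P ?r = lsw M m (\<lambda>x n. lsw M n (\<lambda>y p. \<beta> x \<odot>\<^bsub>M\<^esub> (\<beta>' y \<odot>\<^bsub>M\<^esub> p)))"
      using m
      apply (subst lsw_hom[OF P])
          apply (assumption | rule l)+
      apply (intro lsw_cong module_M, assumption)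
       apply (subst lsw_hom[OF P])
           apply (assumption | rule l)+
       apply (intro lsw_cong module_M, assumption)
        apply (simp only: Pt)
       apply (assumption | rule l)+
      done
    also have "\<dots> = lsw M m (\<lambda>x n. \<beta> x \<odot>\<^bsub>M\<^esub> Lop \<beta>' n)"
    proof (intro lsw_cong module_M m)
      fix x n assume xn: "x \<in> carrier H" "n \<in> carrier M"
      then show "lsw M n (\<lambda>y p. \<beta> x \<odot>\<^bsub>M\<^esub> (\<beta>' y \<odot>\<^bsub>M\<^esub> p)) = \<beta> x \<odot>\<^bsub>M\<^esub> Lop \<beta>' n"
        unfolding Lop_def by (intro lsw_hom[where L = "\<lambda>z. \<beta> x \<odot>\<^bsub>M\<^esub> z", symmetric]) (assumption | rule l)+
    qed (assumption | rule l)+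
    also have "\<dots> = Lop \<beta>' (Lop \<beta> m)" by (rule Lop_tensor) (assumption | rule l)+
    finally show ?B .
  qed
  show ?thesis
  proof
    assume "?l = ?r"
    then show "\<forall>\<beta>\<in>carrier Hd. \<forall>\<beta>'\<in>carrier Hd. Lop \<beta>' (Lop \<beta> m) = Lop (\<beta> \<star> \<beta>') m"
      by (metis (no_types) pair)
  next
    assume *: "\<forall>\<beta>\<in>carrier Hd. \<forall>\<beta>'\<in>carrier Hd. Lop \<beta>' (Lop \<beta> m) = Lop (\<beta> \<star> \<beta>') m"
    show "?l = ?r"
      by (rule pairL_eqI[OF _ cl], (rule l)+, rule pairL_eqI,
        (assumption | rule l linear_map_closed[OF pairL_linear] cl)+) (simp only: pair *)
  qed
qed

end

context hopf_bimodule_data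
begin

text \<open>Here the inner coaction contributes the left one of the two \<open>H\<close>-legs, so
  the order of the product is kept and \<open>Rop\<close> is a left action.\<close>

lemma rcoact_coassoc_iff:
  assumes m: "m \<in> carrier M"
  shows "tensor_lift K (tensor_module3 K M H H)
        (\<lambda>n x. sweedler2 K H (tensor_module3 K M H H) x (\<lambda>x1 x2. tens3 K M H H n x1 x2))
        (rcoact M m) =
      tensor_lift K (tensor_module3 K M H H)
        (\<lambda>n x. tensor_lift K (tensor_module3 K M H H) (\<lambda>p y. tens3 K M H H p y x) (rcoact M n))
        (rcoact M m) \<longleftrightarrow> (\<forall>\<alpha>\<in>carrier Hd. \<forall>\<alpha>'\<in>carrier Hd. Rop \<alpha> (Rop \<alpha>' m) = Rop (\<alpha> \<star> \<alpha>') m)"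
    (is "?l = ?r \<longleftrightarrow> _")
proof -
  let ?T = "tensor_module3 K M H H"
  note l = mlins m
  have cl: "?l \<in> carrier ?T" "?r \<in> carrier ?T" by (assumption | rule l)+
  have pair: "pairRR M \<alpha> \<alpha>' ?l = Rop (\<alpha> \<star> \<alpha>') m" (is ?A)
    "pairRR M \<alpha> \<alpha>' ?r = Rop \<alpha> (Rop \<alpha>' m)" (is ?B)
    if b: "\<alpha> \<in> carrier Hd" "\<alpha>' \<in> carrier Hd" for \<alpha> \<alpha>'
  proof -
    note l = l b dual_app_closed[OF b(1)] dual_app_closed[OF b(2)]
    note P = pairRR_linear[OF module_M b]
    note Pt = pairRR_tens[OF module_M b]
    have "pairRR M \<alpha> \<alpha>' ?l = rsw M m (\<lambda>n x. sw M x (\<lambda>x1 x2. \<alpha> x1 \<odot>\<^bsub>M\<^esub> (\<alpha>' x2 \<odot>\<^bsub>M\<^esub> n)))"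
      using m
      apply (subst rsw_hom[OF P])
          apply (assumption | rule l)+
      apply (intro rsw_cong module_M, assumption)
       apply (subst sw_hom[OF P])
           apply (assumption | rule l)+
       apply (intro sw_cong module_M, assumption)
        apply (simp only: Pt)
       apply (assumption | rule l)+
      done
    also have "\<dots> = rsw M m (\<lambda>n x. (\<alpha> \<star> \<alpha>') x \<odot>\<^bsub>M\<^esub> n)"
      using b by (intro rsw_cong dual_mult_smult m module_M) (assumption | rule l dual_app_closed[OF dual_mult_closed])+
    finally show ?A unfolding Rop_def .
    have "pairRR M \<alpha> \<alpha>' ?r = rsw M m (\<lambda>n x. rsw M n (\<lambda>p y. \<alpha> y \<odot>\<^bsub>M\<^esub> (\<alpha>' x \<odot>\<^bsub>M\<^esub> p)))"
      using m
      apply (subst rsw_hom[OF P])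
          apply (assumption | rule l)+
      apply (intro rsw_cong module_M, assumption)
       apply (subst rsw_hom[OF P])
           apply (assumption | rule l)+
       apply (intro rsw_cong module_M, assumption)
        apply (simp only: Pt)
       apply (assumption | rule l)+
      done
    also have "\<dots> = rsw M m (\<lambda>n x. \<alpha>' x \<odot>\<^bsub>M\<^esub> Rop \<alpha> n)"
    proof (intro rsw_cong module_M m)
      fix n x assume xn: "n \<in> carrier M" "x \<in> carrier H"
      show "rsw M n (\<lambda>p y. \<alpha> y \<odot>\<^bsub>M\<^esub> (\<alpha>' x \<odot>\<^bsub>M\<^esub> p)) = \<alpha>' x \<odot>\<^bsub>M\<^esub> Rop \<alpha> n"
        by (rule Rop_tensor) (assumption | rule l xn)+
    qed (assumption | rule l)+
    also have "\<dots> = Rop \<alpha> (Rop \<alpha>' m)" by (rule Rop_tensor) (assumption | rule l)+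
    finally show ?B .
  qed
  show ?thesis
  proof
    assume "?l = ?r"
    then show "\<forall>\<alpha>\<in>carrier Hd. \<forall>\<alpha>'\<in>carrier Hd. Rop \<alpha> (Rop \<alpha>' m) = Rop (\<alpha> \<star> \<alpha>') m"
      by (metis (no_types) pair)
  next
    assume *: "\<forall>\<alpha>\<in>carrier Hd. \<forall>\<alpha>'\<in>carrier Hd. Rop \<alpha> (Rop \<alpha>' m) = Rop (\<alpha> \<star> \<alpha>') m"
    show "?l = ?r"
      by (rule pairRR_eqI[OF module_M cl]) (simp only: pair *)
  qed
qed

abbreviation "HMH \<equiv> tensor_module3 K H M H"

text \<open>The left leg is contracted before the right one because the brackets are H \<otimes> (M
  \<otimes> H).\<close>

definition pair3 where "pair3 \<beta> \<alpha> t = pairR M \<alpha> (pairL (tensor_module K M H) \<beta> t)"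

lemma pair3_linear: "\<beta> \<in> carrier Hd \<Longrightarrow> \<alpha> \<in> carrier Hd \<Longrightarrow> linear_map K HMH M (pair3 \<beta> \<alpha>)"
  unfolding pair3_def[abs_def] by (intro linear_map_compose[OF pairR_linear pairL_linear]) auto

lemma pair3_tens:
  assumes "\<beta> \<in> carrier Hd" "\<alpha> \<in> carrier Hd" "x \<in> carrier H" "n \<in> carrier M" "y \<in> carrier H"
  shows "pair3 \<beta> \<alpha> (tens3 K H M H x n y) = \<beta> x \<odot>\<^bsub>M\<^esub> (\<alpha> y \<odot>\<^bsub>M\<^esub> n)"
proof -
  have "pairL (tensor_module K M H) \<beta> (tens3 K H M H x n y) = \<beta> x \<odot>\<^bsub>tensor_module K M H\<^esub> tens K M H n y"
    using assms by (intro pairL_tens) auto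
  then show ?thesis
    unfolding pair3_def using assms dual_app_closed[OF assms(1)]
    by (simp add: linear_map_smult[OF pairR_linear[OF module_M assms(2)]] pairR_tens)
qed

lemma pair3_eqI:
  assumes "s \<in> carrier HMH" "t \<in> carrier HMH"
    and "\<And>\<alpha> \<beta>. \<alpha> \<in> carrier Hd \<Longrightarrow> \<beta> \<in> carrier Hd \<Longrightarrow> pair3 \<beta> \<alpha> s = pair3 \<beta> \<alpha> t"
  shows "s = t"
  by (rule pairL_eqI[OF _ assms(1,2)], (rule mlins)+, rule pairR_eqI,
        (assumption | rule mlins linear_map_closed[OF pairL_linear] assms(1,2))+)
     (rule assms(3)[unfolded pair3_def]; assumption)

lemma bisweedler_closed:
  assumes "module K X" "m \<in> carrier M"
    "\<And>x n y. \<lbrakk>x \<in> carrier H; n \<in> carrier M; y \<in> carrier H\<rbrakk> \<Longrightarrow> f x n y \<in> carrier X"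
  shows "bisweedler K M X m f \<in> carrier X"
  unfolding bisweedler_def using assms by (intro lsw_closed rsw_closed)

lemma bisweedler_cong:
  assumes "module K X" "m \<in> carrier M"
    "\<And>x n y. \<lbrakk>x \<in> carrier H; n \<in> carrier M; y \<in> carrier H\<rbrakk> \<Longrightarrow> f x n y = g x n y"
    "\<And>x n y. \<lbrakk>x \<in> carrier H; n \<in> carrier M; y \<in> carrier H\<rbrakk> \<Longrightarrow> g x n y \<in> carrier X"
  shows "bisweedler K M X m f = bisweedler K M X m g"
  unfolding bisweedler_def using assms by (intro lsw_cong rsw_cong rsw_closed)

lemma bisweedler_hom:
  assumes L: "linear_map K X Y L" and "module K X" "module K Y" "m \<in> carrier M"
    and f: "\<And>x n y. \<lbrakk>x \<in> carrier H; n \<in> carrier M; y \<in> carrier H\<rbrakk> \<Longrightarrow> f x n y \<in> carrier X"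
  shows "L (bisweedler K M X m f) = bisweedler K M Y m (\<lambda>x n y. L (f x n y))"
proof -
  have "L (bisweedler K M X m f) = lsw Y m (\<lambda>x n. L (rsw X n (f x)))"
    unfolding bisweedler_def using assms by (intro lsw_hom[OF L] rsw_closed)
  also have "\<dots> = bisweedler K M Y m (\<lambda>x n y. L (f x n y))"
    unfolding bisweedler_def using assms
    by (intro lsw_cong rsw_hom[OF L] rsw_closed linear_map_closed[OF L])
  finally show ?thesis .
qed

text \<open>Contracting the outer legs of the two coactions leaves the two operators. The map \<phi>
  stands for whatever the axioms apply to the middle leg: the identity, a two-sided multiplication
  or the involution.\<close>

lemma bisweedler_ops:
  assumes "\<beta> \<in> carrier Hd" "\<alpha> \<in> carrier Hd" "m \<in> carrier M" "linear_map K M M \<phi>"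
  shows "bisweedler K M M m (\<lambda>x n y. \<beta> x \<odot>\<^bsub>M\<^esub> (\<alpha> y \<odot>\<^bsub>M\<^esub> \<phi> n)) = \<phi> (Rop \<alpha> (Lop \<beta> m))"
proof -
  note l = mlins assms dual_app_closed[OF assms(1)] dual_app_closed[OF assms(2)]
    linear_map_compose[OF assms(4)] linear_map_closed[OF assms(4)]
  have "bisweedler K M M m (\<lambda>x n y. \<beta> x \<odot>\<^bsub>M\<^esub> (\<alpha> y \<odot>\<^bsub>M\<^esub> \<phi> n)) = lsw M m (\<lambda>x n. \<beta> x \<odot>\<^bsub>M\<^esub> \<phi> (Rop \<alpha> n))"
    unfolding bisweedler_def
  proof (intro lsw_cong module_M assms)
    fix x n assume xn: "x \<in> carrier H" "n \<in> carrier M"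
    have "rsw M n (\<lambda>p y. \<beta> x \<odot>\<^bsub>M\<^esub> (\<alpha> y \<odot>\<^bsub>M\<^esub> \<phi> p)) = \<beta> x \<odot>\<^bsub>M\<^esub> rsw M n (\<lambda>p y. \<alpha> y \<odot>\<^bsub>M\<^esub> \<phi> p)"
      by (rule rsw_hom[where L = "\<lambda>z. \<beta> x \<odot>\<^bsub>M\<^esub> z", symmetric]) (assumption | rule l xn)+
    also have "rsw M n (\<lambda>p y. \<alpha> y \<odot>\<^bsub>M\<^esub> \<phi> p) = \<phi> (Rop \<alpha> n)"
      by (rule Rop_tensor) (assumption | rule l xn)+
    finally show "rsw M n (\<lambda>p y. \<beta> x \<odot>\<^bsub>M\<^esub> (\<alpha> y \<odot>\<^bsub>M\<^esub> \<phi> p)) = \<beta> x \<odot>\<^bsub>M\<^esub> \<phi> (Rop \<alpha> n)" .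
  qed (assumption | rule l)+
  also have "\<dots> = \<phi> (Rop \<alpha> (Lop \<beta> m))"
    by (rule Lop_tensor) (assumption | rule l)+
  finally show ?thesis .
qed

lemma lcoact_rcoact_iff:
  assumes m: "m \<in> carrier M"
  shows "tensor_lift K HMH
        (\<lambda>x n. tensor_lift K HMH (\<lambda>p y. tens3 K H M H x p y) (rcoact M n))
        (lcoact M m) =
      tensor_lift K HMH
        (\<lambda>n y. tensor_lift K HMH (\<lambda>x p. tens3 K H M H x p y) (lcoact M n))
        (rcoact M m) \<longleftrightarrow> (\<forall>\<alpha>\<in>carrier Hd. \<forall>\<beta>\<in>carrier Hd. Rop \<alpha> (Lop \<beta> m) = Lop \<beta> (Rop \<alpha> m))"
    (is "?l = ?r \<longleftrightarrow> _")
proof -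
  note l = mlins m
  have cl: "?l \<in> carrier HMH" "?r \<in> carrier HMH" by (assumption | rule l)+
  have pair: "pair3 \<beta> \<alpha> ?l = Rop \<alpha> (Lop \<beta> m)" (is ?A)
    "pair3 \<beta> \<alpha> ?r = Lop \<beta> (Rop \<alpha> m)" (is ?B)
    if b: "\<beta> \<in> carrier Hd" "\<alpha> \<in> carrier Hd" for \<alpha> \<beta>
  proof -
    note l = l b dual_app_closed[OF b(1)] dual_app_closed[OF b(2)]
    note P = pair3_linear[OF b]
    note Pt = pair3_tens[OF b]
    have "pair3 \<beta> \<alpha> ?l = bisweedler K M M m (\<lambda>x n y. \<beta> x \<odot>\<^bsub>M\<^esub> (\<alpha> y \<odot>\<^bsub>M\<^esub> n))"
      unfolding bisweedler_def using m
      apply (subst lsw_hom[OF P])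
          apply (assumption | rule l)+
      apply (intro lsw_cong module_M, assumption)
       apply (subst rsw_hom[OF P])
           apply (assumption | rule l)+
       apply (intro rsw_cong module_M, assumption)
        apply (simp only: Pt)
       apply (assumption | rule l)+
      done
    also have "\<dots> = Rop \<alpha> (Lop \<beta> m)"
      by (rule bisweedler_ops) (assumption | rule l)+
    finally show ?A .
    have "pair3 \<beta> \<alpha> ?r = rsw M m (\<lambda>n y. lsw M n (\<lambda>x p. \<beta> x \<odot>\<^bsub>M\<^esub> (\<alpha> y \<odot>\<^bsub>M\<^esub> p)))"
      using m
      apply (subst rsw_hom[OF P])
          apply (assumption | rule l)+
      apply (intro rsw_cong module_M, assumption)
       apply (subst lsw_hom[OF P])
           apply (assumption | rule l)+
       apply (intro lsw_cong module_M, assumption)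
        apply (simp only: Pt)
       apply (assumption | rule l)+
      done
    also have "\<dots> = rsw M m (\<lambda>n y. \<alpha> y \<odot>\<^bsub>M\<^esub> Lop \<beta> n)"
    proof (intro rsw_cong module_M m)
      fix n y assume ny: "n \<in> carrier M" "y \<in> carrier H"
      show "lsw M n (\<lambda>x p. \<beta> x \<odot>\<^bsub>M\<^esub> (\<alpha> y \<odot>\<^bsub>M\<^esub> p)) = \<alpha> y \<odot>\<^bsub>M\<^esub> Lop \<beta> n"
        by (rule Lop_tensor) (assumption | rule l ny)+
    qed (assumption | rule l)+
    also have "\<dots> = Lop \<beta> (Rop \<alpha> m)" by (rule Rop_tensor) (assumption | rule l)+
    finally show ?B .
  qed
  show ?thesis
  proof
    assume "?l = ?r"
    then show "\<forall>\<alpha>\<in>carrier Hd. \<forall>\<beta>\<in>carrier Hd. Rop \<alpha> (Lop \<beta> m) = Lop \<beta> (Rop \<alpha> m)"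
      by (metis (no_types) pair)
  next
    assume *: "\<forall>\<alpha>\<in>carrier Hd. \<forall>\<beta>\<in>carrier Hd. Rop \<alpha> (Lop \<beta> m) = Lop \<beta> (Rop \<alpha> m)"
    show "?l = ?r"
      by (rule pair3_eqI[OF cl]) (simp only: pair *)
  qed
qed

text \<open>The right side of the compatibility axiom after contraction: \<beta>(h_1 x g_1) is the
  value at x of a shifted functional, and likewise for \<alpha> with the inverse square of the
  antipode on the right. It has the shape of \<open>T_mult_cross\<close>.\<close>

definition cross_sum where
  "cross_sum \<alpha> \<beta> h g m = sw3 M h (\<lambda>h1 h2 h3. sw3 M g (\<lambda>g1 g2 g3.
    ract M (lact M h2 (Rop (dual_shift H \<alpha> h3 (antipode_inv2 H g3)) (Lop (dual_shift H \<beta> h1 g1) m))) g2))"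

lemma coact_act_iff:
  assumes gh: "g \<in> carrier H" "h \<in> carrier H" and m: "m \<in> carrier M"
  shows "bisweedler K M HMH (ract M (lact M h m) g) (\<lambda>x n y. tens3 K H M H x n y) =
      sweedler3 K H HMH h (\<lambda>h1 h2 h3.
        sweedler3 K H HMH g (\<lambda>g1 g2 g3.
          bisweedler K M HMH m (\<lambda>x n y.
            tens3 K H M H
              (h1 \<cdot> x \<cdot> g1)
              (ract M (lact M h2 n) g2)
              (h3 \<cdot> y \<cdot> antipode_inv2 H g3)))) \<longleftrightarrow>
    (\<forall>\<alpha>\<in>carrier Hd. \<forall>\<beta>\<in>carrier Hd. Rop \<alpha> (Lop \<beta> (ract M (lact M h m) g)) = cross_sum \<alpha> \<beta> h g m)"
    (is "?l = ?r \<longleftrightarrow> _")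
proof -
  note l = mlins m gh bisweedler_closed
  have cl: "?l \<in> carrier HMH" "?r \<in> carrier HMH" by (assumption | rule l)+
  have pair: "pair3 \<beta> \<alpha> ?l = Rop \<alpha> (Lop \<beta> (ract M (lact M h m) g))" (is ?A)
    "pair3 \<beta> \<alpha> ?r = cross_sum \<alpha> \<beta> h g m" (is ?B)
    if b: "\<beta> \<in> carrier Hd" "\<alpha> \<in> carrier Hd" for \<alpha> \<beta>
  proof -
    note l = l b dual_app_closed[OF b(1)] dual_app_closed[OF b(2)]
    note P = pair3_linear[OF b]
    note Pt = pair3_tens[OF b]
    have "pair3 \<beta> \<alpha> ?l = bisweedler K M M (ract M (lact M h m) g) (\<lambda>x n y. pair3 \<beta> \<alpha> (tens3 K H M H x n y))"
      by (rule bisweedler_hom[OF P]) (assumption | rule l)+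
    also have "\<dots> = bisweedler K M M (ract M (lact M h m) g) (\<lambda>x n y. \<beta> x \<odot>\<^bsub>M\<^esub> (\<alpha> y \<odot>\<^bsub>M\<^esub> n))"
      by (rule bisweedler_cong) (assumption | rule l Pt)+
    also have "\<dots> = Rop \<alpha> (Lop \<beta> (ract M (lact M h m) g))"
      by (rule bisweedler_ops) (assumption | rule l)+
    finally show ?A .
    have inner: "pair3 \<beta> \<alpha> (bisweedler K M HMH m (\<lambda>x n y. tens3 K H M H (h1 \<cdot> x \<cdot> g1)
              (ract M (lact M h2 n) g2) (h3 \<cdot> y \<cdot> antipode_inv2 H g3))) =
        ract M (lact M h2 (Rop (dual_shift H \<alpha> h3 (antipode_inv2 H g3)) (Lop (dual_shift H \<beta> h1 g1) m))) g2"
      if c: "h1 \<in> carrier H" "h2 \<in> carrier H" "h3 \<in> carrier H" "g1 \<in> carrier H" "g2 \<in> carrier H" "g3 \<in> carrier H"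
      for h1 h2 h3 g1 g2 g3
    proof -
      let ?b = "dual_shift H \<beta> h1 g1" and ?a = "dual_shift H \<alpha> h3 (antipode_inv2 H g3)"
      have ab: "?a \<in> carrier Hd" "?b \<in> carrier Hd" by (assumption | rule l c)+
      have "pair3 \<beta> \<alpha> (bisweedler K M HMH m (\<lambda>x n y. tens3 K H M H (h1 \<cdot> x \<cdot> g1)
              (ract M (lact M h2 n) g2) (h3 \<cdot> y \<cdot> antipode_inv2 H g3))) =
          bisweedler K M M m (\<lambda>x n y. pair3 \<beta> \<alpha> (tens3 K H M H (h1 \<cdot> x \<cdot> g1)
              (ract M (lact M h2 n) g2) (h3 \<cdot> y \<cdot> antipode_inv2 H g3)))"
        by (rule bisweedler_hom[OF P]) (assumption | rule l c)+
      also have "\<dots> = bisweedler K M M m (\<lambda>x n y. ?b x \<odot>\<^bsub>M\<^esub> (?a y \<odot>\<^bsub>M\<^esub> ract M (lact M h2 n) g2))"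
        by (rule bisweedler_cong, rule module_M, rule m, subst Pt)
          (assumption | rule l c dual_app_closed[OF ab(1)] dual_app_closed[OF ab(2)]
            | simp only: dual_shift_app)+
      also have "\<dots> = ract M (lact M h2 (Rop ?a (Lop ?b m))) g2"
        by (rule bisweedler_ops) (assumption | rule l c ab)+
      finally show ?thesis .
    qed
    show ?B
      unfolding cross_sum_def
      apply (subst sw3_hom[OF P])
          apply (assumption | rule l)+
      apply (intro sw3_cong module_M gh)
       apply (subst sw3_hom[OF P])
           apply (assumption | rule l)+
       apply (intro sw3_cong module_M gh)
        apply (rule inner; assumption)
       apply (assumption | rule l)+
      done
  qed
  show ?thesis
  proof
    assume "?l = ?r"
    then show "\<forall>\<alpha>\<in>carrier Hd. \<forall>\<beta>\<in>carrier Hd. Rop \<alpha> (Lop \<beta> (ract M (lact M h m) g)) = cross_sum \<alpha> \<beta> h g m"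
      by (metis (no_types) pair)
  next
    assume *: "\<forall>\<alpha>\<in>carrier Hd. \<forall>\<beta>\<in>carrier Hd. Rop \<alpha> (Lop \<beta> (ract M (lact M h m) g)) = cross_sum \<alpha> \<beta> h g m"
    show "?l = ?r"
      by (rule pair3_eqI[OF cl]) (simp only: pair *)
  qed
qed

text \<open>The axiom interchanges the outer legs, S(y) standing on the left and the inverse
  antipode of x on the right. Hence \<beta> composed with S contracts the right leg and \<alpha>
  composed with the inverse contracts the left one, which is the exchange built into
  \<open>T_auto\<close>.\<close>

lemma invol_coact_iff:
  assumes m: "m \<in> carrier M"
  shows "bisweedler K M HMH m (\<lambda>x n y. tens3 K H M H x (invol M n) y) =
      bisweedler K M HMH (invol M m)
        (\<lambda>x n y. tens3 K H M H (antipode H y) n (antipode_inv H x)) \<longleftrightarrow>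
    (\<forall>\<alpha>\<in>carrier Hd. \<forall>\<beta>\<in>carrier Hd. invol M (Rop \<alpha> (Lop \<beta> m)) =
      Rop (dual_comp H \<beta> (antipode H)) (Lop (dual_comp H \<alpha> (antipode_inv H)) (invol M m)))"
    (is "?l = ?r \<longleftrightarrow> _")
proof -
  note l = mlins m bisweedler_closed invol_lin
  have cl: "?l \<in> carrier HMH" "?r \<in> carrier HMH" by (assumption | rule l)+
  have pair: "pair3 \<beta> \<alpha> ?l = invol M (Rop \<alpha> (Lop \<beta> m))" (is ?A)
    "pair3 \<beta> \<alpha> ?r = Rop (dual_comp H \<beta> (antipode H)) (Lop (dual_comp H \<alpha> (antipode_inv H)) (invol M m))" (is ?B)
    if b: "\<beta> \<in> carrier Hd" "\<alpha> \<in> carrier Hd" for \<alpha> \<beta>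
  proof -
    note l = l b dual_app_closed[OF b(1)] dual_app_closed[OF b(2)]
    note P = pair3_linear[OF b]
    note Pt = pair3_tens[OF b]
    have "pair3 \<beta> \<alpha> ?l = bisweedler K M M m (\<lambda>x n y. pair3 \<beta> \<alpha> (tens3 K H M H x (invol M n) y))"
      by (rule bisweedler_hom[OF P]) (assumption | rule l)+
    also have "\<dots> = bisweedler K M M m (\<lambda>x n y. \<beta> x \<odot>\<^bsub>M\<^esub> (\<alpha> y \<odot>\<^bsub>M\<^esub> invol M n))"
      by (rule bisweedler_cong) (assumption | rule l Pt)+
    also have "\<dots> = invol M (Rop \<alpha> (Lop \<beta> m))"
      by (rule bisweedler_ops) (assumption | rule l)+
    finally show ?A .
    let ?b = "dual_comp H \<beta> (antipode H)" and ?a = "dual_comp H \<alpha> (antipode_inv H)"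
    have ab: "?a \<in> carrier Hd" "?b \<in> carrier Hd" by (assumption | rule l)+
    note abc = dual_app_closed[OF ab(1)] dual_app_closed[OF ab(2)]
    have "pair3 \<beta> \<alpha> ?r = bisweedler K M M (invol M m) (\<lambda>x n y. pair3 \<beta> \<alpha> (tens3 K H M H (antipode H y) n (antipode_inv H x)))"
      by (rule bisweedler_hom[OF P]) (assumption | rule l)+
    also have "\<dots> = bisweedler K M M (invol M m) (\<lambda>x n y. ?a x \<odot>\<^bsub>M\<^esub> (?b y \<odot>\<^bsub>M\<^esub> n))"
    proof (rule bisweedler_cong)
      fix x n y assume c: "x \<in> carrier H" "n \<in> carrier M" "y \<in> carrier H"
      show "pair3 \<beta> \<alpha> (tens3 K H M H (antipode H y) n (antipode_inv H x)) = ?a x \<odot>\<^bsub>M\<^esub> (?b y \<odot>\<^bsub>M\<^esub> n)"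
        using c l(1) abc[OF c(1)] abc[OF c(3)]
        by (simp add: Pt antipode_inv_closed dual_comp_app M.smult_assoc1[symmetric] K.m_comm
            dual_app_closed[OF b(1)] dual_app_closed[OF b(2)])
    qed (assumption | rule l abc)+
    also have "\<dots> = Rop ?b (Lop ?a (invol M m))"
      by (rule bisweedler_ops[where \<phi> = "\<lambda>n. n"]) (assumption | rule l)+
    finally show ?B .
  qed
  show ?thesis
  proof
    assume "?l = ?r"
    then show "\<forall>\<alpha>\<in>carrier Hd. \<forall>\<beta>\<in>carrier Hd. invol M (Rop \<alpha> (Lop \<beta> m)) =
      Rop (dual_comp H \<beta> (antipode H)) (Lop (dual_comp H \<alpha> (antipode_inv H)) (invol M m))"
      by (metis (no_types) pair)
  next
    assume *: "\<forall>\<alpha>\<in>carrier Hd. \<forall>\<beta>\<in>carrier Hd. invol M (Rop \<alpha> (Lop \<beta> m)) =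
      Rop (dual_comp H \<beta> (antipode H)) (Lop (dual_comp H \<alpha> (antipode_inv H)) (invol M m))"
    show "?l = ?r"
      by (rule pair3_eqI[OF cl]) (simp only: pair *)
  qed
qed

end

section \<open>From Hopf bimodules to modules\<close>

context finite_hopf_algebra
begin

text \<open>Written with \<open>pairR\<close> and \<open>pairL\<close> instead of \<open>Rop\<close>
  and \<open>Lop\<close>, so that it is available for any record, in particular for the one built
  from a module.\<close>

definition T_act where
  "T_act M t m = tensor_lift4 K M
    (\<lambda>g h \<alpha> \<beta>. ract M (lact M g (pairR M \<alpha> (rcoact M (pairL M \<beta> (lcoact M m))))) h) t"

end

context hopf_bimodule_data
begin

abbreviation "Tact \<equiv> T_act M"

lemma Tact_eq: "Tact t m = tensor_lift4 K M (\<lambda>g h \<alpha> \<beta>. ract M (lact M g (Rop \<alpha> (Lop \<beta> m))) h) t"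
  by (simp add: T_act_def Rop_eq Lop_eq)

lemma quadrilinear_Tact:
  "m \<in> carrier M \<Longrightarrow> quadrilinear_map K H H Hd Hd M (\<lambda>g h \<alpha> \<beta>. ract M (lact M g (Rop \<alpha> (Lop \<beta> m))) h)"
  by (assumption | rule mlins)+

lemma Tact_linear_left: "m \<in> carrier M \<Longrightarrow> linear_map K T M (\<lambda>t. Tact t m)"
  unfolding Tact_eq by (intro K.linear_map_tensor_lift4 module_H module_dual module_M quadrilinear_Tact)

lemma Tact_tens:
  "\<lbrakk>g \<in> carrier H; h \<in> carrier H; \<alpha> \<in> carrier Hd; \<beta> \<in> carrier Hd; m \<in> carrier M\<rbrakk>
    \<Longrightarrow> Tact (TT g h \<alpha> \<beta>) m = ract M (lact M g (Rop \<alpha> (Lop \<beta> m))) h"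
  unfolding Tact_eq by (intro K.tensor_lift4_tens module_H module_dual module_M quadrilinear_Tact)

lemma Tact_linear_right:
  assumes t: "t \<in> carrier T"
  shows "linear_map K M M (Tact t)"
  unfolding Tact_eq[abs_def]
  by (intro K.linear_map_tensor_lift4_param[OF module_H module_H module_dual module_dual module_M t])
    (assumption | rule mlins)+

lemma Tact_closed: "t \<in> carrier T \<Longrightarrow> m \<in> carrier M \<Longrightarrow> Tact t m \<in> carrier M"
  by (rule linear_map_closed[OF Tact_linear_left])

end

locale involutive_hopf_data = finite_hopf_algebra K H + I: involutive_hopf_bimodule K H M
  for K :: "('k, 'r) ring_scheme" (structure) and H :: "('k, 'h, 'y) hopf_scheme" (structure)
    and M :: "('k, 'h, 'm) hopf_bimodule"

sublocale involutive_hopf_data \<subseteq> hopf_bimodule_data K H M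
  by unfold_locales (rule I.lcoact_linear I.rcoact_linear I.invol_linear)+

context involutive_hopf_data
begin

lemma Lop_one: "m \<in> carrier M \<Longrightarrow> Lop \<one>\<^bsub>Hd\<^esub> m = m"
  using I.lcoact_counit lcoact_counit_iff by blast

lemma Rop_one: "m \<in> carrier M \<Longrightarrow> Rop \<one>\<^bsub>Hd\<^esub> m = m"
  using I.rcoact_counit rcoact_counit_iff by blast

lemma Lop_mult: "\<lbrakk>m \<in> carrier M; \<beta> \<in> carrier Hd; \<beta>' \<in> carrier Hd\<rbrakk> \<Longrightarrow> Lop (\<beta> \<star> \<beta>') m = Lop \<beta>' (Lop \<beta> m)"
  using I.lcoact_coassoc lcoact_coassoc_iff by metis

lemma Rop_mult: "\<lbrakk>m \<in> carrier M; \<beta> \<in> carrier Hd; \<beta>' \<in> carrier Hd\<rbrakk> \<Longrightarrow> Rop (\<beta> \<star> \<beta>') m = Rop \<beta> (Rop \<beta>' m)"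
  using I.rcoact_coassoc rcoact_coassoc_iff by metis

lemma Rop_Lop: "\<lbrakk>m \<in> carrier M; \<alpha> \<in> carrier Hd; \<beta> \<in> carrier Hd\<rbrakk> \<Longrightarrow> Rop \<alpha> (Lop \<beta> m) = Lop \<beta> (Rop \<alpha> m)"
  using I.lcoact_rcoact lcoact_rcoact_iff by metis

lemma cross: "\<lbrakk>m \<in> carrier M; g \<in> carrier H; h \<in> carrier H; \<alpha> \<in> carrier Hd; \<beta> \<in> carrier Hd\<rbrakk>
    \<Longrightarrow> Rop \<alpha> (Lop \<beta> (ract M (lact M h m) g)) = cross_sum \<alpha> \<beta> h g m"
  using iffD1[OF coact_act_iff I.coact_act] by blast

lemma invol_ops: "\<lbrakk>m \<in> carrier M; \<alpha> \<in> carrier Hd; \<beta> \<in> carrier Hd\<rbrakk> \<Longrightarrow> invol M (Rop \<alpha> (Lop \<beta> m)) =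
      Rop (dual_comp H \<beta> (antipode H)) (Lop (dual_comp H \<alpha> (antipode_inv H)) (invol M m))"
  using iffD1[OF invol_coact_iff I.invol_coact] by blast

lemma Tact_T1: "m \<in> carrier M \<Longrightarrow> Tact T1 m = m"
  by (simp only: Tact_tens A.one_closed dual_one_closed Lop_one Rop_one I.lact_one I.ract_one)

text \<open>The axiom in the form \<open>cross\<close> moves \<alpha> and \<beta> past
  \<open>k\<close> and \<open>l\<close>. After that the left multiplications, the right
  multiplications and the operators of each kind are adjacent and combine as in
  \<open>T_prod\<close>.\<close>

lemma Tact_mult_tens:
  assumes st: "g \<in> carrier H" "h \<in> carrier H" "\<alpha> \<in> carrier Hd" "\<beta> \<in> carrier Hd"
    "k \<in> carrier H" "l \<in> carrier H" "\<gamma> \<in> carrier Hd" "\<delta> \<in> carrier Hd" and m: "m \<in> carrier M"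
  shows "Tact (T_mult K H (TT g h \<alpha> \<beta>) (TT k l \<gamma> \<delta>)) m = Tact (TT g h \<alpha> \<beta>) (Tact (TT k l \<gamma> \<delta>) m)"
proof -
  note l' = mlins st m
  let ?n = "Rop \<gamma> (Lop \<delta> m)"
  have n: "?n \<in> carrier M" by (rule l')+
  let ?f = "\<lambda>k1 k2 k3 l1 l2 l3. ract M (lact M g
      (ract M (lact M k2 (Rop (dual_shift H \<alpha> k3 (antipode_inv2 H l3)) (Lop (dual_shift H \<beta> k1 l1) ?n))) l2)) h"
  have L: "linear_map K M M (\<lambda>z. ract M (lact M g z) h)" by (assumption | rule l')+
  have "Tact (TT g h \<alpha> \<beta>) (Tact (TT k l \<gamma> \<delta>) m) = ract M (lact M g (cross_sum \<alpha> \<beta> k l ?n)) h"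
    using st m n by (simp only: Tact_tens cross ract_closed lact_closed)
  also have "\<dots> = sw3 M k (\<lambda>k1 k2 k3. sw3 M l (\<lambda>l1 l2 l3. ?f k1 k2 k3 l1 l2 l3))"
    unfolding cross_sum_def
    apply (subst sw3_hom[OF L])
        apply (assumption | rule l')+
    apply (intro sw3_cong module_M st)
     apply (rule sw3_hom[OF L])
        apply (assumption | rule l')+
    done
  also have "\<dots> = sw3 M k (\<lambda>k1 k2 k3. sw3 M l (\<lambda>l1 l2 l3. Tact (TT (g \<cdot> k2) (l2 \<cdot> h)
        (dual_shift H \<alpha> k3 (antipode_inv2 H l3) \<star> \<gamma>) (\<delta> \<star> dual_shift H \<beta> k1 l1)) m))"
  proof (intro sw3_cong module_M st)
    fix k1 k2 k3 l1 l2 l3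
    assume kl: "k1 \<in> carrier H" "k2 \<in> carrier H" "k3 \<in> carrier H" "l1 \<in> carrier H" "l2 \<in> carrier H" "l3 \<in> carrier H"
    let ?a = "dual_shift H \<alpha> k3 (antipode_inv2 H l3)" and ?b = "dual_shift H \<beta> k1 l1"
    have ab: "?a \<in> carrier Hd" "?b \<in> carrier Hd" by (assumption | rule l' kl)+
    \<comment> \<open>Since \<open>Rop\<close> and \<open>Lop\<close> commute, the two functionals
      of each kind come together.\<close>
    have "Rop (?a \<star> \<gamma>) (Lop (\<delta> \<star> ?b) m) = Rop ?a (Lop ?b ?n)"
      using ab st m by (simp only: Rop_mult Lop_mult Rop_Lop Rop_closed Lop_closed)
    then have "Tact (TT (g \<cdot> k2) (l2 \<cdot> h) (?a \<star> \<gamma>) (\<delta> \<star> ?b)) m =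
        ract M (lact M (g \<cdot> k2) (Rop ?a (Lop ?b ?n))) (l2 \<cdot> h)"
      using ab st m kl by (simp only: Tact_tens A.m_closed dual_mult_closed)
    also have "\<dots> = ?f k1 k2 k3 l1 l2 l3"
      using ab st n kl
      by (simp only: I.lact_mult I.ract_mult I.lact_ract A.m_closed ract_closed lact_closed Rop_closed Lop_closed)
    finally show "?f k1 k2 k3 l1 l2 l3 = Tact (TT (g \<cdot> k2) (l2 \<cdot> h) (?a \<star> \<gamma>) (\<delta> \<star> ?b)) m" ..
  qed (assumption | rule l' Tact_closed)+
  also have "\<dots> = Tact (T_prod g h \<alpha> \<beta> k l \<gamma> \<delta>) m"
    unfolding T_prod_def
    apply (subst sw3_hom[OF Tact_linear_left[OF m]])
        apply (assumption | rule l')+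
    apply (intro sw3_cong module_M st)
     apply (rule sw3_hom[OF Tact_linear_left[OF m], symmetric])
        apply (assumption | rule l' linear_map_closed[OF Tact_linear_left[OF m]])+
    done
  finally show ?thesis using st by (simp only: T_mult_tens)
qed

lemma Tact_mult:
  assumes "s \<in> carrier T" "t \<in> carrier T" and m: "m \<in> carrier M"
  shows "Tact (T_mult K H s t) m = Tact s (Tact t m)"
proof (rule K.tensor4_map_eqI[OF module_H module_H module_dual module_dual module_M assms(1)])
  show "linear_map K T M (\<lambda>s. Tact (T_mult K H s t) m)"
    using assms by (intro linear_map_compose[OF Tact_linear_left T_mult_linear_left])
  show "linear_map K T M (\<lambda>s. Tact s (Tact t m))"
    using assms by (intro Tact_linear_left Tact_closed)
  fix g h \<alpha> \<beta> assume st: "g \<in> carrier H" "h \<in> carrier H" "\<alpha> \<in> carrier Hd" "\<beta> \<in> carrier Hd"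
  show "Tact (T_mult K H (TT g h \<alpha> \<beta>) t) m = Tact (TT g h \<alpha> \<beta>) (Tact t m)"
  proof (rule K.tensor4_map_eqI[OF module_H module_H module_dual module_dual module_M assms(2)])
    show "linear_map K T M (\<lambda>t. Tact (T_mult K H (TT g h \<alpha> \<beta>) t) m)"
      using st m by (intro linear_map_compose[OF Tact_linear_left T_mult_linear_right] T_tens_closed)
    show "linear_map K T M (\<lambda>t. Tact (TT g h \<alpha> \<beta>) (Tact t m))"
      using st m by (intro linear_map_compose[OF Tact_linear_right Tact_linear_left] T_tens_closed)
  qed (intro Tact_mult_tens st m)
qed

lemma invol_Tact:
  assumes t: "t \<in> carrier T" and m: "m \<in> carrier M"
  shows "invol M (Tact t m) = Tact (T_auto K H t) (invol M m)"
proof (rule K.tensor4_map_eqI[OF module_H module_H module_dual module_dual module_M t])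
  show "linear_map K T M (\<lambda>t. invol M (Tact t m))"
    using m by (intro linear_map_compose[OF invol_lin Tact_linear_left])
  show "linear_map K T M (\<lambda>t. Tact (T_auto K H t) (invol M m))"
    using m by (intro linear_map_compose[OF Tact_linear_left T_auto_linear] invol_closed)
  fix g h \<alpha> \<beta> assume st: "g \<in> carrier H" "h \<in> carrier H" "\<alpha> \<in> carrier Hd" "\<beta> \<in> carrier Hd"
  show "invol M (Tact (TT g h \<alpha> \<beta>) m) = Tact (T_auto K H (TT g h \<alpha> \<beta>)) (invol M m)"
    using st m
    by (simp only: Tact_tens T_auto_tens invol_ops I.invol_act Rop_closed Lop_closed invol_closed antipode_closed
        antipode_inv_closed dual_comp_closed antipode_linear antipode_inv_linear)
qed

end

section \<open>Change of record type over the same vector space\<close>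

lemma module_transfer:
  assumes "module K M" "carrier N = carrier M" "add N = add M" "zero N = zero M" "smult N = smult M"
  shows "module K N"
  by (rule module_surj_image[OF assms(1), where \<pi> = "\<lambda>x. x"]) (simp_all add: assms)

lemma linear_map_transfer:
  assumes "carrier V' = carrier V" "add V' = add V" "smult V' = smult V"
    "carrier W' = carrier W" "add W' = add W" "smult W' = smult W"
  shows "linear_map K V' W' f \<longleftrightarrow> linear_map K V W f"
  by (simp add: linear_map_def assms)

lemma finsum_transfer:
  "\<lbrakk>carrier V' = carrier V; add V' = add V; zero V' = zero V\<rbrakk> \<Longrightarrow> finsum V' = finsum V"
  by (rule ext, rule ext) (simp add: finsum_def finprod_def)

text \<open>The construction consults only carrier, addition and scalar multiplication. So the
  tensor spaces before and after a change of record are equal, not merely isomorphic, and coactions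
  can be compared for equality.\<close>

lemma tensor_transfer:
  assumes "carrier V' = carrier V" "add V' = add V" "smult V' = smult V"
    "carrier W' = carrier W" "add W' = add W" "smult W' = smult W"
  shows "tensor_module K V' W' = tensor_module K V W" "tens K V' W' = tens K V W"
  by (simp_all add: tensor_module_def tens_def[abs_def] tensor_null_def tensor_rels_def assms)

section \<open>The two maps on objects, and the module of a Hopf bimodule\<close>

context finite_hopf_algebra
begin

text \<open>A pair (a, b) stands for a + b q and q acts as the involution, so the second component
  acts after \<open>invol\<close>. The value off the domain is the one that normalised objects
  prescribe.\<close>

definition to_left_module :: "('k, 'h, 'm) hopf_bimodule \<Rightarrow> ('k, ('k, 'h) T_hat_elem, 'm) left_module" where
  "to_left_module M =
    \<lparr>carrier = carrier M, mult = mult M, one = one M, zero = zero M, add = add M, smult = smult M,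
     act = (\<lambda>s m. if s \<in> carrier TH \<and> m \<in> carrier M
       then T_act M (fst s) m \<oplus>\<^bsub>M\<^esub> T_act M (snd s) (invol M m) else undefined)\<rparr>"

text \<open>Elements of T act as pairs with second component zero. The coactions are rebuilt from
  the action of the \<open>coord b\<close> by the formulas of \<open>pairL_expand\<close> and
  \<open>pairR_expand\<close>.\<close>

definition to_hopf_bimodule :: "('k, ('k, 'h) T_hat_elem, 'm) left_module \<Rightarrow> ('k, 'h, 'm) hopf_bimodule" where
  "to_hopf_bimodule N = (let A = (\<lambda>t. act N (t, \<zero>\<^bsub>T\<^esub>)); e = \<one>\<^bsub>Hd\<^esub> in
    \<lparr>carrier = carrier N, mult = mult N, one = one N, zero = zero N, add = add N, smult = smult N,
     lact = (\<lambda>h m. if h \<in> carrier H \<and> m \<in> carrier N then A (TT h \<one>\<^bsub>H\<^esub> e e) m else undefined),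
     ract = (\<lambda>m h. if h \<in> carrier H \<and> m \<in> carrier N then A (TT \<one>\<^bsub>H\<^esub> h e e) m else undefined),
     lcoact = (\<lambda>m. if m \<in> carrier N
       then \<Oplus>\<^bsub>tensor_module K H N\<^esub>b\<in>hbasis. tens K H N b (A (TT \<one>\<^bsub>H\<^esub> \<one>\<^bsub>H\<^esub> e (coord b)) m) else undefined),
     rcoact = (\<lambda>m. if m \<in> carrier N
       then \<Oplus>\<^bsub>tensor_module K N H\<^esub>b\<in>hbasis. tens K N H (A (TT \<one>\<^bsub>H\<^esub> \<one>\<^bsub>H\<^esub> (coord b) e) m) b else undefined),
     invol = (\<lambda>m. if m \<in> carrier N then act N (\<zero>\<^bsub>T\<^esub>, T1) m else undefined)\<rparr>)"

lemma to_left_module_simps [simp]: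
  "carrier (to_left_module M) = carrier M" "add (to_left_module M) = add M" "zero (to_left_module M) = zero M"
  "smult (to_left_module M) = smult M" "mult (to_left_module M) = mult M" "one (to_left_module M) = one M"
  by (simp_all add: to_left_module_def)

lemma act_to_left_module: "s \<in> carrier T \<Longrightarrow> t \<in> carrier T \<Longrightarrow> m \<in> carrier M \<Longrightarrow>
    act (to_left_module M) (s, t) m = T_act M s m \<oplus>\<^bsub>M\<^esub> T_act M t (invol M m)"
  by (simp add: to_left_module_def T_hat_simps)

lemma to_hopf_bimodule_simps [simp]:
  "carrier (to_hopf_bimodule M) = carrier M" "add (to_hopf_bimodule M) = add M" "zero (to_hopf_bimodule M) = zero M"
  "smult (to_hopf_bimodule M) = smult M" "mult (to_hopf_bimodule M) = mult M" "one (to_hopf_bimodule M) = one M"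
  by (simp_all add: to_hopf_bimodule_def Let_def)

end

context hopf_bimodule_data
begin

lemmas carrier_simps = M.smult_r_distr M.add.m_ac M.add.m_closed M.smult_closed

lemma act_pure: "t \<in> carrier T \<Longrightarrow> m \<in> carrier M \<Longrightarrow> act (to_left_module M) (t, \<zero>\<^bsub>T\<^esub>) m = Tact t m"
proof -
  interpret T: module K T by (rule module_T)
  assume *: "t \<in> carrier T" "m \<in> carrier M"
  then show ?thesis
    using linear_map_zero[OF module_T module_M Tact_linear_left[OF invol_closed[OF *(2)]]]
    by (simp add: act_to_left_module Tact_closed)
qed

end

context involutive_hopf_data
begin

lemma act_invol: "m \<in> carrier M \<Longrightarrow> act (to_left_module M) (\<zero>\<^bsub>T\<^esub>, T1) m = invol M m"
proof -
  interpret T: module K T by (rule module_T)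
  assume *: "m \<in> carrier M"
  then show ?thesis
    using linear_map_zero[OF module_T module_M Tact_linear_left[OF *]]
    by (simp add: act_to_left_module T1_closed Tact_T1 invol_closed del: dual_simps)
qed

text \<open>Multiplicativity on pairs reduces to \<open>Tact_mult\<close> inside T and to
  \<open>invol_Tact\<close> for moving q past T; the square of q disappears by
  \<open>invol_invol\<close>.\<close>

lemma left_module_to_left_module: "left_module_over K TH (to_left_module M)"
proof -
  interpret T: module K T by (rule module_T)
    note Tl = linear_map_add[OF Tact_linear_left] linear_map_smult[OF Tact_linear_left]
  note Tr = linear_map_add[OF Tact_linear_right] linear_map_smult[OF Tact_linear_right]
  have mod: "module K (to_left_module M)" by (rule module_transfer[OF module_M]) simp_all
  have ax: "left_module_over_axioms K TH (to_left_module M)"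
  proof
    fix s m assume s: "s \<in> carrier TH" and "m \<in> carrier (to_left_module M)"
    then obtain a b where ab: "s = (a, b)" "a \<in> carrier T" "b \<in> carrier T" and m: "m \<in> carrier M"
      by (auto simp: T_hat_simps)
    show "act (to_left_module M) s m \<in> carrier (to_left_module M)"
      using ab m by (simp add: act_to_left_module Tact_closed invol_closed)
    fix x assume x: "x \<in> carrier K"
    show "act (to_left_module M) (x \<odot>\<^bsub>TH\<^esub> s) m = x \<odot>\<^bsub>to_left_module M\<^esub> act (to_left_module M) s m"
      using ab m x by (simp add: act_to_left_module T_hat_simps Tl Tact_closed invol_closed carrier_simps)
  next
    fix s t m assume "s \<in> carrier TH" "t \<in> carrier TH" and "m \<in> carrier (to_left_module M)"
    then obtain a b c d where ab: "s = (a, b)" "a \<in> carrier T" "b \<in> carrier T"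
      "t = (c, d)" "c \<in> carrier T" "d \<in> carrier T" and m: "m \<in> carrier M"
      by (auto simp: T_hat_simps)
    show "act (to_left_module M) (s \<oplus>\<^bsub>TH\<^esub> t) m =
        act (to_left_module M) s m \<oplus>\<^bsub>to_left_module M\<^esub> act (to_left_module M) t m"
      using ab m by (simp add: act_to_left_module T_hat_simps Tl Tact_closed invol_closed carrier_simps)
    \<comment> \<open>The crossed product relation q (c + d q) = \<sigma>(c) q + \<sigma>(d),
      applied to \<open>m\<close>.\<close>
    have x: "invol M (Tact c m \<oplus>\<^bsub>M\<^esub> Tact d (invol M m)) = Tact (T_auto K H c) (invol M m) \<oplus>\<^bsub>M\<^esub> Tact (T_auto K H d) m"
      using ab m by (simp add: linear_map_add[OF invol_lin] invol_Tact Tact_closed invol_closed I.invol_invol)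
    show "act (to_left_module M) (s \<otimes>\<^bsub>TH\<^esub> t) m = act (to_left_module M) s (act (to_left_module M) t m)"
      using ab m
      by (simp add: act_to_left_module T_hat_simps Tl Tr x Tact_closed invol_closed T_mult_closed T_auto_closed
          Tact_mult carrier_simps)
  next
    fix s assume "s \<in> carrier TH"
    then obtain a b where ab: "s = (a, b)" "a \<in> carrier T" "b \<in> carrier T" by (auto simp: T_hat_simps)
    have "linear_map K M M (\<lambda>m. Tact a m \<oplus>\<^bsub>M\<^esub> Tact b (invol M m))"
      using ab by (intro linear_map_add_fun linear_map_compose[OF Tact_linear_right invol_lin] Tact_linear_right module_M)
    then have "linear_map K M M (act (to_left_module M) s)"
      using ab linear_map_cong[OF module_M, of "act (to_left_module M) s" "\<lambda>m. Tact a m \<oplus>\<^bsub>M\<^esub> Tact b (invol M m)" M]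
      by (simp add: act_to_left_module)
    then show "linear_map K (to_left_module M) (to_left_module M) (act (to_left_module M) s)"
      by (subst linear_map_transfer[of _ M _ M]) simp_all
  next
    fix m assume "m \<in> carrier (to_left_module M)"
    then show "act (to_left_module M) \<one>\<^bsub>TH\<^esub> m = m"
      by (simp add: T_hat_simps act_pure T1_closed Tact_T1 del: dual_simps)
  qed
  show ?thesis by (intro left_module_over.intro mod ax)
qed

text \<open>On the domain the generators act by the original operations, and the expansion of a
  coaction in the basis returns it. Off the domain both sides are undefined because \<open>M\<close>
  is normalised.\<close>

lemma to_hopf_bimodule_to_left_module:
  assumes "normal_hopf_bimodule K H M"
  shows "to_hopf_bimodule (to_left_module M) = M"
proof (rule hopf_bimodule.equality)
  let ?N = "to_left_module M"
  note n = assms[unfolded normal_hopf_bimodule_def]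
  have und: "f x = undefined" if "f \<in> extensional A" "x \<notin> A" for f x A using that by (simp add: extensional_def)
  have TTc: "TT h \<one>\<^bsub>H\<^esub> \<one>\<^bsub>Hd\<^esub> \<one>\<^bsub>Hd\<^esub> \<in> carrier T" "TT \<one>\<^bsub>H\<^esub> h \<one>\<^bsub>Hd\<^esub> \<one>\<^bsub>Hd\<^esub> \<in> carrier T" if "h \<in> carrier H" for h
    using that by - (assumption | rule T_tens_closed dual_one_closed A.one_closed)+
  have TTd: "TT \<one>\<^bsub>H\<^esub> \<one>\<^bsub>H\<^esub> \<alpha> \<one>\<^bsub>Hd\<^esub> \<in> carrier T" "TT \<one>\<^bsub>H\<^esub> \<one>\<^bsub>H\<^esub> \<one>\<^bsub>Hd\<^esub> \<alpha> \<in> carrier T" if "\<alpha> \<in> carrier Hd" for \<alpha>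
    using that by - (assumption | rule T_tens_closed dual_one_closed A.one_closed)+
  have tm: "tensor_module K H ?N = tensor_module K H M" "tens K H ?N = tens K H M"
    "tensor_module K ?N H = tensor_module K M H" "tens K ?N H = tens K M H"
    by (rule tensor_transfer; simp)+
  show "lact (to_hopf_bimodule ?N) = lact M"
  proof (intro ext)
    fix h m
    show "lact (to_hopf_bimodule ?N) h m = lact M h m"
    proof (cases "h \<in> carrier H \<and> m \<in> carrier M")
      case True
      then have "Tact (TT h \<one>\<^bsub>H\<^esub> \<one>\<^bsub>Hd\<^esub> \<one>\<^bsub>Hd\<^esub>) m = lact M h m"
        by (simp only: Tact_tens A.one_closed dual_one_closed Lop_one Rop_one I.ract_one lact_closed)
      then show ?thesis using True by (simp add: to_hopf_bimodule_def Let_def act_pure TTc del: dual_simps)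
    next
      case False
      then show ?thesis using und[of "case_prod (lact M)" "carrier H \<times> carrier M" "(h, m)"] n
        by (auto simp: to_hopf_bimodule_def Let_def)
    qed
  qed
  show "ract (to_hopf_bimodule ?N) = ract M"
  proof (intro ext)
    fix h m
    show "ract (to_hopf_bimodule ?N) m h = ract M m h"
    proof (cases "h \<in> carrier H \<and> m \<in> carrier M")
      case True
      then have "Tact (TT \<one>\<^bsub>H\<^esub> h \<one>\<^bsub>Hd\<^esub> \<one>\<^bsub>Hd\<^esub>) m = ract M m h"
        by (simp only: Tact_tens A.one_closed dual_one_closed Lop_one Rop_one I.lact_one)
      then show ?thesis using True by (simp add: to_hopf_bimodule_def Let_def act_pure TTc del: dual_simps)
    next
      case False
      then show ?thesis using und[of "case_prod (ract M)" "carrier M \<times> carrier H" "(m, h)"] n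
        by (auto simp: to_hopf_bimodule_def Let_def)
    qed
  qed
  show "lcoact (to_hopf_bimodule ?N) = lcoact M"
  proof (rule ext)
    fix m
    show "lcoact (to_hopf_bimodule ?N) m = lcoact M m"
    proof (cases "m \<in> carrier M")
      case True
      interpret HM: module K "tensor_module K H M" by auto
      have "Tact (TT \<one>\<^bsub>H\<^esub> \<one>\<^bsub>H\<^esub> \<one>\<^bsub>Hd\<^esub> \<beta>) m = Lop \<beta> m" if "\<beta> \<in> carrier Hd" for \<beta>
        using True that
        by (simp only: Tact_tens A.one_closed dual_one_closed Rop_one I.lact_one I.ract_one Lop_closed)
      note op = this
      have "lcoact (to_hopf_bimodule ?N) m =
          (\<Oplus>\<^bsub>tensor_module K H M\<^esub>b\<in>hbasis. tens K H M b (act ?N (TT \<one>\<^bsub>H\<^esub> \<one>\<^bsub>H\<^esub> \<one>\<^bsub>Hd\<^esub> (coord b), \<zero>\<^bsub>T\<^esub>) m))"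
        using True by (simp add: to_hopf_bimodule_def Let_def tm del: dual_simps)
      also have "\<dots> = (\<Oplus>\<^bsub>tensor_module K H M\<^esub>b\<in>hbasis. tens K H M b (Lop (coord b) m))"
        using True
        by (intro HM.finsum_cong' refl Pi_I K.tens_closed Lop_closed coord_closed hbasis(2) module_H module_M)
          (simp_all only: act_pure TTd coord_closed op)
      finally have "lcoact (to_hopf_bimodule ?N) m =
          (\<Oplus>\<^bsub>tensor_module K H M\<^esub>b\<in>hbasis. tens K H M b (Lop (coord b) m))" .
      then show ?thesis unfolding Lop_eq using pairL_expand[OF module_M lcoact_closed[OF True]] by simp
    next
      case False
      then show ?thesis using und[of "lcoact M" "carrier M" m] n
        by (auto simp: to_hopf_bimodule_def Let_def)
    qed
  qed
  show "rcoact (to_hopf_bimodule ?N) = rcoact M"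
  proof (rule ext)
    fix m
    show "rcoact (to_hopf_bimodule ?N) m = rcoact M m"
    proof (cases "m \<in> carrier M")
      case True
      interpret MH: module K "tensor_module K M H" by auto
      have "Tact (TT \<one>\<^bsub>H\<^esub> \<one>\<^bsub>H\<^esub> \<beta> \<one>\<^bsub>Hd\<^esub>) m = Rop \<beta> m" if "\<beta> \<in> carrier Hd" for \<beta>
        using True that
        by (simp only: Tact_tens A.one_closed dual_one_closed Lop_one I.lact_one I.ract_one Rop_closed)
      note op = this
      have "rcoact (to_hopf_bimodule ?N) m =
          (\<Oplus>\<^bsub>tensor_module K M H\<^esub>b\<in>hbasis. tens K M H (act ?N (TT \<one>\<^bsub>H\<^esub> \<one>\<^bsub>H\<^esub> (coord b) \<one>\<^bsub>Hd\<^esub>, \<zero>\<^bsub>T\<^esub>) m) b)"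
        using True by (simp add: to_hopf_bimodule_def Let_def tm del: dual_simps)
      also have "\<dots> = (\<Oplus>\<^bsub>tensor_module K M H\<^esub>b\<in>hbasis. tens K M H (Rop (coord b) m) b)"
        using True
        by (intro MH.finsum_cong' refl Pi_I K.tens_closed Rop_closed coord_closed hbasis(2) module_H module_M)
          (simp_all only: act_pure TTd coord_closed op)
      finally have "rcoact (to_hopf_bimodule ?N) m =
          (\<Oplus>\<^bsub>tensor_module K M H\<^esub>b\<in>hbasis. tens K M H (Rop (coord b) m) b)" .
      then show ?thesis unfolding Rop_eq using pairR_expand[OF module_M rcoact_closed[OF True]] by simp
    next
      case False
      then show ?thesis using und[of "rcoact M" "carrier M" m] n
        by (auto simp: to_hopf_bimodule_def Let_def)
    qed
  qed
  show "invol (to_hopf_bimodule ?N) = invol M"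
  proof (rule ext)
    fix m
    show "invol (to_hopf_bimodule ?N) m = invol M m"
      using act_invol[of m] und[of "invol M" "carrier M" m] n
      by (cases "m \<in> carrier M") (auto simp: to_hopf_bimodule_def Let_def simp del: dual_simps)
  qed
qed simp_all

end

section \<open>From modules to Hopf bimodules\<close>

locale T_hat_module = finite_hopf_algebra K H + N: left_module_over K "T_hat K H" N
  for K :: "('k, 'r) ring_scheme" (structure) and H :: "('k, 'h, 'y) hopf_scheme" (structure)
    and N :: "('k, ('k, 'h) T_hat_elem, 'm) left_module"
begin

definition Ta where "Ta t n = act N (t, \<zero>\<^bsub>T\<^esub>) n"

definition q where "q n = act N (\<zero>\<^bsub>T\<^esub>, T1) n"

lemma module_N [simp, intro]: "module K N"
  by (rule N.module_axioms)

lemma T_zero_closed: "\<zero>\<^bsub>T\<^esub> \<in> carrier T"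
  using module_T by (meson abelian_group_def abelian_monoid.zero_closed module_def)

lemma hat_closed: "s \<in> carrier T \<Longrightarrow> t \<in> carrier T \<Longrightarrow> (s, t) \<in> carrier TH"
  by (simp add: T_hat_simps)

lemma Ta_linear_left:
  assumes "n \<in> carrier N"
  shows "linear_map K T N (\<lambda>t. Ta t n)"
proof -
  interpret T: module K T by (rule module_T)
  show ?thesis
  proof (rule linear_mapI)
    fix s t assume st: "s \<in> carrier T" "t \<in> carrier T"
    show "Ta (s \<oplus>\<^bsub>T\<^esub> t) n = Ta s n \<oplus>\<^bsub>N\<^esub> Ta t n"
      unfolding Ta_def using N.act_add_left[OF hat_closed hat_closed assms, OF st(1) T_zero_closed st(2) T_zero_closed]
      by (simp add: T_hat_simps)
  next
    fix a t assume "a \<in> carrier K" "t \<in> carrier T"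
    then show "Ta (a \<odot>\<^bsub>T\<^esub> t) n = a \<odot>\<^bsub>N\<^esub> Ta t n"
      unfolding Ta_def using N.act_smult_left[OF _ hat_closed assms, OF _ _ T_zero_closed, of a t]
      by (simp add: T_hat_simps)
  qed (simp add: Ta_def N.act_closed hat_closed T_zero_closed assms)
qed

lemma Ta_linear_right: "t \<in> carrier T \<Longrightarrow> linear_map K N N (Ta t)"
  unfolding Ta_def[abs_def] by (intro N.act_linear hat_closed T_zero_closed)

lemma Ta_closed: "t \<in> carrier T \<Longrightarrow> n \<in> carrier N \<Longrightarrow> Ta t n \<in> carrier N"
  by (rule linear_map_closed[OF Ta_linear_right])

lemma q_linear: "linear_map K N N q"
  unfolding q_def[abs_def] by (intro N.act_linear hat_closed T_zero_closed T1_closed)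

lemma q_closed: "n \<in> carrier N \<Longrightarrow> q n \<in> carrier N"
  by (rule linear_map_closed[OF q_linear])

lemma T_mult_zero: "t \<in> carrier T \<Longrightarrow> T_mult K H \<zero>\<^bsub>T\<^esub> t = \<zero>\<^bsub>T\<^esub>" "t \<in> carrier T \<Longrightarrow> T_mult K H t \<zero>\<^bsub>T\<^esub> = \<zero>\<^bsub>T\<^esub>"
  by (rule linear_map_zero[OF module_T module_T T_mult_linear_left]
      linear_map_zero[OF module_T module_T T_mult_linear_right]; assumption)+

lemma T_auto_zero: "T_auto K H \<zero>\<^bsub>T\<^esub> = \<zero>\<^bsub>T\<^esub>"
  by (rule linear_map_zero[OF module_T module_T T_auto_linear])

lemma T_add_zero: "t \<in> carrier T \<Longrightarrow> \<zero>\<^bsub>T\<^esub> \<oplus>\<^bsub>T\<^esub> t = t" "t \<in> carrier T \<Longrightarrow> t \<oplus>\<^bsub>T\<^esub> \<zero>\<^bsub>T\<^esub> = t"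
proof -
  interpret T: module K T by (rule module_T)
  show "t \<in> carrier T \<Longrightarrow> \<zero>\<^bsub>T\<^esub> \<oplus>\<^bsub>T\<^esub> t = t" "t \<in> carrier T \<Longrightarrow> t \<oplus>\<^bsub>T\<^esub> \<zero>\<^bsub>T\<^esub> = t" by simp_all
qed

lemmas hat_simps = T_hat_simps T_mult_zero T_auto_zero T_add_zero T_zero_closed T1_closed T_mult_closed
  T_auto_closed T_mult_T1 T1_T_mult T_auto_T1

lemma Ta_mult:
  assumes "s \<in> carrier T" "t \<in> carrier T" "n \<in> carrier N"
  shows "Ta (T_mult K H s t) n = Ta s (Ta t n)"
proof -
  have "(s, \<zero>\<^bsub>T\<^esub>) \<otimes>\<^bsub>TH\<^esub> (t, \<zero>\<^bsub>T\<^esub>) = (T_mult K H s t, \<zero>\<^bsub>T\<^esub>)" using assms by (simp only: hat_simps)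
  then show ?thesis
    unfolding Ta_def using N.act_mult[OF hat_closed hat_closed, OF assms(1) T_zero_closed assms(2) T_zero_closed assms(3)]
    by (simp only: )
qed

lemma Ta_one: "n \<in> carrier N \<Longrightarrow> Ta T1 n = n"
  unfolding Ta_def using N.act_one by (simp only: hat_simps)

lemma q_q:
  assumes "n \<in> carrier N"
  shows "q (q n) = n"
proof -
  have "(\<zero>\<^bsub>T\<^esub>, T1) \<otimes>\<^bsub>TH\<^esub> (\<zero>\<^bsub>T\<^esub>, T1) = \<one>\<^bsub>TH\<^esub>" by (simp only: hat_simps)
  then show ?thesis
    unfolding q_def using N.act_mult[OF hat_closed hat_closed assms, OF T_zero_closed T1_closed T_zero_closed T1_closed]
      N.act_one[OF assms] by (simp only: )
qed

text \<open>The relation q t = \<sigma>(t) q, expressed as an equality of two products of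
  pairs.\<close>

lemma q_Ta:
  assumes "t \<in> carrier T" "n \<in> carrier N"
  shows "q (Ta t n) = Ta (T_auto K H t) (q n)"
proof -
  have "(\<zero>\<^bsub>T\<^esub>, T1) \<otimes>\<^bsub>TH\<^esub> (t, \<zero>\<^bsub>T\<^esub>) = (T_auto K H t, \<zero>\<^bsub>T\<^esub>) \<otimes>\<^bsub>TH\<^esub> (\<zero>\<^bsub>T\<^esub>, T1)"
    using assms by (simp only: hat_simps)
  then show ?thesis
    unfolding q_def Ta_def
    using N.act_mult[OF hat_closed hat_closed assms(2), OF T_zero_closed T1_closed assms(1) T_zero_closed]
      N.act_mult[OF hat_closed hat_closed assms(2), OF T_auto_closed[OF assms(1)] T_zero_closed T_zero_closed T1_closed]
    by (simp only: )
qed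

text \<open>In the crossed product the pair is s + t q.\<close>

lemma act_decomp:
  assumes "s \<in> carrier T" "t \<in> carrier T" "n \<in> carrier N"
  shows "act N (s, t) n = Ta s n \<oplus>\<^bsub>N\<^esub> Ta t (q n)"
proof -
  have "(s, t) = (s, \<zero>\<^bsub>T\<^esub>) \<oplus>\<^bsub>TH\<^esub> ((t, \<zero>\<^bsub>T\<^esub>) \<otimes>\<^bsub>TH\<^esub> (\<zero>\<^bsub>T\<^esub>, T1))"
    using assms by (simp only: hat_simps)
  moreover have "(t, \<zero>\<^bsub>T\<^esub>) \<otimes>\<^bsub>TH\<^esub> (\<zero>\<^bsub>T\<^esub>, T1) = (\<zero>\<^bsub>T\<^esub>, t)"
    using assms by (simp only: hat_simps)
  ultimately show ?thesis
    unfolding q_def Ta_def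
    using N.act_add_left[OF hat_closed hat_closed assms(3), OF assms(1) T_zero_closed T_zero_closed assms(2)]
      N.act_mult[OF hat_closed hat_closed assms(3), OF assms(2) T_zero_closed T_zero_closed T1_closed]
    by (simp only: )
qed

section \<open>The generators of T acting on a module\<close>

abbreviation "e \<equiv> \<one>\<^bsub>Hd\<^esub>"
abbreviation "u \<equiv> \<one>\<^bsub>H\<^esub>"

lemmas tcl = T_tens_closed A.one_closed dual_one_closed dual_mult_closed A.m_closed

lemmas tmult = T_mult_tens_one T_mult_one_tens A.one_closed dual_one_closed A.l_one A.r_one dual_one_mult dual_mult_one

text \<open>\<open>T_mult_tens_one\<close> and \<open>T_mult_one_tens\<close> factor the tensor. The
  order of the factors is the one in which \<open>T_act\<close> composes its operations, with the
  left coaction innermost and the right multiplication outermost.\<close>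

lemma Ta_decomp:
  assumes "g \<in> carrier H" "h \<in> carrier H" "\<alpha> \<in> carrier Hd" "\<beta> \<in> carrier Hd" "n \<in> carrier N"
  shows "Ta (TT g h \<alpha> \<beta>) n = Ta (TT u h e e) (Ta (TT g u e e) (Ta (TT u u \<alpha> e) (Ta (TT u u e \<beta>) n)))"
proof -
  have "TT g h \<alpha> \<beta> = T_mult K H (TT g h e e) (TT u u \<alpha> \<beta>)" using assms by (simp only: tmult)
  moreover have "TT u u \<alpha> \<beta> = T_mult K H (TT u u \<alpha> e) (TT u u e \<beta>)" using assms by (simp only: tmult)
  moreover have "TT g h e e = T_mult K H (TT u h e e) (TT g u e e)" using assms by (simp only: tmult)
  ultimately show ?thesis using assms
    by (simp only: Ta_mult tcl T_mult_closed Ta_closed)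
qed

abbreviation "M \<equiv> to_hopf_bimodule N"

lemma M_simps:
  "h \<in> carrier H \<Longrightarrow> m \<in> carrier N \<Longrightarrow> lact M h m = Ta (TT h u e e) m"
  "h \<in> carrier H \<Longrightarrow> m \<in> carrier N \<Longrightarrow> ract M m h = Ta (TT u h e e) m"
  "m \<in> carrier N \<Longrightarrow> lcoact M m =
    (\<Oplus>\<^bsub>tensor_module K H N\<^esub>b\<in>hbasis. tens K H N b (Ta (TT u u e (coord b)) m))"
  "m \<in> carrier N \<Longrightarrow> rcoact M m =
    (\<Oplus>\<^bsub>tensor_module K N H\<^esub>b\<in>hbasis. tens K N H (Ta (TT u u (coord b) e) m) b)"
  "m \<in> carrier N \<Longrightarrow> invol M m = q m"
  by (simp_all add: to_hopf_bimodule_def Let_def Ta_def q_def del: dual_simps)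

lemma module_to_hopf_bimodule: "module K M"
  by (rule module_transfer[OF module_N]) simp_all

lemma linear_N: "linear_map K M W f \<longleftrightarrow> linear_map K N W f" "linear_map K V M f' \<longleftrightarrow> linear_map K V N f'"
  by (simp_all add: linear_map_def)

lemma tens_N:
  "tensor_module K H M = tensor_module K H N" "tensor_module K M H = tensor_module K N H"
  by (rule tensor_transfer; simp)+

lemma lin_Ta: "linear_map K V T A \<Longrightarrow> n \<in> carrier N \<Longrightarrow> linear_map K V N (\<lambda>v. Ta (A v) n)"
  by (rule linear_map_compose[OF Ta_linear_left])

lemma bimodule_to_hopf_bimodule: "bimodule_over K H M"
proof (intro bimodule_over.intro module_to_hopf_bimodule)
  show "bimodule_over_axioms K H M"
  proof
    fix h assume h: "h \<in> carrier H"
    show "linear_map K M M (\<lambda>m. lact M h m)"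
      using linear_map_cong[OF module_N, of "\<lambda>m. lact M h m" "Ta (TT h u e e)" N] h
      by (simp add: linear_N M_simps Ta_linear_right tcl del: dual_simps)
    show "linear_map K M M (\<lambda>m. ract M m h)"
      using linear_map_cong[OF module_N, of "\<lambda>m. ract M m h" "Ta (TT u h e e)" N] h
      by (simp add: linear_N M_simps Ta_linear_right tcl del: dual_simps)
  next
    fix m assume "m \<in> carrier M"
    then have m: "m \<in> carrier N" by simp
    have "linear_map K H N (\<lambda>h. Ta (TT h u e e) m)" "linear_map K H N (\<lambda>h. Ta (TT u h e e) m)"
      using m by - (assumption | rule lin_Ta tlins)+
    then show "linear_map K H M (\<lambda>h. lact M h m)" "linear_map K H M (\<lambda>h. ract M m h)"
      using linear_map_cong[OF module_H, of "\<lambda>h. lact M h m" "\<lambda>h. Ta (TT h u e e) m" N]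
        linear_map_cong[OF module_H, of "\<lambda>h. ract M m h" "\<lambda>h. Ta (TT u h e e) m" N] m
      by (simp_all add: linear_N M_simps del: dual_simps)
    show "lact M u m = m" "ract M m u = m"
      using m by (simp_all add: M_simps Ta_one del: dual_simps)
  next
    fix g h m assume gh: "g \<in> carrier H" "h \<in> carrier H" and "m \<in> carrier M"
    then have m: "m \<in> carrier N" by simp
    \<comment> \<open>In the second slot the later factor stands on the left, which makes that slot
      a right action. The last two products agree, so the two actions commute.\<close>
    have "T_mult K H (TT g u e e) (TT h u e e) = TT (g \<cdot> h) u e e"
      "T_mult K H (TT u h e e) (TT u g e e) = TT u (g \<cdot> h) e e"
      "T_mult K H (TT u h e e) (TT g u e e) = TT g h e e"
      "T_mult K H (TT g u e e) (TT u h e e) = TT g h e e"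
      using gh by (simp_all only: tmult)
    note * = this[symmetric]
    show "lact M (g \<cdot> h) m = lact M g (lact M h m)"
      using gh m by (simp add: M_simps Ta_closed tcl *(1) Ta_mult del: dual_simps)
    show "ract M m (g \<cdot> h) = ract M (ract M m g) h"
      using gh m by (simp add: M_simps Ta_closed tcl *(2) Ta_mult del: dual_simps)
    have "Ta (TT u h e e) (Ta (TT g u e e) m) = Ta (TT g u e e) (Ta (TT u h e e) m)"
      using gh m *(3,4) by (simp only: Ta_mult[symmetric] tcl)
    then show "ract M (lact M g m) h = lact M g (ract M m h)"
      using gh m by (simp add: M_simps Ta_closed tcl del: dual_simps)
  qed
qed

lemma hopf_bimodule_data_M: "hopf_bimodule_data K H M"
proof (intro hopf_bimodule_data.intro finite_hopf_algebra_axioms bimodule_to_hopf_bimodule)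
  show "hopf_bimodule_data_axioms K H M"
  proof
    have "linear_map K N (tensor_module K H N)
        (\<lambda>m. \<Oplus>\<^bsub>tensor_module K H N\<^esub>b\<in>hbasis. tens K H N b (Ta (TT u u e (coord b)) m))"
      by (intro linear_map_finsum_fun lin_tens_right Ta_linear_right tcl coord_closed hbasis
          K.module_tensor_module module_H module_N)
    then show "linear_map K M (tensor_module K H M) (lcoact M)"
      unfolding tens_N linear_N
      using linear_map_cong[OF module_N, of "lcoact M"
        "\<lambda>m. \<Oplus>\<^bsub>tensor_module K H N\<^esub>b\<in>hbasis. tens K H N b (Ta (TT u u e (coord b)) m)" "tensor_module K H N"]
      by (simp add: M_simps del: dual_simps)
    have "linear_map K N (tensor_module K N H)
        (\<lambda>m. \<Oplus>\<^bsub>tensor_module K N H\<^esub>b\<in>hbasis. tens K N H (Ta (TT u u (coord b) e) m) b)"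
      by (intro linear_map_finsum_fun lin_tens_left Ta_linear_right tcl coord_closed hbasis
          K.module_tensor_module module_H module_N)
    then show "linear_map K M (tensor_module K M H) (rcoact M)"
      unfolding tens_N linear_N
      using linear_map_cong[OF module_N, of "rcoact M"
        "\<lambda>m. \<Oplus>\<^bsub>tensor_module K N H\<^esub>b\<in>hbasis. tens K N H (Ta (TT u u (coord b) e) m) b" "tensor_module K N H"]
      by (simp add: M_simps del: dual_simps)
    show "linear_map K M M (invol M)"
      unfolding linear_N using q_linear linear_map_cong[OF module_N, of "invol M" q N] by (simp add: M_simps)
  qed
qed

end

section \<open>Recovering the operators from the rebuilt coactions\<close>

sublocale T_hat_module \<subseteq> M: hopf_bimodule_data K H "to_hopf_bimodule N"
  by (rule hopf_bimodule_data_M)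

context T_hat_module
begin

text \<open>\<open>M\<close> and \<open>N\<close> are records of different types over the same
  vector space, and contraction sees only the latter.\<close>

lemma pairL_N: "pairL M = pairL N" and pairR_N: "pairR M = pairR N"
  by (simp_all add: pairL_def[abs_def] pairR_def[abs_def] tensor_lift_def finsum_transfer[of M N])

text \<open>Contracting the defining sum of the coaction with \<beta> puts the coefficients
  \<beta>(b) on the operators of the \<open>coord b\<close>. These functionals combine to \<beta>,
  so linearity in the fourth slot gives the operator of \<beta> itself.\<close>

lemma Lop_N:
  assumes b: "\<beta> \<in> carrier Hd" and m: "m \<in> carrier N"
  shows "M.Lop \<beta> m = Ta (TT u u e \<beta>) m"
proof -
  interpret N: module K N by (rule module_N)
  have c: "Ta (TT u u e (coord b)) m \<in> carrier N" if "b \<in> hbasis" for b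
    using that m by (intro Ta_closed tcl coord_closed)
  have "M.Lop \<beta> m = pairL N \<beta> (\<Oplus>\<^bsub>tensor_module K H N\<^esub>b\<in>hbasis. tens K H N b (Ta (TT u u e (coord b)) m))"
    using m by (simp only: M.Lop_eq pairL_N M_simps)
  also have "\<dots> = (\<Oplus>\<^bsub>N\<^esub>b\<in>hbasis. pairL N \<beta> (tens K H N b (Ta (TT u u e (coord b)) m)))"
    using c hbasis b by (intro linear_map_finsum[OF _ _ pairL_linear]) auto
  also have "\<dots> = (\<Oplus>\<^bsub>N\<^esub>b\<in>hbasis. \<beta> b \<odot>\<^bsub>N\<^esub> Ta (TT u u e (coord b)) m)"
    using c hbasis b by (intro N.finsum_cong') (auto simp: pairL_tens dual_app_closed)
  also have "\<dots> = Ta (TT u u e \<beta>) m"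
    using b m by (intro K.dual_basis_expand[OF _ _ dual_basis_dual, where L = "\<lambda>\<beta>. Ta (TT u u e \<beta>) m"])
      (assumption | rule lin_Ta tlins module_N)+
  finally show ?thesis .
qed

lemma Rop_N:
  assumes b: "\<beta> \<in> carrier Hd" and m: "m \<in> carrier N"
  shows "M.Rop \<beta> m = Ta (TT u u \<beta> e) m"
proof -
  interpret N: module K N by (rule module_N)
  have c: "Ta (TT u u (coord b) e) m \<in> carrier N" if "b \<in> hbasis" for b
    using that m by (intro Ta_closed tcl coord_closed)
  have "M.Rop \<beta> m = pairR N \<beta> (\<Oplus>\<^bsub>tensor_module K N H\<^esub>b\<in>hbasis. tens K N H (Ta (TT u u (coord b) e) m) b)"
    using m by (simp only: M.Rop_eq pairR_N M_simps)
  also have "\<dots> = (\<Oplus>\<^bsub>N\<^esub>b\<in>hbasis. pairR N \<beta> (tens K N H (Ta (TT u u (coord b) e) m) b))"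
    using c hbasis b by (intro linear_map_finsum[OF _ _ pairR_linear]) auto
  also have "\<dots> = (\<Oplus>\<^bsub>N\<^esub>b\<in>hbasis. \<beta> b \<odot>\<^bsub>N\<^esub> Ta (TT u u (coord b) e) m)"
    using c hbasis b by (intro N.finsum_cong') (auto simp: pairR_tens dual_app_closed)
  also have "\<dots> = Ta (TT u u \<beta> e) m"
    using b m by (intro K.dual_basis_expand[OF _ _ dual_basis_dual, where L = "\<lambda>\<beta>. Ta (TT u u \<beta> e) m"])
      (assumption | rule lin_Ta tlins module_N)+
  finally show ?thesis .
qed

lemma Ta_ops:
  assumes "g \<in> carrier H" "h \<in> carrier H" "\<alpha> \<in> carrier Hd" "\<beta> \<in> carrier Hd" "m \<in> carrier N"
  shows "ract M (lact M g (M.Rop \<alpha> (M.Lop \<beta> m))) h = Ta (TT g h \<alpha> \<beta>) m"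
  using assms by (simp only: Ta_decomp[OF assms] Lop_N Rop_N M_simps Ta_closed tcl)

end

context T_hat_module
begin

lemma Rop_Lop_N:
  assumes "\<alpha> \<in> carrier Hd" "\<beta> \<in> carrier Hd" "m \<in> carrier N"
  shows "M.Rop \<alpha> (M.Lop \<beta> m) = Ta (TT u u \<alpha> \<beta>) m" "M.Lop \<beta> (M.Rop \<alpha> m) = Ta (TT u u \<alpha> \<beta>) m"
  using assms by (simp_all only: Rop_N Lop_N Ta_closed tcl Ta_mult[symmetric] tmult)

lemma ract_lact_N:
  assumes "g \<in> carrier H" "h \<in> carrier H" "m \<in> carrier N"
  shows "ract M (lact M g m) h = Ta (TT g h e e) m"
  using assms by (simp_all only: M_simps Ta_closed tcl Ta_mult[symmetric] tmult)

text \<open>Both sides are one product of T acting on \<open>m\<close>: \<open>T_mult_cross\<close>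
  expands it, and \<open>Ta_ops\<close> reads each term back as bimodule operations.\<close>

lemma cross_sum_N:
  assumes gh: "g \<in> carrier H" "h \<in> carrier H" and b: "\<alpha> \<in> carrier Hd" "\<beta> \<in> carrier Hd" and m: "m \<in> carrier N"
  shows "M.Rop \<alpha> (M.Lop \<beta> (ract M (lact M h m) g)) = M.cross_sum \<alpha> \<beta> h g m"
proof -
  note l = tlins gh b module_T Ta_closed m module_to_hopf_bimodule
  have L: "linear_map K T M (\<lambda>t. Ta t m)" unfolding linear_N by (rule Ta_linear_left[OF m])
  have "M.Rop \<alpha> (M.Lop \<beta> (ract M (lact M h m) g)) = Ta (TT u u \<alpha> \<beta>) (Ta (TT h g e e) m)"
    using gh b m by (simp only: ract_lact_N Rop_Lop_N Ta_closed tcl)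
  also have "\<dots> = Ta (T_mult K H (TT u u \<alpha> \<beta>) (TT h g e e)) m"
    using gh b m by (simp only: Ta_mult tcl)
  also have "\<dots> = Ta (sw3 T h (\<lambda>h1 h2 h3. sw3 T g (\<lambda>g1 g2 g3.
      TT h2 g2 (dual_shift H \<alpha> h3 (antipode_inv2 H g3)) (dual_shift H \<beta> h1 g1)))) m"
    using gh b by (simp only: T_mult_cross)
  also have "\<dots> = M.cross_sum \<alpha> \<beta> h g m"
    unfolding M.cross_sum_def
    apply (subst sw3_hom[OF L])
        apply (assumption | rule l)+
    apply (intro sw3_cong module_to_hopf_bimodule gh)
     apply (subst sw3_hom[OF L])
         apply (assumption | rule l)+
     apply (intro sw3_cong module_to_hopf_bimodule gh)
      apply (rule Ta_ops[symmetric])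
          apply (assumption | rule l)+
     apply (simp only: to_hopf_bimodule_simps Ta_ops dual_shift_closed antipode_inv2_closed b m Ta_closed tcl)
    apply (rule sw3_closed)
      apply (assumption | rule l)+
    apply (simp only: to_hopf_bimodule_simps Ta_ops dual_shift_closed antipode_inv2_closed b m Ta_closed tcl)
    done
  finally show ?thesis .
qed

text \<open>Each axiom about a coaction is entered through its equivalence with a relation between
  operators. These relations hold because the corresponding products of generators agree in the
  crossed product.\<close>

lemma involutive_to_hopf_bimodule: "involutive_hopf_bimodule K H M"
proof (intro involutive_hopf_bimodule.intro bicomodule_over.intro bimodule_to_hopf_bimodule module_to_hopf_bimodule)
  show "bicomodule_over_axioms K H M"
  proof (unfold_locales, goal_cases)
    case 1 show ?case by (rule M.lcoact_lin)
  next
    case (2 m)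
    then have "m \<in> carrier N" by simp
    then show ?case
      by (intro iffD2[OF M.lcoact_coassoc_iff[OF 2]] ballI) (simp only: Lop_N Ta_closed tcl Ta_mult[symmetric] tmult)
  next
    case (3 m)
    then have "m \<in> carrier N" by simp
    then show ?case
      by (intro iffD2[OF M.lcoact_counit_iff[OF 3]]) (simp only: Lop_N tcl Ta_one)
  next
    case 4 show ?case by (rule M.rcoact_lin)
  next
    case (5 m)
    then have "m \<in> carrier N" by simp
    then show ?case
      by (intro iffD2[OF M.rcoact_coassoc_iff[OF 5]] ballI) (simp only: Rop_N Ta_closed tcl Ta_mult[symmetric] tmult)
  next
    case (6 m)
    then have "m \<in> carrier N" by simp
    then show ?case
      by (intro iffD2[OF M.rcoact_counit_iff[OF 6]]) (simp only: Rop_N tcl Ta_one)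
  next
    case (7 m)
    then have "m \<in> carrier N" by simp
    then show ?case
      by (intro iffD2[OF M.lcoact_rcoact_iff[OF 7]] ballI) (simp only: Rop_Lop_N)
  qed
  show "involutive_hopf_bimodule_axioms K H M"
  proof (unfold_locales, goal_cases)
    case (1 g h m)
    then have "m \<in> carrier N" by simp
    then show ?case
      using 1 by (intro iffD2[OF M.coact_act_iff[OF 1]] ballI) (simp only: cross_sum_N)
  next
    case 2 show ?case by (rule M.invol_lin)
  next
    case (3 m)
    then show ?case by (simp add: M_simps q_q q_closed)
  next
    case (4 g h m)
    then have m: "m \<in> carrier N" by simp
    have "invol M (ract M (lact M g m) h) = q (Ta (TT g h e e) m)"
      using 4 m by (simp only: ract_lact_N M_simps(5) Ta_closed tcl)
    also have "\<dots> = Ta (TT (antipode_inv H h) (antipode H g) e e) (q m)"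
      using 4 m by (simp only: q_Ta tcl T_auto_tens dual_comp_one)
    also have "\<dots> = ract M (lact M (antipode_inv H h) (invol M m)) (antipode H g)"
      using 4 m by (simp only: ract_lact_N M_simps(5) q_closed antipode_closed antipode_inv_closed)
    finally show ?case .
  next
    case (5 m)
    then have m: "m \<in> carrier N" by simp
    show ?case
    proof (intro iffD2[OF M.invol_coact_iff[OF 5]] ballI)
      fix \<alpha> \<beta> assume b: "\<alpha> \<in> carrier Hd" "\<beta> \<in> carrier Hd"
      have "invol M (M.Rop \<alpha> (M.Lop \<beta> m)) = q (Ta (TT u u \<alpha> \<beta>) m)"
        using b m by (simp only: Rop_Lop_N M_simps(5) Ta_closed tcl)
      also have "\<dots> = Ta (TT u u (dual_comp H \<beta> (antipode H)) (dual_comp H \<alpha> (antipode_inv H))) (q m)"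
        using b m by (simp only: q_Ta tcl T_auto_tens antipode_one antipode_inv_one)
      also have "\<dots> = M.Rop (dual_comp H \<beta> (antipode H)) (M.Lop (dual_comp H \<alpha> (antipode_inv H)) (invol M m))"
        using b m by (simp only: Rop_Lop_N M_simps(5) q_closed dual_comp_closed antipode_linear antipode_inv_linear)
      finally show "invol M (M.Rop \<alpha> (M.Lop \<beta> m)) =
        M.Rop (dual_comp H \<beta> (antipode H)) (M.Lop (dual_comp H \<alpha> (antipode_inv H)) (invol M m))" .
    qed
  qed
qed

lemma normal_to_hopf_bimodule:
  assumes "normal_left_module K TH N"
  shows "normal_hopf_bimodule K H M"
  using assms
  by (auto simp: normal_left_module_def normal_hopf_bimodule_def normal_space_def extensional_def
      to_hopf_bimodule_def Let_def)

lemma T_act_N: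
  assumes t: "t \<in> carrier T" and m: "m \<in> carrier N"
  shows "T_act M t m = Ta t m"
proof (rule K.tensor4_map_eqI[OF module_H module_H module_dual module_dual module_N t])
  show "linear_map K T N (\<lambda>t. T_act M t m)"
    using M.Tact_linear_left[of m] m by (simp add: linear_N)
  show "linear_map K T N (\<lambda>t. Ta t m)" by (rule Ta_linear_left[OF m])
  fix g h \<alpha> \<beta> assume b: "g \<in> carrier H" "h \<in> carrier H" "\<alpha> \<in> carrier Hd" "\<beta> \<in> carrier Hd"
  show "T_act M (TT g h \<alpha> \<beta>) m = Ta (TT g h \<alpha> \<beta>) m"
    using M.Tact_tens[OF b] Ta_ops[OF b m] m by simp
qed

lemma to_left_module_to_hopf_bimodule:
  assumes "normal_left_module K TH N"
  shows "to_left_module M = N"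
proof (rule left_module.equality)
  show "act (to_left_module M) = act N"
  proof (intro ext)
    fix s m
    show "act (to_left_module M) s m = act N s m"
    proof (cases "s \<in> carrier TH \<and> m \<in> carrier N")
      case True
      then obtain a b where ab: "s = (a, b)" "a \<in> carrier T" "b \<in> carrier T" by (auto simp: T_hat_simps)
      have "act (to_left_module M) s m = T_act M a m \<oplus>\<^bsub>M\<^esub> T_act M b (invol M m)"
        unfolding ab(1) using ab True by (intro act_to_left_module) auto
      also have "\<dots> = act N s m"
        using ab True by (simp add: T_act_N M_simps q_closed act_decomp)
      finally show ?thesis .
    next
      case False
      then have "case_prod (act N) (s, m) = undefined"
        using assms unfolding normal_left_module_def extensional_def by blast
      then show ?thesis using False by (auto simp: to_left_module_def)
    qed
  qed
qed simp_all

end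

section \<open>Isomorphism of categories\<close>

lemma category_left_module: "category (left_module_category K A)"
proof -
  \<comment> \<open>Identities and composites are restricted to the carrier, so checking that they
    are morphisms requires sums, multiples and images under the action to lie in it.\<close>
  have cl: "u \<oplus>\<^bsub>M\<^esub> v \<in> carrier M" "x \<in> carrier K \<Longrightarrow> x \<odot>\<^bsub>M\<^esub> v \<in> carrier M" "s \<in> carrier A \<Longrightarrow> act M s v \<in> carrier M"
    if "left_module_over K A M" "u \<in> carrier M" "v \<in> carrier M" for u v x s M
  proof -
    interpret left_module_over K A M by fact
    show "u \<oplus>\<^bsub>M\<^esub> v \<in> carrier M" "x \<in> carrier K \<Longrightarrow> x \<odot>\<^bsub>M\<^esub> v \<in> carrier M" "s \<in> carrier A \<Longrightarrow> act M s v \<in> carrier M"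
      using that act_closed by auto
  qed
  show ?thesis
    by unfold_locales
      (auto simp: left_module_category_def left_module_hom_def compose_def linear_map_def Pi_iff
        extensional_def cl intro!: ext)
qed

text \<open>Since both categories have functions as morphisms, the functors can be the identity on them, and
  the category axioms of one side carry over from the other.\<close>

lemma isomorphic_categoriesI:
  assumes D: "category D"
    and F: "\<And>X. X \<in> Obj C \<Longrightarrow> F X \<in> Obj D" and G: "\<And>X. X \<in> Obj D \<Longrightarrow> G X \<in> Obj C"
    and GF: "\<And>X. X \<in> Obj C \<Longrightarrow> G (F X) = X" and FG: "\<And>X. X \<in> Obj D \<Longrightarrow> F (G X) = X"
    and Hom: "\<And>X Y. X \<in> Obj C \<Longrightarrow> Y \<in> Obj C \<Longrightarrow> Hom C X Y = Hom D (F X) (F Y)"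
    and Ident: "\<And>X. X \<in> Obj C \<Longrightarrow> Ident C X = Ident D (F X)"
    and Comp: "\<And>X Y Z g f. \<lbrakk>X \<in> Obj C; Y \<in> Obj C; Z \<in> Obj C\<rbrakk>
      \<Longrightarrow> Comp C X Y Z g f = Comp D (F X) (F Y) (F Z) g f"
  shows "isomorphic_categories C D"
proof -
  interpret D: category D by fact
  have C: "category C"
    by unfold_locales
      (simp_all add: Hom Ident Comp F D.Ident_in_Hom D.Comp_in_Hom D.Comp_Ident_right D.Comp_Ident_left D.Comp_assoc)
  have "cat_functor C D F (\<lambda>X Y f. f)"
    by (intro cat_functor.intro C D cat_functor_axioms.intro) (simp_all add: F Hom Ident Comp)
  moreover have "cat_functor D C G (\<lambda>X Y f. f)"
    by (intro cat_functor.intro C D cat_functor_axioms.intro) (simp_all add: G Hom Ident Comp FG)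
  ultimately show ?thesis unfolding isomorphic_categories_def using GF FG by blast
qed

section \<open>Agreement of the hom-sets, and the isomorphism\<close>

context finite_hopf_algebra
begin

text \<open>A linear map commutes with all of T once it commutes with the two multiplications and
  the operators of functionals, since pure tensors act through these. Conversely each of them is the
  action of a pure tensor with units in the other slots. Commuting with every
  \<open>Lop \<beta>\<close> is left colinearity because contractions separate tensors, and likewise
  on the right.\<close>

lemma hom_eq:
  assumes X: "involutive_hopf_bimodule K H X" and Y: "involutive_hopf_bimodule K H Y"
  shows "hopf_bimodule_hom K H X Y = left_module_hom K TH (to_left_module X) (to_left_module Y)"
proof -
  interpret X: involutive_hopf_data K H X by (intro involutive_hopf_data.intro finite_hopf_algebra_axioms X)
  interpret Y: involutive_hopf_data K H Y by (intro involutive_hopf_data.intro finite_hopf_algebra_axioms Y)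
  have tr: "linear_map K (to_left_module X) (to_left_module Y) f \<longleftrightarrow> linear_map K X Y f" for f
    by (rule linear_map_transfer) simp_all
  show ?thesis
  proof (intro equalityI subsetI)
    fix f assume "f \<in> hopf_bimodule_hom K H X Y"
    then have ext: "f \<in> extensional (carrier X)" and f: "linear_map K X Y f"
      and la: "\<And>h m. h \<in> carrier H \<Longrightarrow> m \<in> carrier X \<Longrightarrow> f (lact X h m) = lact Y h (f m)"
      and ra: "\<And>h m. h \<in> carrier H \<Longrightarrow> m \<in> carrier X \<Longrightarrow> f (ract X m h) = ract Y (f m) h"
      and lc: "\<And>m. m \<in> carrier X \<Longrightarrow> lcoact Y (f m) = X.lsw (tensor_module K H Y) m (\<lambda>x n. tens K H Y x (f n))"
      and rc: "\<And>m. m \<in> carrier X \<Longrightarrow> rcoact Y (f m) = X.rsw (tensor_module K Y H) m (\<lambda>n x. tens K Y H (f n) x)"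
      and iv: "\<And>m. m \<in> carrier X \<Longrightarrow> f (invol X m) = invol Y (f m)"
      by (auto simp: hopf_bimodule_hom_def)
    note fc = linear_map_closed[OF f]
    have Lf: "f (X.Lop \<beta> m) = Y.Lop \<beta> (f m)" if b: "\<beta> \<in> carrier Hd" and m: "m \<in> carrier X" for \<beta> m
    proof -
      have "Y.Lop \<beta> (f m) = X.lsw Y m (\<lambda>x n. pairL Y \<beta> (tens K H Y x (f n)))"
        unfolding Y.Lop_eq lc[OF m] using m fc by (intro X.lsw_hom[OF pairL_linear[OF Y.module_M b]]) auto
      also have "\<dots> = X.lsw Y m (\<lambda>x n. \<beta> x \<odot>\<^bsub>Y\<^esub> f n)"
        using b m fc dual_app_closed[OF b]
        by (intro X.lsw_cong) (auto simp: pairL_tens intro: smult_closed_over)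
      also have "\<dots> = f (X.Lop \<beta> m)"
        by (rule X.Lop_tensor[OF b m f Y.module_M])
      finally show ?thesis ..
    qed
    have Rf: "f (X.Rop \<beta> m) = Y.Rop \<beta> (f m)" if b: "\<beta> \<in> carrier Hd" and m: "m \<in> carrier X" for \<beta> m
    proof -
      have "Y.Rop \<beta> (f m) = X.rsw Y m (\<lambda>n x. pairR Y \<beta> (tens K Y H (f n) x))"
        unfolding Y.Rop_eq rc[OF m] using m fc by (intro X.rsw_hom[OF pairR_linear[OF Y.module_M b]]) auto
      also have "\<dots> = X.rsw Y m (\<lambda>n x. \<beta> x \<odot>\<^bsub>Y\<^esub> f n)"
        using b m fc dual_app_closed[OF b]
        by (intro X.rsw_cong) (auto simp: pairR_tens intro: smult_closed_over)
      also have "\<dots> = f (X.Rop \<beta> m)"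
        by (rule X.Rop_tensor[OF b m f Y.module_M])
      finally show ?thesis ..
    qed
    have Tf: "f (T_act X t m) = T_act Y t (f m)" if t: "t \<in> carrier T" and m: "m \<in> carrier X" for t m
    proof (rule K.tensor4_map_eqI[OF module_H module_H module_dual module_dual Y.module_M t])
      show "linear_map K T Y (\<lambda>t. f (T_act X t m))"
        by (rule linear_map_compose[OF f X.Tact_linear_left[OF m]])
      show "linear_map K T Y (\<lambda>t. T_act Y t (f m))"
        by (rule Y.Tact_linear_left[OF fc[OF m]])
      fix g h \<alpha> \<beta> assume b: "g \<in> carrier H" "h \<in> carrier H" "\<alpha> \<in> carrier Hd" "\<beta> \<in> carrier Hd"
      show "f (T_act X (TT g h \<alpha> \<beta>) m) = T_act Y (TT g h \<alpha> \<beta>) (f m)"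
        using b m fc
        by (simp only: X.Tact_tens Y.Tact_tens la ra Lf Rf X.lact_closed X.Lop_closed X.Rop_closed)
    qed
    show "f \<in> left_module_hom K TH (to_left_module X) (to_left_module Y)"
      unfolding left_module_hom_def tr
    proof (intro CollectI conjI ballI)
      fix s m assume s: "s \<in> carrier TH" and "m \<in> carrier (to_left_module X)"
      then have m: "m \<in> carrier X" by simp
      obtain a b where ab: "s = (a, b)" "a \<in> carrier T" "b \<in> carrier T" using s by (auto simp: T_hat_simps)
      show "f (act (to_left_module X) s m) = act (to_left_module Y) s (f m)"
        using ab m fc
        by (simp add: act_to_left_module linear_map_add[OF f] Tf iv X.Tact_closed X.invol_closed)
    qed (simp_all add: ext f)
  next
    fix f assume "f \<in> left_module_hom K TH (to_left_module X) (to_left_module Y)"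
    then have ext: "f \<in> extensional (carrier X)" and f: "linear_map K X Y f"
      and act: "\<And>s m. s \<in> carrier TH \<Longrightarrow> m \<in> carrier X \<Longrightarrow> f (act (to_left_module X) s m) = act (to_left_module Y) s (f m)"
      by (auto simp: left_module_hom_def tr)
    note fc = linear_map_closed[OF f]
    interpret T: module K T by (rule module_T)
    have Tf: "f (T_act X t m) = T_act Y t (f m)" if t: "t \<in> carrier T" and m: "m \<in> carrier X" for t m
    proof -
      \<comment> \<open>Pairs with second component zero isolate T; the pair (0, 1) used below
        isolates the involution.\<close>
      have "f (act (to_left_module X) (t, \<zero>\<^bsub>T\<^esub>) m) = act (to_left_module Y) (t, \<zero>\<^bsub>T\<^esub>) (f m)"
        using t m by (intro act) (auto simp: T_hat_simps)
      then show ?thesis by (simp only: X.act_pure[OF t m] Y.act_pure[OF t fc[OF m]])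
    qed
    have iv: "f (invol X m) = invol Y (f m)" if m: "m \<in> carrier X" for m
    proof -
      have "f (act (to_left_module X) (\<zero>\<^bsub>T\<^esub>, T1) m) = act (to_left_module Y) (\<zero>\<^bsub>T\<^esub>, T1) (f m)"
        using T1_closed m by (intro act) (auto simp: T_hat_simps)
      then show ?thesis by (simp only: X.act_invol[OF m] Y.act_invol[OF fc[OF m]])
    qed
    note c = A.one_closed dual_one_closed T_tens_closed
    note Xs = X.Tact_tens X.Lop_one X.Rop_one X.I.lact_one X.I.ract_one X.lact_closed X.Lop_closed X.Rop_closed
    note Ys = Y.Tact_tens Y.Lop_one Y.Rop_one Y.I.lact_one Y.I.ract_one Y.lact_closed Y.Lop_closed Y.Rop_closed
    have la: "f (lact X h m) = lact Y h (f m)" if "h \<in> carrier H" "m \<in> carrier X" for h m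
      using Tf[of "TT h \<one>\<^bsub>H\<^esub> \<one>\<^bsub>Hd\<^esub> \<one>\<^bsub>Hd\<^esub>" m] that fc by (simp only: c Xs Ys)
    have ra: "f (ract X m h) = ract Y (f m) h" if "h \<in> carrier H" "m \<in> carrier X" for h m
      using Tf[of "TT \<one>\<^bsub>H\<^esub> h \<one>\<^bsub>Hd\<^esub> \<one>\<^bsub>Hd\<^esub>" m] that fc by (simp only: c Xs Ys)
    have Lf: "f (X.Lop \<beta> m) = Y.Lop \<beta> (f m)" if "\<beta> \<in> carrier Hd" "m \<in> carrier X" for \<beta> m
      using Tf[of "TT \<one>\<^bsub>H\<^esub> \<one>\<^bsub>H\<^esub> \<one>\<^bsub>Hd\<^esub> \<beta>" m] that fc by (simp only: c Xs Ys)
    have Rf: "f (X.Rop \<beta> m) = Y.Rop \<beta> (f m)" if "\<beta> \<in> carrier Hd" "m \<in> carrier X" for \<beta> m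
      using Tf[of "TT \<one>\<^bsub>H\<^esub> \<one>\<^bsub>H\<^esub> \<beta> \<one>\<^bsub>Hd\<^esub>" m] that fc by (simp only: c Xs Ys)
    have lc: "lcoact Y (f m) = X.lsw (tensor_module K H Y) m (\<lambda>x n. tens K H Y x (f n))" if m: "m \<in> carrier X" for m
    proof (rule pairL_eqI[OF Y.module_M])
      show "X.lsw (tensor_module K H Y) m (\<lambda>x n. tens K H Y x (f n)) \<in> carrier (tensor_module K H Y)"
        using m fc by (intro X.lsw_closed) auto
      fix \<beta> assume b: "\<beta> \<in> carrier Hd"
      have "pairL Y \<beta> (X.lsw (tensor_module K H Y) m (\<lambda>x n. tens K H Y x (f n))) =
          X.lsw Y m (\<lambda>x n. pairL Y \<beta> (tens K H Y x (f n)))"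
        using m fc by (intro X.lsw_hom[OF pairL_linear[OF Y.module_M b]]) auto
      also have "\<dots> = X.lsw Y m (\<lambda>x n. \<beta> x \<odot>\<^bsub>Y\<^esub> f n)"
        using b m fc dual_app_closed[OF b]
        by (intro X.lsw_cong) (auto simp: pairL_tens intro: smult_closed_over)
      also have "\<dots> = f (X.Lop \<beta> m)"
        by (rule X.Lop_tensor[OF b m f Y.module_M])
      finally show "pairL Y \<beta> (lcoact Y (f m)) = pairL Y \<beta> (X.lsw (tensor_module K H Y) m (\<lambda>x n. tens K H Y x (f n)))"
        using Lf[OF b m] by (simp only: Y.Lop_eq)
    qed (rule Y.lcoact_closed[OF fc[OF m]])
    have rc: "rcoact Y (f m) = X.rsw (tensor_module K Y H) m (\<lambda>n x. tens K Y H (f n) x)" if m: "m \<in> carrier X" for m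
    proof (rule pairR_eqI[OF Y.module_M])
      show "X.rsw (tensor_module K Y H) m (\<lambda>n x. tens K Y H (f n) x) \<in> carrier (tensor_module K Y H)"
        using m fc by (intro X.rsw_closed) auto
      fix \<beta> assume b: "\<beta> \<in> carrier Hd"
      have "pairR Y \<beta> (X.rsw (tensor_module K Y H) m (\<lambda>n x. tens K Y H (f n) x)) =
          X.rsw Y m (\<lambda>n x. pairR Y \<beta> (tens K Y H (f n) x))"
        using m fc by (intro X.rsw_hom[OF pairR_linear[OF Y.module_M b]]) auto
      also have "\<dots> = X.rsw Y m (\<lambda>n x. \<beta> x \<odot>\<^bsub>Y\<^esub> f n)"
        using b m fc dual_app_closed[OF b]
        by (intro X.rsw_cong) (auto simp: pairR_tens intro: smult_closed_over)
      also have "\<dots> = f (X.Rop \<beta> m)"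
        by (rule X.Rop_tensor[OF b m f Y.module_M])
      finally show "pairR Y \<beta> (rcoact Y (f m)) = pairR Y \<beta> (X.rsw (tensor_module K Y H) m (\<lambda>n x. tens K Y H (f n) x))"
        using Rf[OF b m] by (simp only: Y.Rop_eq)
    qed (rule Y.rcoact_closed[OF fc[OF m]])
    show "f \<in> hopf_bimodule_hom K H X Y"
      unfolding hopf_bimodule_hom_def by (intro CollectI conjI ballI ext f la ra lc rc iv)
  qed
qed

lemma normal_to_left_module:
  "normal_hopf_bimodule K H M \<Longrightarrow> normal_left_module K TH (to_left_module M)"
  by (auto simp: normal_left_module_def normal_hopf_bimodule_def normal_space_def extensional_def to_left_module_def)

lemma isomorphic_hopf_bimodules_left_modules:
  "isomorphic_categories
    (involutive_hopf_bimodule_category K H :: (('k, 'h, 'm) hopf_bimodule, 'm \<Rightarrow> 'm) category)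
    (left_module_category K TH :: (('k, ('k, 'h) T_hat_elem, 'm) left_module, 'm \<Rightarrow> 'm) category)"
proof (rule isomorphic_categoriesI[where F = to_left_module and G = to_hopf_bimodule, OF category_left_module])
  fix X :: "('k, 'h, 'm) hopf_bimodule" assume X: "X \<in> Obj (involutive_hopf_bimodule_category K H)"
  then have iX: "involutive_hopf_bimodule K H X" and nX: "normal_hopf_bimodule K H X"
    by (simp_all add: involutive_hopf_bimodule_category_def)
  interpret X: involutive_hopf_data K H X by (intro involutive_hopf_data.intro finite_hopf_algebra_axioms iX)
  show "to_left_module X \<in> Obj (left_module_category K TH)"
    using X.left_module_to_left_module normal_to_left_module[OF nX] by (simp add: left_module_category_def)
  show "to_hopf_bimodule (to_left_module X) = X"
    by (rule X.to_hopf_bimodule_to_left_module[OF nX])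
  show "Ident (involutive_hopf_bimodule_category K H) X = Ident (left_module_category K TH) (to_left_module X)"
    by (simp add: involutive_hopf_bimodule_category_def left_module_category_def)
next
  fix X :: "('k, ('k, 'h) T_hat_elem, 'm) left_module" assume "X \<in> Obj (left_module_category K TH)"
  then have iX: "left_module_over K TH X" and nX: "normal_left_module K TH X"
    by (simp_all add: left_module_category_def)
  interpret X: T_hat_module K H X by (intro T_hat_module.intro finite_hopf_algebra_axioms iX)
  show "to_hopf_bimodule X \<in> Obj (involutive_hopf_bimodule_category K H)"
    using X.involutive_to_hopf_bimodule X.normal_to_hopf_bimodule[OF nX]
    by (simp add: involutive_hopf_bimodule_category_def)
  show "to_left_module (to_hopf_bimodule X) = X"
    by (rule X.to_left_module_to_hopf_bimodule[OF nX])
qed (simp_all add: involutive_hopf_bimodule_category_def left_module_category_def hom_eq)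

end

theorem theorem4:
  fixes K :: "'k ring" and H :: "('k, 'h) hopf"
  assumes "field K"
    and "hopf_algebra K H"
    and "fin_dim K H"
  shows "isomorphic_categories
    (involutive_hopf_bimodule_category K H :: (('k, 'h, 'm) hopf_bimodule, 'm \<Rightarrow> 'm) category)
    (left_module_category K (T_hat K H) :: (('k, ('k, 'h) T_hat_elem, 'm) left_module, 'm \<Rightarrow> 'm) category)"
  by (intro finite_hopf_algebra.isomorphic_hopf_bimodules_left_modules finite_hopf_algebra.intro
      finite_hopf_algebra_axioms.intro assms)

end
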